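(* Let $n\ge 1$, let $p>1$ be an odd integer, and let $s_{cr}=\frac{n}{2}-\frac{2}{p-1}$. Suppose $0<s<s_{cr}$. Then for every $\epsilon>0$ there exist a solution $u$ of the viscous nonlinear wave equation $$\partial_{tt}u-\Delta u+\sqrt{-\Delta}\,\partial_t u+u^p=0\quad\text{on }\mathbb{R}^n,$$ with initial datum $u(0)\in\mathcal{S}(\mathbb{R}^n)$, and a time $t$, such that $$\|u(0)\|_{H^s(\mathbb{R}^n)}<\epsilon,\qquad \partial_t u(0)=0,\qquad 0<t<\epsilon,\qquad \|u(t)\|_{H^s(\mathbb{R}^n)}>\epsilon^{-1}.$$ Consequently, the solution map $(u(0),\partial_tu(0))\mapsto u$ for this equation is not continuous at $(0,0)\in H^s(\mathbb{R}^n)\times H^{s-1}(\mathbb{R}^n)$ for $0<s<s_{cr}$.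
   Context: $\sqrt{-\Delta}$ is the Fourier multiplier with symbol $|\xi|$. $H^s(\mathbb{R}^n)$ is the usual inhomogeneous Sobolev space and $\mathcal{S}(\mathbb{R}^n)$ the Schwartz class. *)

theory Defs
  imports "HOL-Analysis.Analysis"
begin

definition fourier :: "(real^'n \<Rightarrow> complex) \<Rightarrow> real^'n \<Rightarrow> complex" where
  "fourier f \<xi> = (\<integral>x. exp (- \<i> * complex_of_real (x \<bullet> \<xi>)) * f x \<partial>lborel)"

definition inv_fourier :: "(real^'n \<Rightarrow> complex) \<Rightarrow> real^'n \<Rightarrow> complex" where
  "inv_fourier g x = complex_of_real ((2 * pi) powr (- real CARD('n))) *
      (\<integral>\<xi>. exp (\<i> * complex_of_real (x \<bullet> \<xi>)) * g \<xi> \<partial>lborel)"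

text \<open>Inhomogeneous Sobolev norm, normalised so that the H^0 norm is the L^2 norm.\<close>
definition sobolev_norm :: "real \<Rightarrow> (real^'n \<Rightarrow> real) \<Rightarrow> real" where
  "sobolev_norm s f = sqrt ((2 * pi) powr (- real CARD('n)) *
      (\<integral>\<xi>. (1 + (norm \<xi>)\<^sup>2) powr s * (cmod (fourier (\<lambda>x. complex_of_real (f x)) \<xi>))\<^sup>2 \<partial>lborel))"

definition sqrt_neg_lap :: "(real^'n \<Rightarrow> real) \<Rightarrow> real^'n \<Rightarrow> real" where
  "sqrt_neg_lap f x = Re (inv_fourier (\<lambda>\<xi>. complex_of_real (norm \<xi>) * fourier (\<lambda>y. complex_of_real (f y)) \<xi>) x)"

definition partial :: "'n \<Rightarrow> (real^'n \<Rightarrow> real) \<Rightarrow> real^'n \<Rightarrow> real" where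
  "partial i f x = deriv (\<lambda>h. f (x + h *\<^sub>R axis i 1)) 0"

definition has_partial_at :: "'n \<Rightarrow> (real^'n \<Rightarrow> real) \<Rightarrow> real^'n \<Rightarrow> bool" where
  "has_partial_at i f x \<longleftrightarrow> (\<lambda>h. f (x + h *\<^sub>R axis i 1)) differentiable (at 0)"

fun partials :: "'n list \<Rightarrow> (real^'n \<Rightarrow> real) \<Rightarrow> real^'n \<Rightarrow> real" where
  "partials [] f = f"
| "partials (i # is) f = partial i (partials is f)"

definition laplacian :: "(real^'n \<Rightarrow> real) \<Rightarrow> real^'n \<Rightarrow> real" where
  "laplacian f x = (\<Sum>i\<in>UNIV. partial i (partial i f) x)"

definition schwartz :: "(real^'n \<Rightarrow> real) \<Rightarrow> bool" where
  "schwartz f \<longleftrightarrow>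
     (\<forall>ds. continuous_on UNIV (partials ds f)
        \<and> (\<forall>i x. has_partial_at i (partials ds f) x)
        \<and> (\<forall>k::nat. \<exists>C. \<forall>x. (1 + norm x) ^ k * \<bar>partials ds f x\<bar> \<le> C))"

definition dt :: "real \<Rightarrow> (real \<Rightarrow> real^'n \<Rightarrow> real) \<Rightarrow> real \<Rightarrow> real^'n \<Rightarrow> real" where
  "dt T u t x = vector_derivative (\<lambda>\<tau>. u \<tau> x) (at t within {0..T})"

definition solves_vnlw :: "nat \<Rightarrow> real \<Rightarrow> (real \<Rightarrow> real^'n \<Rightarrow> real) \<Rightarrow> bool" where
  "solves_vnlw p T u \<longleftrightarrow> T > 0 \<and>
     continuous_on ({0..T} \<times> UNIV) (\<lambda>(t, x). u t x) \<and>
     continuous_on ({0..T} \<times> UNIV) (\<lambda>(t, x). dt T u t x) \<and>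
     continuous_on ({0..T} \<times> UNIV) (\<lambda>(t, x). dt T (dt T u) t x) \<and>
     (\<forall>t\<in>{0..T}. \<forall>x.
        (\<lambda>\<tau>. u \<tau> x) differentiable (at t within {0..T}) \<and>
        (\<lambda>\<tau>. dt T u \<tau> x) differentiable (at t within {0..T}) \<and>
        (\<forall>i. has_partial_at i (u t) x \<and> has_partial_at i (partial i (u t)) x)) \<and>
     (\<forall>t\<in>{0..T}.
        integrable lborel (u t) \<and>
        integrable lborel (dt T u t) \<and>
        integrable lborel (\<lambda>\<xi>. norm \<xi> * cmod (fourier (\<lambda>y. complex_of_real (dt T u t y)) \<xi>))) \<and>
     (\<forall>t\<in>{0..T}. \<forall>x.
        dt T (dt T u) t x - laplacian (u t) x + sqrt_neg_lap (dt T u t) x + (u t x) ^ p = 0)"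

end

theory Submission
  imports Defs "HOL-Probability.Distributions"
begin

text \<open>
  The argument is the one of Christ, Colliander and Tao. Substituting
  \<open>u t x = \<kappa> v (t / \<rho>) (\<delta> x / \<rho>)\<close> with \<open>\<kappa> = \<rho> powr (- 2 / (p - 1))\<close> turns the equation into
  \<open>v'' + \<delta> |D| v' - \<delta>\<^sup>2 \<Delta> v + v ^ p = 0\<close>, which for small \<open>\<delta>\<close> is a perturbation of the pointwise equation
  \<open>v'' + v ^ p = 0\<close>. For the Gaussian datum gs and \<open>q = (p - 1) / 2\<close> the latter has the solution
  \<open>gs x V (t gs x ^ q)\<close> with V oscillating, so its spectrum drifts to infinity with t and so does its homogeneous
  Sobolev norm of order \<open>s > 0\<close>. Below the critical exponent \<open>\<rho>\<close> can be chosen, depending on \<open>\<delta>\<close>, so that the rescaled datum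
  stays small while the lifespan shrinks to 0.

  Everything takes place in the algebra of functions f for which f and \<open>exp (sqrt |\<xi>|)\<close> times the transform of f
  are integrable. This weight is submultiplicative, hence the norm is an algebra norm; it dominates the symbols of all derivatives;
  and it grows subexponentially, so that the spectral radius of f is the supremum of \<open>|f|\<close>. The last fact
  makes the pointwise equation solvable in the algebra for all times. The damping makes the
  propagator of \<open>v'' + \<delta> |D| v' - \<delta>\<^sup>2 \<Delta> v = 0\<close> a convolution with an integrable kernel, because its symbol is a
  combination of \<open>exp (- om \<delta> |\<xi>| t)\<close> and its conjugate, where \<open>om = exp (\<i> pi / 3)\<close> has positive real part.
\<close>

section \<open>Integration on Euclidean space\<close>

text \<open>The norm of the algebra sees the drift of the spectrum: along the pointwise solution it
  may grow with t, and Picard steps measured in it would shrink. Energy conservation controls only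
  the suprema of the solution and of its velocity. The locale \<open>gauge\<close> bridges the two
  by an equivalent norm, adapted to the current data, in which multiplying by the data costs a
  factor governed by their suprema; hence all steps have the same length.

  The drift is not computed but detected by duality: the solution is paired with a function g built
  from itself, whose transform tends to 0 on bounded sets while the pairing does not. This treats
  every s > 0 at once and needs no rate.

  The propagator acts on v - phi, with the Laplacian of the datum as a source, and on velocities,
  where its symbol depends on \<delta> |\<xi>| t alone: the dilates of one kernel serve all times.

  After rescaling, the initial and the final norm carry the same factor, so the inflation comes from
  the energy alone; s < s_cr is what allows this factor to stay fixed while lifespan and spatial
  scale tend to 0.\<close>

lemma borel_measurable_cis [measurable (raw)]:
  fixes f :: "'a \<Rightarrow> real"
  assumes [measurable]: "f \<in> borel_measurable M"
  shows "(\<lambda>x. cis (f x)) \<in> borel_measurable M"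
  unfolding cis_conv_exp by measurable

lemma continuous_on_integral_dominated:
  fixes f :: "'y::first_countable_topology \<Rightarrow> 'x \<Rightarrow> 'c::{banach,second_countable_topology}"
  assumes meas: "\<And>y. y \<in> S \<Longrightarrow> f y \<in> borel_measurable M"
    and g: "integrable M g"
    and bound: "\<And>y x. y \<in> S \<Longrightarrow> norm (f y x) \<le> g x"
    and cont: "\<And>x. continuous_on S (\<lambda>y. f y x)"
  shows "continuous_on S (\<lambda>y. \<integral>x. f y x \<partial>M)"
proof -
  have "((\<lambda>y. \<integral>x. f y x \<partial>M) \<longlongrightarrow> (\<integral>x. f a x \<partial>M)) (at a within S)" if a: "a \<in> S" for a
    unfolding tendsto_at_iff_sequentially o_def
  proof (intro allI impI)
    fix X assume X: "\<forall>i. X i \<in> S - {a}" "X \<longlonglongrightarrow> a"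
    have "(\<lambda>n. f (X n) x) \<longlonglongrightarrow> f a x" for x
      by (rule continuous_on_tendsto_compose[OF cont[of x] X(2) a]) (use X in auto)
    then show "(\<lambda>n. \<integral>x. f (X n) x \<partial>M) \<longlonglongrightarrow> (\<integral>x. f a x \<partial>M)"
      by (intro integral_dominated_convergence[where w=g]) (use X a meas g bound in auto)
  qed
  then show ?thesis by (auto simp: continuous_on_def)
qed

text \<open>Fatou's lemma for the norms, with the bound required only from index N on because the
  lower limit ignores the beginning. It transfers the Cauchy estimates of the algebra norm to
  pointwise limits.\<close>

lemma integrable_fatou:
  fixes h :: "nat \<Rightarrow> 'a \<Rightarrow> 'b::{banach,second_countable_topology}"
  assumes int: "\<And>m. integrable M (h m)"
    and lim: "\<And>x. (\<lambda>m. h m x) \<longlonglongrightarrow> h' x"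
    and bd: "\<And>m. m \<ge> N \<Longrightarrow> (\<integral>x. norm (h m x) \<partial>M) \<le> B"
  shows "integrable M h'" "(\<integral>x. norm (h' x) \<partial>M) \<le> B"
proof -
  have [measurable]: "\<And>m. h m \<in> borel_measurable M"
    using int by auto
  have m [measurable]: "h' \<in> borel_measurable M"
    by (rule borel_measurable_LIMSEQ_metric[of h]) (use lim in auto)
  have B0: "0 \<le> B"
    by (rule order_trans[OF _ bd[of N]]) auto
  have "(\<integral>\<^sup>+x. ennreal (norm (h' x)) \<partial>M) = (\<integral>\<^sup>+x. liminf (\<lambda>m. ennreal (norm (h m x))) \<partial>M)"
    by (intro nn_integral_cong lim_imp_Liminf[symmetric] tendsto_ennrealI tendsto_norm lim) auto
  also have "\<dots> \<le> liminf (\<lambda>m. \<integral>\<^sup>+x. ennreal (norm (h m x)) \<partial>M)"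
    by (intro nn_integral_liminf) auto
  also have "\<dots> \<le> ennreal B"
  proof (rule Liminf_le)
    show "\<forall>\<^sub>F m in sequentially. (\<integral>\<^sup>+x. ennreal (norm (h m x)) \<partial>M) \<le> ennreal B"
      using eventually_ge_at_top[of N]
      by eventually_elim (subst nn_integral_eq_integral, use int bd in \<open>auto intro!: ennreal_leI\<close>)
  qed auto
  finally have le: "(\<integral>\<^sup>+x. ennreal (norm (h' x)) \<partial>M) \<le> ennreal B" .
  show I: "integrable M h'"
    by (rule integrableI_bounded) (use le in \<open>auto simp: ennreal_less_top intro: le_less_trans\<close>)
  show "(\<integral>x. norm (h' x) \<partial>M) \<le> B"
    using le B0 I by (subst (asm) nn_integral_eq_integral) (auto simp: ennreal_le_iff)
qed

lemma
  fixes f :: "'a::euclidean_space \<Rightarrow> 'b::{banach,second_countable_topology}"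
  assumes [measurable]: "f \<in> borel_measurable borel" and c: "c \<noteq> 0"
  shows integrable_affine_iff: "integrable lborel (\<lambda>x. f (t + c *\<^sub>R x)) \<longleftrightarrow> integrable lborel f"
    and integral_affine: "(\<integral>x. f x \<partial>lborel) = \<bar>c\<bar> ^ DIM('a) *\<^sub>R (\<integral>x. f (t + c *\<^sub>R x) \<partial>lborel)"
proof -
  have eq: "lborel = density (distr lborel borel (\<lambda>x. t + c *\<^sub>R x)) (\<lambda>_. ennreal (\<bar>c\<bar>^DIM('a)))"
    using lborel_affine[OF c, of t] by (simp add: ennreal_power)
  show "integrable lborel (\<lambda>x. f (t + c *\<^sub>R x)) \<longleftrightarrow> integrable lborel f"
  proof -
    have "integrable lborel f \<longleftrightarrow> integrable lborel (\<lambda>x. \<bar>c\<bar> ^ DIM('a) *\<^sub>R f (t + c *\<^sub>R x))"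
      by (subst eq, subst integrable_density) (use c in \<open>auto simp: integrable_distr_eq\<close>)
    also have "\<dots> \<longleftrightarrow> integrable lborel (\<lambda>x. f (t + c *\<^sub>R x))"
      using c integrable_scaleR_right[of "inverse (\<bar>c\<bar> ^ DIM('a))" lborel "\<lambda>x. \<bar>c\<bar> ^ DIM('a) *\<^sub>R f (t + c *\<^sub>R x)"]
      by auto
    finally show ?thesis ..
  qed
  show "(\<integral>x. f x \<partial>lborel) = \<bar>c\<bar> ^ DIM('a) *\<^sub>R (\<integral>x. f (t + c *\<^sub>R x) \<partial>lborel)"
    by (subst eq, subst integral_density) (auto simp: integral_distr)
qed

lemma
  fixes f :: "'a::euclidean_space \<Rightarrow> 'b::{banach,second_countable_topology}"
  assumes [measurable]: "f \<in> borel_measurable borel"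
  shows integrable_shift_iff: "integrable lborel (\<lambda>x. f (x - a)) \<longleftrightarrow> integrable lborel f"
    and lborel_integral_shift: "(\<integral>x. f (x - a) \<partial>lborel) = (\<integral>x. f x \<partial>lborel)"
    and integrable_reflect_iff: "integrable lborel (\<lambda>x. f (a - x)) \<longleftrightarrow> integrable lborel f"
    and lborel_integral_reflect: "(\<integral>x. f (a - x) \<partial>lborel) = (\<integral>x. f x \<partial>lborel)"
  using integrable_affine_iff[of f 1 "-a"] integral_affine[of f 1 "-a"]
    integrable_affine_iff[of f "-1" "a"] integral_affine[of f "-1" "a"]
  by (auto simp: algebra_simps)

text \<open>Fubini's criterion with explicit majorants: b dominates each slice and B the integrals
  of the slices. The interchanges of integration below supply such a pair.\<close>

lemma integrable_pairI:
  fixes f :: "'a::euclidean_space \<times> 'b::euclidean_space \<Rightarrow> 'c::{banach,second_countable_topology}"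
  assumes [measurable]: "f \<in> borel_measurable (borel \<Otimes>\<^sub>M borel)"
    and b: "\<And>x. integrable lborel (b x)" and le: "\<And>x y. norm (f (x, y)) \<le> b x y"
    and B: "integrable lborel B" and bB: "\<And>x. (\<integral>y. b x y \<partial>lborel) \<le> B x"
  shows "integrable (lborel \<Otimes>\<^sub>M lborel) f"
proof (rule lborel_pair.Fubini_integrable)
  have *: "integrable lborel (\<lambda>y. f (x, y))" for x
    by (rule Bochner_Integration.integrable_bound[OF b[of x]])
       (auto intro!: AE_I2 order_trans[OF le abs_ge_self])
  show "AE x in lborel. integrable lborel (\<lambda>y. f (x, y))"
    by (intro AE_I2 *)
  show "integrable lborel (\<lambda>x. \<integral>y. norm (f (x, y)) \<partial>lborel)"
  proof (rule Bochner_Integration.integrable_bound[OF B])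
    have "norm (\<integral>y. norm (f (x, y)) \<partial>lborel) \<le> norm (B x)" for x
    proof -
      have "(\<integral>y. norm (f (x, y)) \<partial>lborel) \<le> (\<integral>y. b x y \<partial>lborel)"
        by (intro integral_mono b integrable_norm *) (use le in auto)
      moreover have "0 \<le> (\<integral>y. norm (f (x, y)) \<partial>lborel)" by (intro integral_nonneg_AE) auto
      ultimately show ?thesis using bB[of x] by auto
    qed
    then show "AE x in lborel. norm (\<integral>y. norm (f (x, y)) \<partial>lborel) \<le> norm (B x)" by auto
  qed measurable
qed auto

lemma integral_swap:
  fixes f :: "'a::euclidean_space \<Rightarrow> 'b::euclidean_space \<Rightarrow> 'c::{banach,second_countable_topology}"
  assumes "(\<lambda>(x,y). f x y) \<in> borel_measurable (borel \<Otimes>\<^sub>M borel)"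
    and "\<And>x. integrable lborel (b x)" and "\<And>x y. norm (f x y) \<le> b x y"
    and "integrable lborel B" and "\<And>x. (\<integral>y. b x y \<partial>lborel) \<le> B x"
  shows "(\<integral>x. (\<integral>y. f x y \<partial>lborel) \<partial>lborel) = (\<integral>y. (\<integral>x. f x y \<partial>lborel) \<partial>lborel)"
    and "integrable lborel (\<lambda>x. \<integral>y. f x y \<partial>lborel)"
    and "integrable lborel (\<lambda>y. \<integral>x. f x y \<partial>lborel)"
proof -
  have i: "integrable (lborel \<Otimes>\<^sub>M lborel) (\<lambda>(x,y). f x y)"
    by (rule integrable_pairI[where b=b and B=B]) (use assms in auto)
  show "(\<integral>x. (\<integral>y. f x y \<partial>lborel) \<partial>lborel) = (\<integral>y. (\<integral>x. f x y \<partial>lborel) \<partial>lborel)"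
    using lborel_pair.Fubini_integral[OF i] by simp
  show "integrable lborel (\<lambda>x. \<integral>y. f x y \<partial>lborel)"
    using lborel_pair.integrable_fst'[OF i] by simp
  show "integrable lborel (\<lambda>y. \<integral>x. f x y \<partial>lborel)"
    using lborel_pair.integrable_snd[OF i] by simp
qed

text \<open>The multiplication formula behind Parseval's identity, the transform of a product and
  the inversion of multipliers: for a bounded phase q, a multiple of |a| |b| is an integrable
  majorant.\<close>

lemma integral_swap_phase:
  fixes a :: "'a::euclidean_space \<Rightarrow> complex" and b :: "'b::euclidean_space \<Rightarrow> complex"
  assumes a: "integrable lborel a" and b: "integrable lborel b"
    and q [measurable]: "(\<lambda>(x,y). q x y) \<in> borel_measurable (borel \<Otimes>\<^sub>M borel)"
    and le: "\<And>x y. cmod (q x y) \<le> C"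
  shows "(\<integral>x. a x * (\<integral>y. q x y * b y \<partial>lborel) \<partial>lborel) = (\<integral>y. b y * (\<integral>x. q x y * a x \<partial>lborel) \<partial>lborel)"
proof -
  have [measurable]: "a \<in> borel_measurable borel" "b \<in> borel_measurable borel"
    using a b by auto
  have "(\<integral>x. a x * (\<integral>y. q x y * b y \<partial>lborel) \<partial>lborel) = (\<integral>x. (\<integral>y. a x * (q x y * b y) \<partial>lborel) \<partial>lborel)"
    by simp
  also have "\<dots> = (\<integral>y. (\<integral>x. a x * (q x y * b y) \<partial>lborel) \<partial>lborel)"
  proof (rule integral_swap(1)[where b="\<lambda>x y. C * cmod (a x) * cmod (b y)" and
       B="\<lambda>x. C * cmod (a x) * (\<integral>y. cmod (b y) \<partial>lborel)"])
    show "norm (a x * (q x y * b y)) \<le> C * cmod (a x) * cmod (b y)" for x y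
      using mult_right_mono[OF le[of x y], of "cmod (a x) * cmod (b y)"]
      by (simp add: norm_mult ac_simps)
  qed (use a b in auto)
  also have "\<dots> = (\<integral>y. b y * (\<integral>x. q x y * a x \<partial>lborel) \<partial>lborel)"
    by (subst integral_mult_right_zero[symmetric]) (simp add: ac_simps)
  finally show ?thesis .
qed

section \<open>Fourier transforms of integrable functions\<close>

lemma exp_i_cis: "exp (\<i> * complex_of_real r) = cis r" "exp (- \<i> * complex_of_real r) = cis (- r)"
  by (simp_all add: cis_conv_exp mult.commute)

lemma fourier_cis: "fourier f \<xi> = (\<integral>x. cis (- (x \<bullet> \<xi>)) * f x \<partial>lborel)"
  unfolding fourier_def exp_i_cis ..

text \<open>The inversion constant; the argument only carries the dimension, which is a
  type.\<close>

definition fnorm :: "'n itself \<Rightarrow> real" where "fnorm _ = (2 * pi) powr (- real CARD('n))"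

lemma inv_fourier_cis:
  "inv_fourier g (x::real^'n) = complex_of_real (fnorm TYPE('n)) * (\<integral>\<xi>. cis (x \<bullet> \<xi>) * g \<xi> \<partial>lborel)"
  unfolding inv_fourier_def exp_i_cis fnorm_def ..

lemma fnorm_pos: "fnorm TYPE('n) > 0"
  by (simp add: fnorm_def)

lemma integrable_phase:
  fixes f :: "'a::euclidean_space \<Rightarrow> complex"
  assumes "integrable lborel f" "q \<in> borel_measurable borel" "\<And>x. cmod (q x) \<le> C"
  shows "integrable lborel (\<lambda>x. q x * f x)"
proof (rule Bochner_Integration.integrable_bound[of _ "\<lambda>x. C * cmod (f x)"])
  show "AE x in lborel. norm (q x * f x) \<le> norm (C * cmod (f x))"
    by (intro AE_I2) (auto simp: norm_mult abs_mult intro!: mult_right_mono order_trans[OF assms(3) abs_ge_self])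
qed (use assms in auto)

lemma continuous_fourier:
  assumes f: "integrable lborel f"
  shows "continuous_on UNIV (fourier f)"
proof -
  have "fourier f = (\<lambda>\<xi>. \<integral>x. cis (- (x \<bullet> \<xi>)) * f x \<partial>lborel)"
    by (simp add: fourier_cis fun_eq_iff)
  moreover have "continuous_on UNIV (\<lambda>\<xi>. \<integral>x. cis (- (x \<bullet> \<xi>)) * f x \<partial>lborel)"
    by (rule continuous_on_integral_dominated[where g="\<lambda>x. cmod (f x)"])
       (use f in \<open>auto simp: norm_mult intro!: continuous_intros\<close>)
  ultimately show ?thesis by simp
qed

lemma borel_measurable_fourier [measurable]:
  "integrable lborel f \<Longrightarrow> fourier f \<in> borel_measurable borel"
  by (intro borel_measurable_continuous_onI continuous_fourier)

lemma cmod_fourier_le: "cmod (fourier f \<xi>) \<le> (\<integral>x. cmod (f x) \<partial>lborel)"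
  unfolding fourier_cis by (rule order_trans[OF integral_norm_bound]) (simp add: norm_mult)

lemma fourier_scaleR_arg:
  fixes f :: "real^'n \<Rightarrow> complex"
  assumes [measurable]: "f \<in> borel_measurable borel" and c: "c > 0"
  shows "fourier (\<lambda>x. f (c *\<^sub>R x)) \<xi> = complex_of_real (c powr (- real CARD('n))) * fourier f (\<xi> /\<^sub>R c)"
proof -
  have "fourier f (\<xi> /\<^sub>R c) = \<bar>c\<bar> ^ CARD('n) *\<^sub>R (\<integral>x. cis (- ((0 + c *\<^sub>R x) \<bullet> (\<xi> /\<^sub>R c))) * f (0 + c *\<^sub>R x) \<partial>lborel)"
    unfolding fourier_cis using c
    by (subst integral_affine[where c=c and t=0]) auto
  also have "\<dots> = \<bar>c\<bar> ^ CARD('n) *\<^sub>R fourier (\<lambda>x. f (c *\<^sub>R x)) \<xi>"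
  proof -
    have "(0 + c *\<^sub>R x) \<bullet> (\<xi> /\<^sub>R c) = x \<bullet> \<xi>" for x :: "real^'n" using c by simp
    then show ?thesis unfolding fourier_cis by (simp only: add_0)
  qed
  finally show ?thesis using c
    by (simp add: powr_minus powr_realpow scaleR_conv_of_real field_simps)
qed

section \<open>Weighted convolution\<close>

definition conv :: "('a::euclidean_space \<Rightarrow> complex) \<Rightarrow> ('a \<Rightarrow> complex) \<Rightarrow> 'a \<Rightarrow> complex" where
  "conv a b \<xi> = (\<integral>\<eta>. a (\<xi> - \<eta>) * b \<eta> \<partial>lborel)"

text \<open>Young's inequality in a weighted L^1 space: submultiplicativity distributes w over the
  two factors of the convolution, and translation invariance does the rest. It serves three weights,
  the constant 1, \<open>W\<close> and \<open>exp (2 * norm \<xi>)\<close>.\<close>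

lemma conv_weighted:
  fixes a b :: "'a::euclidean_space \<Rightarrow> complex" and w :: "'a \<Rightarrow> real"
  assumes [measurable]: "w \<in> borel_measurable borel" "a \<in> borel_measurable borel" "b \<in> borel_measurable borel"
    and w0: "\<And>x. w x > 0" and wm: "\<And>x y. w (x + y) \<le> w x * w y"
    and a: "integrable lborel (\<lambda>x. w x * cmod (a x))" and b: "integrable lborel (\<lambda>x. w x * cmod (b x))"
  shows "integrable lborel (\<lambda>\<xi>. w \<xi> * cmod (conv a b \<xi>))"
    and "(\<integral>\<xi>. w \<xi> * cmod (conv a b \<xi>) \<partial>lborel)
          \<le> (\<integral>x. w x * cmod (a x) \<partial>lborel) * (\<integral>x. w x * cmod (b x) \<partial>lborel)"
proof -
  let ?F = "\<lambda>\<eta> \<xi>. (w (\<xi> - \<eta>) * cmod (a (\<xi> - \<eta>))) * (w \<eta> * cmod (b \<eta>))"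
  let ?A = "\<integral>x. w x * cmod (a x) \<partial>lborel"
  have i1: "integrable lborel (\<lambda>\<xi>. w (\<xi> - \<eta>) * cmod (a (\<xi> - \<eta>)))" for \<eta>
    using integrable_shift_iff[of "\<lambda>x. w x * cmod (a x)" \<eta>] a by simp
  have e1: "(\<integral>\<xi>. w (\<xi> - \<eta>) * cmod (a (\<xi> - \<eta>)) \<partial>lborel) = ?A" for \<eta>
    using lborel_integral_shift[of "\<lambda>x. w x * cmod (a x)" \<eta>] by simp
  have ip: "integrable (lborel \<Otimes>\<^sub>M lborel) (\<lambda>(\<eta>, \<xi>). ?F \<eta> \<xi>)"
    by (rule integrable_pairI[where b="?F" and B="\<lambda>\<eta>. ?A * (w \<eta> * cmod (b \<eta>))"])
       (use w0 less_imp_le[OF w0] in \<open>auto intro!: integrable_mult_left integrable_mult_right b i1 simp: e1 abs_mult abs_of_pos\<close>)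
  have sw: "(\<integral>\<eta>. (\<integral>\<xi>. ?F \<eta> \<xi> \<partial>lborel) \<partial>lborel) = (\<integral>\<xi>. (\<integral>\<eta>. ?F \<eta> \<xi> \<partial>lborel) \<partial>lborel)"
    using lborel_pair.Fubini_integral[OF ip] by simp
  have i2: "integrable lborel (\<lambda>\<xi>. \<integral>\<eta>. ?F \<eta> \<xi> \<partial>lborel)"
    using lborel_pair.integrable_snd[OF ip] by simp
  have i3: "AE \<xi> in lborel. integrable lborel (\<lambda>\<eta>. ?F \<eta> \<xi>)"
    using lborel_pair.AE_integrable_snd[OF ip] by simp
  \<comment> \<open>Only almost everywhere: where the weighted product is not integrable, the
    integral on the right is 0 by convention while \<open>conv a b\<close> may not vanish.\<close>
  have le: "AE \<xi> in lborel. w \<xi> * cmod (conv a b \<xi>) \<le> (\<integral>\<eta>. ?F \<eta> \<xi> \<partial>lborel)"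
    using i3
  proof eventually_elim
    case (elim \<xi>)
    have "cmod (conv a b \<xi>) \<le> (\<integral>\<eta>. cmod (a (\<xi> - \<eta>)) * cmod (b \<eta>) \<partial>lborel)"
      unfolding conv_def by (rule order_trans[OF integral_norm_bound]) (simp add: norm_mult)
    then have "w \<xi> * cmod (conv a b \<xi>) \<le> w \<xi> * (\<integral>\<eta>. cmod (a (\<xi> - \<eta>)) * cmod (b \<eta>) \<partial>lborel)"
      using w0 by (simp add: less_imp_le)
    also have "\<dots> = (\<integral>\<eta>. w \<xi> * (cmod (a (\<xi> - \<eta>)) * cmod (b \<eta>)) \<partial>lborel)" by simp
    also have "\<dots> \<le> (\<integral>\<eta>. ?F \<eta> \<xi> \<partial>lborel)"
    proof (rule integral_mono')
      fix \<eta>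
      have "w \<xi> \<le> w (\<xi> - \<eta>) * w \<eta>" using wm[of "\<xi> - \<eta>" \<eta>] by simp
      from mult_right_mono[OF this, of "cmod (a (\<xi> - \<eta>)) * cmod (b \<eta>)"]
      show "w \<xi> * (cmod (a (\<xi> - \<eta>)) * cmod (b \<eta>)) \<le> ?F \<eta> \<xi>" by (simp add: ac_simps)
      show "0 \<le> ?F \<eta> \<xi>" by (simp add: less_imp_le[OF w0])
    qed (fact elim)
    finally show ?case .
  qed
  have [measurable]: "conv a b \<in> borel_measurable borel"
    unfolding conv_def by measurable
  show I: "integrable lborel (\<lambda>\<xi>. w \<xi> * cmod (conv a b \<xi>))"
    by (rule Bochner_Integration.integrable_bound[OF i2])
       (use le less_imp_le[OF w0] in \<open>auto simp: abs_mult\<close>)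
  have "(\<integral>\<xi>. w \<xi> * cmod (conv a b \<xi>) \<partial>lborel) \<le> (\<integral>\<xi>. (\<integral>\<eta>. ?F \<eta> \<xi> \<partial>lborel) \<partial>lborel)"
    by (rule integral_mono_AE[OF I i2 le])
  also have "\<dots> = (\<integral>\<eta>. (\<integral>\<xi>. ?F \<eta> \<xi> \<partial>lborel) \<partial>lborel)" using sw ..
  also have "\<dots> = (\<integral>\<eta>. ?A * (w \<eta> * cmod (b \<eta>)) \<partial>lborel)" by (simp add: e1)
  also have "\<dots> = ?A * (\<integral>x. w x * cmod (b x) \<partial>lborel)" by simp
  finally show "(\<integral>\<xi>. w \<xi> * cmod (conv a b \<xi>) \<partial>lborel) \<le> ?A * (\<integral>x. w x * cmod (b x) \<partial>lborel)" .
qed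

lemma
  fixes a b :: "'a::euclidean_space \<Rightarrow> complex"
  assumes a: "integrable lborel a" and b: "integrable lborel b"
  shows integrable_conv: "integrable lborel (conv a b)"
    and integral_cis_conv: "(\<integral>\<xi>. cis (x \<bullet> \<xi>) * conv a b \<xi> \<partial>lborel)
      = (\<integral>\<xi>. cis (x \<bullet> \<xi>) * a \<xi> \<partial>lborel) * (\<integral>\<xi>. cis (x \<bullet> \<xi>) * b \<xi> \<partial>lborel)"
proof -
  have [measurable]: "a \<in> borel_measurable borel" "b \<in> borel_measurable borel"
    using a b by auto
  have [measurable]: "conv a b \<in> borel_measurable borel"
    unfolding conv_def by measurable
  have "integrable lborel (\<lambda>\<xi>. 1 * cmod (conv a b \<xi>))"
    by (rule conv_weighted) (use a b in auto)
  then show "integrable lborel (conv a b)" by (simp add: integrable_norm_iff)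
  have "(\<integral>\<xi>. cis (x \<bullet> \<xi>) * conv a b \<xi> \<partial>lborel) = (\<integral>\<xi>. (\<integral>\<eta>. cis (x \<bullet> \<xi>) * (a (\<xi> - \<eta>) * b \<eta>) \<partial>lborel) \<partial>lborel)"
    unfolding conv_def by simp
  also have "\<dots> = (\<integral>\<eta>. (\<integral>\<xi>. cis (x \<bullet> \<xi>) * (a (\<xi> - \<eta>) * b \<eta>) \<partial>lborel) \<partial>lborel)"
  proof (rule integral_swap(1)[symmetric, where b="\<lambda>\<eta> \<xi>. cmod (a (\<xi> - \<eta>)) * cmod (b \<eta>)" and
        B="\<lambda>\<eta>. (\<integral>x. cmod (a x) \<partial>lborel) * cmod (b \<eta>)"])
    show "integrable lborel (\<lambda>\<xi>. cmod (a (\<xi> - \<eta>)) * cmod (b \<eta>))" for \<eta>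
      using integrable_shift_iff[of "\<lambda>x. cmod (a x)" \<eta>] a by simp
    show "(\<integral>\<xi>. cmod (a (\<xi> - \<eta>)) * cmod (b \<eta>) \<partial>lborel) \<le> (\<integral>x. cmod (a x) \<partial>lborel) * cmod (b \<eta>)" for \<eta>
      using lborel_integral_shift[of "\<lambda>x. cmod (a x)" \<eta>] by simp
  qed (use b in \<open>auto simp: norm_mult\<close>)
  also have "\<dots> = (\<integral>\<eta>. (cis (x \<bullet> \<eta>) * b \<eta>) * (\<integral>\<xi>. cis (x \<bullet> \<xi>) * a \<xi> \<partial>lborel) \<partial>lborel)"
  proof (rule Bochner_Integration.integral_cong[OF refl])
    fix \<eta>
    have "(\<integral>\<xi>. cis (x \<bullet> \<xi>) * (a (\<xi> - \<eta>) * b \<eta>) \<partial>lborel)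
      = (\<integral>\<xi>. cis (x \<bullet> \<eta>) * b \<eta> * (cis (x \<bullet> (\<xi> - \<eta>)) * a (\<xi> - \<eta>)) \<partial>lborel)"
      by (intro Bochner_Integration.integral_cong refl)
         (simp add: inner_diff_right cis_mult mult.assoc mult.left_commute flip: cis_divide)
    also have "\<dots> = cis (x \<bullet> \<eta>) * b \<eta> * (\<integral>\<xi>. cis (x \<bullet> (\<xi> - \<eta>)) * a (\<xi> - \<eta>) \<partial>lborel)"
      by simp
    also have "(\<integral>\<xi>. cis (x \<bullet> (\<xi> - \<eta>)) * a (\<xi> - \<eta>) \<partial>lborel) = (\<integral>\<xi>. cis (x \<bullet> \<xi>) * a \<xi> \<partial>lborel)"
      by (rule lborel_integral_shift) measurable
    finally show "(\<integral>\<xi>. cis (x \<bullet> \<xi>) * (a (\<xi> - \<eta>) * b \<eta>) \<partial>lborel)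
      = (cis (x \<bullet> \<eta>) * b \<eta>) * (\<integral>\<xi>. cis (x \<bullet> \<xi>) * a \<xi> \<partial>lborel)" .
  qed
  also have "\<dots> = (\<integral>\<xi>. cis (x \<bullet> \<xi>) * a \<xi> \<partial>lborel) * (\<integral>\<xi>. cis (x \<bullet> \<xi>) * b \<xi> \<partial>lborel)"
    by simp
  finally show "(\<integral>\<xi>. cis (x \<bullet> \<xi>) * conv a b \<xi> \<partial>lborel)
      = (\<integral>\<xi>. cis (x \<bullet> \<xi>) * a \<xi> \<partial>lborel) * (\<integral>\<xi>. cis (x \<bullet> \<xi>) * b \<xi> \<partial>lborel)" .
qed

section \<open>A weighted Wiener algebra\<close>

definition W :: "real^'n \<Rightarrow> real" where "W \<xi> = exp (sqrt (norm \<xi>))"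

lemma W_pos [simp]: "W \<xi> > 0" and W_ge_1 [simp]: "W \<xi> \<ge> 1"
  by (simp_all add: W_def)

lemma W_nonneg [simp]: "W \<xi> \<ge> 0"
  by (simp add: W_def)

lemma W_add: "W (x + y) \<le> W x * W y"
proof -
  have "sqrt (norm (x + y)) \<le> sqrt (norm x + norm y)"
    by (simp add: norm_triangle_ineq)
  also have "\<dots> \<le> sqrt (norm x) + sqrt (norm y)"
    by (rule sqrt_add_le_add_sqrt) auto
  finally show ?thesis by (simp add: W_def flip: exp_add)
qed

lemma continuous_on_W [continuous_intros]: "continuous_on S W"
  unfolding W_def by (intro continuous_intros)

lemma borel_measurable_W [measurable]: "W \<in> borel_measurable borel"
  by (intro borel_measurable_continuous_onI continuous_on_W)

abbreviation FT :: "(real^'n \<Rightarrow> real) \<Rightarrow> real^'n \<Rightarrow> complex" where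
  "FT f \<equiv> fourier (\<lambda>x. complex_of_real (f x))"

text \<open>Inversion at every point is part of membership: it selects the continuous
  representative, so that a function of norm 0 vanishes identically. Each construction below
  verifies it for its own result.\<close>

definition wien :: "(real^'n \<Rightarrow> real) \<Rightarrow> bool" where
  "wien f \<longleftrightarrow> integrable lborel f \<and> integrable lborel (\<lambda>\<xi>. W \<xi> * cmod (FT f \<xi>)) \<and>
     (\<forall>x. inv_fourier (FT f) x = complex_of_real (f x))"

lemma wienD:
  assumes "wien f"
  shows "integrable lborel f" "integrable lborel (\<lambda>\<xi>. W \<xi> * cmod (FT f \<xi>))"
    "inv_fourier (FT f) x = complex_of_real (f x)" "integrable lborel (FT f)"
    "f \<in> borel_measurable borel" "FT f \<in> borel_measurable borel"
proof -
  show i: "integrable lborel f" and w: "integrable lborel (\<lambda>\<xi>. W \<xi> * cmod (FT f \<xi>))"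
    and "inv_fourier (FT f) x = complex_of_real (f x)"
    using assms by (auto simp: wien_def simp del: of_real_eq_iff)
  show m: "FT f \<in> borel_measurable borel"
    by (intro borel_measurable_fourier integrable_of_real i)
  show "integrable lborel (FT f)"
    by (rule Bochner_Integration.integrable_bound[OF w])
       (use m in \<open>auto simp: abs_mult intro!: AE_I2 mult_le_cancel_right1[THEN iffD2]\<close>)
  show "f \<in> borel_measurable borel" using i by auto
qed

lemma fourier_add: "integrable lborel a \<Longrightarrow> integrable lborel b \<Longrightarrow>
    fourier (\<lambda>x. a x + b x) \<xi> = fourier a \<xi> + fourier b \<xi>"
  unfolding fourier_cis
  by (subst Bochner_Integration.integral_add[symmetric])
     (auto intro!: integrable_phase[where C=1] simp: ring_distribs)

lemma fourier_cmult: "fourier (\<lambda>x. c * a x) \<xi> = c * fourier a \<xi>"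
  unfolding fourier_cis by (subst integral_mult_right_zero[symmetric]) (simp add: ac_simps)

lemma inv_fourier_add: "integrable lborel a \<Longrightarrow> integrable lborel b \<Longrightarrow>
    inv_fourier (\<lambda>x. a x + b x) \<xi> = inv_fourier a \<xi> + inv_fourier b \<xi>"
  unfolding inv_fourier_cis ring_distribs[symmetric]
  by (subst Bochner_Integration.integral_add[symmetric])
     (auto intro!: integrable_phase[where C=1] simp: ring_distribs)

lemma inv_fourier_cmult: "inv_fourier (\<lambda>x. c * a x) \<xi> = c * inv_fourier a \<xi>"
  unfolding inv_fourier_cis
  by (subst mult.left_commute, subst integral_mult_right_zero[symmetric]) (simp add: ac_simps)

lemma FT_add: "integrable lborel f \<Longrightarrow> integrable lborel g \<Longrightarrow>
    FT (\<lambda>x. f x + g x) \<xi> = FT f \<xi> + FT g \<xi>"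
  by (simp add: fourier_add)

lemma FT_cmult: "FT (\<lambda>x. c * f x) \<xi> = complex_of_real c * FT f \<xi>"
  by (simp add: fourier_cmult)

lemma wien_0: "wien (\<lambda>x. 0)"
  by (simp add: wien_def fourier_cis inv_fourier_cis)

lemma wien_cmult:
  assumes "wien f" shows "wien (\<lambda>x. c * f x)"
proof -
  note f = wienD[OF assms]
  have FT: "FT (\<lambda>x. c * f x) = (\<lambda>\<xi>. complex_of_real c * FT f \<xi>)"
    by (rule ext) (rule FT_cmult)
  show ?thesis unfolding wien_def FT
    using f(1) integrable_mult_right[OF f(2), of "\<bar>c\<bar>"] f(3)
    by (auto simp: norm_mult inv_fourier_cmult ac_simps)
qed

lemma wien_add:
  assumes "wien f" "wien g" shows "wien (\<lambda>x. f x + g x)"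
proof -
  note f = wienD[OF assms(1)] and g = wienD[OF assms(2)]
  have FT: "FT (\<lambda>x. f x + g x) = (\<lambda>\<xi>. FT f \<xi> + FT g \<xi>)"
    using f g by (intro ext FT_add)
  have "integrable lborel (\<lambda>\<xi>. W \<xi> * cmod (FT f \<xi> + FT g \<xi>))"
  proof (rule Bochner_Integration.integrable_bound[OF Bochner_Integration.integrable_add[OF f(2) g(2)]])
    show "AE \<xi> in lborel. norm (W \<xi> * cmod (FT f \<xi> + FT g \<xi>)) \<le> norm (W \<xi> * cmod (FT f \<xi>) + W \<xi> * cmod (FT g \<xi>))"
      by (intro AE_I2) (simp add: abs_mult norm_triangle_ineq flip: ring_distribs)
  qed (use f g in measurable)
  then show ?thesis unfolding wien_def FT
    using f(1,3,4) g(1,3,4) by (simp add: inv_fourier_add)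
qed

text \<open>Inversion is inserted for f alone, which is why g enters only as an integrable function;
  exchanging the integrals then leaves the transform of g at the shifted frequency.\<close>

lemma FT_mult:
  assumes "wien f" "integrable lborel g"
  shows "FT (\<lambda>x. f x * g x) \<xi> = complex_of_real (fnorm TYPE('n)) * conv (FT g) (FT f) (\<xi>::real^'n)"
proof -
  note f = wienD[OF assms(1)]
  have "FT (\<lambda>x. f x * g x) \<xi> = (\<integral>x. complex_of_real (fnorm TYPE('n)) *
      (complex_of_real (g x) * (\<integral>\<eta>. cis (- (x \<bullet> (\<xi> - \<eta>))) * FT f \<eta> \<partial>lborel)) \<partial>lborel)"
    unfolding fourier_cis[of "\<lambda>x. complex_of_real (f x * g x)"]
  proof (rule Bochner_Integration.integral_cong[OF refl])
    fix x
    have "(\<integral>\<eta>. cis (- (x \<bullet> (\<xi> - \<eta>))) * FT f \<eta> \<partial>lborel) = (\<integral>\<eta>. cis (- (x \<bullet> \<xi>)) * (cis (x \<bullet> \<eta>) * FT f \<eta>) \<partial>lborel)"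
      by (intro Bochner_Integration.integral_cong refl) (simp add: inner_diff_right cis_mult flip: mult.assoc)
    also have "\<dots> = cis (- (x \<bullet> \<xi>)) * (\<integral>\<eta>. cis (x \<bullet> \<eta>) * FT f \<eta> \<partial>lborel)" by simp
    finally show "cis (- (x \<bullet> \<xi>)) * complex_of_real (f x * g x) = complex_of_real (fnorm TYPE('n)) *
      (complex_of_real (g x) * (\<integral>\<eta>. cis (- (x \<bullet> (\<xi> - \<eta>))) * FT f \<eta> \<partial>lborel))"
      using f(3)[of x] unfolding inv_fourier_cis by simp
  qed
  also have "\<dots> = complex_of_real (fnorm TYPE('n)) *
     (\<integral>x. complex_of_real (g x) * (\<integral>\<eta>. cis (- (x \<bullet> (\<xi> - \<eta>))) * FT f \<eta> \<partial>lborel) \<partial>lborel)"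
    by simp
  also have "(\<integral>x. complex_of_real (g x) * (\<integral>\<eta>. cis (- (x \<bullet> (\<xi> - \<eta>))) * FT f \<eta> \<partial>lborel) \<partial>lborel)
      = (\<integral>\<eta>. FT f \<eta> * (\<integral>x. cis (- (x \<bullet> (\<xi> - \<eta>))) * complex_of_real (g x) \<partial>lborel) \<partial>lborel)"
    by (rule integral_swap_phase[where C=1]) (use f assms(2) in auto)
  also have "\<dots> = conv (FT g) (FT f) \<xi>"
    unfolding conv_def fourier_cis[of "\<lambda>x. complex_of_real (g x)"] by (simp add: mult.commute)
  finally show ?thesis .
qed

text \<open>With the inversion constant as a factor, this norm bounds the supremum and is
  submultiplicative with constant 1.\<close>

definition wnorm :: "(real^'n \<Rightarrow> real) \<Rightarrow> real" where
  "wnorm f = (\<integral>\<xi>. W \<xi> * cmod (FT f \<xi>) \<partial>lborel) * fnorm TYPE('n)"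

definition lnorm :: "(real^'n \<Rightarrow> real) \<Rightarrow> real" where
  "lnorm f = (\<integral>x. \<bar>f x\<bar> \<partial>lborel)"

lemma
  fixes f :: "real^'n \<Rightarrow> real"
  shows lnorm_nonneg: "lnorm f \<ge> 0" and wnorm_nonneg: "wnorm f \<ge> 0"
  unfolding lnorm_def wnorm_def using fnorm_pos[where 'n='n]
  by (auto intro!: mult_nonneg_nonneg integral_nonneg_AE simp: less_imp_le)

lemma FT_le_lnorm: "cmod (FT f \<xi>) \<le> lnorm f"
  using cmod_fourier_le[of "\<lambda>x. complex_of_real (f x)" \<xi>] by (simp add: lnorm_def)

lemma cmod_inv_fourier_le:
  assumes "integrable lborel (\<lambda>\<xi>. W \<xi> * cmod (g \<xi>))"
  shows "cmod (inv_fourier g (x::real^'n)) \<le> (\<integral>\<xi>. W \<xi> * cmod (g \<xi>) \<partial>lborel) * fnorm TYPE('n)"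
proof -
  have "cmod (\<integral>\<xi>. cis (x \<bullet> \<xi>) * g \<xi> \<partial>lborel) \<le> (\<integral>\<xi>. cmod (cis (x \<bullet> \<xi>) * g \<xi>) \<partial>lborel)"
    by (rule integral_norm_bound)
  also have "\<dots> \<le> (\<integral>\<xi>. W \<xi> * cmod (g \<xi>) \<partial>lborel)"
    by (rule integral_mono') (use assms in \<open>auto simp: norm_mult mult_le_cancel_right1\<close>)
  finally show ?thesis using fnorm_pos[where 'n='n]
    by (simp add: inv_fourier_cis norm_mult mult.commute)
qed

lemma abs_le_wnorm:
  assumes "wien f" shows "\<bar>f x\<bar> \<le> wnorm f"
  using cmod_inv_fourier_le[OF wienD(2)[OF assms], of x] wienD(3)[OF assms, of x]
  by (simp add: wnorm_def)

text \<open>The product inequality for \<open>lnorm\<close> is mixed: one factor is bounded by its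
  supremum, hence by \<open>wnorm\<close>. Together with the convolution estimate for
  \<open>wnorm\<close>, it makes the sum of the two norms submultiplicative.\<close>

lemma
  assumes "wien f" "wien g"
  shows wien_mult: "wien (\<lambda>x. f x * g x)"
    and wnorm_mult: "wnorm (\<lambda>x. f x * g x) \<le> wnorm f * wnorm g"
    and lnorm_mult: "lnorm (\<lambda>x. f x * g x) \<le> wnorm f * lnorm g"
proof -
  note f = wienD[OF assms(1)] and g = wienD[OF assms(2)]
  note [measurable] = f(5,6) g(5,6)
  let ?c = "fnorm TYPE('a)"
  have c: "?c > 0" by (rule fnorm_pos)
  have FT: "FT (\<lambda>x. f x * g x) = (\<lambda>\<xi>. complex_of_real ?c * conv (FT g) (FT f) \<xi>)"
    by (intro ext FT_mult assms g)
  have b: "\<bar>f x * g x\<bar> \<le> wnorm f * \<bar>g x\<bar>" for x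
    using abs_le_wnorm[OF assms(1), of x] by (simp add: abs_mult mult_right_mono)
  have i: "integrable lborel (\<lambda>x. f x * g x)"
    by (rule Bochner_Integration.integrable_bound[where f="\<lambda>x. wnorm f * \<bar>g x\<bar>"])
       (use g(1) b in \<open>auto simp: wnorm_nonneg abs_mult\<close>)
  have cw: "integrable lborel (\<lambda>\<xi>. W \<xi> * cmod (conv (FT g) (FT f) \<xi>))"
    "(\<integral>\<xi>. W \<xi> * cmod (conv (FT g) (FT f) \<xi>) \<partial>lborel) \<le>
       (\<integral>x. W x * cmod (FT g x) \<partial>lborel) * (\<integral>x. W x * cmod (FT f x) \<partial>lborel)"
    by (rule conv_weighted; use f g in \<open>auto intro: W_add\<close>)+
  have eq: "(\<lambda>\<xi>. W \<xi> * cmod (complex_of_real ?c * conv (FT g) (FT f) \<xi>)) = (\<lambda>\<xi>. ?c * (W \<xi> * cmod (conv (FT g) (FT f) \<xi>)))"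
    using c by (auto simp: norm_mult)
  have "inv_fourier (\<lambda>\<xi>. complex_of_real ?c * conv (FT g) (FT f) \<xi>) x = complex_of_real (f x * g x)" for x
  proof -
    have "inv_fourier (\<lambda>\<xi>. complex_of_real ?c * conv (FT g) (FT f) \<xi>) x = inv_fourier (FT f) x * inv_fourier (FT g) x"
      unfolding inv_fourier_cmult unfolding inv_fourier_cis integral_cis_conv[OF g(4) f(4)] by simp
    then show ?thesis using f(3) g(3) by simp
  qed
  then show "wien (\<lambda>x. f x * g x)"
    unfolding wien_def FT eq using i cw(1) by simp
  show "wnorm (\<lambda>x. f x * g x) \<le> wnorm f * wnorm g"
  proof -
    have "0 \<le> ?c * ?c" by simp
    from mult_left_mono[OF cw(2) this] show ?thesis
      unfolding wnorm_def FT eq integral_mult_right_zero by (simp only: mult_ac)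
  qed
  have "lnorm (\<lambda>x. f x * g x) \<le> (\<integral>x. wnorm f * \<bar>g x\<bar> \<partial>lborel)"
    unfolding lnorm_def by (rule integral_mono') (use b g(1) in \<open>auto simp: wnorm_nonneg\<close>)
  then show "lnorm (\<lambda>x. f x * g x) \<le> wnorm f * lnorm g"
    by (simp add: lnorm_def)
qed

lemma
  assumes "wien f" "wien g"
  shows wnorm_add: "wnorm (\<lambda>x. f x + g x) \<le> wnorm f + wnorm g"
    and lnorm_add: "lnorm (\<lambda>x. f x + g x) \<le> lnorm f + lnorm g"
proof -
  note f = wienD[OF assms(1)] and g = wienD[OF assms(2)]
  note h = wienD[OF wien_add[OF assms]]
  have FT: "FT (\<lambda>x. f x + g x) = (\<lambda>\<xi>. FT f \<xi> + FT g \<xi>)"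
    using f g by (intro ext FT_add)
  have "(\<integral>\<xi>. W \<xi> * cmod (FT f \<xi> + FT g \<xi>) \<partial>lborel) \<le> (\<integral>\<xi>. W \<xi> * cmod (FT f \<xi>) + W \<xi> * cmod (FT g \<xi>) \<partial>lborel)"
  proof (rule integral_mono')
    show "integrable lborel (\<lambda>\<xi>. W \<xi> * cmod (FT f \<xi>) + W \<xi> * cmod (FT g \<xi>))"
      using f g by (intro Bochner_Integration.integrable_add)
    show "W \<xi> * cmod (FT f \<xi> + FT g \<xi>) \<le> W \<xi> * cmod (FT f \<xi>) + W \<xi> * cmod (FT g \<xi>)" for \<xi>
      by (simp add: norm_triangle_ineq flip: ring_distribs)
  qed auto
  also have "\<dots> = (\<integral>\<xi>. W \<xi> * cmod (FT f \<xi>) \<partial>lborel) + (\<integral>\<xi>. W \<xi> * cmod (FT g \<xi>) \<partial>lborel)"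
    using f g by simp
  finally have "(\<integral>\<xi>. W \<xi> * cmod (FT f \<xi> + FT g \<xi>) \<partial>lborel) \<le> (\<integral>\<xi>. W \<xi> * cmod (FT f \<xi>) \<partial>lborel) + (\<integral>\<xi>. W \<xi> * cmod (FT g \<xi>) \<partial>lborel)" .
  from mult_right_mono[OF this less_imp_le[OF fnorm_pos[where 'n='a]]]
  show "wnorm (\<lambda>x. f x + g x) \<le> wnorm f + wnorm g"
    unfolding wnorm_def FT by (simp add: ring_distribs)
  have "lnorm (\<lambda>x. f x + g x) \<le> (\<integral>x. \<bar>f x\<bar> + \<bar>g x\<bar> \<partial>lborel)"
    unfolding lnorm_def by (rule integral_mono') (use f g in auto)
  then show "lnorm (\<lambda>x. f x + g x) \<le> lnorm f + lnorm g"
    using f g by (simp add: lnorm_def)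
qed

lemma
  shows wnorm_cmult: "wnorm (\<lambda>x. c * f x) = \<bar>c\<bar> * wnorm f"
    and lnorm_cmult: "lnorm (\<lambda>x. c * f x) = \<bar>c\<bar> * lnorm f"
proof -
  have FT: "FT (\<lambda>x. c * f x) = (\<lambda>\<xi>. complex_of_real c * FT f \<xi>)"
    by (rule ext) (rule FT_cmult)
  have "(\<lambda>\<xi>. W \<xi> * cmod (complex_of_real c * FT f \<xi>)) = (\<lambda>\<xi>. \<bar>c\<bar> * (W \<xi> * cmod (FT f \<xi>)))"
    by (auto simp: norm_mult)
  then show "wnorm (\<lambda>x. c * f x) = \<bar>c\<bar> * wnorm f"
    unfolding wnorm_def FT by simp
  show "lnorm (\<lambda>x. c * f x) = \<bar>c\<bar> * lnorm f"
    by (simp add: lnorm_def abs_mult)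
qed

text \<open>Values and Fourier coefficients are both dominated by the norm, so functions and
  transforms converge pointwise, and Fatou's lemma turns the Cauchy bounds into bounds for the
  limits. What remains is that the two limits belong together: the limit of the transforms is the
  transform of the limit, and inversion survives.\<close>

lemma wien_complete:
  fixes f :: "nat \<Rightarrow> real^'n \<Rightarrow> real"
  assumes w: "\<And>n. wien (f n)"
    and cauchy: "\<And>e. e > 0 \<Longrightarrow> \<exists>N. \<forall>m\<ge>N. \<forall>n\<ge>N. lnorm (\<lambda>x. f m x - f n x) + wnorm (\<lambda>x. f m x - f n x) < e"
  shows "\<exists>g. wien g \<and> (\<forall>e>0. \<exists>N. \<forall>n\<ge>N. lnorm (\<lambda>x. f n x - g x) + wnorm (\<lambda>x. f n x - g x) \<le> e)"
proof -
  have wd: "wien (\<lambda>x. f m x - f n x)" for m n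
    using wien_add[OF w[of m] wien_cmult[OF w[of n], of "-1"]] by simp
  note D = wienD[OF w] and DD = wienD[OF wd]
  have FTd: "FT (\<lambda>x. f m x - f n x) \<xi> = FT (f m) \<xi> - FT (f n) \<xi>" for m n \<xi>
    using FT_add[OF D(1)[of m] wienD(1)[OF wien_cmult[OF w[of n], of "-1"]], of \<xi>] FT_cmult[of "-1" "f n" \<xi>] by simp
  have C1: "Cauchy (\<lambda>n. f n x)" for x
  proof (rule CauchyI)
    fix e :: real assume "e > 0"
    then obtain N where N: "\<forall>m\<ge>N. \<forall>n\<ge>N. lnorm (\<lambda>x. f m x - f n x) + wnorm (\<lambda>x. f m x - f n x) < e"
      using cauchy by blast
    show "\<exists>M. \<forall>m\<ge>M. \<forall>n\<ge>M. norm (f m x - f n x) < e"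
    proof (intro exI[of _ N] allI impI)
      fix m n assume "m \<ge> N" "n \<ge> N"
      with N have "lnorm (\<lambda>x. f m x - f n x) + wnorm (\<lambda>x. f m x - f n x) < e" by blast
      then show "norm (f m x - f n x) < e"
        using abs_le_wnorm[OF wd[of m n], of x] lnorm_nonneg[of "\<lambda>x. f m x - f n x"] by simp
    qed
  qed
  have C2: "Cauchy (\<lambda>n. FT (f n) \<xi>)" for \<xi>
  proof (rule CauchyI)
    fix e :: real assume "e > 0"
    then obtain N where N: "\<forall>m\<ge>N. \<forall>n\<ge>N. lnorm (\<lambda>x. f m x - f n x) + wnorm (\<lambda>x. f m x - f n x) < e"
      using cauchy by blast
    show "\<exists>M. \<forall>m\<ge>M. \<forall>n\<ge>M. norm (FT (f m) \<xi> - FT (f n) \<xi>) < e"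
    proof (intro exI[of _ N] allI impI)
      fix m n assume "m \<ge> N" "n \<ge> N"
      with N have "lnorm (\<lambda>x. f m x - f n x) + wnorm (\<lambda>x. f m x - f n x) < e" by blast
      then show "norm (FT (f m) \<xi> - FT (f n) \<xi>) < e"
        using FT_le_lnorm[of "\<lambda>x. f m x - f n x" \<xi>] wnorm_nonneg[of "\<lambda>x. f m x - f n x"] by (simp only: FTd)
    qed
  qed
  define g where "g x = lim (\<lambda>n. f n x)" for x
  define gh where "gh \<xi> = lim (\<lambda>n. FT (f n) \<xi>)" for \<xi>
  have g: "(\<lambda>n. f n x) \<longlonglongrightarrow> g x" for x
    unfolding g_def using C1[of x] by (simp add: Cauchy_convergent_iff convergent_LIMSEQ_iff)
  have gh: "(\<lambda>n. FT (f n) \<xi>) \<longlonglongrightarrow> gh \<xi>" for \<xi>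
    unfolding gh_def using C2[of \<xi>] by (simp add: Cauchy_convergent_iff convergent_LIMSEQ_iff)
  have L: "integrable lborel (\<lambda>x. f n x - g x) \<and> lnorm (\<lambda>x. f n x - g x) \<le> e"
    if N: "\<forall>m\<ge>N. \<forall>n\<ge>N. lnorm (\<lambda>x. f m x - f n x) + wnorm (\<lambda>x. f m x - f n x) < e" and n: "n \<ge> N" for N n e
  proof -
    have "(\<integral>x. norm (f n x - f m x) \<partial>lborel) \<le> e" if "m \<ge> N" for m
      using N[rule_format, OF n that] wnorm_nonneg[of "\<lambda>x. f n x - f m x"] by (simp add: lnorm_def)
    note * = integrable_fatou[of lborel "\<lambda>m x. f n x - f m x" "\<lambda>x. f n x - g x", OF DD(1) tendsto_diff[OF tendsto_const g] this]
    show ?thesis using * by (simp add: lnorm_def)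
  qed
  let ?D = "\<lambda>n \<xi>. W \<xi> * cmod (FT (f n) \<xi> - gh \<xi>)"
  have LW: "integrable lborel (?D n) \<and> (\<integral>\<xi>. ?D n \<xi> \<partial>lborel) * fnorm TYPE('n) \<le> e"
    if N: "\<forall>m\<ge>N. \<forall>n\<ge>N. lnorm (\<lambda>x. f m x - f n x) + wnorm (\<lambda>x. f m x - f n x) < e" and n: "n \<ge> N" for N n e
  proof -
    have "(\<integral>\<xi>. norm (W \<xi> * cmod (FT (f n) \<xi> - FT (f m) \<xi>)) \<partial>lborel) \<le> e / fnorm TYPE('n)" if "m \<ge> N" for m
    proof -
      have "wnorm (\<lambda>x. f n x - f m x) = (\<integral>\<xi>. W \<xi> * cmod (FT (f n) \<xi> - FT (f m) \<xi>) \<partial>lborel) * fnorm TYPE('n)"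
        by (simp only: wnorm_def FTd)
      then show ?thesis
        using N[rule_format, OF n that] lnorm_nonneg[of "\<lambda>x. f n x - f m x"] fnorm_pos[where 'n='n]
        by (simp add: abs_mult field_simps)
    qed
    moreover have "(\<lambda>m. W \<xi> * cmod (FT (f n) \<xi> - FT (f m) \<xi>)) \<longlonglongrightarrow> ?D n \<xi>" for \<xi>
      by (intro tendsto_intros gh)
    moreover have "integrable lborel (\<lambda>\<xi>. W \<xi> * cmod (FT (f n) \<xi> - FT (f m) \<xi>))" for m
      using DD(2)[of n m] by (simp only: FTd)
    ultimately have *: "integrable lborel (?D n)" "(\<integral>\<xi>. norm (?D n \<xi>) \<partial>lborel) \<le> e / fnorm TYPE('n)"
      using integrable_fatou[of lborel "\<lambda>m \<xi>. W \<xi> * cmod (FT (f n) \<xi> - FT (f m) \<xi>)" "?D n" N "e / fnorm TYPE('n)"] by auto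
    then show ?thesis using fnorm_pos[where 'n='n] by (simp add: abs_mult field_simps)
  qed
  obtain N1 where N1: "\<forall>m\<ge>N1. \<forall>n\<ge>N1. lnorm (\<lambda>x. f m x - f n x) + wnorm (\<lambda>x. f m x - f n x) < 1"
    using cauchy[of 1] by auto
  have ig: "integrable lborel g"
    using Bochner_Integration.integrable_diff[OF D(1)[of N1] conjunct1[OF L[OF N1 order_refl]]] by simp
  have FTg: "FT g = gh"
  proof
    fix \<xi>
    have "(\<lambda>n. FT (f n) \<xi>) \<longlonglongrightarrow> FT g \<xi>"
    proof (rule LIMSEQ_I)
      fix e :: real assume e: "e > 0"
      then obtain N where N: "\<forall>m\<ge>N. \<forall>n\<ge>N. lnorm (\<lambda>x. f m x - f n x) + wnorm (\<lambda>x. f m x - f n x) < e/2"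
        using cauchy[of "e/2"] by auto
      have "norm (FT (f n) \<xi> - FT g \<xi>) < e" if "n \<ge> N" for n
      proof -
        have "FT (\<lambda>x. f n x - g x) \<xi> = FT (f n) \<xi> - FT g \<xi>"
          using FT_add[of "f n" "\<lambda>x. -1 * g x" \<xi>] FT_cmult[of "-1" g \<xi>] D(1) ig by simp
        then show ?thesis using FT_le_lnorm[of "\<lambda>x. f n x - g x" \<xi>] L[OF N that] e by simp
      qed
      then show "\<exists>no. \<forall>n\<ge>no. norm (FT (f n) \<xi> - FT g \<xi>) < e" by blast
    qed
    then show "FT g \<xi> = gh \<xi>" using gh[of \<xi>] LIMSEQ_unique by blast
  qed
  have FTdg: "FT (\<lambda>x. f n x - g x) \<xi> = FT (f n) \<xi> - gh \<xi>" for n \<xi>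
    using FT_add[of "f n" "\<lambda>x. -1 * g x" \<xi>] FT_cmult[of "-1" g \<xi>] D(1) ig FTg by simp
  have mgh [measurable]: "gh \<in> borel_measurable borel"
    unfolding FTg[symmetric] by (intro borel_measurable_fourier integrable_of_real ig)
  have iWg: "integrable lborel (\<lambda>\<xi>. W \<xi> * cmod (gh \<xi>))"
  proof (rule Bochner_Integration.integrable_bound[OF Bochner_Integration.integrable_add[OF D(2)[of N1] conjunct1[OF LW[OF N1 order_refl]]]])
    have "cmod (gh \<xi>) \<le> cmod (FT (f N1) \<xi>) + cmod (FT (f N1) \<xi> - gh \<xi>)" for \<xi>
      using norm_triangle_ineq4[of "FT (f N1) \<xi>" "FT (f N1) \<xi> - gh \<xi>"] by simp
    then show "AE \<xi> in lborel. norm (W \<xi> * cmod (gh \<xi>)) \<le> norm (W \<xi> * cmod (FT (f N1) \<xi>) + ?D N1 \<xi>)"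
      by (intro AE_I2) (auto simp: abs_mult simp flip: ring_distribs intro!: mult_left_mono)
  qed measurable
  have igh: "integrable lborel gh"
    by (rule Bochner_Integration.integrable_bound[OF iWg])
       (auto simp: abs_mult intro!: AE_I2 mult_le_cancel_right1[THEN iffD2])
  have inv: "inv_fourier gh x = complex_of_real (g x)" for x
  proof -
    have "(\<lambda>n. complex_of_real (f n x)) \<longlonglongrightarrow> inv_fourier gh x"
    proof (rule LIMSEQ_I)
      fix e :: real assume e: "e > 0"
      then obtain N where N: "\<forall>m\<ge>N. \<forall>n\<ge>N. lnorm (\<lambda>x. f m x - f n x) + wnorm (\<lambda>x. f m x - f n x) < e/2"
        using cauchy[of "e/2"] by auto
      have "norm (complex_of_real (f n x) - inv_fourier gh x) < e" if "n \<ge> N" for n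
      proof -
        have "complex_of_real (f n x) - inv_fourier gh x = inv_fourier (\<lambda>\<xi>. FT (f n) \<xi> - gh \<xi>) x"
          using inv_fourier_add[OF D(4)[of n], of "\<lambda>\<xi>. -1 * gh \<xi>" x] inv_fourier_cmult[of "-1" gh x] igh D(3)[of n x] by simp
        then show ?thesis
          using cmod_inv_fourier_le[OF conjunct1[OF LW[OF N that]], of x] conjunct2[OF LW[OF N that]] e by simp
      qed
      then show "\<exists>no. \<forall>n\<ge>no. norm (complex_of_real (f n x) - inv_fourier gh x) < e" by blast
    qed
    then show ?thesis using tendsto_of_real[OF g[of x]] LIMSEQ_unique by blast
  qed
  have "wien g" unfolding wien_def FTg using ig iWg inv by blast
  moreover have "\<exists>N. \<forall>n\<ge>N. lnorm (\<lambda>x. f n x - g x) + wnorm (\<lambda>x. f n x - g x) \<le> e" if e: "e > 0" for e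
  proof -
    obtain N where N: "\<forall>m\<ge>N. \<forall>n\<ge>N. lnorm (\<lambda>x. f m x - f n x) + wnorm (\<lambda>x. f m x - f n x) < e/2"
      using cauchy[of "e/2"] e by auto
    show ?thesis
    proof (intro exI[of _ N] allI impI)
      fix n assume n: "n \<ge> N"
      have "wnorm (\<lambda>x. f n x - g x) = (\<integral>\<xi>. ?D n \<xi> \<partial>lborel) * fnorm TYPE('n)"
        by (simp only: wnorm_def FTdg)
      with L[OF N n] LW[OF N n]
      show "lnorm (\<lambda>x. f n x - g x) + wnorm (\<lambda>x. f n x - g x) \<le> e"
        by linarith
    qed
  qed
  ultimately show ?thesis by blast
qed

section \<open>The Wiener algebra as a commutative Banach algebra type\<close>

typedef (overloaded) 'n walg = "{f :: real^'n::finite \<Rightarrow> real. wien f}"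
  morphisms fn Abs_walg
  using wien_0 by auto

lemma wien_fn [simp]: "wien (fn f)"
  using fn[of f] by simp

lemma fn_Abs: "wien f \<Longrightarrow> fn (Abs_walg f) = f"
  by (simp add: Abs_walg_inverse)

lemma walg_eqI: "(\<And>x. fn f x = fn g x) \<Longrightarrow> f = g"
  using fn_inject[of f g] by auto

instantiation walg :: (finite) real_vector
begin

definition "0 = Abs_walg (\<lambda>x. 0)"
definition "f + g = Abs_walg (\<lambda>x. fn f x + fn g x)"
definition "f - g = Abs_walg (\<lambda>x. fn f x - fn g x)"
definition "- f = Abs_walg (\<lambda>x. - fn f x)"
definition "c *\<^sub>R f = Abs_walg (\<lambda>x. c * fn f x)"

lemma fn_0 [simp]: "fn 0 x = 0"
  unfolding zero_walg_def by (subst fn_Abs) (auto intro: wien_0)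

lemma fn_add [simp]: "fn (f + g) x = fn f x + fn g x"
  unfolding plus_walg_def by (subst fn_Abs) (auto intro: wien_add)

lemma fn_uminus [simp]: "fn (- f) x = - fn f x"
  unfolding uminus_walg_def using wien_cmult[OF wien_fn[of f], of "-1"] by (subst fn_Abs) auto

lemma fn_diff [simp]: "fn (f - g) x = fn f x - fn g x"
proof -
  have "wien (\<lambda>x. fn f x - fn g x)"
    using wien_add[OF wien_fn[of f] wien_cmult[OF wien_fn[of g], of "-1"]] by simp
  then show ?thesis unfolding minus_walg_def by (subst fn_Abs) auto
qed

lemma fn_scaleR [simp]: "fn (c *\<^sub>R f) x = c * fn f x"
  unfolding scaleR_walg_def by (subst fn_Abs) (auto intro: wien_cmult)

instance
  by standard (auto intro!: walg_eqI simp: algebra_simps)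

end

instantiation walg :: (finite) real_normed_algebra
begin

definition "f * g = Abs_walg (\<lambda>x. fn f x * fn g x)"
definition "norm f = lnorm (fn f) + wnorm (fn f)"
definition "sgn (f :: 'a walg) = f /\<^sub>R norm f"
definition "dist (f :: 'a walg) g = norm (f - g)"
definition [code del]: "uniformity = (INF e\<in>{0<..}. principal {(x, y). dist (x :: 'a walg) y < e})"
definition [code del]: "open (U :: 'a walg set) \<longleftrightarrow> (\<forall>x\<in>U. eventually (\<lambda>(x', y). x' = x \<longrightarrow> y \<in> U) uniformity)"

lemma fn_mult [simp]: "fn (f * g) x = fn f x * fn g x"
  unfolding times_walg_def by (subst fn_Abs) (auto intro: wien_mult)

instance
proof
  fix f g h :: "'a walg" and a b :: real
  show "norm (f + g) \<le> norm f + norm g"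
    unfolding norm_walg_def using wnorm_add[OF wien_fn wien_fn, of f g] lnorm_add[OF wien_fn wien_fn, of f g]
    by (simp add: fn_add[abs_def] ext[of "fn (f + g)", OF fn_add])
  show "norm (a *\<^sub>R f) = \<bar>a\<bar> * norm f"
    unfolding norm_walg_def ext[of "fn (a *\<^sub>R f)", OF fn_scaleR]
    by (simp add: wnorm_cmult lnorm_cmult ring_distribs)
  have *: "lnorm (\<lambda>x. fn f x * fn g x) \<le> wnorm (fn f) * lnorm (fn g)"
       "wnorm (\<lambda>x. fn f x * fn g x) \<le> wnorm (fn f) * wnorm (fn g)"
    by (rule lnorm_mult wnorm_mult; simp)+
  have "0 \<le> lnorm (fn f) * lnorm (fn g)" "0 \<le> lnorm (fn f) * wnorm (fn g)"
    by (simp_all add: lnorm_nonneg wnorm_nonneg)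
  with * show "norm (f * g) \<le> norm f * norm g"
    unfolding norm_walg_def ext[of "fn (f * g)", OF fn_mult] by (simp add: ring_distribs)
  show "(norm f = 0) = (f = 0)"
  proof
    assume "norm f = 0"
    then have "wnorm (fn f) = 0"
      using lnorm_nonneg[of "fn f"] wnorm_nonneg[of "fn f"] by (simp add: norm_walg_def)
    then have "fn f x = 0" for x using abs_le_wnorm[OF wien_fn, of f x] by simp
    then show "f = 0" by (intro walg_eqI) simp
  next
    assume "f = 0"
    then have "fn f = (\<lambda>x. 0 * fn f x)" by auto
    then have "lnorm (fn f) = 0 * lnorm (fn f)" "wnorm (fn f) = 0 * wnorm (fn f)"
      using lnorm_cmult[of 0 "fn f"] wnorm_cmult[of 0 "fn f"] by simp_all
    then show "norm f = 0" by (simp add: norm_walg_def)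
  qed
qed (auto intro!: walg_eqI simp: sgn_walg_def dist_walg_def uniformity_walg_def open_walg_def algebra_simps)

end

instance walg :: (finite) comm_ring
  by standard (auto intro!: walg_eqI simp: algebra_simps)

instance walg :: (finite) banach
proof
  fix X :: "nat \<Rightarrow> 'a walg" assume X: "Cauchy X"
  have nd: "norm (f - g) = lnorm (\<lambda>x. fn f x - fn g x) + wnorm (\<lambda>x. fn f x - fn g x)" for f g :: "'a walg"
    unfolding norm_walg_def ext[of "fn (f - g)", OF fn_diff] ..
  obtain g where g: "wien g" "\<forall>e>0. \<exists>N. \<forall>n\<ge>N. lnorm (\<lambda>x. fn (X n) x - g x) + wnorm (\<lambda>x. fn (X n) x - g x) \<le> e"
    using wien_complete[of "\<lambda>n. fn (X n)"] CauchyD[OF X] unfolding nd by auto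
  have "X \<longlonglongrightarrow> Abs_walg g"
  proof (rule LIMSEQ_I)
    fix r :: real assume "r > 0"
    then obtain N where "\<forall>n\<ge>N. lnorm (\<lambda>x. fn (X n) x - g x) + wnorm (\<lambda>x. fn (X n) x - g x) \<le> r/2"
      using g(2)[rule_format, of "r/2"] by auto
    then show "\<exists>no. \<forall>n\<ge>no. norm (X n - Abs_walg g) < r"
      unfolding nd fn_Abs[OF g(1)] using \<open>r > 0\<close> by (intro exI[of _ N]) force
  qed
  then show "convergent X" by (auto simp: convergent_def)
qed

section \<open>Evaluation and Fourier coefficients as functionals on the algebra\<close>

lemma norm_walg: "norm f = lnorm (fn f) + wnorm (fn f)"
  by (rule norm_walg_def)

abbreviation ft :: "'n::finite walg \<Rightarrow> real^'n \<Rightarrow> complex" where "ft f \<equiv> FT (fn f)"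

lemmas walgD = wienD[OF wien_fn]

lemma lnorm_le_norm: "lnorm (fn f) \<le> norm f" and wnorm_le_norm: "wnorm (fn f) \<le> norm f"
  by (simp_all add: norm_walg lnorm_nonneg wnorm_nonneg)

lemma abs_fn_le: "\<bar>fn f x\<bar> \<le> norm f"
  using abs_le_wnorm[OF wien_fn[of f], of x] wnorm_le_norm[of f] by simp

lemma cmod_ft_le: "cmod (ft f \<xi>) \<le> norm f"
  using FT_le_lnorm[of "fn f" \<xi>] lnorm_le_norm[of f] by simp

lemma ft_add: "ft (f + g) \<xi> = ft f \<xi> + ft g \<xi>"
  unfolding ext[of "fn (f + g)", OF fn_add] by (rule FT_add) (rule walgD)+

lemma ft_scaleR: "ft (c *\<^sub>R f) \<xi> = complex_of_real c * ft f \<xi>"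
  unfolding ext[of "fn (c *\<^sub>R f)", OF fn_scaleR] by (rule FT_cmult)

lemma ft_diff: "ft (f - g) \<xi> = ft f \<xi> - ft g \<xi>"
  using ft_add[of "f - g" g \<xi>] by simp

lemma bounded_linear_fn: "bounded_linear (\<lambda>f. fn f x)"
  by (rule bounded_linear_intro[of _ 1]) (auto simp: abs_fn_le)

lemma bounded_linear_ft: "bounded_linear (\<lambda>f. ft f \<xi>)"
  by (rule bounded_linear_intro[of _ 1]) (simp_all only: cmod_ft_le ft_add ft_scaleR scaleR_conv_of_real mult_1_right)

section \<open>Convolution operators with dilated integrable kernels\<close>

text \<open>Minkowski's integral inequality for L^1. It gives the bounds for convolution operators
  and the integrability of the wave kernel, which is a superposition of Gaussians.\<close>

lemma
  fixes g :: "'a::euclidean_space \<Rightarrow> 'b::euclidean_space \<Rightarrow> 'c::{banach,second_countable_topology}"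
  assumes [measurable]: "(\<lambda>(y,x). g y x) \<in> borel_measurable (borel \<Otimes>\<^sub>M borel)"
    and g: "\<And>y. integrable lborel (g y)" and B: "integrable lborel B"
    and le: "\<And>y. (\<integral>x. norm (g y x) \<partial>lborel) \<le> B y"
  shows integrable_superposition: "integrable lborel (\<lambda>x. \<integral>y. g y x \<partial>lborel)"
    and norm_superposition_le: "(\<integral>x. norm (\<integral>y. g y x \<partial>lborel) \<partial>lborel) \<le> (\<integral>y. B y \<partial>lborel)"
proof -
  have i: "integrable (lborel \<Otimes>\<^sub>M lborel) (\<lambda>(y,x). g y x)"
    by (rule integrable_pairI[where b="\<lambda>y x. norm (g y x)" and B=B]) (use g B le in auto)
  have i': "integrable (lborel \<Otimes>\<^sub>M lborel) (\<lambda>(y,x). norm (g y x))"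
    using integrable_norm[OF i] by (simp add: case_prod_unfold)
  show 1: "integrable lborel (\<lambda>x. \<integral>y. g y x \<partial>lborel)"
    using lborel_pair.integrable_snd[OF i] by simp
  have "(\<integral>x. norm (\<integral>y. g y x \<partial>lborel) \<partial>lborel) \<le> (\<integral>x. (\<integral>y. norm (g y x) \<partial>lborel) \<partial>lborel)"
    by (intro integral_mono integrable_norm 1 integral_norm_bound)
       (use lborel_pair.integrable_snd[OF i'] in simp)
  also have "\<dots> = (\<integral>y. (\<integral>x. norm (g y x) \<partial>lborel) \<partial>lborel)"
    using lborel_pair.Fubini_integral[OF i'] by simp
  also have "\<dots> \<le> (\<integral>y. B y \<partial>lborel)"
    by (intro integral_mono B le) (use lborel_pair.integrable_fst'[OF i'] in simp)
  finally show "(\<integral>x. norm (\<integral>y. g y x \<partial>lborel) \<partial>lborel) \<le> (\<integral>y. B y \<partial>lborel)" .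
qed

lemma continuous_on_fn [continuous_intros]: "continuous_on S (fn f)"
proof -
  have "continuous_on UNIV (inv_fourier (ft f))"
    unfolding inv_fourier_cis[abs_def]
    by (intro continuous_intros continuous_on_integral_dominated[where g="\<lambda>x. cmod (ft f x)"])
       (use walgD[of f] in \<open>auto simp: norm_mult intro!: continuous_intros\<close>)
  then have "continuous_on UNIV (\<lambda>x. Re (inv_fourier (ft f) x))"
    by (intro continuous_intros)
  then show ?thesis
    unfolding walgD(3) by (auto intro: continuous_on_subset)
qed

lemma borel_measurable_fn [measurable]: "fn f \<in> borel_measurable borel"
  by (rule walgD(5))

lemma borel_measurable_ft [measurable]: "ft f \<in> borel_measurable borel"
  by (rule walgD(6))

lemma integrable_fn: "integrable lborel (fn f)"
  by (rule walgD(1))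

lemma integrable_fn_shift [simp]: "integrable lborel (\<lambda>x. fn f (x - c))"
  using integrable_shift_iff[of "fn f" c] integrable_fn[of f] by simp

text \<open>Continuity of f gives pointwise convergence of the translates, and all translates have
  the same L^1 norm, so Scheffe's lemma applies.\<close>

lemma tendsto_L1_translation:
  assumes "a \<longlonglongrightarrow> b"
  shows "(\<lambda>n. \<integral>x. \<bar>fn f (x - a n) - fn f (x - b)\<bar> \<partial>lborel) \<longlonglongrightarrow> 0"
proof -
  have i: "integrable lborel (\<lambda>x. fn f (x - c))" for c
    by simp
  have n: "(\<integral>\<^sup>+ x. ennreal \<bar>fn f (x - c)\<bar> \<partial>lborel) = ennreal (lnorm (fn f))" for c
    using nn_integral_eq_integral[OF integrable_norm[OF i[of c]]]
      lborel_integral_shift[of "\<lambda>x. norm (fn f x)" c] by (simp add: lnorm_def)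
  have "(\<lambda>n. \<integral>\<^sup>+ x. norm (fn f (x - a n) - fn f (x - b)) \<partial>lborel) \<longlonglongrightarrow> 0"
  proof (rule Scheffe_lemma2)
    show "AE x in lborel. (\<lambda>n. fn f (x - a n)) \<longlonglongrightarrow> fn f (x - b)"
      by (intro AE_I2 continuous_on_tendsto_compose[OF continuous_on_fn[of UNIV f]] tendsto_intros assms) auto
  qed (auto intro: i simp: n)
  moreover have "(\<integral>\<^sup>+ x. norm (fn f (x - a n) - fn f (x - b)) \<partial>lborel) = ennreal (\<integral>x. \<bar>fn f (x - a n) - fn f (x - b)\<bar> \<partial>lborel)" for n
    by (subst nn_integral_eq_integral) (auto intro!: i Bochner_Integration.integrable_diff)
  ultimately show ?thesis
    by (simp add: ennreal_tendsto_0_iff)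
qed

text \<open>Convolution with the kernel k dilated to scale \<tau>, after the substitution that moves
  the dilation onto f. In this form \<tau> = 0 is allowed and gives the integral of k times f, the
  initial value of the propagator.\<close>

definition kfun :: "(real^'n \<Rightarrow> real) \<Rightarrow> real \<Rightarrow> 'n walg \<Rightarrow> real^'n \<Rightarrow> real" where
  "kfun k \<tau> f x = (\<integral>y. k y * fn f (x - \<tau> *\<^sub>R y) \<partial>lborel)"

lemma integrable_kernel_mult:
  assumes "integrable lborel k"
  shows "integrable lborel (\<lambda>y. k y * fn f (x - \<tau> *\<^sub>R y))"
proof (rule Bochner_Integration.integrable_bound[of _ "\<lambda>y. norm f * \<bar>k y\<bar>"])
  show "AE y in lborel. norm (k y * fn f (x - \<tau> *\<^sub>R y)) \<le> norm (norm f * \<bar>k y\<bar>)"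
  proof (intro AE_I2)
    fix y
    show "norm (k y * fn f (x - \<tau> *\<^sub>R y)) \<le> norm (norm f * \<bar>k y\<bar>)"
      using mult_left_mono[OF abs_fn_le[of f "x - \<tau> *\<^sub>R y"] abs_ge_zero[of "k y"]]
      by (simp add: abs_mult mult.commute)
  qed
qed (use assms in auto)

context
  fixes k :: "real^'n \<Rightarrow> real"
  assumes k: "integrable lborel k"
begin

lemma k_meas [measurable]: "k \<in> borel_measurable borel"
  using k by auto

lemma
  shows integrable_kfun: "integrable lborel (kfun k \<tau> f)"
    and lnorm_kfun_le: "lnorm (kfun k \<tau> f) \<le> lnorm k * lnorm (fn f)"
proof -
  let ?g = "\<lambda>y x. k y * fn f (x - \<tau> *\<^sub>R y)"
  have 1: "integrable lborel (?g y)" for y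
    by (intro integrable_mult_right integrable_abs integrable_fn_shift)
  have 2: "(\<integral>x. norm (?g y x) \<partial>lborel) \<le> \<bar>k y\<bar> * lnorm (fn f)" for y
    using lborel_integral_shift[of "\<lambda>x. \<bar>fn f x\<bar>" "\<tau> *\<^sub>R y"] by (simp add: abs_mult lnorm_def)
  have 3: "integrable lborel (\<lambda>y. \<bar>k y\<bar> * lnorm (fn f))"
    using k by simp
  show "integrable lborel (kfun k \<tau> f)"
    unfolding kfun_def[abs_def]
    by (rule integrable_superposition[OF _ 1 3 2]) measurable
  show "lnorm (kfun k \<tau> f) \<le> lnorm k * lnorm (fn f)"
    using norm_superposition_le[OF _ 1 3 2] by (simp add: kfun_def lnorm_def)
qed

lemma FT_kfun: "FT (kfun k \<tau> f) \<xi> = FT k (\<tau> *\<^sub>R \<xi>) * ft f \<xi>"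
proof -
  let ?g = "\<lambda>y x. cis (- (x \<bullet> \<xi>)) * (complex_of_real (k y) * complex_of_real (fn f (x - \<tau> *\<^sub>R y)))"
  have "FT (kfun k \<tau> f) \<xi> = (\<integral>x. (\<integral>y. ?g y x \<partial>lborel) \<partial>lborel)"
    unfolding fourier_cis kfun_def by (simp flip: integral_complex_of_real)
  also have "\<dots> = (\<integral>y. (\<integral>x. ?g y x \<partial>lborel) \<partial>lborel)"
  proof (rule integral_swap(1)[symmetric, where b="\<lambda>y x. \<bar>k y\<bar> * \<bar>fn f (x - \<tau> *\<^sub>R y)\<bar>" and B="\<lambda>y. \<bar>k y\<bar> * lnorm (fn f)"])
    show "integrable lborel (\<lambda>x. \<bar>k y\<bar> * \<bar>fn f (x - \<tau> *\<^sub>R y)\<bar>)" for y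
      by (intro integrable_mult_right integrable_abs integrable_fn_shift)
    show "(\<integral>x. \<bar>k y\<bar> * \<bar>fn f (x - \<tau> *\<^sub>R y)\<bar> \<partial>lborel) \<le> \<bar>k y\<bar> * lnorm (fn f)" for y
      using lborel_integral_shift[of "\<lambda>x. \<bar>fn f x\<bar>" "\<tau> *\<^sub>R y"] by (simp add: lnorm_def)
  qed (use k in \<open>auto simp: norm_mult\<close>)
  also have "\<dots> = (\<integral>y. cis (- (y \<bullet> (\<tau> *\<^sub>R \<xi>))) * complex_of_real (k y) * ft f \<xi> \<partial>lborel)"
  proof (rule Bochner_Integration.integral_cong[OF refl])
    fix y
    have "(\<integral>x. ?g y x \<partial>lborel) = (\<integral>x. cis (- (y \<bullet> (\<tau> *\<^sub>R \<xi>))) * complex_of_real (k y) *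
        (cis (- ((x - \<tau> *\<^sub>R y) \<bullet> \<xi>)) * complex_of_real (fn f (x - \<tau> *\<^sub>R y))) \<partial>lborel)"
    proof (intro Bochner_Integration.integral_cong refl)
      fix x
      have "cis (- (x \<bullet> \<xi>)) = cis (- (y \<bullet> (\<tau> *\<^sub>R \<xi>))) * cis (- ((x - \<tau> *\<^sub>R y) \<bullet> \<xi>))"
        by (simp add: cis_mult inner_diff_left)
      then show "?g y x = cis (- (y \<bullet> (\<tau> *\<^sub>R \<xi>))) * complex_of_real (k y) *
        (cis (- ((x - \<tau> *\<^sub>R y) \<bullet> \<xi>)) * complex_of_real (fn f (x - \<tau> *\<^sub>R y)))" by (simp only: ac_simps)
    qed
    also have "\<dots> = cis (- (y \<bullet> (\<tau> *\<^sub>R \<xi>))) * complex_of_real (k y) *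
        (\<integral>x. cis (- ((x - \<tau> *\<^sub>R y) \<bullet> \<xi>)) * complex_of_real (fn f (x - \<tau> *\<^sub>R y)) \<partial>lborel)"
      by (rule integral_mult_right_zero)
    also have "(\<integral>x. cis (- ((x - \<tau> *\<^sub>R y) \<bullet> \<xi>)) * complex_of_real (fn f (x - \<tau> *\<^sub>R y)) \<partial>lborel) = ft f \<xi>"
      unfolding fourier_cis by (rule lborel_integral_shift) measurable
    finally show "(\<integral>x. ?g y x \<partial>lborel) = cis (- (y \<bullet> (\<tau> *\<^sub>R \<xi>))) * complex_of_real (k y) * ft f \<xi>" .
  qed
  also have "\<dots> = FT k (\<tau> *\<^sub>R \<xi>) * ft f \<xi>"
    unfolding integral_mult_left_zero fourier_cis[of "\<lambda>x. complex_of_real (k x)"] ..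
  finally show ?thesis .
qed

lemma FT_kernel_le: "cmod (FT k \<xi>) \<le> lnorm k"
  by (rule FT_le_lnorm)

lemma borel_measurable_FT_kernel [measurable]: "FT k \<in> borel_measurable borel"
  by (intro borel_measurable_fourier integrable_of_real k)

text \<open>The multiplier \<open>FT k (\<tau> *\<^sub>R \<xi>)\<close> is bounded by
  \<open>lnorm k\<close> at every scale, so the weighted norm is controlled uniformly in \<tau>,
  like the L^1 norm before.\<close>

lemma
  shows wien_kfun: "wien (kfun k \<tau> f)"
    and wnorm_kfun_le: "wnorm (kfun k \<tau> f) \<le> lnorm k * wnorm (fn f)"
proof -
  have FT: "FT (kfun k \<tau> f) = (\<lambda>\<xi>. FT k (\<tau> *\<^sub>R \<xi>) * ft f \<xi>)"
    by (rule ext) (rule FT_kfun)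
  have le: "W \<xi> * cmod (FT k (\<tau> *\<^sub>R \<xi>) * ft f \<xi>) \<le> lnorm k * (W \<xi> * cmod (ft f \<xi>))" for \<xi>
    using mult_right_mono[OF FT_kernel_le[of "\<tau> *\<^sub>R \<xi>"], of "W \<xi> * cmod (ft f \<xi>)"]
    by (simp add: norm_mult ac_simps)
  have i: "integrable lborel (\<lambda>\<xi>. W \<xi> * cmod (FT k (\<tau> *\<^sub>R \<xi>) * ft f \<xi>))"
    by (rule Bochner_Integration.integrable_bound[OF integrable_mult_right[OF walgD(2)[of f], of "lnorm k"]])
       (use le in \<open>auto intro!: AE_I2 simp: lnorm_nonneg\<close>)
  have inv: "inv_fourier (\<lambda>\<xi>. FT k (\<tau> *\<^sub>R \<xi>) * ft f \<xi>) x = complex_of_real (kfun k \<tau> f x)" for x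
  proof -
    have "(\<integral>\<xi>. cis (x \<bullet> \<xi>) * (FT k (\<tau> *\<^sub>R \<xi>) * ft f \<xi>) \<partial>lborel)
      = (\<integral>\<xi>. (cis (x \<bullet> \<xi>) * ft f \<xi>) * (\<integral>y. cis (- (y \<bullet> (\<tau> *\<^sub>R \<xi>))) * complex_of_real (k y) \<partial>lborel) \<partial>lborel)"
      unfolding fourier_cis[of "\<lambda>x. complex_of_real (k x)"] by (simp only: ac_simps)
    also have "\<dots> = (\<integral>y. complex_of_real (k y) * (\<integral>\<xi>. cis (- (y \<bullet> (\<tau> *\<^sub>R \<xi>))) * (cis (x \<bullet> \<xi>) * ft f \<xi>) \<partial>lborel) \<partial>lborel)"
      by (rule integral_swap_phase[where C=1]) (auto intro!: integrable_phase[where C=1] walgD integrable_of_real k)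
    also have "\<dots> = (\<integral>y. complex_of_real (k y) * (\<integral>\<xi>. cis ((x - \<tau> *\<^sub>R y) \<bullet> \<xi>) * ft f \<xi> \<partial>lborel) \<partial>lborel)"
    proof -
      have "(\<integral>\<xi>. cis (- (y \<bullet> (\<tau> *\<^sub>R \<xi>))) * (cis (x \<bullet> \<xi>) * ft f \<xi>) \<partial>lborel) = (\<integral>\<xi>. cis ((x - \<tau> *\<^sub>R y) \<bullet> \<xi>) * ft f \<xi> \<partial>lborel)" for y
        by (intro Bochner_Integration.integral_cong refl)
           (simp add: cis_mult inner_diff_left flip: mult.assoc)
      then show ?thesis by (simp only:)
    qed
    finally have "inv_fourier (\<lambda>\<xi>. FT k (\<tau> *\<^sub>R \<xi>) * ft f \<xi>) x =
        (\<integral>y. complex_of_real (fnorm TYPE('n)) * (complex_of_real (k y) * (\<integral>\<xi>. cis ((x - \<tau> *\<^sub>R y) \<bullet> \<xi>) * ft f \<xi> \<partial>lborel)) \<partial>lborel)"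
      by (simp add: inv_fourier_cis)
    also have "\<dots> = (\<integral>y. complex_of_real (k y) * inv_fourier (ft f) (x - \<tau> *\<^sub>R y) \<partial>lborel)"
      unfolding inv_fourier_cis by (simp only: ac_simps)
    also have "\<dots> = complex_of_real (kfun k \<tau> f x)"
      unfolding walgD(3) kfun_def by (simp flip: integral_complex_of_real)
    finally show ?thesis .
  qed
  show "wien (kfun k \<tau> f)"
    unfolding wien_def FT using i inv integrable_kfun by blast
  have "(\<integral>\<xi>. W \<xi> * cmod (FT k (\<tau> *\<^sub>R \<xi>) * ft f \<xi>) \<partial>lborel) \<le> (\<integral>\<xi>. lnorm k * (W \<xi> * cmod (ft f \<xi>)) \<partial>lborel)"
    by (intro integral_mono i le integrable_mult_right walgD)
  also have "\<dots> = lnorm k * (\<integral>\<xi>. W \<xi> * cmod (ft f \<xi>) \<partial>lborel)" by simp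
  finally have "(\<integral>\<xi>. W \<xi> * cmod (FT k (\<tau> *\<^sub>R \<xi>) * ft f \<xi>) \<partial>lborel) \<le> lnorm k * (\<integral>\<xi>. W \<xi> * cmod (ft f \<xi>) \<partial>lborel)" .
  from mult_right_mono[OF this less_imp_le[OF fnorm_pos[where 'n='n]]]
  show "wnorm (kfun k \<tau> f) \<le> lnorm k * wnorm (fn f)"
    unfolding wnorm_def FT by (simp add: ac_simps)
qed

end

definition kop :: "(real^'n \<Rightarrow> real) \<Rightarrow> real \<Rightarrow> 'n::finite walg \<Rightarrow> 'n walg" where
  "kop k \<tau> f = Abs_walg (kfun k \<tau> f)"

context
  fixes k :: "real^'n \<Rightarrow> real"
  assumes k: "integrable lborel k"
begin

lemma fn_kop_fun: "fn (kop k \<tau> f) = kfun k \<tau> f"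
  unfolding kop_def by (rule fn_Abs[OF wien_kfun[OF k]])

lemma fn_kop: "fn (kop k \<tau> f) x = (\<integral>y. k y * fn f (x - \<tau> *\<^sub>R y) \<partial>lborel)"
  unfolding fn_kop_fun kfun_def ..

lemma ft_kop: "ft (kop k \<tau> f) \<xi> = FT k (\<tau> *\<^sub>R \<xi>) * ft f \<xi>"
  unfolding fn_kop_fun by (rule FT_kfun[OF k])

lemma norm_kop_le: "norm (kop k \<tau> f) \<le> lnorm k * norm f"
  unfolding norm_walg fn_kop_fun using lnorm_kfun_le[OF k, of \<tau> f] wnorm_kfun_le[OF k, of \<tau> f]
  by (simp add: ring_distribs)

lemma kop_add: "kop k \<tau> (f + g) = kop k \<tau> f + kop k \<tau> g"
proof (rule walg_eqI)
  fix x show "fn (kop k \<tau> (f + g)) x = fn (kop k \<tau> f + kop k \<tau> g) x"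
    unfolding fn_kop fn_add ring_distribs
    by (rule Bochner_Integration.integral_add) (rule integrable_kernel_mult[OF k])+
qed

lemma kop_scaleR: "kop k \<tau> (c *\<^sub>R f) = c *\<^sub>R kop k \<tau> f"
proof (rule walg_eqI)
  fix x show "fn (kop k \<tau> (c *\<^sub>R f)) x = fn (c *\<^sub>R kop k \<tau> f) x"
    unfolding fn_kop fn_scaleR by (subst integral_mult_right_zero[symmetric]) (simp add: ac_simps)
qed

lemma bounded_linear_kop: "bounded_linear (kop k \<tau>)"
  by (rule bounded_linear_intro[of _ "lnorm k"])
     (simp_all add: kop_add kop_scaleR norm_kop_le mult.commute[of _ "lnorm k"])

lemma kop_diff: "kop k \<tau> (f - g) = kop k \<tau> f - kop k \<tau> g"
  by (rule linear_diff[OF bounded_linear.linear[OF bounded_linear_kop]])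

lemma kop_0_left: "kop k 0 f = (\<integral>y. k y \<partial>lborel) *\<^sub>R f"
  by (rule walg_eqI) (simp add: fn_kop)

text \<open>Strong continuity, for fixed f: in the L^1 part translations of f are continuous, and in
  the weighted part the multipliers converge pointwise under the integrable majorant
  \<open>2 * lnorm k * (W \<xi> * cmod (ft f \<xi>))\<close>.\<close>

lemma tendsto_kop:
  assumes t: "t \<longlonglongrightarrow> \<tau>"
  shows "(\<lambda>n. kop k (t n) f) \<longlonglongrightarrow> kop k \<tau> f"
proof -
  have [measurable]: "k \<in> borel_measurable borel" using k by auto
  have [measurable]: "FT k \<in> borel_measurable borel"
    by (rule borel_measurable_FT_kernel[OF k])
  let ?d = "\<lambda>n. kop k (t n) f - kop k \<tau> f"
  let ?D = "\<lambda>n y. \<integral>x. \<bar>fn f (x - t n *\<^sub>R y) - fn f (x - \<tau> *\<^sub>R y)\<bar> \<partial>lborel"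
  have i: "integrable lborel (\<lambda>x. fn f (x - c))" for c
    by simp
  have D2: "\<bar>?D n y\<bar> \<le> 2 * lnorm (fn f)" for n y
  proof -
    have "?D n y \<le> (\<integral>x. \<bar>fn f (x - t n *\<^sub>R y)\<bar> + \<bar>fn f (x - \<tau> *\<^sub>R y)\<bar> \<partial>lborel)"
      by (intro integral_mono Bochner_Integration.integrable_add integrable_abs Bochner_Integration.integrable_diff i) auto
    also have "\<dots> = 2 * lnorm (fn f)"
      using lborel_integral_shift[of "\<lambda>x. \<bar>fn f x\<bar>"] by (subst Bochner_Integration.integral_add) (auto intro: i simp: lnorm_def)
    finally show ?thesis by (simp add: abs_of_nonneg integral_nonneg_AE)
  qed
  have lim1: "(\<lambda>n. \<integral>y. \<bar>k y\<bar> * ?D n y \<partial>lborel) \<longlonglongrightarrow> (\<integral>y. 0 \<partial>(lborel :: (real^'n) measure))"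
  proof (rule integral_dominated_convergence[where w="\<lambda>y. \<bar>k y\<bar> * (2 * lnorm (fn f))"])
    show "AE y in lborel. (\<lambda>n. \<bar>k y\<bar> * ?D n y) \<longlonglongrightarrow> 0"
      by (intro AE_I2 tendsto_mult_right_zero tendsto_L1_translation tendsto_intros t)
    show "AE y in lborel. norm (\<bar>k y\<bar> * ?D n y) \<le> \<bar>k y\<bar> * (2 * lnorm (fn f))" for n
      using D2 by (intro AE_I2) (auto simp: abs_mult intro!: mult_left_mono)
  qed (use k in auto)
  have le1: "lnorm (fn (?d n)) \<le> (\<integral>y. \<bar>k y\<bar> * ?D n y \<partial>lborel)" for n
  proof -
    let ?g = "\<lambda>y x. k y * (fn f (x - t n *\<^sub>R y) - fn f (x - \<tau> *\<^sub>R y))"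
    have 1: "integrable lborel (?g y)" for y
      by (intro integrable_mult_right Bochner_Integration.integrable_diff i)
    have 2: "(\<integral>x. norm (?g y x) \<partial>lborel) \<le> \<bar>k y\<bar> * ?D n y" for y
      by (simp add: abs_mult)
    have 3: "integrable lborel (\<lambda>y. \<bar>k y\<bar> * ?D n y)"
      by (rule Bochner_Integration.integrable_bound[where f="\<lambda>y. \<bar>k y\<bar> * (2 * lnorm (fn f))"])
         (use k D2 in \<open>auto simp: abs_mult lnorm_nonneg intro!: AE_I2 mult_left_mono\<close>)
    have eq: "fn (?d n) x = (\<integral>y. ?g y x \<partial>lborel)" for x
      unfolding fn_diff fn_kop right_diff_distrib
      by (rule Bochner_Integration.integral_diff[symmetric]) (rule integrable_kernel_mult[OF k])+
    show ?thesis
      using norm_superposition_le[OF _ 1 3 2] unfolding lnorm_def eq by simp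
  qed
  have lim2: "(\<lambda>n. \<integral>\<xi>. W \<xi> * cmod ((FT k (t n *\<^sub>R \<xi>) - FT k (\<tau> *\<^sub>R \<xi>)) * ft f \<xi>) \<partial>lborel) \<longlonglongrightarrow> (\<integral>\<xi>. 0 \<partial>(lborel :: (real^'n) measure))"
  proof (rule integral_dominated_convergence[where w="\<lambda>\<xi>. 2 * lnorm k * (W \<xi> * cmod (ft f \<xi>))"])
    have "(\<lambda>n. W \<xi> * cmod ((FT k (t n *\<^sub>R \<xi>) - FT k (\<tau> *\<^sub>R \<xi>)) * ft f \<xi>)) \<longlonglongrightarrow> W \<xi> * cmod ((FT k (\<tau> *\<^sub>R \<xi>) - FT k (\<tau> *\<^sub>R \<xi>)) * ft f \<xi>)" for \<xi>
      by (intro tendsto_intros continuous_on_tendsto_compose[OF continuous_fourier[OF integrable_of_real[OF k]]] t) auto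
    then show "AE \<xi> in lborel. (\<lambda>n. W \<xi> * cmod ((FT k (t n *\<^sub>R \<xi>) - FT k (\<tau> *\<^sub>R \<xi>)) * ft f \<xi>)) \<longlonglongrightarrow> 0"
      by simp
    have "cmod (FT k a - FT k b) \<le> 2 * lnorm k" for a b
      using norm_triangle_ineq4[of "FT k a" "FT k b"] FT_le_lnorm[of k a] FT_le_lnorm[of k b] by simp
    then have "W \<xi> * cmod (ft f \<xi>) * cmod (FT k a - FT k b) \<le> W \<xi> * cmod (ft f \<xi>) * (2 * lnorm k)" for a b \<xi>
      by (intro mult_left_mono) auto
    then show "AE \<xi> in lborel. norm (W \<xi> * cmod ((FT k (t n *\<^sub>R \<xi>) - FT k (\<tau> *\<^sub>R \<xi>)) * ft f \<xi>)) \<le> 2 * lnorm k * (W \<xi> * cmod (ft f \<xi>))" for n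
      by (intro AE_I2) (simp only: norm_mult ac_simps abs_mult real_norm_def abs_of_nonneg W_nonneg norm_ge_zero)
    show "integrable lborel (\<lambda>\<xi>. 2 * lnorm k * (W \<xi> * cmod (ft f \<xi>)))"
      by (intro integrable_mult_right walgD)
  qed measurable
  have eq2: "wnorm (fn (?d n)) = (\<integral>\<xi>. W \<xi> * cmod ((FT k (t n *\<^sub>R \<xi>) - FT k (\<tau> *\<^sub>R \<xi>)) * ft f \<xi>) \<partial>lborel) * fnorm TYPE('n)" for n
    unfolding wnorm_def ft_diff ft_kop left_diff_distrib ..
  have "(\<lambda>n. norm (?d n)) \<longlonglongrightarrow> 0"
  proof (rule tendsto_sandwich[OF _ _ tendsto_const])
    show "\<forall>\<^sub>F n in sequentially. norm (?d n) \<le> (\<integral>y. \<bar>k y\<bar> * ?D n y \<partial>lborel) +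
        (\<integral>\<xi>. W \<xi> * cmod ((FT k (t n *\<^sub>R \<xi>) - FT k (\<tau> *\<^sub>R \<xi>)) * ft f \<xi>) \<partial>lborel) * fnorm TYPE('n)"
      using le1 by (simp add: norm_walg eq2)
    show "(\<lambda>n. (\<integral>y. \<bar>k y\<bar> * ?D n y \<partial>lborel) +
        (\<integral>\<xi>. W \<xi> * cmod ((FT k (t n *\<^sub>R \<xi>) - FT k (\<tau> *\<^sub>R \<xi>)) * ft f \<xi>) \<partial>lborel) * fnorm TYPE('n)) \<longlonglongrightarrow> 0"
      using tendsto_add[OF lim1 tendsto_mult_left_zero[OF lim2[unfolded integral_zero], of "fnorm TYPE('n)"]] by simp
  qed auto
  then show ?thesis by (simp add: LIM_zero_iff tendsto_norm_zero_iff)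
qed

text \<open>Strong continuity becomes joint continuity because the operators are bounded uniformly
  by \<open>lnorm k\<close>.\<close>

lemma continuous_on_kop:
  assumes g: "continuous_on S g" and h: "continuous_on S h"
  shows "continuous_on S (\<lambda>x. kop k (g x) (h x :: 'n walg))"
proof -
  have "continuous_on UNIV (\<lambda>\<tau>. kop k \<tau> f)" for f
    unfolding continuous_on_def tendsto_at_iff_sequentially o_def using tendsto_kop by blast
  then have c: "((\<lambda>x. kop k (g x) (h a)) \<longlongrightarrow> kop k (g a) (h a)) (at a within S)" if "a \<in> S" for a
    using continuous_on_compose2[OF _ g, of UNIV "\<lambda>\<tau>. kop k \<tau> (h a)"] that by (auto simp: continuous_on_def)
  have "((\<lambda>x. kop k (g x) (h x)) \<longlongrightarrow> kop k (g a) (h a)) (at a within S)" if a: "a \<in> S" for a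
  proof -
    have "((\<lambda>x. lnorm k * norm (h x - h a)) \<longlongrightarrow> lnorm k * norm (h a - h a)) (at a within S)"
      using h a by (intro tendsto_intros) (auto simp: continuous_on_def)
    then have "((\<lambda>x. kop k (g x) (h x - h a)) \<longlongrightarrow> 0) (at a within S)"
      by (intro Lim_null_comparison[OF always_eventually[OF allI[OF norm_kop_le]]]) simp
    from tendsto_add[OF this c[OF a]] show ?thesis by (simp add: kop_diff)
  qed
  then show ?thesis by (auto simp: continuous_on_def)
qed

end

section \<open>Differentiation and integration by parts for Lebesgue integrals\<close>

lemma has_vector_derivative_integral_dominated:
  fixes f :: "real \<Rightarrow> 'x \<Rightarrow> 'c::{banach,second_countable_topology}"
  assumes int: "\<And>t. integrable M (f t)" and m': "\<And>t. f' t \<in> borel_measurable M"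
    and der: "\<And>t x. ((\<lambda>t. f t x) has_vector_derivative f' t x) (at t)"
    and bd: "\<And>t x. norm (f' t x) \<le> g x" and g: "integrable M g"
  shows "((\<lambda>t. \<integral>x. f t x \<partial>M) has_vector_derivative (\<integral>x. f' t x \<partial>M)) (at t)"
proof -
  have [measurable]: "\<And>t. f t \<in> borel_measurable M" using int by auto
  note [measurable] = m'
  have i': "integrable M (f' t)" for t
    by (rule Bochner_Integration.integrable_bound[OF g]) (auto intro!: AE_I2 order_trans[OF bd abs_ge_self])
  let ?r = "\<lambda>s x. norm (f (t + s) x - f t x - s *\<^sub>R f' t x) / norm s"
  have lip: "norm (f (t + s) x - f t x) \<le> g x * norm s" for s x
  proof -
    have "norm (f (t + s) x - f t x) \<le> g x * norm (t + s - t)"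
    proof (rule differentiable_bound[of UNIV _ "\<lambda>t h. h *\<^sub>R f' t x"])
      fix u show "((\<lambda>t. f t x) has_derivative (\<lambda>h. h *\<^sub>R f' u x)) (at u within UNIV)"
        using der[of x u] by (simp add: has_vector_derivative_def)
      show "onorm (\<lambda>h. h *\<^sub>R f' u x) \<le> g x"
        using bd[of u x] by (intro onorm_le) (simp add: mult.commute[of "g x"] mult_left_mono)
    qed auto
    then show ?thesis by simp
  qed
  have rb: "?r s x \<le> 2 * g x" for s x
  proof (cases "s = 0")
    case True
    then show ?thesis using order_trans[OF norm_ge_zero bd[of t x]] by simp
  next
    case False
    have "norm (f (t + s) x - f t x - s *\<^sub>R f' t x) \<le> norm (f (t + s) x - f t x) + norm (s *\<^sub>R f' t x)"
      by (rule norm_triangle_ineq4)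
    also have "\<dots> \<le> g x * norm s + norm s * g x"
      using lip[of s x] mult_left_mono[OF bd[of t x], of "norm s"]
      unfolding norm_scaleR real_norm_def by linarith
    finally show ?thesis using False by (simp add: field_simps)
  qed
  have rm: "integrable M (?r s)" for s
    by (intro integrable_divide integrable_norm Bochner_Integration.integrable_diff int integrable_scaleR_right i')
  have lim: "((\<lambda>s. \<integral>x. ?r s x \<partial>M) \<longlongrightarrow> 0) (at 0)"
    unfolding tendsto_at_iff_sequentially o_def
  proof (intro allI impI)
    fix X :: "nat \<Rightarrow> real" assume X: "\<forall>i. X i \<in> UNIV - {0}" "X \<longlonglongrightarrow> 0"
    have "(\<lambda>n. \<integral>x. ?r (X n) x \<partial>M) \<longlonglongrightarrow> (\<integral>x. 0 \<partial>M)"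
    proof (rule integral_dominated_convergence[where w="\<lambda>x. 2 * g x"])
      have "((\<lambda>s. ?r s x) \<longlongrightarrow> 0) (at 0)" for x
        using der[of x t] unfolding has_vector_derivative_def has_derivative_at by auto
      then show "AE x in M. (\<lambda>n. ?r (X n) x) \<longlonglongrightarrow> 0"
        unfolding tendsto_at_iff_sequentially o_def using X by (intro AE_I2) blast
      show "AE x in M. norm (?r (X n) x) \<le> 2 * g x" for n
        using rb by (intro AE_I2) auto
    qed (use g in auto)
    then show "(\<lambda>n. \<integral>x. ?r (X n) x \<partial>M) \<longlonglongrightarrow> 0" by simp
  qed
  show ?thesis
    unfolding has_vector_derivative_def has_derivative_at
  proof (intro conjI bounded_linear_scaleR_left)
    show "(\<lambda>s. norm ((\<integral>x. f (t + s) x \<partial>M) - (\<integral>x. f t x \<partial>M) - s *\<^sub>R (\<integral>x. f' t x \<partial>M)) / norm s) \<midarrow>0\<rightarrow> 0"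
    proof (rule Lim_null_comparison[OF always_eventually[OF allI] lim])
      fix s
      have "(\<integral>x. f (t + s) x \<partial>M) - (\<integral>x. f t x \<partial>M) - s *\<^sub>R (\<integral>x. f' t x \<partial>M)
         = (\<integral>x. f (t + s) x - f t x - s *\<^sub>R f' t x \<partial>M)"
        by (simp add: int i')
      then show "norm (norm ((\<integral>x. f (t + s) x \<partial>M) - (\<integral>x. f t x \<partial>M) - s *\<^sub>R (\<integral>x. f' t x \<partial>M)) / norm s) \<le> (\<integral>x. ?r s x \<partial>M)"
        by (simp add: divide_right_mono)
    qed
  qed
qed

text \<open>The form in which integration by parts is used throughout: G is a directional derivative
  of F, so its integral along a unit segment is a difference of two translates of F, and averaging
  over all segments gives 0 by translation invariance.\<close>

lemma integral_directional_derivative_eq_0: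
  fixes F :: "'a::euclidean_space \<Rightarrow> 'c::euclidean_space"
  assumes F: "integrable lborel F" and G: "integrable lborel G" and cont: "continuous_on UNIV G"
    and der: "\<And>x. ((\<lambda>s. F (x + s *\<^sub>R v)) has_vector_derivative G x) (at 0)"
  shows "(\<integral>x. G x \<partial>lborel) = 0"
proof -
  have [measurable]: "G \<in> borel_measurable borel" "F \<in> borel_measurable borel" using F G by auto
  have der': "((\<lambda>s. F (x + s *\<^sub>R v)) has_vector_derivative G (x + u *\<^sub>R v)) (at u)" for x u
  proof -
    have "((\<lambda>s. F ((x + u *\<^sub>R v) + s *\<^sub>R v)) has_vector_derivative G (x + u *\<^sub>R v)) (at (u - u))"
      using der[of "x + u *\<^sub>R v"] by simp
    moreover have "((\<lambda>s. s - u) has_vector_derivative 1) (at u)"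
      by (auto intro!: derivative_eq_intros)
    ultimately have "((\<lambda>s. F ((x + u *\<^sub>R v) + s *\<^sub>R v)) \<circ> (\<lambda>s. s - u) has_vector_derivative 1 *\<^sub>R G (x + u *\<^sub>R v)) (at u)"
      by (intro vector_diff_chain_at)
    then show ?thesis by (simp add: o_def algebra_simps)
  qed
  have ftc: "(\<integral>s. indicator {0..1} s *\<^sub>R G (x + s *\<^sub>R v) \<partial>lborel) = F (x + v) - F x" for x
  proof -
    have "((\<lambda>s. F (x + s *\<^sub>R v)) has_vector_derivative G (x + s *\<^sub>R v)) (at s within {0..1})" for s
      by (rule has_vector_derivative_at_within[OF der'])
    moreover have "continuous_on {0..1} (\<lambda>s. G (x + s *\<^sub>R v))"
      by (intro continuous_on_compose2[OF cont] continuous_intros) auto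
    ultimately show ?thesis
      using integral_FTC_Icc[of 0 1 "\<lambda>s. F (x + s *\<^sub>R v)" "\<lambda>s. G (x + s *\<^sub>R v)"] by simp
  qed
  have G': "integrable lborel (\<lambda>x. G (x + c))" "(\<integral>x. G (x + c) \<partial>lborel) = (\<integral>x. G x \<partial>lborel)" for c
    using integrable_shift_iff[of G "-c"] lborel_integral_shift[of G "-c"] G by auto
  have nG': "(\<integral>x. norm (G (x + c)) \<partial>lborel) = (\<integral>x. norm (G x) \<partial>lborel)" for c
    using lborel_integral_shift[of "\<lambda>x. norm (G x)" "-c"] by auto
  have i: "integrable (lborel \<Otimes>\<^sub>M lborel) (\<lambda>(s::real, x). indicator {0..1} s *\<^sub>R G (x + s *\<^sub>R v))"
    by (rule integrable_pairI[where b="\<lambda>s x. indicator {0..1} s * norm (G (x + s *\<^sub>R v))" and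
         B="\<lambda>s. indicator {0..1} s * (\<integral>x. norm (G x) \<partial>lborel)"])
       (auto intro!: integrable_mult_right integrable_mult_left integrable_norm G' simp: nG')
  have "(\<integral>x. (\<integral>s. indicator {0..1} s *\<^sub>R G (x + s *\<^sub>R v) \<partial>lborel) \<partial>lborel)
      = (\<integral>s. (\<integral>x. indicator {0..1} s *\<^sub>R G (x + s *\<^sub>R v) \<partial>lborel) \<partial>(lborel :: real measure))"
    using lborel_pair.Fubini_integral[OF i] by simp
  also have "\<dots> = (\<integral>s. indicator {0..1} s *\<^sub>R (\<integral>x. G x \<partial>lborel) \<partial>(lborel :: real measure))"
    by (simp add: G')
  also have "\<dots> = (\<integral>x. G x \<partial>lborel)" by simp
  finally have "(\<integral>x. G x \<partial>lborel) = (\<integral>x. F (x + v) - F x \<partial>lborel)"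
    unfolding ftc ..
  also have "\<dots> = 0"
    using integrable_shift_iff[of F "-v"] lborel_integral_shift[of F "-v"] F by simp
  finally show ?thesis .
qed

section \<open>Gaussians\<close>

lemma
  fixes c :: real assumes c: "c > 0"
  shows integrable_gauss_1: "integrable lborel (\<lambda>x::real. exp (- c * x\<^sup>2))"
    and integral_gauss_1: "(\<integral>x. exp (- c * (x::real)\<^sup>2) \<partial>lborel) = sqrt (pi / c)"
proof -
  define \<sigma> where "\<sigma> = sqrt (1 / (2 * c))"
  have s2: "\<sigma>\<^sup>2 = 1 / (2 * c)" using c by (simp add: \<sigma>_def)
  have s: "\<sigma> > 0" using c by (simp add: \<sigma>_def)
  have eq: "(\<lambda>x. exp (- c * x\<^sup>2)) = (\<lambda>x. sqrt (pi / c) * normal_density 0 \<sigma> x)"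
    using c by (auto simp: normal_density_def s2 real_sqrt_divide field_simps)
  show "integrable lborel (\<lambda>x::real. exp (- c * x\<^sup>2))" unfolding eq
    by (intro integrable_mult_right integrable_normal_density s)
  show "(\<integral>x. exp (- c * (x::real)\<^sup>2) \<partial>lborel) = sqrt (pi / c)" unfolding eq
    using integral_normal_density[OF s, of 0] by simp
qed

lemma
  fixes c :: real assumes c: "c > 0"
  shows integrable_gauss: "integrable lborel (\<lambda>x::'a::euclidean_space. exp (- c * (norm x)\<^sup>2))"
    and integral_gauss: "(\<integral>x. exp (- c * (norm (x::'a::euclidean_space))\<^sup>2) \<partial>lborel) = sqrt (pi / c) ^ DIM('a)"
proof -
  have eq: "exp (- c * (norm x)\<^sup>2) = (\<Prod>b\<in>Basis. exp (- c * (x \<bullet> b)\<^sup>2))" for x :: 'a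
    by (subst power2_norm_eq_inner, subst euclidean_inner)
       (simp add: sum_distrib_left exp_sum power2_eq_square flip: sum_negf)
  have "(\<integral>\<^sup>+x. ennreal (exp (- c * (norm (x::'a))\<^sup>2)) \<partial>lborel) = (\<integral>\<^sup>+x. (\<Prod>b\<in>Basis. ennreal (exp (- c * ((x::'a) \<bullet> b)\<^sup>2))) \<partial>lborel)"
    unfolding eq by (simp add: prod_ennreal)
  also have "\<dots> = (\<Prod>b\<in>(Basis::'a set). (\<integral>\<^sup>+x. ennreal (exp (- c * x\<^sup>2)) \<partial>lborel))"
    by (rule nn_integral_lborel_prod) auto
  also have "\<dots> = ennreal (sqrt (pi / c) ^ DIM('a))"
  proof -
    have "(\<integral>\<^sup>+x. ennreal (exp (- c * (x::real)\<^sup>2)) \<partial>lborel) = ennreal (sqrt (pi / c))"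
      using nn_integral_eq_integral[OF integrable_gauss_1[OF c]] integral_gauss_1[OF c] by simp
    then show ?thesis using c by (simp only: prod_constant) (simp add: ennreal_power)
  qed
  finally have nn: "(\<integral>\<^sup>+x. ennreal (exp (- c * (norm (x::'a))\<^sup>2)) \<partial>lborel) = ennreal (sqrt (pi / c) ^ DIM('a))" .
  show I: "integrable lborel (\<lambda>x::'a. exp (- c * (norm x)\<^sup>2))"
    by (rule integrableI_nonneg) (use nn in auto)
  show "(\<integral>x. exp (- c * (norm (x::'a))\<^sup>2) \<partial>lborel) = sqrt (pi / c) ^ DIM('a)"
    using nn c by (subst (asm) nn_integral_eq_integral[OF I]) (auto simp: integral_nonneg_AE)
qed

lemma power_mult_gauss_le:
  fixes c t :: real assumes c: "c > 0"
  shows "\<exists>K\<ge>0. \<forall>t\<ge>0. t ^ m * exp (- c * t\<^sup>2) \<le> K * exp (- (c/2) * t\<^sup>2)"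
proof -
  define K where "K = (1 + fact m * (2 / c) ^ m)"
  have "t ^ m * exp (- c * t\<^sup>2) \<le> K * exp (- (c/2) * t\<^sup>2)" if "t \<ge> 0" for t :: real
  proof -
    have 1: "t ^ m \<le> 1 + (t\<^sup>2) ^ m"
    proof (cases "t \<le> 1")
      case True
      then have "t ^ m \<le> 1" using that by (simp add: power_le_one)
      then show ?thesis by (simp add: add_increasing2)
    next
      case False
      then have "t ^ m \<le> (t\<^sup>2) ^ m" by (intro power_mono) (auto simp: power2_eq_square)
      then show ?thesis by simp
    qed
    have "(c / 2 * t\<^sup>2) ^ m / fact m \<le> exp (c / 2 * t\<^sup>2)"
    proof -
      have s: "(\<lambda>n. (c / 2 * t\<^sup>2) ^ n /\<^sub>R fact n) sums exp (c / 2 * t\<^sup>2)" by (rule exp_converges)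
      have "sum (\<lambda>n. (c / 2 * t\<^sup>2) ^ n /\<^sub>R fact n) {m} \<le> exp (c / 2 * t\<^sup>2)"
        unfolding sums_unique[OF s] by (rule sum_le_suminf[OF sums_summable[OF s]]) (use c in auto)
      then show ?thesis by (simp add: field_simps)
    qed
    then have "(t\<^sup>2) ^ m \<le> fact m * (2 / c) ^ m * exp (c / 2 * t\<^sup>2)"
      using c by (simp add: power_mult_distrib power_divide field_simps)
    moreover have "1 \<le> exp (c / 2 * t\<^sup>2)" using c by simp
    ultimately have "t ^ m \<le> K * exp (c / 2 * t\<^sup>2)"
      using 1 unfolding K_def distrib_right by linarith
    then have "t ^ m * exp (- c * t\<^sup>2) \<le> K * exp (c / 2 * t\<^sup>2) * exp (- c * t\<^sup>2)"
      by (intro mult_right_mono) auto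
    also have "\<dots> = K * exp (- (c/2) * t\<^sup>2)"
      by (simp add: mult.assoc flip: exp_add)
    finally show ?thesis .
  qed
  moreover have "K \<ge> 0" using c by (simp add: K_def)
  ultimately show ?thesis by blast
qed

lemma integrable_power_gauss:
  fixes c :: real assumes c: "c > 0"
  shows "integrable lborel (\<lambda>x::'a::euclidean_space. norm x ^ m * exp (- c * (norm x)\<^sup>2))"
proof -
  obtain K where K: "K \<ge> 0" "\<forall>t\<ge>0. t ^ m * exp (- c * t\<^sup>2) \<le> K * exp (- (c/2) * t\<^sup>2)"
    using power_mult_gauss_le[OF c] by blast
  show ?thesis
    by (rule Bochner_Integration.integrable_bound[of _ "\<lambda>x. K * exp (- (c/2) * (norm x)\<^sup>2)"])
       (use K c integrable_gauss[of "c/2", where 'a='a] in \<open>auto simp: abs_mult\<close>)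
qed

lemma has_vector_derivative_exp_comp:
  "(f has_vector_derivative f') (at t within S) \<Longrightarrow>
   ((\<lambda>t. exp (f t :: complex)) has_vector_derivative (f' * exp (f t))) (at t within S)"
  using field_vector_diff_chain_within[of f f' t S exp "exp (f t)"]
  by (auto simp: o_def intro!: DERIV_exp has_field_derivative_at_within)

lemma has_vector_derivative_cis [derivative_intros]:
  "(f has_real_derivative f') (at t within S) \<Longrightarrow>
   ((\<lambda>t. cis (f t)) has_vector_derivative (\<i> * complex_of_real f' * cis (f t))) (at t within S)"
proof -
  assume f: "(f has_real_derivative f') (at t within S)"
  have "((\<lambda>t. \<i> * complex_of_real (f t)) has_vector_derivative (\<i> * complex_of_real f')) (at t within S)"
    by (intro has_vector_derivative_mult_right has_vector_derivative_of_real f)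
  from has_vector_derivative_exp_comp[OF this] show ?thesis by (simp add: cis_conv_exp)
qed

definition cgauss :: "complex \<Rightarrow> 'a::euclidean_space \<Rightarrow> complex" where
  "cgauss a x = exp (- a * complex_of_real ((norm x)\<^sup>2))"

text \<open>For complex parameters the value is never computed: scaling and non-vanishing suffice
  for the wave kernel, where these constants are divided out.\<close>

definition cgauss_int :: "'a::euclidean_space itself \<Rightarrow> complex \<Rightarrow> complex" where
  "cgauss_int _ a = (\<integral>x. cgauss a x \<partial>(lborel :: 'a measure))"

lemma norm_cgauss: "cmod (cgauss a x) = exp (- Re a * (norm x)\<^sup>2)"
  by (simp add: cgauss_def)

lemma borel_measurable_cgauss [measurable]: "cgauss a \<in> borel_measurable borel"
  unfolding cgauss_def by measurable

lemma continuous_on_cgauss [continuous_intros]: "continuous_on S (cgauss a)"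
  unfolding cgauss_def by (intro continuous_intros)

lemma integrable_cgauss: "Re a > 0 \<Longrightarrow> integrable lborel (cgauss a)"
  by (rule Bochner_Integration.integrable_bound[OF integrable_gauss[of "Re a"]])
     (auto simp: norm_cgauss)

text \<open>Along the ray through \<xi> the transform h satisfies the linear equation h' = - (t
  |\<xi>|^2 / (2 a)) h: differentiation in t produces the moment \<open>x \<bullet> \<xi>\<close>,
  which integration by parts in the direction \<xi> converts back to h.\<close>

lemma fourier_cgauss_aux:
  fixes \<xi> :: "'a::euclidean_space"
  assumes a: "Re a > 0"
  shows "(\<integral>x. cis (- (x \<bullet> \<xi>)) * cgauss a x \<partial>lborel) = cgauss_int TYPE('a) a * exp (- complex_of_real ((norm \<xi>)\<^sup>2) / (4 * a))"
proof -
  have a0: "a \<noteq> 0" using a by auto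
  let ?F = "\<lambda>t x. cis (- t * (x \<bullet> \<xi>)) * cgauss a x"
  let ?X = "\<lambda>t. \<integral>x. complex_of_real (x \<bullet> \<xi>) * ?F t x \<partial>lborel"
  define h where "h t = (\<integral>x. ?F t x \<partial>lborel)" for t
  have iF: "integrable lborel (?F t)" for t
    by (rule integrable_phase[where C=1]) (auto intro: integrable_cgauss[OF a])
  let ?g = "\<lambda>x. norm \<xi> * (norm x ^ 1 * exp (- Re a * (norm x)\<^sup>2))"
  have ig: "integrable lborel ?g"
    by (intro integrable_mult_right integrable_power_gauss a)
  have bd: "cmod (complex_of_real (x \<bullet> \<xi>) * ?F t x) \<le> ?g x" for t x
    using Cauchy_Schwarz_ineq2[of x \<xi>] by (simp add: norm_mult norm_cgauss mult.commute)
  have iX: "integrable lborel (\<lambda>x. complex_of_real (x \<bullet> \<xi>) * ?F t x)" for t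
    by (rule Bochner_Integration.integrable_bound[OF ig]) (measurable, intro AE_I2, rule order_trans[OF bd], simp)
  have h': "(h has_vector_derivative (\<integral>x. - \<i> * (complex_of_real (x \<bullet> \<xi>) * ?F t x) \<partial>lborel)) (at t)" for t
    unfolding h_def
  proof (rule has_vector_derivative_integral_dominated[where g="?g"])
    show "((\<lambda>t. ?F t x) has_vector_derivative - \<i> * (complex_of_real (x \<bullet> \<xi>) * ?F t x)) (at t)" for t x
      by (auto intro!: derivative_eq_intros has_vector_derivative_mult_left simp: mult_ac)
    show "norm (- \<i> * (complex_of_real (x \<bullet> \<xi>) * ?F t x)) \<le> ?g x" for t x
      using bd[of x t] by (simp add: norm_mult)
  qed (use iF ig in auto)
  have parts: "2 * a * ?X t + \<i> * complex_of_real (t * (norm \<xi>)\<^sup>2) * h t = 0" for t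
  proof -
    let ?G = "\<lambda>x. - (2 * a * (complex_of_real (x \<bullet> \<xi>) * ?F t x) + \<i> * complex_of_real (t * (norm \<xi>)\<^sup>2) * ?F t x)"
    have "(\<integral>x. ?G x \<partial>lborel) = 0"
    proof (rule integral_directional_derivative_eq_0[OF iF[of t]])
      show "integrable lborel ?G"
        by (intro integrable_minus Bochner_Integration.integrable_add integrable_mult_right iX iF)
      show "continuous_on UNIV ?G" by (intro continuous_intros)
      show "((\<lambda>s. ?F t (x + s *\<^sub>R \<xi>)) has_vector_derivative ?G x) (at 0)" for x
      proof -
        have n: "(norm (x + s *\<^sub>R \<xi>))\<^sup>2 = (norm x)\<^sup>2 + 2 * s * (x \<bullet> \<xi>) + s\<^sup>2 * (norm \<xi>)\<^sup>2" for s
          unfolding power2_norm_eq_inner by (simp add: algebra_simps inner_commute power2_eq_square)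
        have e: "((\<lambda>s. cgauss a (x + s *\<^sub>R \<xi>)) has_vector_derivative (- 2 * a * complex_of_real (x \<bullet> \<xi>)) * cgauss a x) (at 0)"
        proof -
          have "((\<lambda>s. (norm x)\<^sup>2 + 2 * s * (x \<bullet> \<xi>) + s\<^sup>2 * (norm \<xi>)\<^sup>2) has_real_derivative 2 * (x \<bullet> \<xi>)) (at 0)"
            by (auto intro!: derivative_eq_intros)
          from has_vector_derivative_exp_comp[OF has_vector_derivative_mult_right[OF has_vector_derivative_of_real[OF this], of "- a"]]
          show ?thesis unfolding cgauss_def n by (simp add: mult_ac)
        qed
        have c: "((\<lambda>s. cis (- t * ((x + s *\<^sub>R \<xi>) \<bullet> \<xi>))) has_vector_derivative (\<i> * complex_of_real (- t * (norm \<xi>)\<^sup>2) * cis (- t * (x \<bullet> \<xi>)))) (at 0)"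
          by (auto intro!: derivative_eq_intros simp: inner_add_left power2_norm_eq_inner)
        have "((\<lambda>s. ?F t (x + s *\<^sub>R \<xi>)) has_vector_derivative
           cis (- t * ((x + 0 *\<^sub>R \<xi>) \<bullet> \<xi>)) * ((- 2 * a * complex_of_real (x \<bullet> \<xi>)) * cgauss a x) +
           (\<i> * complex_of_real (- t * (norm \<xi>)\<^sup>2) * cis (- t * (x \<bullet> \<xi>))) * cgauss a (x + 0 *\<^sub>R \<xi>)) (at 0)"
          by (rule has_vector_derivative_mult[OF c e])
        then show ?thesis by (simp add: algebra_simps)
      qed
    qed
    moreover have "(\<integral>x. ?G x \<partial>lborel) = - (2 * a * ?X t + \<i> * complex_of_real (t * (norm \<xi>)\<^sup>2) * h t)"
      unfolding h_def by (subst Bochner_Integration.integral_minus, subst Bochner_Integration.integral_add)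
        (intro integrable_mult_right iX iF, intro integrable_mult_right iX iF, simp)
    ultimately show ?thesis by (simp only: neg_equal_0_iff_equal)
  qed
  \<comment> \<open>The integrating factor, reciprocal to the expected Gaussian.\<close>
  define E where "E t = exp (complex_of_real (t\<^sup>2) * (complex_of_real ((norm \<xi>)\<^sup>2) / (4 * a)))" for t
  have E': "(E has_vector_derivative (complex_of_real (2 * t) * (complex_of_real ((norm \<xi>)\<^sup>2) / (4 * a))) * E t) (at t)" for t
  proof -
    have "((\<lambda>t. t\<^sup>2) has_real_derivative 2 * t) (at t)"
      by (auto intro!: derivative_eq_intros)
    from has_vector_derivative_exp_comp[OF has_vector_derivative_mult_left[OF has_vector_derivative_of_real[OF this], of "complex_of_real ((norm \<xi>)\<^sup>2) / (4 * a)"]]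
    show ?thesis unfolding E_def .
  qed
  have hE: "((\<lambda>t. h t * E t) has_vector_derivative 0) (at t)" for t
  proof -
    have X: "?X t = - (\<i> * complex_of_real (t * (norm \<xi>)\<^sup>2) * h t) / (2 * a)"
      using parts[of t] a0 by (simp add: field_simps add_eq_0_iff)
    have hh: "(h has_vector_derivative (- \<i> * ?X t)) (at t)" using h'[of t] by simp
    have "((\<lambda>t. h t * E t) has_vector_derivative
       (h t * ((complex_of_real (2 * t) * (complex_of_real ((norm \<xi>)\<^sup>2) / (4 * a))) * E t) + (- \<i> * ?X t) * E t)) (at t)"
      by (rule has_vector_derivative_mult[OF hh E'])
    also have "h t * ((complex_of_real (2 * t) * (complex_of_real ((norm \<xi>)\<^sup>2) / (4 * a))) * E t) + (- \<i> * ?X t) * E t = 0"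
      unfolding X using a0 by (simp add: field_simps)
    finally show ?thesis .
  qed
  have "h 1 * E 1 = h 0 * E 0"
  proof -
    have "\<exists>c. \<forall>t\<in>UNIV. h t * E t = c"
      by (rule has_derivative_zero_constant) (use hE in \<open>auto simp: has_vector_derivative_def\<close>)
    then show ?thesis by force
  qed
  then have "h 1 = h 0 * exp (- complex_of_real ((norm \<xi>)\<^sup>2) / (4 * a))"
    by (simp add: E_def exp_minus field_simps)
  then show ?thesis by (simp add: h_def cgauss_int_def)
qed

lemma cgauss_int_scale:
  fixes c :: real assumes c: "c > 0"
  shows "cgauss_int TYPE('a::euclidean_space) a = complex_of_real (c ^ DIM('a)) * cgauss_int TYPE('a) (complex_of_real (c\<^sup>2) * a)"
proof -
  have "cgauss_int TYPE('a) a = \<bar>c\<bar> ^ DIM('a) *\<^sub>R (\<integral>x. cgauss a (0 + c *\<^sub>R x :: 'a) \<partial>lborel)"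
    unfolding cgauss_int_def by (rule integral_affine) (use c in auto)
  also have "(\<integral>x. cgauss a (0 + c *\<^sub>R x :: 'a) \<partial>lborel) = cgauss_int TYPE('a) (complex_of_real (c\<^sup>2) * a)"
    unfolding cgauss_int_def
    by (intro Bochner_Integration.integral_cong refl) (simp add: cgauss_def power_mult_distrib mult_ac)
  finally show ?thesis using c by (simp add: scaleR_conv_of_real)
qed

lemma cgauss_int_real: "c > 0 \<Longrightarrow> cgauss_int TYPE('a::euclidean_space) (complex_of_real c) = complex_of_real (sqrt (pi / c) ^ DIM('a))"
proof -
  assume c: "c > 0"
  have "cgauss (complex_of_real c) = (\<lambda>x::'a. complex_of_real (exp (- c * (norm x)\<^sup>2)))"
    by (rule ext) (simp add: cgauss_def flip: exp_of_real)
  then show ?thesis unfolding cgauss_int_def using integral_gauss[OF c, where 'a='a] by simp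
qed

text \<open>If the integral vanished, so would the whole transform; pairing it with real Gaussians moves the
  parameter by a positive amount, and scaling brings it close to 1.\<close>

lemma cgauss_int_nonzero:
  assumes a: "Re a > 0"
  shows "cgauss_int TYPE('a::euclidean_space) a \<noteq> 0"
proof
  assume 0: "cgauss_int TYPE('a) a = 0"
  have z: "cgauss_int TYPE('a) (complex_of_real (e\<^sup>2) * a + 1) = 0" if e: "e > 0" for e :: real
  proof -
    let ?b = "complex_of_real (e\<^sup>2) * a"
    have b0: "cgauss_int TYPE('a) ?b = 0" using cgauss_int_scale[OF e, of a, where 'a='a] 0 e by simp
    have b: "Re ?b > 0" using a e by simp
    \<comment> \<open>The parameter 1/4 is chosen because the transform of that Gaussian is a
      multiple of exp (- |x|^2): the pairing adds exactly 1 to the parameter.\<close>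
    have "(\<integral>\<xi>. cgauss (1/4) \<xi> * (\<integral>x. cis (- (x \<bullet> \<xi>)) * cgauss ?b (x::'a) \<partial>lborel) \<partial>lborel) =
       (\<integral>x. cgauss ?b (x::'a) * (\<integral>\<xi>. cis (- (x \<bullet> \<xi>)) * cgauss (1/4) \<xi> \<partial>lborel) \<partial>lborel)"
      by (rule integral_swap_phase[of "cgauss (1/4)" "cgauss ?b" "\<lambda>\<xi> x. cis (- (x \<bullet> \<xi>))" 1])
         (use b in \<open>auto intro!: integrable_cgauss\<close>)
    also have "\<dots> = (\<integral>x. cgauss ?b (x::'a) * (\<integral>\<xi>. cis (- (\<xi> \<bullet> x)) * cgauss (1/4) \<xi> \<partial>lborel) \<partial>lborel)"
      by (simp add: inner_commute)
    also have "\<dots> = (\<integral>x. cgauss_int TYPE('a) (1/4) * cgauss (?b + 1) (x::'a) \<partial>lborel)"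
      by (subst fourier_cgauss_aux) (auto simp: cgauss_def algebra_simps exp_diff exp_minus field_simps)
    finally have "cgauss_int TYPE('a) (1/4) * cgauss_int TYPE('a) (?b + 1) = 0"
      unfolding fourier_cgauss_aux[OF b] b0 by (simp add: cgauss_int_def)
    moreover have "cgauss_int TYPE('a) (1/4) \<noteq> 0"
      using cgauss_int_real[of "1/4", where 'a='a] by simp
    ultimately show ?thesis by simp
  qed
  have "(\<lambda>n. \<integral>x. cgauss (complex_of_real ((1 / real (Suc n))\<^sup>2) * a + 1) (x::'a) \<partial>lborel) \<longlonglongrightarrow> (\<integral>x. cgauss 1 (x::'a) \<partial>lborel)"
  proof (rule integral_dominated_convergence[where w="\<lambda>x. exp (- 1 * (norm x)\<^sup>2)"])
    show "integrable lborel (\<lambda>x::'a. exp (- 1 * (norm x)\<^sup>2))" by (rule integrable_gauss) simp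
    have "(\<lambda>n. cgauss (complex_of_real ((1 / real (Suc n))\<^sup>2) * a + 1) x) \<longlonglongrightarrow> cgauss (complex_of_real (0\<^sup>2) * a + 1) x" for x :: 'a
      unfolding cgauss_def by (intro tendsto_intros LIMSEQ_Suc[OF lim_1_over_n])
    then show "AE x::'a in lborel. (\<lambda>n. cgauss (complex_of_real ((1 / real (Suc n))\<^sup>2) * a + 1) x) \<longlonglongrightarrow> cgauss 1 x"
      by simp
    show "AE x::'a in lborel. cmod (cgauss (complex_of_real ((1 / real (Suc n))\<^sup>2) * a + 1) x) \<le> exp (- 1 * (norm x)\<^sup>2)" for n
    proof (intro AE_I2)
      fix x :: 'a
      have "1 * (norm x)\<^sup>2 \<le> Re (complex_of_real ((1 / real (Suc n))\<^sup>2) * a + 1) * (norm x)\<^sup>2"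
        using a by (intro mult_right_mono) auto
      then show "cmod (cgauss (complex_of_real ((1 / real (Suc n))\<^sup>2) * a + 1) x) \<le> exp (- 1 * (norm x)\<^sup>2)"
        unfolding norm_cgauss by (simp only: exp_le_cancel_iff mult_minus_left neg_le_iff_le)
    qed
  qed auto
  moreover have "(\<integral>x. cgauss (complex_of_real ((1 / real (Suc n))\<^sup>2) * a + 1) (x::'a) \<partial>lborel) = 0" for n
    using z[of "1 / real (Suc n)"] by (simp add: cgauss_int_def)
  ultimately have "cgauss_int TYPE('a) 1 = 0"
    by (simp add: cgauss_int_def LIMSEQ_const_iff)
  then show False using cgauss_int_real[of 1, where 'a='a] by simp
qed

section \<open>The damped wave kernel\<close>

text \<open>With its conjugate, the roots of o^2 - o + 1 = 0; that is, exp (- o \<eta> t) solves y''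
  + \<eta> y' + \<eta>^2 y = 0.\<close>

definition om :: complex where "om = Complex (1/2) (sqrt 3 / 2)"
text \<open>The weights that make \<open>gsym\<close> the derivative of a fundamental solution:
  \<open>gam + cnj gam = 1\<close> expresses unit initial velocity and, as 1 / om = cnj om, the
  identity \<open>gam_om\<close> expresses zero initial displacement.\<close>

definition gam :: complex where "gam = Complex (1/2) (- 1 / (2 * sqrt 3))"

lemma Re_om [simp]: "Re om = 1/2" "Re (cnj om) = 1/2"
  by (simp_all add: om_def)

lemma om_nonzero [simp]: "om \<noteq> 0"
  using Re_om by (metis zero_complex.sel(1) zero_neq_numeral divide_eq_0_iff zero_neq_one)

lemma om_mult_cnj: "om * cnj om = 1" and om_plus_cnj: "om + cnj om = 1"
  by (simp_all add: om_def complex_eq_iff)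

lemma gam_plus_cnj: "gam + cnj gam = 1"
  by (simp add: gam_def complex_eq_iff)

lemma gam_om: "gam * cnj om + cnj gam * om = 0"
  by (simp add: gam_def om_def complex_eq_iff)

text \<open>The velocity at time \<rho> of the oscillator y'' + y' + y = 0 released from 0 with unit
  velocity. Unlike the displacement, it acquires no factor 1 / |\<xi>| when time is rescaled to
  frequency |\<xi>|.\<close>

definition gsym :: "real \<Rightarrow> complex" where
  "gsym \<rho> = gam * exp (- om * complex_of_real \<rho>) + cnj gam * exp (- cnj om * complex_of_real \<rho>)"

lemma gsym_0 [simp]: "gsym 0 = 1"
  by (simp add: gsym_def gam_plus_cnj)

lemma integral_half_line_even:
  fixes h :: "real \<Rightarrow> complex"
  assumes h: "integrable lborel h" and even: "\<And>x. h (- x) = h x"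
  shows "(\<integral>x. indicator {0<..} x *\<^sub>R h x \<partial>lborel) = (\<integral>x. h x \<partial>lborel) / 2"
proof -
  have [measurable]: "h \<in> borel_measurable borel" using h by auto
  have i: "integrable lborel (\<lambda>x. indicator A x *\<^sub>R h x)" if [measurable]: "A \<in> sets borel" for A
    by (rule Bochner_Integration.integrable_bound[OF h]) (auto simp: indicator_def)
  have "(\<integral>x. indicator {0<..} (0 - x) *\<^sub>R h (0 - x) \<partial>lborel) = (\<integral>x. indicator {0<..} x *\<^sub>R h x \<partial>lborel)"
    by (rule lborel_integral_reflect[of "\<lambda>x. indicator {0<..} x *\<^sub>R h x" 0]) measurable
  moreover have "(\<lambda>x. indicator {0<..} (0 - x) *\<^sub>R h (0 - x)) = (\<lambda>x. indicator {..<0} x *\<^sub>R h x)"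
    using even by (auto simp: indicator_def)
  ultimately have "(\<integral>x. indicator {..<0} x *\<^sub>R h x \<partial>lborel) = (\<integral>x. indicator {0<..} x *\<^sub>R h x \<partial>lborel)"
    by simp
  moreover have "(\<integral>x. h x \<partial>lborel) = (\<integral>x. indicator {0<..} x *\<^sub>R h x + indicator {..<0} x *\<^sub>R h x \<partial>lborel)"
  proof (rule integral_cong_AE)
    show "AE x in lborel. h x = indicator {0<..} x *\<^sub>R h x + indicator {..<0} x *\<^sub>R h x"
      using AE_lborel_singleton[of 0] by eventually_elim (auto simp: indicator_def)
  qed measurable
  ultimately show ?thesis
    by (subst (asm) Bochner_Integration.integral_add) (auto intro: i)
qed

text \<open>The substitution rho = c / sigma shows that the half-line integral of an even function of
  rho - c / rho does not depend on c (Cauchy and Schloemilch).\<close>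

lemma cauchy_schloemilch:
  fixes h :: "real \<Rightarrow> complex"
  assumes h: "integrable lborel h" and even: "\<And>x. h (- x) = h x" and cont: "continuous_on UNIV h" and c: "c > 0"
  shows "integral {0<..} (\<lambda>\<rho>. h (\<rho> - c / \<rho>)) = (\<integral>x. h x \<partial>lborel) / 2"
proof -
  let ?S = "{0<..} :: real set"
  have Sl: "?S \<in> sets lebesgue" by simp
  let ?g = "\<lambda>\<rho>::real. \<rho> - c / \<rho>"
  have mono: "?g x < ?g y" if "0 < x" "x < y" for x y
    using that c by (simp add: diff_strict_mono divide_strict_left_mono)
  have inj: "inj_on ?g ?S"
    by (intro linorder_inj_onI) (use mono in \<open>force+\<close>)
  have im: "?g ` ?S = UNIV"
  proof -
    have "y \<in> ?g ` ?S" for y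
    proof
      \<comment> \<open>The positive root of r^2 - y r - c = 0.\<close>
      let ?r = "(y + sqrt (y\<^sup>2 + 4 * c)) / 2"
      have "sqrt (y\<^sup>2 + 4 * c) > sqrt (y\<^sup>2)" using c by (intro real_sqrt_less_mono) auto
      then have r: "?r > 0" by simp
      then show "?r \<in> ?S" by simp
      have "?r * ?r - c = y * ?r"
        using c by (simp add: field_simps power2_eq_square flip: real_sqrt_mult)
      then show "y = ?g ?r" using r by (simp add: field_simps)
    qed
    then show ?thesis by blast
  qed
  have der: "(?g has_field_derivative (1 + c / \<rho>\<^sup>2)) (at \<rho> within ?S)" if "\<rho> \<in> ?S" for \<rho>
    using that by (auto intro!: derivative_eq_intros simp: power2_eq_square)
  have hi: "h absolutely_integrable_on UNIV \<and> integral UNIV h = (\<integral>x. h x \<partial>lborel)"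
  proof
    show "h absolutely_integrable_on UNIV"
      using integrable_completion[of h lborel] h by (simp add: set_integrable_def)
    show "integral UNIV h = (\<integral>x. h x \<partial>lborel)" by (rule integral_lborel[OF h])
  qed
  have A: "(\<lambda>\<rho>. \<bar>1 + c / \<rho>\<^sup>2\<bar> *\<^sub>R h (?g \<rho>)) absolutely_integrable_on ?S"
     and Ai: "integral ?S (\<lambda>\<rho>. \<bar>1 + c / \<rho>\<^sup>2\<bar> *\<^sub>R h (?g \<rho>)) = (\<integral>x. h x \<partial>lborel)"
    using has_absolute_integral_change_of_variables_real[OF Sl der inj, of h "\<integral>x. h x \<partial>lborel"] hi
    unfolding im by auto
  have B: "(\<lambda>\<rho>. h (?g \<rho>)) absolutely_integrable_on ?S"
  proof (rule measurable_bounded_by_integrable_imp_absolutely_integrable)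
    show "(\<lambda>\<rho>. h (?g \<rho>)) \<in> borel_measurable (lebesgue_on ?S)"
      by (intro continuous_imp_measurable_on_sets_lebesgue Sl continuous_on_compose2[OF cont] continuous_intros) auto
    show "(\<lambda>\<rho>. norm (\<bar>1 + c / \<rho>\<^sup>2\<bar> *\<^sub>R h (?g \<rho>))) integrable_on ?S"
      using A by (simp add: absolutely_integrable_on_def)
    show "norm (h (?g \<rho>)) \<le> norm (\<bar>1 + c / \<rho>\<^sup>2\<bar> *\<^sub>R h (?g \<rho>))" if "\<rho> \<in> ?S" for \<rho>
    proof -
      have "1 \<le> \<bar>1 + c / \<rho>\<^sup>2\<bar>" using c by (simp add: abs_of_nonneg add_nonneg_nonneg)
      from mult_right_mono[OF this norm_ge_zero[of "h (?g \<rho>)"]] show ?thesis by simp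
    qed
  qed (rule Sl)
  have inj2: "inj_on (\<lambda>\<sigma>. c / \<sigma>) ?S" using c by (auto simp: inj_on_def)
  have im2: "(\<lambda>\<sigma>. c / \<sigma>) ` ?S = ?S"
  proof -
    have "y \<in> (\<lambda>\<sigma>. c / \<sigma>) ` ?S" if "y > 0" for y
      using c that by (intro image_eqI[of _ _ "c / y"]) auto
    then show ?thesis using c by auto
  qed
  have der2: "((\<lambda>\<sigma>. c / \<sigma>) has_field_derivative (- c / \<rho>\<^sup>2)) (at \<rho> within ?S)" if "\<rho> \<in> ?S" for \<rho>
    using that by (auto intro!: derivative_eq_intros simp: power2_eq_square)
  have C: "(\<lambda>\<rho>. \<bar>- c / \<rho>\<^sup>2\<bar> *\<^sub>R h (?g (c / \<rho>))) absolutely_integrable_on ?S"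
     and Ci: "integral ?S (\<lambda>\<rho>. \<bar>- c / \<rho>\<^sup>2\<bar> *\<^sub>R h (?g (c / \<rho>))) = integral ?S (\<lambda>\<rho>. h (?g \<rho>))"
    using has_absolute_integral_change_of_variables_real[OF Sl der2 inj2, of "\<lambda>\<rho>. h (?g \<rho>)" "integral ?S (\<lambda>\<rho>. h (?g \<rho>))"] B
    unfolding im2 by blast+
  have flip: "h (?g (c / \<rho>)) = h (?g \<rho>)" for \<rho>
    using even[of "?g \<rho>"] c by simp
  have C': "(\<lambda>\<rho>. \<bar>- c / \<rho>\<^sup>2\<bar> *\<^sub>R h (?g \<rho>)) integrable_on ?S"
    and Ci': "integral ?S (\<lambda>\<rho>. \<bar>- c / \<rho>\<^sup>2\<bar> *\<^sub>R h (?g \<rho>)) = integral ?S (\<lambda>\<rho>. h (?g \<rho>))"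
    using C Ci unfolding flip by (simp_all add: absolutely_integrable_on_def)
  have "\<bar>1 + c / \<rho>\<^sup>2\<bar> *\<^sub>R h (?g \<rho>) = h (?g \<rho>) + \<bar>- c / \<rho>\<^sup>2\<bar> *\<^sub>R h (?g \<rho>)" for \<rho>
    using c by (simp add: abs_of_nonneg add_nonneg_nonneg scaleR_left_distrib)
  then have "integral ?S (\<lambda>\<rho>. \<bar>1 + c / \<rho>\<^sup>2\<bar> *\<^sub>R h (?g \<rho>)) = integral ?S (\<lambda>\<rho>. h (?g \<rho>) + \<bar>- c / \<rho>\<^sup>2\<bar> *\<^sub>R h (?g \<rho>))"
    by (simp only:)
  also have "\<dots> = integral ?S (\<lambda>\<rho>. h (?g \<rho>)) + integral ?S (\<lambda>\<rho>. \<bar>- c / \<rho>\<^sup>2\<bar> *\<^sub>R h (?g \<rho>))"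
    by (rule Henstock_Kurzweil_Integration.integral_add) (use B C' in \<open>auto simp: absolutely_integrable_on_def\<close>)
  also note Ci'
  finally show ?thesis using Ai by simp
qed

text \<open>Completing the square, \<rho>^2 + A^2 / (4 \<rho>^2) = A + (\<rho> - A / (2 \<rho>))^2,
  splits off the factor exp (- om A) and leaves an integral independent of A by
  \<open>cauchy_schloemilch\<close>. That result concerns a positive constant, so A = 0 is treated
  as a half-line Gaussian integral.\<close>

lemma subordination:
  assumes A: "A \<ge> 0"
  shows "(\<integral>\<rho>. indicator {0<..} \<rho> *\<^sub>R exp (- om * complex_of_real (\<rho>\<^sup>2 + A\<^sup>2 / (4 * \<rho>\<^sup>2))) \<partial>lborel)
     = cgauss_int TYPE(real) om / 2 * exp (- om * complex_of_real A)"
proof (cases "A = 0")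
  case True
  have "(\<integral>\<rho>. indicator {0<..} \<rho> *\<^sub>R cgauss om (\<rho>::real) \<partial>lborel) = (\<integral>\<rho>. cgauss om (\<rho>::real) \<partial>lborel) / 2"
    by (rule integral_half_line_even[OF integrable_cgauss]) (auto simp: cgauss_def)
  then show ?thesis using True by (simp add: cgauss_int_def cgauss_def)
next
  case False
  with A have A: "A > 0" by simp
  let ?h = "cgauss om :: real \<Rightarrow> complex"
  let ?f = "\<lambda>\<rho>. exp (- om * complex_of_real (\<rho>\<^sup>2 + A\<^sup>2 / (4 * \<rho>\<^sup>2)))"
  have eq: "?f \<rho> = exp (- om * complex_of_real A) * ?h (\<rho> - (A/2) / \<rho>)" if "\<rho> > 0" for \<rho>
  proof -
    have "\<rho>\<^sup>2 + A\<^sup>2 / (4 * \<rho>\<^sup>2) = A + (\<rho> - (A/2) / \<rho>)\<^sup>2"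
      using that by (simp add: power2_diff power_divide)
    then have "?f \<rho> = exp (- om * complex_of_real A + - om * complex_of_real ((\<rho> - (A/2) / \<rho>)\<^sup>2))"
      by (simp only: of_real_add distrib_left)
    then show ?thesis by (simp only: exp_add cgauss_def real_norm_def power2_abs)
  qed
  have si: "set_integrable lborel {0<..} ?f"
    unfolding set_integrable_def
  proof (rule Bochner_Integration.integrable_bound[OF integrable_gauss_1[of "1/2"]])
    show "AE \<rho> in lborel. norm (indicator {0<..} \<rho> *\<^sub>R ?f \<rho>) \<le> norm (exp (- (1/2) * \<rho>\<^sup>2))"
      by (intro AE_I2) (auto simp: indicator_def)
  qed auto
  have "(\<integral>\<rho>. indicator {0<..} \<rho> *\<^sub>R ?f \<rho> \<partial>lborel) = integral {0<..} ?f"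
    using set_borel_integral_eq_integral(2)[OF si] by (simp add: set_lebesgue_integral_def)
  also have "\<dots> = integral {0<..} (\<lambda>\<rho>. exp (- om * complex_of_real A) * ?h (\<rho> - (A/2) / \<rho>))"
    by (rule Henstock_Kurzweil_Integration.integral_cong) (use eq in auto)
  also have "\<dots> = exp (- om * complex_of_real A) * integral {0<..} (\<lambda>\<rho>. ?h (\<rho> - (A/2) / \<rho>))"
    by (rule integral_mult_right)
  also have "integral {0<..} (\<lambda>\<rho>. ?h (\<rho> - (A/2) / \<rho>)) = (\<integral>x. ?h x \<partial>lborel) / 2"
    by (rule cauchy_schloemilch[OF integrable_cgauss _ continuous_on_cgauss]) (use A in \<open>auto simp: cgauss_def\<close>)
  finally show ?thesis by (simp add: cgauss_int_def)
qed

text \<open>A superposition of complex Gaussians whose widths all have the argument of om, so that the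
  total mass stays finite.\<close>

lemma ex_half_wave_kernel:
  "\<exists>K. integrable lborel K \<and> (\<forall>\<xi>::real^'n. fourier K \<xi> = exp (- om * complex_of_real (norm \<xi>)))"
proof -
  let ?n = "CARD('n)"
  define \<kappa> where "\<kappa> = cgauss_int TYPE(real) om"
  define \<Gamma> where "\<Gamma> = cgauss_int TYPE(real^'n) (cnj om)"
  have k0: "\<kappa> \<noteq> 0" and G0: "\<Gamma> \<noteq> 0"
    unfolding \<kappa>_def \<Gamma>_def by (intro cgauss_int_nonzero; simp)+
  \<comment> \<open>Normalisation: \<Gamma> comes from the spatial transform and \<kappa> / 2 from
    the integral over \<rho>. The power of \<rho> in g cancels the dependence of the spatial
    Gaussian integral on \<rho>.\<close>
  define kc where "kc = 2 / (\<kappa> * \<Gamma>)"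
  define g :: "real \<Rightarrow> real^'n \<Rightarrow> complex" where "g \<rho> x = indicator {0<..} \<rho> *\<^sub>R
     (kc * complex_of_real (\<rho> ^ ?n) * cgauss om \<rho> * cgauss (complex_of_real (\<rho>\<^sup>2) * cnj om) x)" for \<rho> x
  define B where "B \<rho> = cmod kc * sqrt (2 * pi) ^ ?n * exp (- (1/2) * \<rho>\<^sup>2)" for \<rho> :: real
  have [measurable]: "(\<lambda>(\<rho>, x). g \<rho> x) \<in> borel_measurable (borel \<Otimes>\<^sub>M borel)"
    unfolding g_def cgauss_def by measurable
  have ig: "integrable lborel (g \<rho>)" for \<rho>
  proof (cases "\<rho> > 0")
    case True
    then have "Re (complex_of_real (\<rho>\<^sup>2) * cnj om) > 0" by simp
    from integrable_cgauss[OF this] show ?thesis unfolding g_def by (intro integrable_scaleR_right integrable_mult_right)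
  next
    case False
    then have "g \<rho> = (\<lambda>x. 0)" by (auto simp: g_def fun_eq_iff)
    then show ?thesis by simp
  qed
  have iB: "integrable lborel B"
    unfolding B_def by (intro integrable_mult_right integrable_gauss_1) simp
  have gB: "(\<integral>x. norm (g \<rho> x) \<partial>lborel) \<le> B \<rho>" for \<rho>
  proof (cases "\<rho> > 0")
    case True
    have "(\<integral>x. norm (g \<rho> x) \<partial>lborel) = (\<integral>x. cmod kc * \<rho> ^ ?n * exp (- (1/2) * \<rho>\<^sup>2) * exp (- (\<rho>\<^sup>2 / 2) * (norm (x::real^'n))\<^sup>2) \<partial>lborel)"
      using True by (intro Bochner_Integration.integral_cong refl) (simp add: g_def norm_mult norm_cgauss norm_power)
    also have "\<dots> = cmod kc * \<rho> ^ ?n * exp (- (1/2) * \<rho>\<^sup>2) * sqrt (pi / (\<rho>\<^sup>2 / 2)) ^ ?n"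
      using integral_gauss[of "\<rho>\<^sup>2 / 2", where 'a="real^'n"] True by (subst integral_mult_right_zero) simp
    also have "sqrt (pi / (\<rho>\<^sup>2 / 2)) = sqrt (2 * pi) / \<rho>"
      using True by (simp add: real_sqrt_divide real_sqrt_mult field_simps)
    also have "cmod kc * \<rho> ^ ?n * exp (- (1/2) * \<rho>\<^sup>2) * (sqrt (2 * pi) / \<rho>) ^ ?n = B \<rho>"
      using True by (simp add: B_def power_divide)
    finally show ?thesis by simp
  qed (simp add: g_def B_def)
  define K where "K x = (\<integral>\<rho>. g \<rho> x \<partial>lborel)" for x
  have iK: "integrable lborel K"
    unfolding K_def by (rule integrable_superposition[OF _ ig iB gB]) measurable
  have "fourier K \<xi> = exp (- om * complex_of_real (norm \<xi>))" for \<xi>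
  proof -
    have "fourier K \<xi> = (\<integral>x. (\<integral>\<rho>. cis (- (x \<bullet> \<xi>)) * g \<rho> x \<partial>lborel) \<partial>lborel)"
      unfolding fourier_cis K_def by simp
    also have "\<dots> = (\<integral>\<rho>. (\<integral>x. cis (- (x \<bullet> \<xi>)) * g \<rho> x \<partial>lborel) \<partial>lborel)"
      by (rule integral_swap(1)[symmetric, where b="\<lambda>\<rho> x. norm (g \<rho> x)" and B=B])
         (use ig iB gB in \<open>auto simp: norm_mult\<close>)
    also have "\<dots> = (\<integral>\<rho>. 2 / \<kappa> * (indicator {0<..} \<rho> *\<^sub>R exp (- om * complex_of_real (\<rho>\<^sup>2 + (norm \<xi>)\<^sup>2 / (4 * \<rho>\<^sup>2)))) \<partial>lborel)"
    proof (intro Bochner_Integration.integral_cong refl)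
      fix \<rho> :: real
      show "(\<integral>x. cis (- (x \<bullet> \<xi>)) * g \<rho> x \<partial>lborel) = 2 / \<kappa> * (indicator {0<..} \<rho> *\<^sub>R exp (- om * complex_of_real (\<rho>\<^sup>2 + (norm \<xi>)\<^sup>2 / (4 * \<rho>\<^sup>2))))"
      proof (cases "\<rho> > 0")
        case True
        let ?a = "complex_of_real (\<rho>\<^sup>2) * cnj om"
        have "(\<integral>x. cis (- (x \<bullet> \<xi>)) * g \<rho> x \<partial>lborel) =
            (\<integral>x. kc * complex_of_real (\<rho> ^ ?n) * cgauss om \<rho> * (cis (- (x \<bullet> \<xi>)) * cgauss ?a x) \<partial>lborel)"
          using True by (simp add: g_def mult_ac)
        also have "\<dots> = kc * complex_of_real (\<rho> ^ ?n) * cgauss om \<rho> * (cgauss_int TYPE(real^'n) ?a * exp (- complex_of_real ((norm \<xi>)\<^sup>2) / (4 * ?a)))"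
          by (subst integral_mult_right_zero, subst fourier_cgauss_aux) (use True in auto)
        also have "\<dots> = kc * \<Gamma> * (cgauss om \<rho> * exp (- complex_of_real ((norm \<xi>)\<^sup>2) / (4 * ?a)))"
          using cgauss_int_scale[OF True, of "cnj om", where 'a="real^'n"] by (simp add: \<Gamma>_def mult_ac)
        \<comment> \<open>The spatial parameter carries \<open>cnj om\<close> so that its reciprocal
          is \<open>om\<close>: both exponents then have the same complex direction, as
          subordination requires.\<close>
        also have "- complex_of_real ((norm \<xi>)\<^sup>2) / (4 * ?a) = - om * complex_of_real ((norm \<xi>)\<^sup>2 / (4 * \<rho>\<^sup>2))"
        proof -
          have "cnj om \<noteq> 0" by simp
          then have 1: "1 / cnj om = om" using om_mult_cnj by (simp add: divide_eq_eq)
          have "- complex_of_real ((norm \<xi>)\<^sup>2) / (4 * ?a) = - complex_of_real ((norm \<xi>)\<^sup>2) / (4 * complex_of_real (\<rho>\<^sup>2)) * (1 / cnj om)"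
            by (simp only: times_divide_times_eq mult_1_right mult.assoc)
          then show ?thesis unfolding 1 by simp
        qed
        also have "cgauss om \<rho> * exp (- om * complex_of_real ((norm \<xi>)\<^sup>2 / (4 * \<rho>\<^sup>2))) = exp (- om * complex_of_real (\<rho>\<^sup>2 + (norm \<xi>)\<^sup>2 / (4 * \<rho>\<^sup>2)))"
          unfolding cgauss_def exp_add[symmetric] by (simp add: distrib_left)
        finally show ?thesis using True G0 by (simp add: kc_def)
      qed (simp add: g_def)
    qed
    also have "\<dots> = exp (- om * complex_of_real (norm \<xi>))"
      by (subst integral_mult_right_zero, subst subordination) (use k0 in \<open>auto simp: \<kappa>_def\<close>)
    finally show ?thesis .
  qed
  with iK show ?thesis by blast
qed

lemma fourier_cnj:
  assumes "integrable lborel f"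
  shows "fourier (\<lambda>x. cnj (f x)) \<xi> = cnj (fourier f (- \<xi>))"
proof -
  have "cis (- (x \<bullet> \<xi>)) * cnj (f x) = cnj (cis (- (x \<bullet> (- \<xi>))) * f x)" for x
    by (simp add: cis_cnj)
  moreover have "integrable lborel (\<lambda>x. cis (- (x \<bullet> (- \<xi>))) * f x)"
    by (rule integrable_phase[where C=1]) (use assms in auto)
  ultimately show ?thesis unfolding fourier_cis
    by (simp only: Bochner_Integration.integral_cnj)
qed

text \<open>Conjugating K conjugates its transform up to a reflection, which is harmless because the
  symbol is radial. Twice the real part of \<open>gam * K\<close> therefore has exactly the two
  exponentials of \<open>gsym\<close> as its transform.\<close>

lemma ex_wave_kernel:
  "\<exists>k. integrable lborel k \<and> (\<forall>\<xi>::real^'n. FT k \<xi> = gsym (norm \<xi>))"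
proof -
  obtain K where K: "integrable lborel K" "\<And>\<xi>::real^'n. fourier K \<xi> = exp (- om * complex_of_real (norm \<xi>))"
    using ex_half_wave_kernel by blast
  define k where "k x = Re (2 * gam * K x)" for x
  have ik: "integrable lborel k" unfolding k_def using K(1) by (intro integrable_Re integrable_mult_right)
  have "FT k \<xi> = gsym (norm \<xi>)" for \<xi>
  proof -
    have "complex_of_real (k x) = gam * K x + cnj (gam * K x)" for x
      using complex_add_cnj[of "gam * K x"] by (simp add: k_def)
    then have "FT k \<xi> = fourier (\<lambda>x. gam * K x + cnj (gam * K x)) \<xi>" by simp
    also have "\<dots> = fourier (\<lambda>x. gam * K x) \<xi> + fourier (\<lambda>x. cnj (gam * K x)) \<xi>"
      by (rule fourier_add) (use K(1) in \<open>auto simp del: complex_cnj_mult\<close>)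
    also have "\<dots> = gsym (norm \<xi>)"
      unfolding fourier_cnj[OF integrable_mult_right[OF K(1)]] fourier_cmult K(2) gsym_def by (simp add: exp_cnj)
    finally show ?thesis .
  qed
  with ik show ?thesis by blast
qed

section \<open>Powers in non-unital Banach algebras\<close>

text \<open>The Wiener algebra has no unit, so \<open>pw x m\<close> stands for the (m+1)-st power of x.\<close>

definition pw :: "'a::times \<Rightarrow> nat \<Rightarrow> 'a" where "pw x m = ((*) x ^^ m) x"

lemma pw_0 [simp]: "pw x 0 = x" and pw_Suc [simp]: "pw x (Suc m) = x * pw x m"
  by (simp_all add: pw_def)

lemma norm_pw_le: "norm (pw (x::'a::real_normed_algebra) m) \<le> norm x ^ Suc m"
proof (induction m)
  case (Suc m)
  have "norm (x * pw x m) \<le> norm x * norm (pw x m)" by (rule norm_mult_ineq)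
  also have "\<dots> \<le> norm x * norm x ^ Suc m" by (intro mult_left_mono Suc) auto
  finally show ?case by simp
qed simp

lemma pw_diff_le:
  fixes x y :: "'a::real_normed_algebra"
  assumes "norm x \<le> R" "norm y \<le> R"
  shows "norm (pw x m - pw y m) \<le> real (Suc m) * R ^ m * norm (x - y)"
proof (induction m)
  case (Suc m)
  have R: "R \<ge> 0" using assms(1) norm_ge_zero order_trans by blast
  have "pw x (Suc m) - pw y (Suc m) = x * (pw x m - pw y m) + (x - y) * pw y m"
    by (simp add: algebra_simps)
  also have "norm \<dots> \<le> norm x * norm (pw x m - pw y m) + norm (x - y) * norm (pw y m)"
    by (intro order_trans[OF norm_triangle_ineq] add_mono norm_mult_ineq)
  also have "\<dots> \<le> R * (real (Suc m) * R ^ m * norm (x - y)) + norm (x - y) * R ^ Suc m"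
    using assms R by (intro add_mono mult_mono Suc order_trans[OF norm_pw_le] power_mono) auto
  also have "\<dots> = real (Suc (Suc m)) * R ^ Suc m * norm (x - y)"
    by (simp add: algebra_simps)
  finally show ?case .
qed simp

lemma continuous_on_pw [continuous_intros]:
  fixes f :: "'b::topological_space \<Rightarrow> 'a::real_normed_algebra"
  shows "continuous_on S f \<Longrightarrow> continuous_on S (\<lambda>t. pw (f t) m)"
  by (induction m) (auto intro: continuous_intros)

section \<open>Duhamel integrals\<close>

text \<open>Moves the variable endpoint into the integrand, so that continuity of the Duhamel
  integral in its endpoint becomes continuity in a parameter over a fixed interval.\<close>

lemma integral_stretch01:
  fixes f :: "real \<Rightarrow> 'a::banach"
  assumes f: "continuous_on {0..r} f" and r: "r \<ge> 0"
  shows "integral {0..r} f = r *\<^sub>R integral {0..1} (\<lambda>\<sigma>. f (r * \<sigma>))"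
proof -
  define F where "F x = integral {0..x} f" for x
  have F: "(F has_vector_derivative f x) (at x within {0..r})" if "x \<in> {0..r}" for x
    unfolding F_def using integral_has_vector_derivative[OF f that] .
  have im: "(\<lambda>\<sigma>. r * \<sigma>) ` {0..1} \<subseteq> {0..r}"
    using r by (auto simp: mult_left_le)
  have "((\<lambda>\<sigma>. F (r * \<sigma>)) has_vector_derivative r *\<^sub>R f (r * \<sigma>)) (at \<sigma> within {0..1})" if "\<sigma> \<in> {0..1}" for \<sigma>
  proof -
    have "((\<lambda>\<sigma>. r * \<sigma>) has_vector_derivative r) (at \<sigma> within {0..1})"
      by (auto intro!: derivative_eq_intros)
    moreover have "(F has_vector_derivative f (r * \<sigma>)) (at (r * \<sigma>) within (\<lambda>\<sigma>. r * \<sigma>) ` {0..1})"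
      by (rule has_vector_derivative_within_subset[OF F im]) (use that im in blast)
    ultimately show ?thesis using vector_diff_chain_within[of "\<lambda>\<sigma>. r * \<sigma>" r \<sigma> "{0..1}" F "f (r * \<sigma>)"]
      by (simp add: o_def)
  qed
  from fundamental_theorem_of_calculus[OF _ this]
  have "((\<lambda>\<sigma>. r *\<^sub>R f (r * \<sigma>)) has_integral (F (r * 1) - F (r * 0))) {0..1}" by simp
  from integral_unique[OF this] have "integral {0..1} (\<lambda>\<sigma>. r *\<^sub>R f (r * \<sigma>)) = F r - F 0"
    by simp
  then show ?thesis by (simp add: F_def)
qed

text \<open>The forced equation is answered through velocities: \<open>H \<tau>\<close> is the
  velocity response to an impulse, \<open>D1 N\<close> the velocity up to sign, and its time
  integral \<open>D2 N\<close> the displacement. The family of identities belongs to the pointwise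
  equation, the dilated wave kernel to the viscous one.\<close>

locale duhamel =
  fixes H :: "real \<Rightarrow> 'a::banach \<Rightarrow> 'a" and B :: real
  assumes lin: "bounded_linear (H \<tau>)" and bd: "norm (H \<tau> x) \<le> B * norm x" and B0: "B \<ge> 0"
    and cont: "continuous_on UNIV (\<lambda>p. H (fst p) (snd p))"
begin

lemma cont_H:
  "continuous_on S g \<Longrightarrow> continuous_on S h \<Longrightarrow> continuous_on S (\<lambda>x. H (g x) (h x))"
  using continuous_on_compose2[OF cont, of S "\<lambda>x. (g x, h x)"] by (auto intro!: continuous_intros)

definition D1 :: "(real \<Rightarrow> 'a) \<Rightarrow> real \<Rightarrow> 'a" where
  "D1 N r = integral {0..r} (\<lambda>s. H (r - s) (N s))"

definition D2 :: "(real \<Rightarrow> 'a) \<Rightarrow> real \<Rightarrow> 'a" where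
  "D2 N t = integral {0..t} (D1 N)"

lemma cont_integrand: "continuous_on {0..T} N \<Longrightarrow> r \<le> T \<Longrightarrow> continuous_on {0..r} (\<lambda>s. H (r - s) (N s))"
  by (intro cont_H continuous_intros) (auto intro: continuous_on_subset)

lemma continuous_on_D1:
  assumes N: "continuous_on {0..T} N"
  shows "continuous_on {0..T} (D1 N)"
proof -
  have "continuous_on {0..T} (\<lambda>r. r *\<^sub>R integral (cbox 0 1) (\<lambda>\<sigma>. H (r - r * \<sigma>) (N (r * \<sigma>))))"
  proof (intro continuous_intros integral_continuous_on_param)
    have "continuous_on ({0..T} \<times> cbox 0 1) (\<lambda>p. H (fst p - fst p * snd p) (N (fst p * snd p)))"
      by (intro cont_H continuous_intros continuous_on_compose2[OF N])
         (auto simp: mult_left_le intro: order_trans[OF mult_left_le])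
    then show "continuous_on ({0..T} \<times> cbox 0 1) (\<lambda>(r, \<sigma>). H (r - r * \<sigma>) (N (r * \<sigma>)))"
      by (simp add: case_prod_unfold)
  qed
  then show ?thesis
  proof (rule continuous_on_eq)
    fix r assume r: "r \<in> {0..T}"
    show "r *\<^sub>R integral (cbox 0 1) (\<lambda>\<sigma>. H (r - r * \<sigma>) (N (r * \<sigma>))) = D1 N r"
      unfolding D1_def using r by (subst integral_stretch01[OF cont_integrand[OF N]]) auto
  qed
qed

lemma continuous_on_D2: "continuous_on {0..T} N \<Longrightarrow> continuous_on {0..T} (D2 N)"
  unfolding D2_def by (intro indefinite_integral_continuous_1 integrable_continuous_real continuous_on_D1)

lemma D1_diff:
  assumes "continuous_on {0..T} N" "continuous_on {0..T} N'" "r \<le> T"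
  shows "D1 (\<lambda>s. N s - N' s) r = D1 N r - D1 N' r"
  unfolding D1_def linear_diff[OF bounded_linear.linear[OF lin]]
  by (intro Henstock_Kurzweil_Integration.integral_diff integrable_continuous_real
      cont_integrand[OF assms(1)] cont_integrand[OF assms(2)] assms(3))

lemma D2_diff:
  assumes N: "continuous_on {0..T} N" "continuous_on {0..T} N'" and t: "t \<le> T"
  shows "D2 (\<lambda>s. N s - N' s) t = D2 N t - D2 N' t"
proof -
  have "D2 (\<lambda>s. N s - N' s) t = integral {0..t} (\<lambda>r. D1 N r - D1 N' r)"
    unfolding D2_def by (intro Henstock_Kurzweil_Integration.integral_cong) (use D1_diff[OF N] t in auto)
  also have "\<dots> = D2 N t - D2 N' t"
    unfolding D2_def
    by (intro Henstock_Kurzweil_Integration.integral_diff integrable_continuous_real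
        continuous_on_subset[OF continuous_on_D1[OF N(1)]] continuous_on_subset[OF continuous_on_D1[OF N(2)]])
       (use t in auto)
  finally show ?thesis .
qed

lemma exp_integral:
  fixes L :: real assumes "L > 0" "t \<ge> 0"
  shows "integral {0..t} (\<lambda>s. exp (L * s)) \<le> exp (L * t) / L" "(\<lambda>s. exp (L * s)) integrable_on {0..t}"
proof -
  have "((\<lambda>s. exp (L * s)) has_integral (exp (L * t) / L - exp (L * 0) / L)) {0..t}"
    by (rule fundamental_theorem_of_calculus)
       (use assms in \<open>auto intro!: derivative_eq_intros simp flip: has_real_derivative_iff_has_vector_derivative\<close>)
  then show "integral {0..t} (\<lambda>s. exp (L * s)) \<le> exp (L * t) / L" "(\<lambda>s. exp (L * s)) integrable_on {0..t}"
    using assms by (auto simp: integral_unique integrable_on_def)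
qed

text \<open>Two integrations against exp (L s) gain L^(-2). In the norm weighted by exp (- L t) the
  Duhamel map thus contracts on an interval of any length once L is large.\<close>

lemma norm_D2_le_exp:
  assumes N: "continuous_on {0..T} N" and L: "L > 0" and M: "\<And>s. s \<in> {0..T} \<Longrightarrow> norm (N s) \<le> M * exp (L * s)"
    and t: "t \<in> {0..T}"
  shows "norm (D2 N t) \<le> B * M / L\<^sup>2 * exp (L * t)"
proof -
  have M0: "M \<ge> 0" using M[of 0] t order_trans[OF norm_ge_zero] by fastforce
  have 1: "norm (D1 N r) \<le> B * M / L * exp (L * r)" if r: "r \<in> {0..T}" for r
  proof -
    have "norm (D1 N r) \<le> integral {0..r} (\<lambda>s. (B * M) * exp (L * s))"
      unfolding D1_def
    proof (rule Henstock_Kurzweil_Integration.integral_norm_bound_integral)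
      show "(\<lambda>s. H (r - s) (N s)) integrable_on {0..r}"
        by (intro integrable_continuous_real cont_integrand[OF N]) (use r in auto)
      show "(\<lambda>s. (B * M) * exp (L * s)) integrable_on {0..r}"
        by (intro integrable_continuous_real continuous_intros)
      show "norm (H (r - s) (N s)) \<le> (B * M) * exp (L * s)" if "s \<in> {0..r}" for s
        using mult_left_mono[OF M[of s] B0] that r by (intro order_trans[OF bd]) auto
    qed
    also have "\<dots> = (B * M) * integral {0..r} (\<lambda>s. exp (L * s))" by simp
    also have "\<dots> \<le> (B * M) * (exp (L * r) / L)"
      using exp_integral(1)[OF L, of r] r M0 B0 by (intro mult_left_mono) auto
    finally show ?thesis by simp
  qed
  have "norm (D2 N t) \<le> integral {0..t} (\<lambda>r. B * M / L * exp (L * r))"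
    unfolding D2_def
  proof (rule Henstock_Kurzweil_Integration.integral_norm_bound_integral)
    show "D1 N integrable_on {0..t}"
      by (intro integrable_continuous_real continuous_on_subset[OF continuous_on_D1[OF N]]) (use t in auto)
    show "(\<lambda>s. B * M / L * exp (L * s)) integrable_on {0..t}"
      using L by (intro integrable_continuous_real continuous_intros) auto
  qed (use 1 t in auto)
  also have "\<dots> = B * M / L * integral {0..t} (\<lambda>s. exp (L * s))" by simp
  also have "\<dots> \<le> B * M / L * (exp (L * t) / L)"
    using exp_integral(1)[OF L, of t] t M0 B0 L by (intro mult_left_mono) auto
  finally show ?thesis by (simp add: power2_eq_square)
qed

lemma norm_D2_le:
  assumes N: "continuous_on {0..T} N" and M: "\<And>s. s \<in> {0..T} \<Longrightarrow> norm (N s) \<le> M" and t: "t \<in> {0..T}"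
  shows "norm (D2 N t) \<le> B * M * T\<^sup>2"
proof -
  have M0: "M \<ge> 0" using M[of 0] t order_trans[OF norm_ge_zero] by fastforce
  have 1: "norm (D1 N r) \<le> B * M * T" if r: "r \<in> {0..T}" for r
  proof -
    have "norm (D1 N r) \<le> B * M * (r - 0)"
      unfolding D1_def
    proof (rule integral_bound)
      show "norm (H (r - s) (N s)) \<le> B * M" if "s \<in> {0..r}" for s
        using mult_left_mono[OF M[of s] B0] that r by (intro order_trans[OF bd]) auto
    qed (use r cont_integrand[OF N] in auto)
    also have "\<dots> \<le> B * M * T" using r M0 B0 by (intro mult_left_mono) auto
    finally show ?thesis .
  qed
  have "norm (D2 N t) \<le> B * M * T * (t - 0)"
    unfolding D2_def
    by (rule integral_bound) (use 1 t continuous_on_subset[OF continuous_on_D1[OF N]] in auto)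
  also have "\<dots> \<le> B * M * T * T" using t M0 B0 by (intro mult_left_mono) auto
  finally show ?thesis by (simp add: power2_eq_square)
qed

end

text \<open>The passage to the limit shared by the iteration for the pointwise equation and the one
  for small dispersion. Geometric decay of the increments is an assumption here because the two
  iterations obtain it differently, one of them from estimates other than those in the algebra
  norm.\<close>

lemma picard_limit:
  fixes H :: "real \<Rightarrow> 'a::{real_normed_algebra,banach} \<Rightarrow> 'a"
  assumes "duhamel H B"
    and c: "\<And>n. continuous_on {0..T} (y n)"
    and step: "\<And>n t. t \<in> {0..T} \<Longrightarrow> y (Suc n) t = g t - duhamel.D2 H (\<lambda>s. pw (y n s) m - f) t"
    and diff: "\<And>n t. t \<in> {0..T} \<Longrightarrow> norm (y (Suc n) t - y n t) \<le> C / 2 ^ n"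
  shows "\<exists>v. continuous_on {0..T} v \<and> (\<forall>t\<in>{0..T}. norm (v t - y 0 t) \<le> 2 * C) \<and>
     (\<forall>t\<in>{0..T}. v t = g t - duhamel.D2 H (\<lambda>s. pw (v s) m - f) t)"
proof (cases "T \<ge> 0")
  case False
  then show ?thesis by auto
next
  case True
  interpret duhamel H B by fact
  have C0: "C \<ge> 0" using order_trans[OF norm_ge_zero diff[of 0 0]] True by simp
  let ?d = "\<lambda>n t. y (Suc n) t - y n t"
  have sC: "(\<lambda>n. C / 2 ^ n) sums (2 * C)"
    using sums_mult[OF geometric_sums[of "1/2 :: real"], of C] by (simp add: power_divide mult.commute)
  define v where "v t = y 0 t + suminf (\<lambda>n. ?d n t)" for t
  have tele: "(\<Sum>i<n. ?d i t) = y n t - y 0 t" for n t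
    by (rule sum_lessThan_telescope)
  have "uniform_limit {0..T} (\<lambda>n t. \<Sum>i<n. ?d i t) (\<lambda>t. suminf (\<lambda>n. ?d n t)) sequentially"
    by (rule Weierstrass_m_test[OF _ sums_summable[OF sC]]) (use diff in auto)
  then have "uniform_limit {0..T} (\<lambda>n t. y 0 t + (\<Sum>i<n. ?d i t)) v sequentially"
    unfolding v_def by (intro uniform_limit_intros)
  then have ul: "uniform_limit {0..T} y v sequentially"
    unfolding tele by simp
  have cv: "continuous_on {0..T} v"
    by (rule uniform_limit_theorem[OF always_eventually[OF allI[OF c]] ul]) simp
  have vb: "norm (v t - y 0 t) \<le> 2 * C" if t: "t \<in> {0..T}" for t
  proof -
    have "norm (suminf (\<lambda>n. ?d n t)) \<le> suminf (\<lambda>n. C / 2 ^ n)"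
      by (rule norm_suminf_le) (use diff[OF t] sums_summable[OF sC] in auto)
    then show ?thesis using sums_unique[OF sC] by (simp add: v_def)
  qed
  obtain R0 where "\<forall>x\<in>v ` {0..T}. norm x \<le> R0"
    using compact_imp_bounded[OF compact_continuous_image[OF cv compact_Icc]] unfolding bounded_iff by blast
  then have R0: "\<And>t. t \<in> {0..T} \<Longrightarrow> norm (v t) \<le> R0" by auto
  have R00: "R0 \<ge> 0" using R0[of 0] True order_trans[OF norm_ge_zero] by fastforce
  define R where "R = R0 + 1"
  define K where "K = real (Suc m) * R ^ m"
  have K0: "K > 0" unfolding K_def R_def using R00 by simp
  have fixp: "v t = g t - D2 (\<lambda>s. pw (v s) m - f) t" if t: "t \<in> {0..T}" for t
  proof -
    have cN: "continuous_on {0..T} (\<lambda>s. pw (y n s) m - f)" for n by (intro continuous_intros c)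
    have cN': "continuous_on {0..T} (\<lambda>s. pw (v s) m - f)" by (intro continuous_intros cv)
    have "(\<lambda>n. D2 (\<lambda>s. pw (y n s) m - f) t) \<longlonglongrightarrow> D2 (\<lambda>s. pw (v s) m - f) t"
    proof (rule LIMSEQ_I)
      fix e :: real assume e: "e > 0"
      \<comment> \<open>The cap 1 keeps the iterates in the ball of radius
        \<open>R = R0 + 1\<close>, on which K is a Lipschitz constant of the power.\<close>
      define e' where "e' = min 1 (e / (B * K * T\<^sup>2 + 1))"
      have den: "B * K * T\<^sup>2 + 1 > 0" using B0 K0 by (intro add_nonneg_pos mult_nonneg_nonneg) auto
      have e': "e' > 0" using e den by (simp add: e'_def)
      obtain N where N: "\<And>n t. n \<ge> N \<Longrightarrow> t \<in> {0..T} \<Longrightarrow> norm (y n t - v t) < e'"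
        using uniform_limitD[OF ul e'] unfolding eventually_sequentially dist_norm by blast
      have "norm (D2 (\<lambda>s. pw (y n s) m - f) t - D2 (\<lambda>s. pw (v s) m - f) t) < e" if n: "n \<ge> N" for n
      proof -
        have "norm (pw (y n s) m - f - (pw (v s) m - f)) \<le> K * e'" if s: "s \<in> {0..T}" for s
        proof -
          have ns: "norm (y n s - v s) < e'" by (rule N[OF n s])
          then have "norm (y n s) \<le> R" using R0[OF s] norm_triangle_ineq2[of "y n s" "v s"]
            by (simp add: R_def e'_def)
          moreover have "norm (v s) \<le> R" using R0[OF s] by (simp add: R_def)
          ultimately have "norm (pw (y n s) m - pw (v s) m) \<le> K * norm (y n s - v s)"
            unfolding K_def by (rule pw_diff_le)
          also have "\<dots> \<le> K * e'" using ns K0 by (intro mult_left_mono) auto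
          finally show ?thesis by simp
        qed
        from norm_D2_le[OF continuous_on_diff[OF cN[of n] cN'] this t]
        have "norm (D2 (\<lambda>s. pw (y n s) m - f - (pw (v s) m - f)) t) \<le> B * (K * e') * T\<^sup>2" by simp
        also have "\<dots> = (B * K * T\<^sup>2) * e'" by simp
        also have "\<dots> \<le> (B * K * T\<^sup>2) * (e / (B * K * T\<^sup>2 + 1))"
          using B0 K0 by (intro mult_left_mono) (auto simp: e'_def)
        also have "\<dots> < e" using e den by (simp add: field_simps)
        finally show ?thesis using D2_diff[OF cN[of n] cN', of t] t by simp
      qed
      then show "\<exists>no. \<forall>n\<ge>no. norm (D2 (\<lambda>s. pw (y n s) m - f) t - D2 (\<lambda>s. pw (v s) m - f) t) < e" by blast
    qed
    then have "(\<lambda>n. y (Suc n) t) \<longlonglongrightarrow> g t - D2 (\<lambda>s. pw (v s) m - f) t"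
      unfolding step[OF t] by (intro tendsto_intros)
    moreover have "(\<lambda>n. y (Suc n) t) \<longlonglongrightarrow> v t"
      by (rule LIMSEQ_Suc[OF tendsto_uniform_limitI[OF ul t]])
    ultimately show ?thesis using LIMSEQ_unique by blast
  qed
  show ?thesis using cv vb fixp by blast
qed

section \<open>Local solvability governed by the spectral radius of the data\<close>

lemma duhamel_id: "duhamel (\<lambda>\<tau> x. x :: 'a::banach) 1"
  by (intro duhamel.intro bounded_linear_ident) (auto intro!: continuous_intros)

text \<open>The supremum over j and k of norm (a^j b^k y) / r^(j + k) is an equivalent norm in which
  multiplication by a and by b has norm at most r. The constant C may be huge, but it does not enter
  the time of existence, which is governed by r and the exponent.\<close>

locale gauge =
  fixes a b :: "'a::{real_normed_algebra,comm_ring,banach}" and C r :: real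
  assumes r: "r > 0" and C: "C \<ge> 0"
    and ab: "\<And>j k y. norm (((*) a ^^ j) (((*) b ^^ k) y)) \<le> C * r ^ (j + k) * norm y"
begin

text \<open>Monomials a^j b^k as operators, since without a unit no element stands for the case j =
  k = 0.\<close>

definition L :: "nat \<Rightarrow> nat \<Rightarrow> 'a \<Rightarrow> 'a" where "L j k y = ((*) a ^^ j) (((*) b ^^ k) y)"

text \<open>States that the equivalent norm of y is at most M, without forming the supremum.\<close>

definition nb :: "real \<Rightarrow> 'a \<Rightarrow> bool" where "nb M y \<longleftrightarrow> (\<forall>j k. norm (L j k y) \<le> M * r ^ (j + k))"

text \<open>In a unital algebra a bound for multiplication by x would also bound x as the image of
  1. Here \<open>C'\<close> stands in for the norm of the missing unit, calibrated so that a and b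
  themselves satisfy \<open>nb (r * C')\<close>.\<close>

definition C' :: real where "C' = C * (norm a + norm b) / r"

text \<open>\<open>Op x g\<close>: multiplication by x has norm at most g for the seminorm that \<open>nb\<close> measures.\<close>

definition Op :: "'a \<Rightarrow> real \<Rightarrow> bool" where
  "Op x \<gamma> \<longleftrightarrow> (\<forall>M y. nb M y \<longrightarrow> nb (\<gamma> * M) (x * y)) \<and> nb (\<gamma> * C') x"

lemma C'_nonneg: "C' \<ge> 0" using C r by (simp add: C'_def)

lemma bl_funpow: "bounded_linear ((*) (x::'a) ^^ j)"
proof (induction j)
  case (Suc j)
  have "bounded_linear (\<lambda>y. x * ((*) x ^^ j) y)"
    by (rule bounded_linear_compose[OF bounded_linear_mult_right Suc])
  then show ?case by (simp only: funpow.simps o_def)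
qed (simp add: bounded_linear_ident id_def)

lemma bl_L: "bounded_linear (L j k)"
  unfolding L_def by (rule bounded_linear_compose[OF bl_funpow bl_funpow])

lemma nb_nonneg: "nb M y \<Longrightarrow> M \<ge> 0"
  unfolding nb_def
  by (drule spec[of _ 0], drule spec[of _ 0]) (use order_trans[OF norm_ge_zero, of "L 0 0 y" M] in simp)

lemma nb_norm: "nb M y \<Longrightarrow> norm y \<le> M"
  unfolding nb_def by (drule spec[of _ 0], drule spec[of _ 0]) (simp add: L_def)

lemma nb_mono: "nb M y \<Longrightarrow> M \<le> M' \<Longrightarrow> nb M' y"
  unfolding nb_def
proof (intro allI)
  fix j k assume M: "\<forall>j k. norm (L j k y) \<le> M * r ^ (j + k)" "M \<le> M'"
  have "norm (L j k y) \<le> M * r ^ (j + k)" using M by blast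
  also have "\<dots> \<le> M' * r ^ (j + k)" using M r by (intro mult_right_mono) auto
  finally show "norm (L j k y) \<le> M' * r ^ (j + k)" .
qed

lemma nb_add: "nb M y \<Longrightarrow> nb M' y' \<Longrightarrow> nb (M + M') (y + y')"
  unfolding nb_def linear_add[OF bounded_linear.linear[OF bl_L]] distrib_right
  by (intro allI order_trans[OF norm_triangle_ineq] add_mono) auto

lemma nb_minus: "nb M y \<Longrightarrow> nb M (- y)"
  unfolding nb_def linear_neg[OF bounded_linear.linear[OF bl_L]] by simp

lemma nb_scaleR: "nb M y \<Longrightarrow> nb (\<bar>c\<bar> * M) (c *\<^sub>R y)"
  unfolding nb_def linear_scale[OF bounded_linear.linear[OF bl_L]]
  by (simp add: mult.assoc mult_left_mono)

lemma nb_integral: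
  assumes f: "continuous_on {0..t} f" and t: "t \<ge> 0" and nb: "\<And>s. s \<in> {0..t} \<Longrightarrow> nb M (f s)"
  shows "nb (t * M) (integral {0..t} f)"
  unfolding nb_def
proof (intro allI)
  fix j k
  have "L j k (integral {0..t} f) = integral {0..t} (L j k \<circ> f)"
    by (rule integral_linear[symmetric, OF integrable_continuous_real[OF f] bl_L])
  also have "norm \<dots> \<le> (M * r ^ (j + k)) * (t - 0)"
  proof (rule integral_bound)
    show "continuous_on {0..t} (L j k \<circ> f)"
      unfolding o_def by (rule bounded_linear.continuous_on[OF bl_L f])
  qed (use nb t in \<open>auto simp: nb_def\<close>)
  finally show "norm (L j k (integral {0..t} f)) \<le> t * M * r ^ (j + k)" by (simp add: ac_simps)
qed

lemma funpow_mult_commute: "((*) (x::'a) ^^ j) (z * y) = z * ((*) x ^^ j) y"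
  by (induction j) (simp_all add: mult.left_commute)

lemma L_a: "L j k (a * y) = L (Suc j) k y" and L_b: "L j k (b * y) = L j (Suc k) y"
  by (simp_all add: L_def funpow_mult_commute)

lemma Op_a: "Op a r" and Op_b: "Op b r"
proof -
  have *: "C * r ^ (j + k) * norm x \<le> r * C' * r ^ (j + k)" if "norm x \<le> norm a + norm b" for j k and x :: 'a
    using mult_left_mono[OF that, of "C * r ^ (j + k)"] C r by (simp add: C'_def mult_ac)
  show "Op a r" unfolding Op_def nb_def L_a
  proof (intro conjI allI impI)
    fix M y j k assume "\<forall>j k. norm (L j k y) \<le> M * r ^ (j + k)"
    then have "norm (L (Suc j) k y) \<le> M * r ^ (Suc j + k)" by blast
    then show "norm (L (Suc j) k y) \<le> r * M * r ^ (j + k)" by (simp add: mult_ac)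
  next
    fix j k
    show "norm (L j k a) \<le> r * C' * r ^ (j + k)"
      using ab[folded L_def, of j k a] *[of a j k] by simp
  qed
  show "Op b r" unfolding Op_def nb_def L_b
  proof (intro conjI allI impI)
    fix M y j k assume "\<forall>j k. norm (L j k y) \<le> M * r ^ (j + k)"
    then have "norm (L j (Suc k) y) \<le> M * r ^ (j + Suc k)" by blast
    then show "norm (L j (Suc k) y) \<le> r * M * r ^ (j + k)" by (simp add: mult_ac)
  next
    fix j k
    show "norm (L j k b) \<le> r * C' * r ^ (j + k)"
      using ab[folded L_def, of j k b] *[of b j k] by simp
  qed
qed

lemma Op_0: "Op 0 0"
  by (simp add: Op_def nb_def linear_0[OF bounded_linear.linear[OF bl_L]])

lemma Op_mono: "Op x \<gamma> \<Longrightarrow> \<gamma> \<le> \<gamma>' \<Longrightarrow> Op x \<gamma>'"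
proof -
  assume x: "Op x \<gamma>" and le: "\<gamma> \<le> \<gamma>'"
  show "Op x \<gamma>'" unfolding Op_def
  proof (intro conjI allI impI)
    fix M y assume y: "nb M y"
    then have "nb (\<gamma> * M) (x * y)" using x unfolding Op_def by blast
    then show "nb (\<gamma>' * M) (x * y)" by (rule nb_mono) (rule mult_right_mono[OF le nb_nonneg[OF y]])
  next
    have "nb (\<gamma> * C') x" using x unfolding Op_def by blast
    then show "nb (\<gamma>' * C') x" by (rule nb_mono) (rule mult_right_mono[OF le C'_nonneg])
  qed
qed

lemma Op_add: "Op x \<gamma> \<Longrightarrow> Op x' \<gamma>' \<Longrightarrow> Op (x + x') (\<gamma> + \<gamma>')"
  unfolding Op_def distrib_right using nb_add by blast

lemma Op_minus: "Op x \<gamma> \<Longrightarrow> Op (- x) \<gamma>"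
  unfolding Op_def mult_minus_left by (auto intro: nb_minus)

lemma Op_diff: "Op x \<gamma> \<Longrightarrow> Op x' \<gamma>' \<Longrightarrow> Op (x - x') (\<gamma> + \<gamma>')"
  using Op_add[OF _ Op_minus, of x \<gamma> x' \<gamma>'] by simp

lemma Op_scaleR: "Op x \<gamma> \<Longrightarrow> Op (c *\<^sub>R x) (\<bar>c\<bar> * \<gamma>)"
  unfolding Op_def mult_scaleR_left mult.assoc by (auto intro: nb_scaleR)

lemma Op_mult: "Op x \<gamma> \<Longrightarrow> Op x' \<gamma>' \<Longrightarrow> Op (x * x') (\<gamma> * \<gamma>')"
  unfolding Op_def mult.assoc by simp

lemma Op_norm: "Op x \<gamma> \<Longrightarrow> norm x \<le> \<gamma> * C'"
  unfolding Op_def by (intro nb_norm) (rule conjunct2)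

lemma Op_integral:
  assumes f: "continuous_on {0..t} f" and t: "t \<ge> 0" and op: "\<And>s. s \<in> {0..t} \<Longrightarrow> Op (f s) \<gamma>"
  shows "Op (integral {0..t} f) (t * \<gamma>)"
  unfolding Op_def
proof (intro conjI allI impI)
  fix M y assume y: "nb M y"
  have "integral {0..t} f * y = integral {0..t} ((\<lambda>x. x * y) \<circ> f)"
    by (rule integral_linear[symmetric, OF integrable_continuous_real[OF f] bounded_linear_mult_left])
  moreover have "nb (t * (\<gamma> * M)) (integral {0..t} ((\<lambda>x. x * y) \<circ> f))"
    unfolding o_def using op y by (intro nb_integral continuous_intros f t) (auto simp: Op_def)
  ultimately show "nb (t * \<gamma> * M) (integral {0..t} f * y)" by (simp add: mult.assoc)
next
  have "nb (t * (\<gamma> * C')) (integral {0..t} f)"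
    using op by (intro nb_integral f t) (auto simp: Op_def)
  then show "nb (t * \<gamma> * C') (integral {0..t} f)" by (simp add: mult.assoc)
qed

lemma Op_pw: "Op x \<gamma> \<Longrightarrow> Op (pw x m) (\<gamma> ^ Suc m)"
  by (induction m) (auto intro: Op_mult)

lemma Op_pw_diff:
  assumes "Op x R" "Op y R" "Op (x - y) d"
  shows "Op (pw x m - pw y m) (real (Suc m) * R ^ m * d)"
proof (induction m)
  case (Suc m)
  have "Op (x * (pw x m - pw y m) + (x - y) * pw y m) (R * (real (Suc m) * R ^ m * d) + d * R ^ Suc m)"
    by (intro Op_add Op_mult Suc Op_pw assms)
  moreover have "x * (pw x m - pw y m) + (x - y) * pw y m = pw x (Suc m) - pw y (Suc m)"
    by (simp add: algebra_simps)
  moreover have "R * (real (Suc m) * R ^ m * d) + d * R ^ Suc m = real (Suc (Suc m)) * R ^ Suc m * d"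
    by (simp add: algebra_simps)
  ultimately show ?case by simp
qed (use assms in simp)

text \<open>The iteration is estimated with \<open>Op\<close>, where the data have size r: the free
  motion stays below \<open>2 * r\<close>, the iterates below \<open>4 * r\<close>, and the
  condition on \<tau> halves each increment. \<open>Op_norm\<close> then yields convergence in the
  norm of the algebra, with a constant that does not affect \<tau>.\<close>

lemma local_solution:
  assumes \<tau>: "0 < \<tau>" "\<tau> \<le> 1" "\<tau>\<^sup>2 * (2 * real (Suc m) * (4 * r) ^ m) \<le> 1"
  shows "\<exists>v z. v 0 = a \<and> z 0 = b \<and> (\<forall>t\<in>{0..\<tau>}. (v has_vector_derivative z t) (at t within {0..\<tau>}) \<and>
     (z has_vector_derivative - pw (v t) m) (at t within {0..\<tau>}))"
proof -
  interpret I: duhamel "\<lambda>\<tau> x. x :: 'a" 1 by (rule duhamel_id)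
  define g where "g t = a + t *\<^sub>R b" for t
  define y where "y n = ((\<lambda>y t. g t - I.D2 (\<lambda>s. pw (y s) m - 0) t) ^^ n) (\<lambda>t. 0)" for n
  have y0: "y 0 = (\<lambda>t. 0)" by (simp add: y_def)
  have yS: "y (Suc n) t = g t - I.D2 (\<lambda>s. pw (y n s) m - 0) t" for n t by (simp add: y_def)
  have c: "continuous_on {0..\<tau>} (y n)" for n
  proof (induction n)
    case (Suc n)
    show ?case unfolding yS[abs_def] g_def
      by (intro continuous_intros I.continuous_on_D2 Suc)
  qed (simp add: y0)
  have opD2: "Op (I.D2 N t) (\<tau>\<^sup>2 * \<gamma>)"
    if N: "continuous_on {0..\<tau>} N" and t: "t \<in> {0..\<tau>}" and op: "\<And>s. s \<in> {0..\<tau>} \<Longrightarrow> Op (N s) \<gamma>" and \<gamma>: "\<gamma> \<ge> 0" for N t \<gamma>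
  proof -
    have "Op (I.D1 N r) (\<tau> * \<gamma>)" if r: "r \<in> {0..\<tau>}" for r
    proof -
      have "Op (I.D1 N r) (r * \<gamma>)"
        unfolding I.D1_def using op r by (intro Op_integral continuous_on_subset[OF N]) auto
      then show ?thesis by (rule Op_mono) (use r \<gamma> in \<open>auto intro: mult_right_mono\<close>)
    qed
    then have "Op (I.D2 N t) (t * (\<tau> * \<gamma>))"
      unfolding I.D2_def using t by (intro Op_integral continuous_on_subset[OF I.continuous_on_D1[OF N]]) auto
    then show ?thesis
      by (rule Op_mono) (use t \<gamma> in \<open>auto simp: power2_eq_square mult.assoc intro!: mult_right_mono\<close>)
  qed
  have key: "\<tau>\<^sup>2 * (4 * r) ^ Suc m \<le> 2 * r" 
  proof -
    have "\<tau>\<^sup>2 * (2 * 1 * (4 * r) ^ m) \<le> \<tau>\<^sup>2 * (2 * real (Suc m) * (4 * r) ^ m)"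
      using r by (intro mult_left_mono mult_right_mono) auto
    then have "\<tau>\<^sup>2 * (2 * (4 * r) ^ m) \<le> 1" using \<tau>(3) by simp
    from mult_right_mono[OF this, of "2 * r"] show ?thesis using r by (simp add: mult_ac)
  qed
  have opg: "Op (g t) (2 * r)" if "t \<in> {0..\<tau>}" for t
  proof -
    have "Op (g t) (r + \<bar>t\<bar> * r)" unfolding g_def by (intro Op_add Op_a Op_scaleR Op_b)
    then show ?thesis
      by (rule Op_mono) (use that \<tau> r in \<open>auto simp: mult_left_le_one_le\<close>)
  qed
  have b1: "Op (y n t) (4 * r)" if "t \<in> {0..\<tau>}" for n t
    using that
  proof (induction n arbitrary: t)
    case 0
    show ?case using Op_mono[OF Op_0, of "4 * r"] r by (simp add: y0)
  next
    case (Suc n)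
    have "Op (y (Suc n) t) (2 * r + \<tau>\<^sup>2 * (4 * r) ^ Suc m)"
      unfolding yS
    proof (intro Op_diff opg opD2)
      show "Op (pw (y n s) m - 0) ((4 * r) ^ Suc m)" if "s \<in> {0..\<tau>}" for s
        unfolding diff_0_right by (rule Op_pw[OF Suc.IH[OF that]])
      show "continuous_on {0..\<tau>} (\<lambda>s. pw (y n s) m - 0)" by (intro continuous_intros c)
      show "0 \<le> (4 * r) ^ Suc m" using r by (intro zero_le_power) auto
    qed (use Suc.prems in auto)
    then show ?case by (rule Op_mono) (use key in simp)
  qed
  have b2: "Op (y (Suc n) t - y n t) (4 * r / 2 ^ n)" if "t \<in> {0..\<tau>}" for n t
    using that
  proof (induction n arbitrary: t)
    case 0
    then show ?case using b1[OF 0, of 1] by (simp add: y0)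
  next
    case (Suc n)
    have cN: "continuous_on {0..\<tau>} (\<lambda>s. pw (y k s) m - 0)" for k by (intro continuous_intros c)
    have "y (Suc (Suc n)) t - y (Suc n) t = - I.D2 (\<lambda>s. (pw (y (Suc n) s) m - 0) - (pw (y n s) m - 0)) t"
      unfolding yS[of "Suc n" t] yS[of n t] using I.D2_diff[OF cN[of "Suc n"] cN[of n], of t] Suc.prems by simp
    moreover have "Op (I.D2 (\<lambda>s. (pw (y (Suc n) s) m - 0) - (pw (y n s) m - 0)) t) (\<tau>\<^sup>2 * (real (Suc m) * (4 * r) ^ m * (4 * r / 2 ^ n)))"
    proof (rule opD2)
      show "Op ((pw (y (Suc n) s) m - 0) - (pw (y n s) m - 0)) (real (Suc m) * (4 * r) ^ m * (4 * r / 2 ^ n))"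
        if "s \<in> {0..\<tau>}" for s
        unfolding diff_0_right by (intro Op_pw_diff b1 Suc.IH that)
      show "continuous_on {0..\<tau>} (\<lambda>s. (pw (y (Suc n) s) m - 0) - (pw (y n s) m - 0))"
        by (intro continuous_on_diff cN)
    qed (use r Suc.prems in auto)
    ultimately have "Op (y (Suc (Suc n)) t - y (Suc n) t) (\<tau>\<^sup>2 * (real (Suc m) * (4 * r) ^ m * (4 * r / 2 ^ n)))"
      using Op_minus by simp
    then show ?case
    proof (rule Op_mono)
      have "\<tau>\<^sup>2 * (real (Suc m) * (4 * r) ^ m * (4 * r / 2 ^ n)) = (\<tau>\<^sup>2 * (2 * real (Suc m) * (4 * r) ^ m)) * (4 * r / 2 ^ Suc n)"
        by simp
      also have "\<dots> \<le> 1 * (4 * r / 2 ^ Suc n)" by (intro mult_right_mono \<tau>) (use r in auto)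
      finally show "\<tau>\<^sup>2 * (real (Suc m) * (4 * r) ^ m * (4 * r / 2 ^ n)) \<le> 4 * r / 2 ^ Suc n" by simp
    qed
  qed
  have nd: "norm (y (Suc n) t - y n t) \<le> 4 * r * C' / 2 ^ n" if "t \<in> {0..\<tau>}" for n t
    using Op_norm[OF b2[OF that, of n]] by simp
  obtain v where v: "continuous_on {0..\<tau>} v" "\<And>t. t \<in> {0..\<tau>} \<Longrightarrow> v t = g t - I.D2 (\<lambda>s. pw (v s) m - 0) t"
    using picard_limit[OF duhamel_id c yS nd] by blast
  define z where "z t = b - I.D1 (\<lambda>s. pw (v s) m - 0) t" for t
  have cN: "continuous_on {0..\<tau>} (\<lambda>s. pw (v s) m - 0)" by (intro continuous_intros v)
  have z': "(z has_vector_derivative - pw (v t) m) (at t within {0..\<tau>})" if "t \<in> {0..\<tau>}" for t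
    using integral_has_vector_derivative[OF cN that] unfolding z_def I.D1_def
    by (auto intro!: derivative_eq_intros)
  have g': "((\<lambda>t. g t - I.D2 (\<lambda>s. pw (v s) m - 0) t) has_vector_derivative z t) (at t within {0..\<tau>})" if "t \<in> {0..\<tau>}" for t
    using integral_has_vector_derivative[OF I.continuous_on_D1[OF cN] that] unfolding z_def I.D2_def g_def
    by (auto intro!: derivative_eq_intros)
  have v': "(v has_vector_derivative z t) (at t within {0..\<tau>})" if "t \<in> {0..\<tau>}" for t
    by (rule has_vector_derivative_transform[OF that v(2) g'[OF that]])
  have "v 0 = a" using v(2)[of 0] \<tau> by (simp add: g_def I.D2_def)
  moreover have "z 0 = b" by (simp add: z_def I.D1_def)
  ultimately show ?thesis using v' z' by blast
qed

end

section \<open>Small dispersion as a perturbation\<close>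

text \<open>The iteration starts from v0. As \<delta> tends to 0,
  \<open>H (\<delta> * \<tau>)\<close> approaches the identity strongly, and uniformly on the
  compact set of values of the power along v0, so the first step is small. The exponentially
  weighted estimate keeps all later steps geometrically smaller on the whole interval, however
  long.\<close>

lemma perturbed_solution:
  fixes H :: "real \<Rightarrow> 'a::{real_normed_algebra,banach} \<Rightarrow> 'a"
  assumes "duhamel H B" and H0: "\<And>x. H 0 x = x" and T: "T > 0"
    and v0: "continuous_on {0..T} v0"
    and eq0: "\<And>t. t \<in> {0..T} \<Longrightarrow> v0 t = \<phi> - duhamel.D2 (\<lambda>\<tau> x. x) (\<lambda>s. pw (v0 s) m) t"
    and \<eta>: "\<eta> > 0"
  shows "\<exists>\<delta>0>0. \<forall>\<delta>. 0 < \<delta> \<and> \<delta> \<le> \<delta>0 \<longrightarrow> (\<exists>v. continuous_on {0..T} v \<and> (\<forall>t\<in>{0..T}. norm (v t - v0 t) \<le> \<eta>) \<and>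
     (\<forall>t\<in>{0..T}. v t = \<phi> - duhamel.D2 (\<lambda>\<tau>. H (\<delta> * \<tau>)) (\<lambda>s. pw (v s) m - \<delta>\<^sup>2 *\<^sub>R f) t))"
proof -
  interpret H: duhamel H B by fact
  interpret I: duhamel "\<lambda>\<tau> x. x :: 'a" 1 by (rule duhamel_id)
  obtain R0 where "\<forall>x\<in>v0 ` {0..T}. norm x \<le> R0"
    using compact_imp_bounded[OF compact_continuous_image[OF v0 compact_Icc]] unfolding bounded_iff by blast
  then have R0: "\<And>t. t \<in> {0..T} \<Longrightarrow> norm (v0 t) \<le> R0" by auto
  have R00: "R0 \<ge> 0" using R0[of 0] T order_trans[OF norm_ge_zero] by fastforce
  define R where "R = R0 + 1"
  define K where "K = real (Suc m) * R ^ m"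
  have K0: "K > 0" unfolding K_def R_def using R00 by simp
  \<comment> \<open>Large enough for \<open>B * K / \<Lambda>\<^sup>2 \<le> 1 / 2\<close>, the
    contraction factor in the exponentially weighted norm.\<close>
  define \<Lambda> where "\<Lambda> = 1 + 2 * B * K"
  have \<Lambda>: "\<Lambda> > 0" "\<Lambda> \<ge> 1" using H.B0 K0 by (auto simp: \<Lambda>_def add_pos_nonneg)
  have \<Lambda>2: "B * K / \<Lambda>\<^sup>2 \<le> 1 / 2"
  proof -
    have "2 * (B * K) \<le> \<Lambda> * 1" by (simp add: \<Lambda>_def)
    also have "\<dots> \<le> \<Lambda> * \<Lambda>" using \<Lambda> by (intro mult_left_mono) auto
    finally show ?thesis using \<Lambda> by (simp add: power2_eq_square field_simps)
  qed
  \<comment> \<open>Twice \<open>E * exp (\<Lambda> * T)\<close> bounds the total deviation from v0: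
    at most \<eta>, as claimed, and at most 1, so that the iterates remain where K is a Lipschitz
    constant.\<close>
  define E where "E = min \<eta> 1 / (2 * exp (\<Lambda> * T))"
  have E: "E > 0" "2 * (E * exp (\<Lambda> * T)) = min \<eta> 1" using \<eta> by (auto simp: E_def)
  \<comment> \<open>Two errors of size e, one from the kernel and one from the source f, integrated
    twice over an interval of length T, add up to E.\<close>
  define e where "e = E / (2 * T\<^sup>2)"
  have e: "e > 0" using E T by (simp add: e_def)
  let ?N0 = "\<lambda>s. pw (v0 s) m"
  have cN0: "continuous_on {0..T} ?N0" by (intro continuous_intros v0)
  have "compact ({0..1::real} \<times> {0..T})" by (intro compact_Times compact_Icc)
  moreover have "continuous_on ({0..1::real} \<times> {0..T}) (\<lambda>p. H (fst p) (?N0 (snd p)))"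
    by (intro H.cont_H continuous_intros continuous_on_compose2[OF v0]) auto
  ultimately have "uniformly_continuous_on ({0..1::real} \<times> {0..T}) (\<lambda>p. H (fst p) (?N0 (snd p)))"
    by (rule compact_uniformly_continuous[rotated])
  then obtain d where d: "d > 0" "\<And>p q. p \<in> {0..1::real} \<times> {0..T} \<Longrightarrow> q \<in> {0..1::real} \<times> {0..T} \<Longrightarrow> dist q p < d \<Longrightarrow>
      dist (H (fst q) (?N0 (snd q))) (H (fst p) (?N0 (snd p))) < e"
    using e unfolding uniformly_continuous_on_def by meson
  have Hd: "norm (H \<theta> (?N0 s) - ?N0 s) \<le> e" if "0 \<le> \<theta>" "\<theta> < d" "\<theta> \<le> 1" "s \<in> {0..T}" for \<theta> s
    using d(2)[of "(0, s)" "(\<theta>, s)"] that by (simp add: dist_norm H0 dist_Pair_Pair)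
  define \<delta>0 where "\<delta>0 = Min {d / (2 * T), 1 / T, 1, e / (B * norm f + 1)}"
  have Bf: "B * norm f + 1 > 0" using H.B0 by (intro add_nonneg_pos) auto
  have \<delta>0: "\<delta>0 > 0" using d T e Bf by (simp add: \<delta>0_def)
  show ?thesis
  proof (intro exI[of _ \<delta>0] conjI \<delta>0 allI impI, elim conjE)
    fix \<delta> :: real assume \<delta>: "0 < \<delta>" "\<delta> \<le> \<delta>0"
    have d1: "\<delta> * T \<le> d / 2" "\<delta> * T \<le> 1" "\<delta> \<le> 1" "\<delta> * (B * norm f) \<le> e"
    proof -
      have "\<delta> \<le> d / (2 * T)" "\<delta> \<le> 1 / T" "\<delta> \<le> 1" "\<delta> \<le> e / (B * norm f + 1)" using \<delta> by (auto simp: \<delta>0_def)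
      then show "\<delta> * T \<le> d / 2" "\<delta> * T \<le> 1" "\<delta> \<le> 1" using T by (auto simp: field_simps)
      have "\<delta> * (B * norm f) \<le> \<delta> * (B * norm f + 1)" using \<delta> by simp
      also have "\<dots> \<le> e" using \<open>\<delta> \<le> e / (B * norm f + 1)\<close> Bf by (simp add: pos_le_divide_eq)
      finally show "\<delta> * (B * norm f) \<le> e" .
    qed
    have dH: "duhamel (\<lambda>\<tau>. H (\<delta> * \<tau>)) B"
      by (intro duhamel.intro H.lin H.bd H.B0 H.cont_H continuous_intros)
    interpret D: duhamel "\<lambda>\<tau>. H (\<delta> * \<tau>)" B by (rule dH)
    define y where "y n = ((\<lambda>y t. \<phi> - D.D2 (\<lambda>s. pw (y s) m - \<delta>\<^sup>2 *\<^sub>R f) t) ^^ n) v0" for n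
    have y0: "y 0 = v0" by (simp add: y_def)
    have yS: "y (Suc n) t = \<phi> - D.D2 (\<lambda>s. pw (y n s) m - \<delta>\<^sup>2 *\<^sub>R f) t" for n t by (simp add: y_def)
    have c: "continuous_on {0..T} (y n)" for n
    proof (induction n)
      case (Suc n)
      show ?case unfolding yS[abs_def] by (intro continuous_intros D.continuous_on_D2 Suc)
    qed (simp add: y0 v0)
    have first: "norm (y (Suc 0) t - y 0 t) \<le> E" if t: "t \<in> {0..T}" for t
    proof -
      let ?F = "\<lambda>s. ?N0 s - \<delta>\<^sup>2 *\<^sub>R f"
      have cF: "continuous_on {0..T} ?F" by (intro continuous_intros v0)
      have i1: "norm (I.D1 ?N0 r - D.D1 ?F r) \<le> 2 * e * T" if r: "r \<in> {0..T}" for r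
      proof -
        have "I.D1 ?N0 r - D.D1 ?F r = integral {0..r} (\<lambda>s. ?N0 s - H (\<delta> * (r - s)) (?F s))"
          unfolding I.D1_def D.D1_def
          by (intro Henstock_Kurzweil_Integration.integral_diff[symmetric] integrable_continuous_real D.cont_integrand[OF cF]
              continuous_on_subset[OF cN0]) (use r in auto)
        also have "norm \<dots> \<le> 2 * e * (r - 0)"
        proof (rule integral_bound)
          show "continuous_on {0..r} (\<lambda>s. ?N0 s - H (\<delta> * (r - s)) (?F s))"
            by (intro continuous_on_diff D.cont_integrand[OF cF] continuous_on_subset[OF cN0]) (use r in auto)
          fix s assume s: "s \<in> {0..r}"
          have rs: "0 \<le> \<delta> * (r - s)" "\<delta> * (r - s) \<le> \<delta> * T" using s r \<delta> by (auto intro!: mult_left_mono)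
          have n1: "norm (?N0 s - H (\<delta> * (r - s)) (?N0 s)) \<le> e"
            using Hd[of "\<delta> * (r - s)" s] rs d1 d(1) s r by (subst norm_minus_commute) auto
          have n2: "norm (H (\<delta> * (r - s)) (\<delta>\<^sup>2 *\<^sub>R f)) \<le> e"
          proof -
            have "norm (H (\<delta> * (r - s)) (\<delta>\<^sup>2 *\<^sub>R f)) \<le> B * norm (\<delta>\<^sup>2 *\<^sub>R f)" by (rule H.bd)
            also have "\<dots> = \<delta> * (\<delta> * (B * norm f))" by (simp add: power2_eq_square)
            also have "\<dots> \<le> 1 * (\<delta> * (B * norm f))" using d1 \<delta> H.B0 by (intro mult_right_mono) auto
            finally show ?thesis using d1 by simp
          qed
          have eq: "?N0 s - H (\<delta> * (r - s)) (?F s) = (?N0 s - H (\<delta> * (r - s)) (?N0 s)) + H (\<delta> * (r - s)) (\<delta>\<^sup>2 *\<^sub>R f)"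
            by (simp add: linear_diff[OF bounded_linear.linear[OF H.lin]])
          show "norm (?N0 s - H (\<delta> * (r - s)) (?F s)) \<le> 2 * e"
            unfolding eq
            using norm_triangle_ineq[of "?N0 s - H (\<delta> * (r - s)) (?N0 s)" "H (\<delta> * (r - s)) (\<delta>\<^sup>2 *\<^sub>R f)"] n1 n2 by linarith
        qed (use r in auto)
        also have "\<dots> \<le> 2 * e * T" using r e by (intro mult_left_mono) auto
        finally show ?thesis .
      qed
      have "y (Suc 0) t - y 0 t = I.D2 ?N0 t - D.D2 ?F t"
        unfolding yS y0 using eq0[OF t] by simp
      also have "\<dots> = integral {0..t} (\<lambda>r. I.D1 ?N0 r - D.D1 ?F r)"
        unfolding I.D2_def D.D2_def
        by (intro Henstock_Kurzweil_Integration.integral_diff[symmetric] integrable_continuous_real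
           continuous_on_subset[OF D.continuous_on_D1[OF cF]] continuous_on_subset[OF I.continuous_on_D1[OF cN0]]) (use t in auto)
      also have "norm \<dots> \<le> 2 * e * T * (t - 0)"
        by (rule integral_bound) (use t i1 in \<open>auto intro!: continuous_on_diff
           continuous_on_subset[OF D.continuous_on_D1[OF cF]] continuous_on_subset[OF I.continuous_on_D1[OF cN0]]\<close>)
      also have "\<dots> \<le> 2 * e * T * T" using t e T by (intro mult_left_mono) auto
      also have "\<dots> = E" using T by (simp add: e_def power2_eq_square)
      finally show ?thesis .
    qed
    \<comment> \<open>The two bounds are carried together: halving the increment requires the
      iterates to lie in the ball of radius R, and this follows by summing the previous
      increments.\<close>
    have main: "(\<forall>t\<in>{0..T}. norm (y (Suc n) t - y n t) \<le> E * exp (\<Lambda> * t) / 2 ^ n) \<and>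
       (\<forall>t\<in>{0..T}. norm (y n t - v0 t) \<le> 2 * E * exp (\<Lambda> * t) * (1 - 1 / 2 ^ n))" for n
    proof (induction n)
      case 0
      have "E \<le> E * exp (\<Lambda> * t)" if "t \<in> {0..T}" for t using that E \<Lambda> by simp
      then have "norm (y (Suc 0) t - y 0 t) \<le> E * exp (\<Lambda> * t)" if "t \<in> {0..T}" for t
        using first[OF that] that by (meson order_trans)
      then show ?case by (simp add: y0)
    next
      case (Suc n)
      have b: "norm (y (Suc n) t - v0 t) \<le> 2 * E * exp (\<Lambda> * t) * (1 - 1 / 2 ^ Suc n)" if t: "t \<in> {0..T}" for t
      proof -
        have "norm (y (Suc n) t - v0 t) \<le> norm (y (Suc n) t - y n t) + norm (y n t - v0 t)"
          using norm_triangle_ineq[of "y (Suc n) t - y n t" "y n t - v0 t"] by simp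
        also have "\<dots> \<le> E * exp (\<Lambda> * t) / 2 ^ n + 2 * E * exp (\<Lambda> * t) * (1 - 1 / 2 ^ n)"
          using Suc t by (intro add_mono) auto
        also have "\<dots> = 2 * E * exp (\<Lambda> * t) * (1 - 1 / 2 ^ Suc n)" by (simp add: field_simps)
        finally show ?thesis .
      qed
      have small: "norm (y k t) \<le> R" if t: "t \<in> {0..T}" and k: "norm (y k t - v0 t) \<le> 2 * E * exp (\<Lambda> * t) * (1 - 1 / 2 ^ k)" for k t
      proof -
        have "2 * E * exp (\<Lambda> * t) * (1 - 1 / 2 ^ k) \<le> 2 * E * exp (\<Lambda> * t) * 1" using E by (intro mult_left_mono) auto
        also have "\<dots> \<le> 2 * E * exp (\<Lambda> * T)" using E t \<Lambda> by auto
        also have "\<dots> \<le> 1" using E by simp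
        finally have "norm (y k t - v0 t) \<le> 1" using k by linarith
        then show ?thesis using R0[OF t] norm_triangle_ineq2[of "y k t" "v0 t"] by (simp add: R_def)
      qed
      let ?G = "\<lambda>k s. pw (y k s) m - \<delta>\<^sup>2 *\<^sub>R f"
      have cG: "continuous_on {0..T} (?G k)" for k by (intro continuous_intros c)
      have a: "norm (y (Suc (Suc n)) t - y (Suc n) t) \<le> E * exp (\<Lambda> * t) / 2 ^ Suc n" if t: "t \<in> {0..T}" for t
      proof -
        have "y (Suc (Suc n)) t - y (Suc n) t = - D.D2 (\<lambda>s. ?G (Suc n) s - ?G n s) t"
          unfolding yS[of "Suc n" t] yS[of n t] using D.D2_diff[OF cG[of "Suc n"] cG[of n], of t] t by simp
        then have "norm (y (Suc (Suc n)) t - y (Suc n) t) = norm (D.D2 (\<lambda>s. ?G (Suc n) s - ?G n s) t)"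
          by simp
        also have "\<dots> \<le> B * (K * (E / 2 ^ n)) / \<Lambda>\<^sup>2 * exp (\<Lambda> * t)"
        proof (rule D.norm_D2_le_exp[OF continuous_on_diff[OF cG[of "Suc n"] cG[of n]] \<Lambda>(1) _ t])
          fix s assume s: "s \<in> {0..T}"
          have "norm (pw (y (Suc n) s) m - pw (y n s) m) \<le> K * norm (y (Suc n) s - y n s)"
            unfolding K_def using Suc s b[OF s] by (intro pw_diff_le small) auto
          also have "\<dots> \<le> K * (E * exp (\<Lambda> * s) / 2 ^ n)" using Suc s K0 by (intro mult_left_mono) auto
          finally show "norm (?G (Suc n) s - ?G n s) \<le> K * (E / 2 ^ n) * exp (\<Lambda> * s)" by simp
        qed
        also have "\<dots> = (B * K / \<Lambda>\<^sup>2) * (E * exp (\<Lambda> * t) / 2 ^ n)" by (simp add: mult_ac)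
        also have "\<dots> \<le> (1/2) * (E * exp (\<Lambda> * t) / 2 ^ n)" using \<Lambda>2 E by (intro mult_right_mono) auto
        finally show ?thesis by simp
      qed
      show ?case using a b by blast
    qed
    have "norm (y (Suc n) t - y n t) \<le> (E * exp (\<Lambda> * T)) / 2 ^ n" if t: "t \<in> {0..T}" for n t
    proof -
      have "norm (y (Suc n) t - y n t) \<le> E * exp (\<Lambda> * t) / 2 ^ n" using main t by blast
      also have "\<dots> \<le> E * exp (\<Lambda> * T) / 2 ^ n" using E t \<Lambda> by (intro divide_right_mono mult_left_mono) auto
      finally show ?thesis .
    qed
    from picard_limit[OF dH c yS this]
    obtain v where v: "continuous_on {0..T} v" "\<forall>t\<in>{0..T}. norm (v t - y 0 t) \<le> 2 * (E * exp (\<Lambda> * T))"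
       "\<forall>t\<in>{0..T}. v t = \<phi> - D.D2 (\<lambda>s. pw (v s) m - \<delta>\<^sup>2 *\<^sub>R f) t" by blast
    then show "\<exists>v. continuous_on {0..T} v \<and> (\<forall>t\<in>{0..T}. norm (v t - v0 t) \<le> \<eta>) \<and>
       (\<forall>t\<in>{0..T}. v t = \<phi> - D.D2 (\<lambda>s. pw (v s) m - \<delta>\<^sup>2 *\<^sub>R f) t)"
      using E(2) by (intro exI[of _ v]) (auto simp: y0)
  qed
qed

section \<open>The Gaussian and its Laplacian as elements of the algebra\<close>

definition gs :: "real^'n \<Rightarrow> real" where "gs x = exp (- (norm x)\<^sup>2 / 2)"

definition gc :: "'n itself \<Rightarrow> real" where "gc _ = sqrt (2 * pi) ^ CARD('n)"

lemma gc_pos: "gc TYPE('n) > 0" by (simp add: gc_def)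

lemma gs_pos: "gs x > 0" and gs_le_1: "gs x \<le> 1" and gs_0: "gs 0 = 1" and gs_minus: "gs (- x) = gs x"
  by (simp_all add: gs_def)

lemma gs_alt: "gs x = exp (- (1/2) * (norm x)\<^sup>2)" by (simp add: gs_def)

lemma continuous_on_gs [continuous_intros]: "continuous_on S gs"
  unfolding gs_def by (intro continuous_intros) auto

lemma borel_measurable_gs [measurable]: "gs \<in> borel_measurable borel"
  by (intro borel_measurable_continuous_onI continuous_on_gs)

lemma integrable_gs: "integrable lborel gs"
  unfolding gs_alt[abs_def] by (rule integrable_gauss) simp

lemma integrable_power_gs: "integrable lborel (\<lambda>x. norm x ^ k * gs x)"
  unfolding gs_alt[abs_def] by (rule integrable_power_gauss) simp

lemma fnorm_gc: "fnorm TYPE('n) * gc TYPE('n) * gc TYPE('n) = 1"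
proof -
  have "gc TYPE('n) * gc TYPE('n) = (2 * pi) ^ CARD('n)"
    unfolding gc_def power_mult_distrib[symmetric] by simp
  then show ?thesis by (simp add: fnorm_def powr_minus powr_realpow mult.assoc power_mult_distrib field_simps)
qed

lemma FT_gs: "FT gs \<xi> = complex_of_real (gc TYPE('n) * gs (\<xi> :: real^'n))"
proof -
  have "cgauss (1/2) x = complex_of_real (gs x)" for x :: "real^'n"
    by (simp add: cgauss_def gs_def flip: exp_of_real)
  then have "FT gs \<xi> = (\<integral>x. cis (- (x \<bullet> \<xi>)) * cgauss (1/2) x \<partial>lborel)"
    by (simp add: fourier_cis)
  also have "\<dots> = cgauss_int TYPE(real^'n) (1/2) * exp (- complex_of_real ((norm \<xi>)\<^sup>2) / (4 * (1/2)))"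
    by (rule fourier_cgauss_aux) simp
  also have "cgauss_int TYPE(real^'n) (1/2) = complex_of_real (gc TYPE('n))"
    using cgauss_int_real[of "1/2", where 'a="real^'n"] by (simp add: gc_def mult.commute)
  also have "exp (- complex_of_real ((norm \<xi>)\<^sup>2) / (4 * (1/2))) = complex_of_real (gs \<xi>)"
    by (simp add: gs_def flip: exp_of_real)
  finally show ?thesis by simp
qed

text \<open>The arithmetic-geometric mean inequality for 1 / \<eta> and \<eta> |\<xi>|. With \<eta>
  arbitrarily small it expresses the subexponential growth of \<open>W\<close>
  quantitatively.\<close>

lemma W_le_exp: assumes "\<eta> > 0" shows "W \<xi> \<le> exp (1 / \<eta> + \<eta> * norm \<xi>)"
proof -
  have "sqrt (norm \<xi>) = sqrt ((1/\<eta>) * (\<eta> * norm \<xi>))" using assms by simp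
  also have "\<dots> \<le> ((1/\<eta>) + \<eta> * norm \<xi>) / 2"
    by (rule arith_geo_mean_sqrt) (use assms in auto)
  also have "\<dots> \<le> 1 / \<eta> + \<eta> * norm \<xi>"
  proof -
    have half: "a / 2 \<le> a" if "0 \<le> a" for a :: real using that by simp
    show ?thesis by (rule half) (use assms in simp)
  qed
  finally show ?thesis by (simp add: W_def)
qed

lemma W_gs_le: "W \<xi> * gs \<xi> \<le> exp 2 * exp (- (1/4) * (norm \<xi>)\<^sup>2)"
proof -
  have "norm \<xi> \<le> 1 + (norm \<xi>)\<^sup>2 / 4"
    using zero_le_power2[of "norm \<xi> / 2 - 1"] by (simp add: power2_diff power_divide)
  then have "W \<xi> \<le> exp (2 + (norm \<xi>)\<^sup>2 / 4)"
    using W_le_exp[of 1 \<xi>] by (smt (verit) exp_le_cancel_iff div_by_1 mult_1)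
  then have "W \<xi> * gs \<xi> \<le> exp (2 + (norm \<xi>)\<^sup>2 / 4) * gs \<xi>"
    by (intro mult_right_mono less_imp_le[OF gs_pos])
  also have "\<dots> = exp 2 * exp (- (1/4) * (norm \<xi>)\<^sup>2)"
    by (simp add: gs_def flip: exp_add)
  finally show ?thesis .
qed

lemma integrable_W_power_gs: "integrable lborel (\<lambda>\<xi>::real^'n. W \<xi> * (norm \<xi> ^ k * gs \<xi>))"
proof (rule Bochner_Integration.integrable_bound)
  show "integrable lborel (\<lambda>\<xi>::real^'n. exp 2 * (norm \<xi> ^ k * exp (- (1/4) * (norm \<xi>)\<^sup>2)))"
    by (intro integrable_mult_right integrable_power_gauss) simp
  show "AE \<xi>::real^'n in lborel. norm (W \<xi> * (norm \<xi> ^ k * gs \<xi>)) \<le> norm (exp 2 * (norm \<xi> ^ k * exp (- (1/4) * (norm \<xi>)\<^sup>2)))"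
  proof (intro AE_I2)
    fix \<xi> :: "real^'n"
    show "norm (W \<xi> * (norm \<xi> ^ k * gs \<xi>)) \<le> norm (exp 2 * (norm \<xi> ^ k * exp (- (1/4) * (norm \<xi>)\<^sup>2)))"
      using mult_left_mono[OF W_gs_le[of \<xi>], of "norm \<xi> ^ k"] less_imp_le[OF gs_pos[of \<xi>]]
      by (simp add: abs_mult mult_ac)
  qed
qed measurable

lemma inv_fourier_conv_fourier: "inv_fourier g (x::real^'n) = complex_of_real (fnorm TYPE('n)) * fourier g (- x)"
  unfolding inv_fourier_cis fourier_cis by (simp add: inner_commute)

text \<open>Inversion is read off from the forward transform: \<open>gs\<close> is an eigenfunction,
  and \<open>fnorm_gc\<close> normalises the square of the eigenvalue.\<close>

lemma wien_gs: "wien gs"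
proof -
  have FT: "FT gs = (\<lambda>\<xi>. complex_of_real (gc TYPE('a)) * complex_of_real (gs (\<xi> :: real^'a)))"
    by (rule ext) (simp add: FT_gs)
  have "integrable lborel (\<lambda>\<xi>::real^'a. W \<xi> * cmod (FT gs \<xi>))"
  proof -
    have "W \<xi> * cmod (FT gs \<xi>) = gc TYPE('a) * (W \<xi> * (norm \<xi> ^ 0 * gs \<xi>))" for \<xi> :: "real^'a"
      unfolding FT using gc_pos[where 'n='a] gs_pos[of \<xi>] by (simp add: norm_mult)
    then show ?thesis by (simp only:) (intro integrable_mult_right integrable_W_power_gs)
  qed
  moreover have "inv_fourier (FT gs) x = complex_of_real (gs x)" for x :: "real^'a"
  proof -
    have "inv_fourier (FT gs) x = complex_of_real (fnorm TYPE('a)) * (complex_of_real (gc TYPE('a)) * FT gs (- x))"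
      unfolding inv_fourier_conv_fourier FT[THEN arg_cong[of _ _ fourier]] fourier_cmult ..
    also have "\<dots> = complex_of_real (fnorm TYPE('a) * gc TYPE('a) * gc TYPE('a) * gs x)"
      by (simp add: FT_gs gs_minus)
    finally show ?thesis unfolding fnorm_gc by simp
  qed
  ultimately show ?thesis unfolding wien_def using integrable_gs by blast
qed

lemma fourier_partial:
  fixes F :: "real^'n \<Rightarrow> complex"
  assumes F: "integrable lborel F" "continuous_on UNIV F" and F': "integrable lborel F'" "continuous_on UNIV F'"
    and der: "\<And>x. ((\<lambda>s. F (x + s *\<^sub>R axis i 1)) has_vector_derivative F' x) (at 0)"
  shows "fourier F' \<xi> = \<i> * complex_of_real (\<xi> $ i) * fourier F \<xi>"
proof -
  let ?e = "\<lambda>x. cis (- (x \<bullet> \<xi>))"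
  let ?G = "\<lambda>x. ?e x * F' x - \<i> * complex_of_real (\<xi> $ i) * (?e x * F x)"
  have i: "integrable lborel (\<lambda>x. ?e x * F x)" "integrable lborel (\<lambda>x. ?e x * F' x)"
    by (rule integrable_phase[where C=1]; use F F' in simp)+
  have "(\<integral>x. ?G x \<partial>lborel) = 0"
  proof (rule integral_directional_derivative_eq_0[OF i(1), where v="axis i 1"])
    show "integrable lborel ?G" using i by (intro Bochner_Integration.integrable_diff integrable_mult_right)
    show "continuous_on UNIV ?G" by (intro continuous_intros F F')
    fix x
    have c: "((\<lambda>s. ?e (x + s *\<^sub>R axis i 1)) has_vector_derivative (\<i> * complex_of_real (- (\<xi> $ i)) * ?e (x + 0 *\<^sub>R axis i 1))) (at 0)"
      by (rule has_vector_derivative_cis) (auto intro!: derivative_eq_intros simp: inner_add_left inner_axis')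
    have "((\<lambda>s. ?e (x + s *\<^sub>R axis i 1) * F (x + s *\<^sub>R axis i 1)) has_vector_derivative
       (?e (x + 0 *\<^sub>R axis i 1) * F' x + (\<i> * complex_of_real (- (\<xi> $ i)) * ?e (x + 0 *\<^sub>R axis i 1)) * F (x + 0 *\<^sub>R axis i 1))) (at 0)"
      by (rule has_vector_derivative_mult[OF c der])
    then show "((\<lambda>s. ?e (x + s *\<^sub>R axis i 1) * F (x + s *\<^sub>R axis i 1)) has_vector_derivative ?G x) (at 0)"
      by (simp add: algebra_simps)
  qed
  then show ?thesis using i by (simp add: fourier_cis)
qed

lemma has_real_derivative_gs_line: "((\<lambda>s. gs (x + s *\<^sub>R axis i 1)) has_real_derivative (- (x $ i) * gs x)) (at 0)"
proof -
  have n: "(norm (x + s *\<^sub>R axis i 1))\<^sup>2 = (norm x)\<^sup>2 + 2 * s * x $ i + s\<^sup>2" for s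
    unfolding power2_norm_eq_inner
    by (simp add: inner_add_left inner_add_right inner_axis inner_axis' algebra_simps power2_eq_square)
  show ?thesis unfolding gs_def n by (auto intro!: derivative_eq_intros)
qed

lemma component_nth_axis: "(x + s *\<^sub>R axis i 1) $ i = x $ i + s"
  by simp

text \<open>The Laplacian of \<open>gs\<close> in closed form.\<close>

definition lg :: "real^'n \<Rightarrow> real" where "lg x = ((norm x)\<^sup>2 - real CARD('n)) * gs x"

lemma integrable_mult_gs:
  assumes [measurable]: "P \<in> borel_measurable borel" and "\<And>x. \<bar>P x\<bar> \<le> c * norm x ^ k"
  shows "integrable lborel (\<lambda>x. P x * gs x)"
proof (rule Bochner_Integration.integrable_bound[OF integrable_mult_right[OF integrable_power_gs[of k], of c]])
  show "AE x in lborel. norm (P x * gs x) \<le> norm (c * (norm x ^ k * gs x))"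
  proof (intro AE_I2)
    fix x
    show "norm (P x * gs x) \<le> norm (c * (norm x ^ k * gs x))"
      using mult_right_mono[OF order_trans[OF assms(2)[of x] abs_ge_self], of "gs x"] gs_pos[of x]
      by (simp add: abs_mult mult_ac)
  qed
qed measurable

lemma integrable_lg: "integrable lborel lg"
proof -
  have "integrable lborel (\<lambda>x::real^'a. norm x ^ 2 * gs x - real CARD('a) * gs x)"
    by (intro Bochner_Integration.integrable_diff integrable_power_gs integrable_mult_right integrable_gs)
  then show ?thesis unfolding lg_def[abs_def] by (simp add: left_diff_distrib)
qed

lemma FT_lg: "FT lg \<xi> = - complex_of_real ((norm \<xi>)\<^sup>2) * FT gs (\<xi> :: real^'n)"
proof -
  let ?g1 = "\<lambda>i x. complex_of_real (- (x $ i) * gs x)"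
  let ?g2 = "\<lambda>i x. complex_of_real (((x $ i)\<^sup>2 - 1) * gs x)"
  have i1: "integrable lborel (\<lambda>x::real^'n. - (x $ i) * gs x)" for i
    by (rule integrable_mult_gs[where c=1 and k=1]) (auto simp: component_le_norm_cart)
  have sq: "integrable lborel (\<lambda>x::real^'n. (x $ i)\<^sup>2 * gs x)" for i
  proof (rule integrable_mult_gs[where c=1 and k=2])
    show "\<bar>(x $ i)\<^sup>2\<bar> \<le> 1 * (norm x)\<^sup>2" for x :: "real^'n"
      using power_mono[OF component_le_norm_cart[of x i], of 2] by simp
  qed measurable
  have i2: "integrable lborel (\<lambda>x::real^'n. ((x $ i)\<^sup>2 - 1) * gs x)" for i
    using Bochner_Integration.integrable_diff[OF sq[of i] integrable_gs] by (simp add: left_diff_distrib)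
  have d1: "fourier (?g1 i) \<xi> = \<i> * complex_of_real (\<xi> $ i) * FT gs \<xi>" for i
  proof (rule fourier_partial)
    show "((\<lambda>s. complex_of_real (gs (x + s *\<^sub>R axis i 1))) has_vector_derivative ?g1 i x) (at 0)" for x :: "real^'n"
      by (rule has_vector_derivative_of_real[OF has_real_derivative_gs_line])
  qed (use integrable_gs i1 in \<open>auto intro!: continuous_intros integrable_of_real simp del: of_real_mult of_real_minus\<close>)
  have d2: "fourier (?g2 i) \<xi> = \<i> * complex_of_real (\<xi> $ i) * fourier (?g1 i) \<xi>" for i
  proof (rule fourier_partial)
    show "((\<lambda>s. ?g1 i (x + s *\<^sub>R axis i 1)) has_vector_derivative ?g2 i x) (at 0)" for x :: "real^'n"
    proof (rule has_vector_derivative_of_real)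
      have "((\<lambda>s. - (x $ i + s) * gs (x + s *\<^sub>R axis i 1)) has_real_derivative
          (- 1 * gs (x + 0 *\<^sub>R axis i 1) + - (x $ i) * gs x * (- (x $ i + 0)))) (at 0)"
      proof (rule DERIV_mult)
        show "((\<lambda>s. - (x $ i + s)) has_real_derivative - 1) (at 0)"
          by (auto intro!: derivative_eq_intros)
      qed (rule has_real_derivative_gs_line)
      then show "((\<lambda>s. - ((x + s *\<^sub>R axis i 1) $ i) * gs (x + s *\<^sub>R axis i 1)) has_real_derivative ((x $ i)\<^sup>2 - 1) * gs x) (at 0)"
        unfolding component_nth_axis by (simp add: algebra_simps power2_eq_square)
    qed
  qed (use i1 i2 in \<open>auto intro!: continuous_intros integrable_of_real simp del: of_real_mult of_real_minus of_real_diff\<close>)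
  have "lg x = (\<Sum>i\<in>UNIV. ((x $ i)\<^sup>2 - 1) * gs x)" for x :: "real^'n"
    by (simp add: lg_def norm_vec_def L2_set_def sum_nonneg sum_subtractf sum_distrib_right left_diff_distrib)
  then have "FT lg \<xi> = (\<integral>x. (\<Sum>i\<in>UNIV. cis (- (x \<bullet> \<xi>)) * ?g2 i x) \<partial>lborel)"
    unfolding fourier_cis by (simp add: sum_distrib_left)
  also have "\<dots> = (\<Sum>i\<in>UNIV. \<integral>x. cis (- (x \<bullet> \<xi>)) * ?g2 i x \<partial>lborel)"
    by (rule Bochner_Integration.integral_sum, rule integrable_phase[where C=1])
       (use i2 in \<open>auto intro!: integrable_of_real simp del: of_real_mult of_real_diff\<close>)
  also have "\<dots> = (\<Sum>i\<in>UNIV. - complex_of_real ((\<xi> $ i)\<^sup>2) * FT gs \<xi>)"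
  proof (rule sum.cong[OF refl])
    fix i
    have "(\<integral>x. cis (- (x \<bullet> \<xi>)) * ?g2 i x \<partial>lborel) = \<i> * complex_of_real (\<xi> $ i) * (\<i> * complex_of_real (\<xi> $ i) * FT gs \<xi>)"
      using d2[of i] unfolding d1 fourier_cis[of "?g2 i"] .
    also have "\<dots> = (\<i> * \<i>) * complex_of_real ((\<xi> $ i)\<^sup>2) * FT gs \<xi>"
      by (simp only: power2_eq_square of_real_mult mult_ac)
    finally show "(\<integral>x. cis (- (x \<bullet> \<xi>)) * ?g2 i x \<partial>lborel) = - complex_of_real ((\<xi> $ i)\<^sup>2) * FT gs \<xi>" by simp
  qed
  also have "\<dots> = - complex_of_real ((norm \<xi>)\<^sup>2) * FT gs \<xi>"
    by (simp add: norm_vec_def L2_set_def sum_nonneg sum_negf sum_distrib_right)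
  finally show ?thesis .
qed

text \<open>The transform of \<open>lg\<close> is again a combination of \<open>lg\<close> and
  \<open>gs\<close>, so transforming once more proves inversion.\<close>

lemma wien_lg: "wien lg"
proof -
  let ?c = "gc TYPE('a)"
  have FT: "FT lg \<xi> = complex_of_real (- ?c) * complex_of_real (lg \<xi>) + complex_of_real (- ?c * real CARD('a)) * complex_of_real (gs \<xi>)" for \<xi> :: "real^'a"
    unfolding FT_lg FT_gs by (simp add: lg_def algebra_simps)
  have "integrable lborel (\<lambda>\<xi>::real^'a. W \<xi> * cmod (FT lg \<xi>))"
  proof -
    have "W \<xi> * cmod (FT lg \<xi>) = ?c * (W \<xi> * (norm \<xi> ^ 2 * gs \<xi>))" for \<xi> :: "real^'a"
      unfolding FT_lg FT_gs using gc_pos[where 'n='a] gs_pos[of \<xi>] by (simp add: norm_mult norm_power)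
    then show ?thesis by (simp only:) (intro integrable_mult_right integrable_W_power_gs)
  qed
  moreover have "inv_fourier (FT lg) x = complex_of_real (lg x)" for x :: "real^'a"
  proof -
    have "fourier (FT lg) (- x) = complex_of_real (- ?c) * FT lg (- x) + complex_of_real (- ?c * real CARD('a)) * FT gs (- x)"
    proof -
      have "FT lg = (\<lambda>\<xi>::real^'a. complex_of_real (- ?c) * complex_of_real (lg \<xi>) + complex_of_real (- ?c * real CARD('a)) * complex_of_real (gs \<xi>))"
        by (rule ext) (rule FT)
      from arg_cong[OF this, of "\<lambda>h. fourier h (- x)"] show ?thesis
        by (simp only:) (subst fourier_add;  auto simp: fourier_cmult intro!: integrable_mult_right integrable_of_real integrable_lg integrable_gs simp del: of_real_mult of_real_minus)
    qed
    then have "inv_fourier (FT lg) x = complex_of_real (fnorm TYPE('a)) * (complex_of_real (- ?c) * FT lg (- x) + complex_of_real (- ?c * real CARD('a)) * FT gs (- x))"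
      unfolding inv_fourier_conv_fourier by (simp only:)
    also have "\<dots> = complex_of_real (fnorm TYPE('a) * ?c * ?c * lg x)"
      unfolding FT_lg FT_gs gs_minus norm_minus_cancel by (simp add: lg_def algebra_simps)
    finally show ?thesis unfolding fnorm_gc by simp
  qed
  ultimately show ?thesis unfolding wien_def using integrable_lg by blast
qed

definition phi :: "'n::finite walg" where "phi = Abs_walg gs"
definition lphi :: "'n::finite walg" where "lphi = Abs_walg lg"

lemma fn_phi: "fn phi = gs" and fn_lphi: "fn lphi = lg"
  unfolding phi_def lphi_def by (intro fn_Abs wien_gs wien_lg)+

lemma ft_lphi: "ft lphi \<xi> = - complex_of_real ((norm \<xi>)\<^sup>2) * ft phi \<xi>"
  unfolding fn_phi fn_lphi by (rule FT_lg)

section \<open>The spectral radius is the supremum norm\<close>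

text \<open>A mollifier: as a probability density it does not increase suprema, its dilates tend to
  the identity, and its Gaussian symbol supplies the exponential moments that a general element of
  the algebra lacks.\<close>

definition gk :: "real^'n \<Rightarrow> real" where "gk x = gs x / gc TYPE('n)"

lemma integrable_gk: "integrable lborel gk"
  unfolding gk_def[abs_def] by (intro integrable_divide integrable_gs)

lemma gk_nonneg: "gk x \<ge> 0"
  unfolding gk_def by (intro divide_nonneg_pos gc_pos less_imp_le[OF gs_pos])

lemma FT_gk: "FT gk \<xi> = complex_of_real (gs (\<xi>::real^'a))"
proof -
  have eq: "gk = (\<lambda>x::real^'a. (1 / gc TYPE('a)) * gs x)" by (auto simp: gk_def)
  have "FT gk \<xi> = FT (\<lambda>x. (1 / gc TYPE('a)) * gs x) \<xi>" using arg_cong[OF eq, of "\<lambda>h. FT h \<xi>"] .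
  then have "FT gk \<xi> = complex_of_real (1 / gc TYPE('a)) * FT gs \<xi>" unfolding FT_cmult .
  then show ?thesis using gc_pos[where 'n='a] by (simp add: FT_gs)
qed

lemma integral_gk: "(\<integral>x. gk (x::real^'a) \<partial>lborel) = 1"
proof -
  have "complex_of_real (\<integral>x. gk x \<partial>(lborel :: (real^'a) measure)) = FT gk (0 :: real^'a)"
    by (simp add: fourier_cis)
  then show ?thesis by (simp add: FT_gk gs_0)
qed

lemma abs_kop_gk_le:
  fixes f :: "'n::finite walg"
  assumes "\<And>x. \<bar>fn f x\<bar> \<le> M" shows "\<bar>fn (kop gk \<tau> f) x\<bar> \<le> M"
proof -
  have "\<bar>fn (kop gk \<tau> f) x\<bar> \<le> (\<integral>y. \<bar>gk y * fn f (x - \<tau> *\<^sub>R y)\<bar> \<partial>lborel)"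
    unfolding fn_kop[OF integrable_gk] by (rule integral_abs_bound)
  also have "\<dots> \<le> (\<integral>y. gk (y::real^'n) * M \<partial>lborel)"
    by (intro integral_mono integrable_abs integrable_kernel_mult integrable_gk integrable_mult_left)
       (auto simp: abs_mult gk_nonneg intro!: mult_left_mono assms)
  also have "\<dots> = M" by (simp add: integral_gk)
  finally show ?thesis .
qed

lemma fn_pw: "fn (pw f m) x = fn f x ^ Suc m"
  by (induction m) (simp_all only: pw_0 pw_Suc fn_mult power_Suc power_0 mult_1_right)

lemma ft_mult: "ft (f * g) = (\<lambda>\<xi>. complex_of_real (fnorm TYPE('n)) * conv (ft g) (ft f) (\<xi>::real^'n))"
proof
  fix \<xi> :: "real^'n"
  show "ft (f * g) \<xi> = complex_of_real (fnorm TYPE('n)) * conv (ft g) (ft f) \<xi>"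
    unfolding ext[of "fn (f * g)", OF fn_mult] by (rule FT_mult[OF wien_fn integrable_fn])
qed

text \<open>A crude geometric rate, \<open>fnorm TYPE('n) * S 0\<close>, unrelated to the supremum
  of b. It is used only at frequencies so high that the weight exp (2 |\<xi>|) compensates for
  it.\<close>

lemma ft_pw_exp_weight:
  fixes b :: "'n::finite walg"
  defines "S \<equiv> \<lambda>j. \<integral>\<xi>. exp (2 * norm \<xi>) * cmod (ft (pw b j) \<xi>) \<partial>lborel"
  assumes b: "integrable lborel (\<lambda>\<xi>. exp (2 * norm \<xi>) * cmod (ft b \<xi>))"
  shows "integrable lborel (\<lambda>\<xi>. exp (2 * norm \<xi>) * cmod (ft (pw b j) \<xi>)) \<and> S j \<le> S 0 * (fnorm TYPE('n) * S 0) ^ j"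
proof (induction j)
  case 0
  show ?case using b by simp
next
  case (Suc j)
  have F: "fnorm TYPE('n) > 0" by (rule fnorm_pos)
  have S0: "S j \<ge> 0" for j unfolding S_def by (intro integral_nonneg_AE) auto
  have cw: "integrable lborel (\<lambda>\<xi>. exp (2 * norm \<xi>) * cmod (conv (ft (pw b j)) (ft b) \<xi>))"
    "(\<integral>\<xi>. exp (2 * norm \<xi>) * cmod (conv (ft (pw b j)) (ft b) \<xi>) \<partial>lborel) \<le> S j * S 0"
  proof -
    have "exp (2 * norm (x + y)) \<le> exp (2 * norm x) * exp (2 * norm y)" for x y :: "real^'n"
      using norm_triangle_ineq[of x y] by (simp flip: exp_add)
    note cw = conv_weighted[of "\<lambda>\<xi>::real^'n. exp (2 * norm \<xi>)" "ft (pw b j)" "ft b", OF _ _ _ _ this conjunct1[OF Suc] b]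
    show "integrable lborel (\<lambda>\<xi>. exp (2 * norm \<xi>) * cmod (conv (ft (pw b j)) (ft b) \<xi>))"
      by (rule cw(1)) auto
    show "(\<integral>\<xi>. exp (2 * norm \<xi>) * cmod (conv (ft (pw b j)) (ft b) \<xi>) \<partial>lborel) \<le> S j * S 0"
      unfolding S_def pw_0 by (rule cw(2)) auto
  qed
  have eq: "exp (2 * norm \<xi>) * cmod (ft (pw b (Suc j)) \<xi>) = fnorm TYPE('n) * (exp (2 * norm \<xi>) * cmod (conv (ft (pw b j)) (ft b) \<xi>))" for \<xi>
    unfolding pw_Suc ft_mult using F by (simp add: norm_mult)
  have "S (Suc j) = fnorm TYPE('n) * (\<integral>\<xi>. exp (2 * norm \<xi>) * cmod (conv (ft (pw b j)) (ft b) \<xi>) \<partial>lborel)"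
    unfolding S_def eq by simp
  also have "\<dots> \<le> fnorm TYPE('n) * (S j * S 0)" using cw(2) F by (intro mult_left_mono) auto
  also have "\<dots> \<le> fnorm TYPE('n) * ((S 0 * (fnorm TYPE('n) * S 0) ^ j) * S 0)"
    using Suc F S0[of 0] by (intro mult_left_mono mult_right_mono) auto
  finally have "S (Suc j) \<le> S 0 * (fnorm TYPE('n) * S 0) ^ Suc j" by (simp add: mult_ac)
  then show ?case unfolding eq using cw(1) by simp
qed

lemma power_le_exp: "0 \<le> t \<Longrightarrow> (t::real) ^ n \<le> fact n * exp t"
proof -
  assume t: "0 \<le> t"
  have s: "(\<lambda>n. t ^ n /\<^sub>R fact n) sums exp t" by (rule exp_converges)
  have "sum (\<lambda>n. t ^ n /\<^sub>R fact n) {n} \<le> exp t"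
    unfolding sums_unique[OF s] by (rule sum_le_suminf[OF sums_summable[OF s]]) (use t in auto)
  then show ?thesis by (simp add: field_simps)
qed

text \<open>The transform of the j-th power is bounded by the j-th power of the supremum on a ball of radius
  proportional to j, whose volume and weight grow subexponentially; outside, the exponential weight wins.\<close>

lemma smooth_power_bound:
  fixes b :: "'n::finite walg"
  assumes b: "integrable lborel (\<lambda>\<xi>. exp (2 * norm \<xi>) * cmod (ft b \<xi>))"
    and M: "\<And>x. \<bar>fn b x\<bar> \<le> M" "M > 0" and \<rho>: "M < \<rho>"
  shows "\<exists>C\<ge>0. \<forall>j. norm (pw b j) \<le> C * \<rho> ^ j"
proof -
  define S where "S = (\<integral>\<xi>. exp (2 * norm \<xi>) * cmod (ft b \<xi>) \<partial>lborel)"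
  have S0: "S \<ge> 0" unfolding S_def by (intro integral_nonneg_AE) auto
  have F: "fnorm TYPE('n) > 0" by (rule fnorm_pos)
  \<comment> \<open>Beyond radius K j the exponential weight gains exp (- K j), enough to bring the
    crude rate below M.\<close>
  define K where "K = 1 + \<bar>ln ((fnorm TYPE('n) * S + 1) / M)\<bar>"
  have K: "K > 0" by (simp add: K_def)
  have KS: "fnorm TYPE('n) * S * exp (- K) \<le> M"
  proof -
    have p: "(fnorm TYPE('n) * S + 1) / M > 0" using F S0 M by (simp add: add_nonneg_pos)
    have "(fnorm TYPE('n) * S + 1) / M = exp (ln ((fnorm TYPE('n) * S + 1) / M))" using p by simp
    also have "\<dots> \<le> exp K" by (simp add: K_def)
    finally have "fnorm TYPE('n) * S + 1 \<le> M * exp K" using M by (simp add: pos_divide_le_eq mult.commute)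
    then show ?thesis by (simp add: exp_minus field_simps)
  qed
  \<comment> \<open>Splits the quotient \<rho> / M into two factors exp (\<eta> K): their j-th
    powers pay for the weight \<open>W\<close> on the ball of radius K j and for the volume of that
    ball.\<close>
  define \<eta> where "\<eta> = ln (\<rho> / M) / (2 * K)"
  have \<eta>: "\<eta> > 0" using \<rho> M K by (simp add: \<eta>_def)
  have "\<eta> * K + \<eta> * K = ln (\<rho> / M)" using K by (simp add: \<eta>_def)
  then have "exp (\<eta> * K) * exp (\<eta> * K) = \<rho> / M" using \<rho> M by (simp flip: exp_add)
  then have M\<eta>': "M * exp (\<eta> * K) * exp (\<eta> * K) = \<rho>" using M by (simp add: mult.assoc)
  let ?n = "CARD('n)"
  define V where "V = unit_ball_vol (real ?n) * (fact ?n * (1 / \<eta>) ^ ?n)"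
  have V0: "V \<ge> 0" unfolding V_def using \<eta> by (intro mult_nonneg_nonneg zero_le_power) auto
  define C where "C = lnorm (fn b) + fnorm TYPE('n) * (exp (1 / \<eta>) * V * lnorm (fn b) + exp 1 * S)"
  have C: "C \<ge> 0" unfolding C_def using F V0 S0 by (intro add_nonneg_nonneg mult_nonneg_nonneg) (auto simp: lnorm_nonneg)
  have "norm (pw b j) \<le> C * \<rho> ^ j" for j
  proof -
    let ?f = "pw b j"
    have l: "lnorm (fn ?f) \<le> M ^ j * lnorm (fn b)"
    proof -
      have "lnorm (fn ?f) \<le> (\<integral>x. M ^ j * \<bar>fn b x\<bar> \<partial>lborel)"
        unfolding lnorm_def
      proof (intro integral_mono integrable_abs integrable_fn integrable_mult_right)
        fix x
        have "\<bar>fn b x\<bar> ^ j \<le> M ^ j" by (intro power_mono M) auto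
        then show "\<bar>fn ?f x\<bar> \<le> M ^ j * \<bar>fn b x\<bar>"
          using mult_right_mono[OF _ abs_ge_zero[of "fn b x"], of "\<bar>fn b x\<bar> ^ j" "M ^ j"]
          by (simp add: fn_pw abs_mult power_abs mult.commute)
      qed
      then show ?thesis by (simp add: lnorm_def)
    qed
    let ?B = "cball 0 (K * real j) :: (real^'n) set"
    let ?h1 = "\<lambda>\<xi>. indicator ?B \<xi> * (exp (1 / \<eta> + \<eta> * (K * real j)) * (M ^ j * lnorm (fn b)))"
    let ?h2 = "\<lambda>\<xi>. exp 1 * exp (- K * real j) * (exp (2 * norm \<xi>) * cmod (ft ?f \<xi>))"
    have vB: "measure lborel ?B \<le> V * exp (\<eta> * K * real j)"
    proof -
      have "measure lborel ?B = unit_ball_vol (real ?n) * (K * real j) ^ ?n"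
        using K content_cball[of "K * real j" "0 :: real^'n"] by simp
      also have "(K * real j) ^ ?n = (1 / \<eta>) ^ ?n * (\<eta> * (K * real j)) ^ ?n"
        using \<eta> by (simp flip: power_mult_distrib)
      also have "unit_ball_vol (real ?n) * \<dots> \<le> unit_ball_vol (real ?n) * ((1 / \<eta>) ^ ?n * (fact ?n * exp (\<eta> * (K * real j))))"
        using \<eta> K by (intro mult_left_mono power_le_exp) auto
      also have "\<dots> = V * exp (\<eta> * K * real j)" by (simp add: V_def mult_ac)
      finally show ?thesis .
    qed
    have pt: "W \<xi> * cmod (ft ?f \<xi>) \<le> ?h1 \<xi> + ?h2 \<xi>" for \<xi>
    proof (cases "\<xi> \<in> ?B")
      case True
      then have n: "norm \<xi> \<le> K * real j" by simp
      have "W \<xi> \<le> exp (1 / \<eta> + \<eta> * norm \<xi>)" by (rule W_le_exp[OF \<eta>])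
      also have "\<dots> \<le> exp (1 / \<eta> + \<eta> * (K * real j))" using n \<eta> by simp
      finally have "W \<xi> * cmod (ft ?f \<xi>) \<le> exp (1 / \<eta> + \<eta> * (K * real j)) * (M ^ j * lnorm (fn b))"
        using order_trans[OF FT_le_lnorm l, of \<xi>] by (intro mult_mono) auto
      moreover have "?h2 \<xi> \<ge> 0" by simp
      ultimately show ?thesis using True by (simp only: indicator_simps mult_1)
    next
      case False
      then have n: "norm \<xi> > K * real j" by simp
      \<comment> \<open>With parameter 1, \<open>W\<close> uses one of the two units in the weight
        exp (2 |\<xi>|); outside the ball the other unit yields exp (- K j).\<close>
      have "W \<xi> \<le> exp (1 / 1 + 1 * norm \<xi>)" by (rule W_le_exp) simp
      also have "\<dots> \<le> exp (1 - K * real j + 2 * norm \<xi>)" using n by simp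
      also have "\<dots> = exp 1 * exp (- K * real j) * exp (2 * norm \<xi>)" by (simp flip: exp_add)
      finally have "W \<xi> * cmod (ft ?f \<xi>) \<le> (exp 1 * exp (- K * real j) * exp (2 * norm \<xi>)) * cmod (ft ?f \<xi>)"
        by (intro mult_right_mono) auto
      then show ?thesis using False by (simp add: mult.assoc)
    qed
    note iS = ft_pw_exp_weight[OF b, of j, THEN conjunct1] and bS = ft_pw_exp_weight[OF b, of j, THEN conjunct2, unfolded pw_0, folded S_def]
    have i1: "integrable lborel ?h1"
      by (intro integrable_mult_left integrable_real_indicator) (use emeasure_bounded_finite[OF bounded_cball, of "0 :: real^'n" "K * real j"] in simp_all)
    have i2: "integrable lborel ?h2" by (intro integrable_mult_right iS)
    have "(\<integral>\<xi>. W \<xi> * cmod (ft ?f \<xi>) \<partial>lborel) \<le> (\<integral>\<xi>. ?h1 \<xi> + ?h2 \<xi> \<partial>lborel)"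
      by (intro integral_mono walgD Bochner_Integration.integrable_add i1 i2 pt)
    also have "\<dots> = (\<integral>\<xi>. ?h1 \<xi> \<partial>lborel) + (\<integral>\<xi>. ?h2 \<xi> \<partial>lborel)"
      by (rule Bochner_Integration.integral_add[OF i1 i2])
    also have "(\<integral>\<xi>. ?h1 \<xi> \<partial>lborel) = measure lborel ?B * (exp (1 / \<eta> + \<eta> * (K * real j)) * (M ^ j * lnorm (fn b)))"
      by simp
    also have "\<dots> \<le> V * exp (\<eta> * K * real j) * (exp (1 / \<eta> + \<eta> * (K * real j)) * (M ^ j * lnorm (fn b)))"
      using vB M by (intro mult_right_mono) (auto simp: lnorm_nonneg)
    also have "\<dots> = exp (1 / \<eta>) * V * lnorm (fn b) * (M ^ j * exp (\<eta> * K) ^ j * exp (\<eta> * K) ^ j)"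
      by (simp add: exp_add exp_of_nat_mult[symmetric] mult_ac)
    also have "M ^ j * exp (\<eta> * K) ^ j * exp (\<eta> * K) ^ j = \<rho> ^ j"
      unfolding power_mult_distrib[symmetric] M\<eta>' ..
    also have "(\<integral>\<xi>. ?h2 \<xi> \<partial>lborel) \<le> exp 1 * S * \<rho> ^ j"
    proof -
      have "(\<integral>\<xi>. ?h2 \<xi> \<partial>lborel) = exp 1 * exp (- K * real j) * (\<integral>\<xi>. exp (2 * norm \<xi>) * cmod (ft ?f \<xi>) \<partial>lborel)" by simp
      also have "\<dots> \<le> exp 1 * exp (- K * real j) * (S * (fnorm TYPE('n) * S) ^ j)"
        by (intro mult_left_mono bS) auto
      also have "\<dots> = exp 1 * S * (fnorm TYPE('n) * S * exp (- K)) ^ j"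
        by (simp add: power_mult_distrib exp_of_nat_mult[symmetric] mult_ac)
      also have "\<dots> \<le> exp 1 * S * \<rho> ^ j"
        using KS \<rho> F S0 by (intro mult_left_mono power_mono) auto
      finally show ?thesis .
    qed
    finally have w: "(\<integral>\<xi>. W \<xi> * cmod (ft ?f \<xi>) \<partial>lborel) \<le> (exp (1 / \<eta>) * V * lnorm (fn b) + exp 1 * S) * \<rho> ^ j"
      by (simp add: distrib_right)
    have "M ^ j \<le> \<rho> ^ j" using M \<rho> by (intro power_mono) auto
    then have "lnorm (fn ?f) \<le> \<rho> ^ j * lnorm (fn b)"
      using l by (meson lnorm_nonneg mult_right_mono order_trans)
    moreover have "wnorm (fn ?f) \<le> (exp (1 / \<eta>) * V * lnorm (fn b) + exp 1 * S) * \<rho> ^ j * fnorm TYPE('n)"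
      unfolding wnorm_def using w F by (intro mult_right_mono) auto
    ultimately show ?thesis unfolding norm_walg C_def by (simp add: algebra_simps)
  qed
  with C show ?thesis by blast
qed

lemma funpow_mult_pw: "((*) (x::'n::finite walg) ^^ Suc j) y = pw x j * y"
  by (induction j) (simp_all add: mult.assoc)

lemma funpow_mult_distrib: "((*) (x::'n::finite walg) ^^ j) (z * y) = z * ((*) x ^^ j) y"
  by (induction j) (simp_all add: mult.left_commute)

lemma funpow_mult_add: "((*) (x::'n::finite walg) ^^ j) (y + z) = ((*) x ^^ j) y + ((*) x ^^ j) z"
  by (induction j) (simp_all add: distrib_left)

text \<open>Mollifying f at a small scale gives b with exponential moments, the same bound on the
  supremum, and f - b small in norm. Powers of b grow at a rate \<rho> < r, and the remainder, which
  commutes with b, costs at most r - \<rho> per factor.\<close>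

theorem spectral_bound:
  fixes f :: "'n::finite walg"
  assumes M: "\<And>x. \<bar>fn f x\<bar> \<le> M" and r: "M < r"
  shows "\<exists>C\<ge>0. \<forall>j y. norm (((*) f ^^ j) y) \<le> C * r ^ j * norm y"
proof -
  have M0: "M \<ge> 0" using M[of 0] by simp
  \<comment> \<open>Strictly above M, hence positive even when M = 0, as
    \<open>smooth_power_bound\<close> requires.\<close>
  define M1 where "M1 = (M + r) / 2"
  define \<rho> where "\<rho> = (M1 + r) / 2"
  have r0: "0 < r" using M0 r by linarith
  have o: "M < M1" "M1 < \<rho>" "\<rho> < r" "0 < M1" "0 < \<rho>" "0 < r"
    unfolding \<rho>_def M1_def using M0 r r0 by (auto simp: field_simps)
  have "(\<lambda>n. kop gk (1 / real (Suc n)) f) \<longlonglongrightarrow> kop gk 0 f"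
    by (intro tendsto_kop integrable_gk LIMSEQ_Suc[OF lim_1_over_n])
  then have "(\<lambda>n. kop gk (1 / real (Suc n)) f) \<longlonglongrightarrow> f"
    by (simp add: kop_0_left[OF integrable_gk] integral_gk)
  from LIMSEQ_D[OF this, of "r - \<rho>"] o obtain n where n: "norm (kop gk (1 / real (Suc n)) f - f) < r - \<rho>"
    by auto
  define \<tau> where "\<tau> = 1 / real (Suc n)"
  define b where "b = kop gk \<tau> f"
  define e where "e = f - b"
  have \<tau>: "\<tau> > 0" by (simp add: \<tau>_def)
  have e: "norm e \<le> r - \<rho>" using n by (simp add: e_def b_def \<tau>_def norm_minus_commute)
  have bM: "\<bar>fn b x\<bar> \<le> M1" for x
    using abs_kop_gk_le[OF M, of \<tau> x] o by (simp add: b_def)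
  have "integrable lborel (\<lambda>\<xi>. exp (2 * norm \<xi>) * cmod (ft b \<xi>))"
  proof (rule Bochner_Integration.integrable_bound)
    show "integrable lborel (\<lambda>\<xi>::real^'n. norm f * exp (4 / \<tau>\<^sup>2) * exp (- (\<tau>\<^sup>2 / 4) * (norm \<xi>)\<^sup>2))"
      using \<tau> by (intro integrable_mult_right integrable_gauss) simp
    show "AE \<xi> in lborel. norm (exp (2 * norm \<xi>) * cmod (ft b \<xi>)) \<le> norm (norm f * exp (4 / \<tau>\<^sup>2) * exp (- (\<tau>\<^sup>2 / 4) * (norm \<xi>)\<^sup>2))"
    proof (intro AE_I2)
      fix \<xi> :: "real^'n"
      have "2 * norm \<xi> \<le> 4 / \<tau>\<^sup>2 + (\<tau>\<^sup>2 / 4) * (norm \<xi>)\<^sup>2"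
      proof -
        have "(2 / \<tau> - \<tau> * norm \<xi> / 2)\<^sup>2 = 4 / \<tau>\<^sup>2 + (\<tau>\<^sup>2 / 4) * (norm \<xi>)\<^sup>2 - 2 * norm \<xi>"
          using \<tau> by (simp add: power2_diff power_divide power_mult_distrib)
        then show ?thesis using zero_le_power2[of "2 / \<tau> - \<tau> * norm \<xi> / 2"] by linarith
      qed
      then have "exp (2 * norm \<xi>) * gs (\<tau> *\<^sub>R \<xi>) \<le> exp (4 / \<tau>\<^sup>2 + (\<tau>\<^sup>2 / 4) * (norm \<xi>)\<^sup>2) * gs (\<tau> *\<^sub>R \<xi>)"
        by (intro mult_right_mono) (auto intro: less_imp_le[OF gs_pos])
      also have "\<dots> = exp (4 / \<tau>\<^sup>2) * exp (- (\<tau>\<^sup>2 / 4) * (norm \<xi>)\<^sup>2)"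
        by (simp add: gs_def power_mult_distrib flip: exp_add)
      finally have "exp (2 * norm \<xi>) * gs (\<tau> *\<^sub>R \<xi>) * cmod (ft f \<xi>) \<le> exp (4 / \<tau>\<^sup>2) * exp (- (\<tau>\<^sup>2 / 4) * (norm \<xi>)\<^sup>2) * norm f"
        by (rule mult_mono[OF _ cmod_ft_le]) auto
      then show "norm (exp (2 * norm \<xi>) * cmod (ft b \<xi>)) \<le> norm (norm f * exp (4 / \<tau>\<^sup>2) * exp (- (\<tau>\<^sup>2 / 4) * (norm \<xi>)\<^sup>2))"
        using less_imp_le[OF gs_pos[of "\<tau> *\<^sub>R \<xi>"]]
        by (simp add: b_def ft_kop[OF integrable_gk] FT_gk norm_mult mult_ac)
    qed
  qed measurable
  from smooth_power_bound[OF this bM o(4) o(2)]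
  obtain C1 where C1: "C1 \<ge> 0" "\<And>j. norm (pw b j) \<le> C1 * \<rho> ^ j" by blast
  define C2 where "C2 = 1 + C1 / \<rho>"
  have C2: "C2 \<ge> 0" using C1 o by (simp add: C2_def)
  have bj: "norm (((*) b ^^ j) y) \<le> C2 * norm y * \<rho> ^ j" for j y
  proof (cases j)
    case 0
    have "1 * norm y \<le> C2 * norm y" using C1 o by (intro mult_right_mono) (auto simp: C2_def)
    then show ?thesis using 0 by simp
  next
    case (Suc i)
    have "norm (pw b i * y) \<le> norm (pw b i) * norm y" by (rule norm_mult_ineq)
    also have "\<dots> \<le> C1 * \<rho> ^ i * norm y" by (intro mult_right_mono C1) auto
    also have "\<dots> = (C1 / \<rho>) * norm y * \<rho> ^ j" using Suc o by simp
    also have "\<dots> \<le> C2 * norm y * \<rho> ^ j" using o by (intro mult_right_mono) (auto simp: C2_def)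
    finally show ?thesis unfolding Suc funpow_mult_pw .
  qed
  \<comment> \<open>The free power i of b lets the induction absorb either summand of f = b + e: the
    summand b raises i, the summand e costs its norm, and \<rho> + (r - \<rho>) = r.\<close>
  have step: "norm (((*) b ^^ i) (((*) f ^^ j) y)) \<le> r ^ j * (C2 * norm y) * \<rho> ^ i" for i j y
  proof (induction j arbitrary: i)
    case 0
    show ?case using bj[of i y] by simp
  next
    case (Suc j)
    let ?y = "((*) f ^^ j) y"
    have "((*) b ^^ i) (((*) f ^^ Suc j) y) = ((*) b ^^ i) (b * ?y + e * ?y)"
      by (simp add: e_def algebra_simps)
    also have "\<dots> = ((*) b ^^ Suc i) ?y + e * ((*) b ^^ i) ?y"
      by (simp add: funpow_mult_add funpow_mult_distrib)
    also have "norm \<dots> \<le> norm (((*) b ^^ Suc i) ?y) + norm e * norm (((*) b ^^ i) ?y)"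
      by (intro order_trans[OF norm_triangle_ineq] add_mono norm_mult_ineq order_refl)
    also have "\<dots> \<le> r ^ j * (C2 * norm y) * \<rho> ^ Suc i + (r - \<rho>) * (r ^ j * (C2 * norm y) * \<rho> ^ i)"
      using e o by (intro add_mono mult_mono Suc) auto
    also have "\<dots> = r ^ Suc j * (C2 * norm y) * \<rho> ^ i" by (simp add: algebra_simps)
    finally show ?case .
  qed
  show ?thesis
    using step[of 0] C2 by (intro exI[of _ C2]) (auto simp: mult_ac)
qed

section \<open>The dispersionless equation\<close>

text \<open>The velocity is kept as a companion so that a solution can be continued from its
  endpoint.\<close>

definition ode_sol :: "nat \<Rightarrow> real \<Rightarrow> (real \<Rightarrow> 'n::finite walg) \<Rightarrow> (real \<Rightarrow> 'n walg) \<Rightarrow> bool" where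
  "ode_sol m T v z \<longleftrightarrow> v 0 = phi \<and> z 0 = 0 \<and> (\<forall>t\<in>{0..T}.
     (v has_vector_derivative z t) (at t within {0..T}) \<and>
     (z has_vector_derivative - pw (v t) m) (at t within {0..T}))"

lemma ode_sol_fn:
  assumes "ode_sol m T v z" "t \<in> {0..T}"
  shows "((\<lambda>t. fn (v t) x) has_real_derivative fn (z t) x) (at t within {0..T})"
    and "((\<lambda>t. fn (z t) x) has_real_derivative - (fn (v t) x ^ Suc m)) (at t within {0..T})"
proof -
  have "(v has_vector_derivative z t) (at t within {0..T})" "(z has_vector_derivative - pw (v t) m) (at t within {0..T})"
    using assms by (auto simp: ode_sol_def)
  from this[THEN bounded_linear.has_vector_derivative[OF bounded_linear_fn[of x]]]
  show "((\<lambda>t. fn (v t) x) has_real_derivative fn (z t) x) (at t within {0..T})"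
    "((\<lambda>t. fn (z t) x) has_real_derivative - (fn (v t) x ^ Suc m)) (at t within {0..T})"
    by (simp_all only: has_real_derivative_iff_has_vector_derivative fn_uminus fn_pw)
qed

lemma ode_sol_energy:
  assumes sol: "ode_sol m T v z" and t: "t \<in> {0..T}"
  shows "(fn (z t) x)\<^sup>2 / 2 + fn (v t) x ^ (m + 2) / (real m + 2) = gs x ^ (m + 2) / (real m + 2)"
proof -
  let ?e = "\<lambda>t. (fn (z t) x)\<^sup>2 / 2 + fn (v t) x ^ (m + 2) / (real m + 2)"
  have "(?e has_derivative (\<lambda>h. 0)) (at u within {0..T})" if u: "u \<in> {0..T}" for u
  proof -
    have "(?e has_real_derivative (2 * fn (z u) x * (- (fn (v u) x ^ Suc m)) / 2 + real (m + 2) * fn (v u) x ^ (m + 1) * fn (z u) x / (real m + 2))) (at u within {0..T})"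
      using DERIV_add[OF DERIV_cdivide[OF DERIV_power[OF ode_sol_fn(2)[OF sol u, of x], of 2], of 2] DERIV_cdivide[OF DERIV_power[OF ode_sol_fn(1)[OF sol u, of x], of "m + 2"], of "real m + 2"]]
      by (simp add: mult_ac)
    moreover have "2 * fn (z u) x * (- (fn (v u) x ^ Suc m)) / 2 + real (m + 2) * fn (v u) x ^ (m + 1) * fn (z u) x / (real m + 2) = 0"
    proof -
      have "real (m + 2) = real m + 2" "real m + 2 \<noteq> 0" by simp_all
      then show ?thesis by (simp add: field_simps)
    qed
    ultimately have "(?e has_real_derivative 0) (at u within {0..T})" by (simp only:)
    then show ?thesis unfolding has_field_derivative_def lambda_zero .
  qed
  then have "\<exists>c. \<forall>u\<in>{0..T}. ?e u = c" by (intro has_derivative_zero_constant) auto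
  then have "?e t = ?e 0" using t by force
  also have "\<dots> = gs x ^ (m + 2) / (real m + 2)" using sol by (simp add: ode_sol_def fn_phi)
  finally show ?thesis .
qed

text \<open>For even m the potential energy is nonnegative, so conservation of energy bounds
  position and velocity at each point, uniformly in time. Both bounds are at most 1: these are the
  suprema that a restart of the local solution requires.\<close>

lemma ode_sol_bounds:
  assumes sol: "ode_sol m T v z" and m: "even m" and t: "t \<in> {0..T}"
  shows "\<bar>fn (v t) x\<bar> \<le> gs x" "\<bar>fn (z t) x\<bar> \<le> 1"
proof -
  note E = ode_sol_energy[OF sol t, of x]
  let ?a = "fn (v t) x" and ?c = "fn (z t) x"
  have ev: "?a ^ (m + 2) \<ge> 0" by (rule zero_le_even_power) (use m in simp)
  have "?a ^ (m + 2) / (real m + 2) \<le> gs x ^ (m + 2) / (real m + 2)" using E zero_le_power2[of ?c] by linarith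
  then have "?a ^ (m + 2) \<le> gs x ^ (m + 2)" by (simp add: divide_le_cancel)
  then have "\<bar>?a\<bar> ^ (m + 2) \<le> gs x ^ (m + 2)" using m by (simp only: power_even_abs even_add even_numeral)
  then show "\<bar>?a\<bar> \<le> gs x" using gs_pos[of x] power_mono_iff[of "\<bar>?a\<bar>" "gs x" "m + 2"] by simp
  have "gs x ^ (m + 2) \<le> 1" using gs_pos[of x] gs_le_1[of x] by (intro power_le_one) auto
  then have "gs x ^ (m + 2) / (real m + 2) \<le> 1 / 2" by (simp add: divide_le_eq) 
  moreover have "?a ^ (m + 2) / (real m + 2) \<ge> 0" using ev by simp
  ultimately have "?c\<^sup>2 \<le> 1" using E by linarith
  then show "\<bar>?c\<bar> \<le> 1" by (simp add: abs_square_le_1)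
qed

lemma has_vector_derivative_glue:
  fixes f g :: "real \<Rightarrow> 'a::real_normed_vector"
  assumes a: "0 \<le> a" "0 \<le> b" and t: "t \<in> {0..a + b}"
    and f: "\<And>t. t \<in> {0..a} \<Longrightarrow> (f has_vector_derivative f' t) (at t within {0..a})"
    and g: "\<And>t. t \<in> {0..b} \<Longrightarrow> (g has_vector_derivative g' t) (at t within {0..b})"
    and eq: "f a = g 0" "f' a = g' 0"
  shows "((\<lambda>t. if t \<in> {0..a} then f t else g (t - a)) has_vector_derivative
     (if t \<in> {0..a} then f' t else g' (t - a))) (at t within {0..a + b})"
proof -
  have cl: "closure {0..a} \<inter> closure {a..a + b} = {a}" using a by auto
  have u: "{0..a + b} = {0..a} \<union> {a..a + b}" using a by auto
  have g2: "((\<lambda>t. g (t - a)) has_vector_derivative g' (t - a)) (at t within {a..a + b})" if "t \<in> {a..a + b}" for t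
  proof -
    have "((\<lambda>t. t - a) has_vector_derivative 1) (at t within {a..a + b})" by (auto intro!: derivative_eq_intros)
    moreover have "(\<lambda>t. t - a) ` {a..a + b} \<subseteq> {0..b}" by auto
    then have "(g has_vector_derivative g' (t - a)) (at (t - a) within (\<lambda>t. t - a) ` {a..a + b})"
      using that by (intro has_vector_derivative_within_subset[OF g]) auto
    ultimately show ?thesis
      using vector_diff_chain_within[of "\<lambda>t. t - a" 1 t "{a..a + b}" g "g' (t - a)"] by (simp add: o_def)
  qed
  show ?thesis
  proof (rule has_vector_derivative_If_within_closures[where T="{a..a + b}"])
    show "t \<in> {0..a} \<union> {a..a + b}" using t u by simp
    show "(f has_vector_derivative f' t) (at t within {0..a} \<union> closure {0..a} \<inter> closure {a..a + b})"
      if "t \<in> {0..a} \<union> closure {0..a} \<inter> closure {a..a + b}"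
      using that f[of t] a unfolding cl by (auto simp: insert_absorb)
    show "((\<lambda>t. g (t - a)) has_vector_derivative g' (t - a)) (at t within {a..a + b} \<union> closure {0..a} \<inter> closure {a..a + b})"
      if "t \<in> {a..a + b} \<union> closure {0..a} \<inter> closure {a..a + b}"
      using that g2[of t] a unfolding cl by (auto simp: insert_absorb)
    show "f t = g (t - a)" if "t \<in> closure {0..a}" "t \<in> closure {a..a + b}"
      using that cl eq by (auto simp: eq)
    show "f' t = g' (t - a)" if "t \<in> closure {0..a}" "t \<in> closure {a..a + b}"
      using that cl eq by (auto simp: eq)
  qed (rule u)
qed

text \<open>The value 2 is a fixed number above the suprema. The constant C varies with the data,
  but the time of existence is computed from 2.\<close>

lemma walg_gauge:
  fixes a b :: "'n::finite walg"
  assumes "\<And>x. \<bar>fn a x\<bar> \<le> 1" "\<And>x. \<bar>fn b x\<bar> \<le> 1"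
  shows "\<exists>C. gauge a b C 2"
proof -
  obtain C1 where C1: "C1 \<ge> 0" "\<And>j y. norm (((*) a ^^ j) y) \<le> C1 * 2 ^ j * norm y"
    using spectral_bound[of a 1 2] assms by auto
  obtain C2 where C2: "C2 \<ge> 0" "\<And>j y. norm (((*) b ^^ j) y) \<le> C2 * 2 ^ j * norm y"
    using spectral_bound[of b 1 2] assms by auto
  have "norm (((*) a ^^ j) (((*) b ^^ k) y)) \<le> (C1 * C2) * 2 ^ (j + k) * norm y" for j k y
  proof -
    have "norm (((*) a ^^ j) (((*) b ^^ k) y)) \<le> C1 * 2 ^ j * norm (((*) b ^^ k) y)" by (rule C1)
    also have "\<dots> \<le> C1 * 2 ^ j * (C2 * 2 ^ k * norm y)" using C1 by (intro mult_left_mono C2) auto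
    also have "\<dots> = (C1 * C2) * 2 ^ (j + k) * norm y" by (simp add: power_add)
    finally show ?thesis .
  qed
  then have "gauge a b (C1 * C2) 2" using C1 C2 by unfold_locales auto
  then show ?thesis by blast
qed

text \<open>The norm of the data may grow from step to step, but their suprema stay at most 1 by
  conservation of energy, so every restart lasts for the same time \<tau>.\<close>

theorem ode_sol_exists:
  assumes m: "even m"
  shows "\<exists>v z. ode_sol m T (v :: real \<Rightarrow> 'n::finite walg) z"
proof -
  \<comment> \<open>The reciprocal itself, instead of its square root, satisfies the smallness
    condition because the denominator is at least 1.\<close>
  define \<tau> where "\<tau> = 1 / (2 * real (Suc m) * (4 * 2) ^ m)"
  have den: "2 * real (Suc m) * (4 * 2) ^ m \<ge> (1::real)"
  proof -
    have "1 * 1 \<le> (2 * real (Suc m)) * (4 * 2 :: real) ^ m" by (intro mult_mono) auto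
    then show ?thesis by simp
  qed
  have \<tau>: "0 < \<tau>" "\<tau> \<le> 1" using den by (auto simp: \<tau>_def)
  have \<tau>3: "\<tau>\<^sup>2 * (2 * real (Suc m) * (4 * 2) ^ m) \<le> 1"
  proof -
    have "\<tau>\<^sup>2 * (2 * real (Suc m) * (4 * 2) ^ m) = \<tau>"
      using den by (simp add: \<tau>_def power2_eq_square)
    then show ?thesis using \<tau> by simp
  qed
  have loc: "\<exists>v z. v 0 = a \<and> z 0 = b \<and> (\<forall>t\<in>{0..\<tau>}. (v has_vector_derivative z t) (at t within {0..\<tau>}) \<and>
     (z has_vector_derivative - pw (v t) m) (at t within {0..\<tau>}))"
    if "\<And>x. \<bar>fn a x\<bar> \<le> 1" "\<And>x. \<bar>fn b x\<bar> \<le> 1" for a b :: "'n walg"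
    using walg_gauge[OF that] gauge.local_solution[OF _ \<tau> \<tau>3] by blast
  have step: "\<exists>v z. ode_sol m (real (Suc k) * \<tau>) (v :: real \<Rightarrow> 'n walg) z" for k
  proof (induction k)
    case 0
    have "\<bar>fn phi x\<bar> \<le> 1" "\<bar>fn 0 x\<bar> \<le> 1" for x :: "real^'n"
      using gs_pos[of x] gs_le_1[of x] by (auto simp: fn_phi)
    from loc[OF this] show ?case unfolding ode_sol_def by simp
  next
    case (Suc k)
    let ?a = "real (Suc k) * \<tau>"
    have a0: "?a \<ge> 0" using \<tau> by simp
    obtain v z where vz: "ode_sol m ?a (v :: real \<Rightarrow> 'n walg) z" using Suc by blast
    have aa: "?a \<in> {0..?a}" using a0 by simp
    have "\<bar>fn (v ?a) x\<bar> \<le> 1" "\<bar>fn (z ?a) x\<bar> \<le> 1" for x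
      using ode_sol_bounds[OF vz m aa, of x] gs_le_1[of x] by auto
    from loc[OF this] obtain v2 z2 where 2: "v2 0 = v ?a" "z2 0 = z ?a"
      "\<And>t. t \<in> {0..\<tau>} \<Longrightarrow> (v2 has_vector_derivative z2 t) (at t within {0..\<tau>})"
      "\<And>t. t \<in> {0..\<tau>} \<Longrightarrow> (z2 has_vector_derivative - pw (v2 t) m) (at t within {0..\<tau>})" by blast
    let ?v = "\<lambda>t. if t \<in> {0..?a} then v t else v2 (t - ?a)"
    let ?z = "\<lambda>t. if t \<in> {0..?a} then z t else z2 (t - ?a)"
    have ea: "real (Suc (Suc k)) * \<tau> = ?a + \<tau>" by (simp add: algebra_simps)
    have "(?v has_vector_derivative ?z t) (at t within {0..?a + \<tau>})" if "t \<in> {0..?a + \<tau>}" for t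
      by (rule has_vector_derivative_glue[OF a0 _ that]) (use vz 2 \<tau> in \<open>auto simp: ode_sol_def\<close>)
    moreover have "(?z has_vector_derivative - pw (?v t) m) (at t within {0..?a + \<tau>})" if "t \<in> {0..?a + \<tau>}" for t
    proof -
      have "(?z has_vector_derivative (if t \<in> {0..?a} then - pw (v t) m else - pw (v2 (t - ?a)) m)) (at t within {0..?a + \<tau>})"
        by (rule has_vector_derivative_glue[OF a0 _ that, where f'="\<lambda>t. - pw (v t) m" and g'="\<lambda>t. - pw (v2 t) m"])
           (use vz 2 \<tau> in \<open>auto simp: ode_sol_def\<close>)
      moreover have "(if t \<in> {0..?a} then - pw (v t) m else - pw (v2 (t - ?a)) m) = - pw (?v t) m" by simp
      ultimately show ?thesis by (simp only:)
    qed
    ultimately have "ode_sol m (?a + \<tau>) ?v ?z"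
      unfolding ode_sol_def using vz a0 by (auto simp: ode_sol_def)
    then show ?case unfolding ea by blast
  qed
  obtain k where k: "T / \<tau> < real k" using reals_Archimedean2 by blast
  then have kT: "T \<le> real (Suc k) * \<tau>" using \<tau> by (simp add: field_simps)
  obtain v z where vz: "ode_sol m (real (Suc k) * \<tau>) (v :: real \<Rightarrow> 'n walg) z" using step by blast
  have sub: "{0..T} \<subseteq> {0..real (Suc k) * \<tau>}" using kT by auto
  have "ode_sol m T v z"
    unfolding ode_sol_def
  proof (intro conjI ballI)
    fix t assume "t \<in> {0..T}"
    then have "t \<in> {0..real (Suc k) * \<tau>}" using sub by blast
    then show "(v has_vector_derivative z t) (at t within {0..T})" "(z has_vector_derivative - pw (v t) m) (at t within {0..T})"
      using vz has_vector_derivative_within_subset[OF _ sub] unfolding ode_sol_def by blast+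
  qed (use vz in \<open>auto simp: ode_sol_def\<close>)
  then show ?thesis by blast
qed

text \<open>By uniqueness for the scalar equation, the solution at x is the one at 0 with amplitude and clock
  rescaled by the initial value.\<close>

lemma ode_sol_scaling:
  fixes v z :: "real \<Rightarrow> 'n::finite walg"
  assumes sol: "ode_sol (2 * q) T v z" and t: "t \<in> {0..T}"
  shows "fn (v t) x = gs x * fn (v (t * gs x ^ q)) 0"
proof -
  let ?m = "2 * q"
  let ?g = "gs x"
  have g: "0 < ?g" "?g \<le> 1" "?g ^ q \<le> 1" "0 \<le> ?g ^ q"
    using gs_pos[of x] gs_le_1[of x] by (auto intro: power_le_one)
  have in_T: "u * ?g ^ q \<in> {0..T}" if "u \<in> {0..T}" for u
    using that g mult_left_mono[OF g(3), of u] by auto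
  define A where "A u = fn (v u) x - ?g * fn (v (u * ?g ^ q)) 0" for u
  define C where "C u = fn (z u) x - ?g ^ Suc q * fn (z (u * ?g ^ q)) 0" for u
  have comp: "((\<lambda>u. h (u * ?g ^ q)) has_real_derivative h' * ?g ^ q) (at u within {0..T})"
    if "(h has_real_derivative h') (at (u * ?g ^ q) within {0..T})" for h h' u
  proof -
    have "((\<lambda>u. u * ?g ^ q) has_real_derivative ?g ^ q) (at u within {0..T})" by (auto intro!: derivative_eq_intros)
    moreover have "(h has_real_derivative h') (at (u * ?g ^ q) within (\<lambda>u. u * ?g ^ q) ` {0..T})"
      by (rule DERIV_subset[OF that]) (use in_T in blast)
    ultimately show ?thesis using DERIV_image_chain[of h h' "\<lambda>u. u * ?g ^ q" u "{0..T}" "?g ^ q"] by (simp add: o_def)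
  qed
  have dA: "(A has_real_derivative C u) (at u within {0..T})" if u: "u \<in> {0..T}" for u
    unfolding A_def C_def
    using DERIV_diff[OF ode_sol_fn(1)[OF sol u, of x] DERIV_cmult[OF comp[OF ode_sol_fn(1)[OF sol in_T[OF u], of 0]], of ?g]]
    by (simp add: mult_ac)
  let ?N = "\<lambda>u. fn (v u) x ^ Suc ?m - (?g * fn (v (u * ?g ^ q)) 0) ^ Suc ?m"
  have dC: "(C has_real_derivative - ?N u) (at u within {0..T})" if u: "u \<in> {0..T}" for u
  proof -
    \<comment> \<open>Two time derivatives bring out gs^(2 q), and the amplitude makes this gs^(2 q
      + 1), the factor produced by the nonlinearity. This fixes the exponent q of the clock.\<close>
    have e: "?g ^ Suc q * ?g ^ q = ?g ^ Suc ?m" by (simp add: mult_2 power_add)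
    have "(C has_real_derivative (- (fn (v u) x ^ Suc ?m) - ?g ^ Suc q * (- (fn (v (u * ?g ^ q)) 0 ^ Suc ?m) * ?g ^ q))) (at u within {0..T})"
      unfolding C_def
      by (rule DERIV_diff[OF ode_sol_fn(2)[OF sol u, of x] DERIV_cmult[OF comp[OF ode_sol_fn(2)[OF sol in_T[OF u], of 0]], of "?g ^ Suc q"]])
    moreover have "- (fn (v u) x ^ Suc ?m) - ?g ^ Suc q * (- (fn (v (u * ?g ^ q)) 0 ^ Suc ?m) * ?g ^ q) = - ?N u"
      unfolding power_mult_distrib e[symmetric] by (simp only: algebra_simps)
    ultimately show ?thesis by (simp only:)
  qed
  have N: "\<bar>?N u\<bar> \<le> real (Suc ?m) * \<bar>A u\<bar>" if u: "u \<in> {0..T}" for u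
  proof -
    have "\<bar>fn (v u) x\<bar> \<le> 1" using ode_sol_bounds(1)[OF sol _ u, of x] g by simp
    moreover have "\<bar>?g * fn (v (u * ?g ^ q)) 0\<bar> \<le> 1"
      using ode_sol_bounds(1)[OF sol _ in_T[OF u], of 0] g by (simp add: abs_mult gs_0 mult_le_one)
    ultimately show ?thesis unfolding A_def using norm_power_diff[of "fn (v u) x" "?g * fn (v (u * ?g ^ q)) 0" "Suc ?m"] by simp
  qed
  \<comment> \<open>One for the coupling of A and C, plus the Lipschitz constant
    \<open>Suc (2 * q)\<close> of the power on [-1, 1]: at this rate the weighted sum of squares
    cannot increase.\<close>
  define K where "K = real (?m + 2)"
  define E where "E u = exp (- K * u) * ((A u)\<^sup>2 + (C u)\<^sup>2)" for u
  let ?E' = "\<lambda>u. exp (- K * u) * (2 * A u * C u - 2 * C u * ?N u - K * ((A u)\<^sup>2 + (C u)\<^sup>2))"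
  have dE: "(E has_derivative (\<lambda>h. ?E' u * h)) (at u within {0..T})" if u: "u \<in> {0..T}" for u
  proof -
    have "(E has_real_derivative ?E' u) (at u within {0..T})"
      unfolding E_def by (rule derivative_eq_intros dA[OF u] dC[OF u] refl)+ (simp add: algebra_simps)
    then show ?thesis by (simp add: has_field_derivative_def)
  qed
  have E': "?E' u \<le> 0" if u: "u \<in> {0..T}" for u
  proof -
    have "2 * A u * C u - 2 * C u * ?N u \<le> 2 * \<bar>A u\<bar> * \<bar>C u\<bar> + 2 * \<bar>C u\<bar> * \<bar>?N u\<bar>"
    proof -
      have "2 * A u * C u \<le> \<bar>2 * A u * C u\<bar>" "- (2 * C u * ?N u) \<le> \<bar>2 * C u * ?N u\<bar>" by linarith+
      then show ?thesis unfolding abs_mult by simp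
    qed
    also have "\<dots> \<le> 2 * \<bar>A u\<bar> * \<bar>C u\<bar> + 2 * \<bar>C u\<bar> * (real (Suc ?m) * \<bar>A u\<bar>)"
      by (intro add_left_mono mult_left_mono N u) auto
    also have "\<dots> = K * (2 * \<bar>A u\<bar> * \<bar>C u\<bar>)" by (simp add: K_def algebra_simps)
    also have "\<dots> \<le> K * ((A u)\<^sup>2 + (C u)\<^sup>2)"
      using sum_squares_bound[of "\<bar>A u\<bar>" "\<bar>C u\<bar>"] by (intro mult_left_mono) (auto simp: K_def)
    finally show ?thesis by (simp add: mult_le_0_iff)
  qed
  have "\<exists>u\<in>{0..t}. E t - E 0 = ?E' u * (t - 0)"
  proof (rule mvt_very_simple)
    show "(E has_derivative (*) (?E' u)) (at u within {0..t})" if "0 \<le> u" "u \<le> t" for u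
      using has_derivative_subset[OF dE[of u], of "{0..t}"] that t by auto
  qed (use t in auto)
  then obtain u where u: "u \<in> {0..t}" "E t - E 0 = ?E' u * (t - 0)" by (rule bexE)
  have E0: "E 0 = 0" using sol by (simp add: E_def A_def C_def ode_sol_def fn_phi gs_0)
  have "u \<in> {0..T}" "0 \<le> t" using u(1) t by auto
  then have "?E' u * t \<le> 0" by (rule mult_nonpos_nonneg[OF E'])
  then have "E t \<le> 0" using u(2) E0 by (simp only: diff_0_right)
  then have "(A t)\<^sup>2 + (C t)\<^sup>2 \<le> 0" by (simp add: E_def mult_le_0_iff)
  then have "A t = 0" by (metis add_le_same_cancel1 add_nonneg_eq_0_iff antisym sum_power2_eq_zero_iff sum_power2_ge_zero)
  then show ?thesis by (simp add: A_def)
qed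

section \<open>Oscillation\<close>

text \<open>The integral bounds the terms left after integrating by parts in one coordinate
  direction, and the factor \<open>CARD('n)\<close> sums over the directions.\<close>

definition osc_const :: "'n::finite itself \<Rightarrow> nat \<Rightarrow> real" where
  "osc_const _ j = real CARD('n) * (\<integral>x. (1 + norm x + real j * (norm x)\<^sup>2) * gs (x::real^'n) \<partial>lborel)"

lemma integrable_osc: "integrable lborel (\<lambda>x. (1 + norm x + real j * (norm x)\<^sup>2) * gs x)"
proof -
  have "integrable lborel (\<lambda>x::real^'a. norm x ^ 0 * gs x + norm x ^ 1 * gs x + real j * (norm x ^ 2 * gs x))"
    by (intro Bochner_Integration.integrable_add integrable_mult_right integrable_power_gs)
  then show ?thesis by (simp add: algebra_simps)
qed

lemma gs_power_le: "j \<ge> 1 \<Longrightarrow> gs x ^ j \<le> gs x"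
  using gs_pos[of x] gs_le_1[of x] power_decreasing[of 1 j "gs x"] by simp

lemma has_real_derivative_gs_power_line:
  "((\<lambda>s. gs (x + s *\<^sub>R axis i 1) ^ j) has_real_derivative (- (real j * x $ i) * gs x ^ j)) (at 0)"
proof (cases j)
  case (Suc k)
  show ?thesis unfolding Suc
    using DERIV_power[OF has_real_derivative_gs_line[of x i], of "Suc k"] by (simp add: mult_ac)
qed simp

text \<open>Integrating the derivative of \<open>x\<^sub>i K W(T gs\<^sup>q)\<close> trades the oscillating factor G = W' for a factor 1/T.\<close>

lemma oscillation:
  fixes \<zeta> :: "real^'n"
  assumes T: "T > 0" and q: "q \<ge> 1" and j: "j \<ge> 1"
    and W: "\<And>t. t \<in> {0..T} \<Longrightarrow> (U has_real_derivative G t) (at t within {0..T})"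
    and G: "continuous_on {0..T} G" and B: "\<And>t. t \<in> {0..T} \<Longrightarrow> \<bar>U t\<bar> \<le> 1"
  shows "cmod (\<integral>x. cis (- (x \<bullet> \<zeta>)) * complex_of_real ((norm x)\<^sup>2 * gs x ^ (q + j) * G (T * gs x ^ q)) \<partial>lborel)
     \<le> osc_const TYPE('n) j * (1 + norm \<zeta>) / T"
    and "integrable lborel (\<lambda>x::real^'n. (norm x)\<^sup>2 * gs x ^ (q + j) * G (T * gs x ^ q))"
proof -
  let ?\<psi> = "\<lambda>x::real^'n. gs x ^ q"
  have psi: "T * ?\<psi> x \<in> {0..T}" for x
    using T gs_pos[of x] gs_le_1[of x] by (auto simp: mult_left_le power_le_one)
  have cU: "continuous_on {0..T} U"
    using W by (meson DERIV_continuous continuous_on_eq_continuous_within)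
  have cU': "continuous_on S (\<lambda>x. U (T * ?\<psi> x))" and cG': "continuous_on S (\<lambda>x. G (T * ?\<psi> x))" for S
    by (intro continuous_on_compose2[OF cU] continuous_on_compose2[OF G] continuous_intros; use psi in auto)+
  have [measurable]: "(\<lambda>x. U (T * ?\<psi> x)) \<in> borel_measurable borel" "(\<lambda>x. G (T * ?\<psi> x)) \<in> borel_measurable borel"
    by (intro borel_measurable_continuous_onI cU' cG')+
  have cmeas: "continuous_on UNIV f \<Longrightarrow> f \<in> borel_measurable lborel" for f :: "real^'n \<Rightarrow> complex"
    by (simp add: borel_measurable_continuous_onI)
  obtain BG where "\<forall>x\<in>G ` {0..T}. norm x \<le> BG"
    using compact_imp_bounded[OF compact_continuous_image[OF G compact_Icc]] unfolding bounded_iff by blast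
  then have BG: "\<bar>G (T * ?\<psi> x)\<bar> \<le> BG" for x using psi[of x] by auto
  have BG0: "BG \<ge> 0" using BG[of 0] by linarith
  have U1: "\<bar>U (T * ?\<psi> x)\<bar> \<le> 1" for x using B psi by blast
  let ?K = "\<lambda>x. cis (- (x \<bullet> \<zeta>)) * complex_of_real (gs x ^ j)"
  \<comment> \<open>\<open>?R\<close> collects the derivatives that fall on the coordinate, the
    phase and \<open>gs x ^ j\<close>; the one that falls on \<open>U\<close> is - q T times
    \<open>?M\<close>, and this factor T is the gain. The coordinate in front pairs with the
    coordinate from the derivative of \<open>gs x ^ q\<close>, so the sum over directions has the
    weight |x|^2.\<close>
  let ?R = "\<lambda>i x. (1 + complex_of_real (x $ i) * (- \<i> * complex_of_real (\<zeta> $ i) - complex_of_real (real j * x $ i))) * ?K x * complex_of_real (U (T * ?\<psi> x))"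
  let ?M = "\<lambda>i x. cis (- (x \<bullet> \<zeta>)) * complex_of_real ((x $ i)\<^sup>2 * gs x ^ (q + j) * G (T * ?\<psi> x))"
  have gj: "gs x ^ j \<le> gs x" "gs x ^ (q + j) \<le> gs x" for x :: "real^'n" using gs_power_le[of j x] gs_power_le[of "q + j" x] j by auto
  have xi: "\<bar>x $ i\<bar> \<le> norm x" "(x $ i)\<^sup>2 \<le> (norm x)\<^sup>2" for x :: "real^'n" and i
    using component_le_norm_cart[of x i] power_mono[of "\<bar>x $ i\<bar>" "norm x" 2] by auto
  have Rle: "cmod (?R i x) \<le> (1 + norm \<zeta>) * ((1 + norm x + real j * (norm x)\<^sup>2) * gs x)" for i x
  proof -
    have "cmod (1 + complex_of_real (x $ i) * (- \<i> * complex_of_real (\<zeta> $ i) - complex_of_real (real j * x $ i)))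
        \<le> 1 + \<bar>x $ i\<bar> * (\<bar>\<zeta> $ i\<bar> + real j * \<bar>x $ i\<bar>)"
    proof -
      have "cmod (- \<i> * complex_of_real (\<zeta> $ i) - complex_of_real (real j * x $ i)) \<le> \<bar>\<zeta> $ i\<bar> + real j * \<bar>x $ i\<bar>"
        by (rule order_trans[OF norm_triangle_ineq4]) (simp add: norm_mult abs_mult)
      then show ?thesis
        by (intro order_trans[OF norm_triangle_ineq]) (auto simp: norm_mult intro!: mult_left_mono)
    qed
    also have "\<dots> \<le> 1 + norm x * (norm \<zeta> + real j * norm x)"
      by (intro add_left_mono mult_mono add_mono xi mult_left_mono) auto
    also have "\<dots> \<le> (1 + norm \<zeta>) * (1 + norm x + real j * (norm x)\<^sup>2)"
      by (simp add: algebra_simps power2_eq_square)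
    finally have 1: "cmod (1 + complex_of_real (x $ i) * (- \<i> * complex_of_real (\<zeta> $ i) - complex_of_real (real j * x $ i)))
       \<le> (1 + norm \<zeta>) * (1 + norm x + real j * (norm x)\<^sup>2)" .
    have 2: "cmod (?K x) \<le> gs x" using gj(1)[of x] gs_pos[of x] by (simp add: norm_mult norm_power)
    have "cmod (?R i x) \<le> ((1 + norm \<zeta>) * (1 + norm x + real j * (norm x)\<^sup>2)) * gs x * 1"
      unfolding norm_mult[of "_ * ?K x"] norm_mult[of "1 + _"]
      by (intro mult_mono 1 2) (use U1[of x] gs_pos[of x] in \<open>auto intro!: mult_nonneg_nonneg add_nonneg_nonneg\<close>)
    then show ?thesis by (simp add: mult.assoc)
  qed
  have iR: "integrable lborel (?R i)" for i
    by (rule Bochner_Integration.integrable_bound[OF integrable_mult_right[OF integrable_osc[of j], of "1 + norm \<zeta>"]])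
       (intro cmeas continuous_intros cU', intro AE_I2, rule order_trans[OF Rle], rule order_trans[OF abs_ge_self], simp only: real_norm_def)
  have Mle: "cmod (?M i x) \<le> BG * (norm x ^ 2 * gs x)" for i x
  proof -
    have "cmod (?M i x) = (x $ i)\<^sup>2 * gs x ^ (q + j) * \<bar>G (T * ?\<psi> x)\<bar>"
      using gs_pos[of x] by (simp add: norm_mult norm_power abs_mult)
    also have "\<dots> \<le> (norm x)\<^sup>2 * gs x * BG"
      using gs_pos[of x] by (intro mult_mono xi gj BG) auto
    finally show ?thesis by (simp add: mult_ac)
  qed
  have iM: "integrable lborel (?M i)" for i
    by (rule Bochner_Integration.integrable_bound[OF integrable_mult_right[OF integrable_power_gs[of 2], of BG]])
       (intro cmeas continuous_intros cG', intro AE_I2, rule order_trans[OF Mle], rule order_trans[OF abs_ge_self], simp only: real_norm_def)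
  have main: "complex_of_real (real q * T) * (\<integral>x. ?M i x \<partial>lborel) = (\<integral>x. ?R i x \<partial>lborel)" for i
  proof -
    let ?F = "\<lambda>x. complex_of_real (x $ i) * ?K x * complex_of_real (U (T * ?\<psi> x))"
    let ?F' = "\<lambda>x. ?R i x - complex_of_real (real q * T) * ?M i x"
    have "(\<integral>x. ?F' x \<partial>lborel) = 0"
    proof (rule integral_directional_derivative_eq_0[where F="?F" and v="axis i 1"])
      have "cmod (?F x) \<le> norm x ^ 1 * gs x" for x
      proof -
        have "cmod (?F x) = \<bar>x $ i\<bar> * gs x ^ j * \<bar>U (T * ?\<psi> x)\<bar>"
          using gs_pos[of x] by (simp add: norm_mult norm_power)
        also have "\<dots> \<le> norm x * gs x * 1"
          using gs_pos[of x] by (intro mult_mono xi gj U1) auto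
        finally show ?thesis by simp
      qed
      note Fle = this
      show "integrable lborel ?F"
        by (rule Bochner_Integration.integrable_bound[OF integrable_power_gs[of 1]])
           (intro cmeas continuous_intros cU', intro AE_I2, rule order_trans[OF Fle], rule order_trans[OF abs_ge_self], simp only: real_norm_def)
      show "integrable lborel ?F'" by (intro Bochner_Integration.integrable_diff integrable_mult_right iR iM)
      show "continuous_on UNIV ?F'" by (intro continuous_intros cU' cG')
      fix x :: "real^'n"
      let ?l = "\<lambda>s. x + s *\<^sub>R axis i 1"
      have d1: "((\<lambda>s. complex_of_real (?l s $ i)) has_vector_derivative complex_of_real 1) (at 0)"
        by (rule has_vector_derivative_of_real) (auto intro!: derivative_eq_intros)
      have d2: "((\<lambda>s. cis (- (?l s \<bullet> \<zeta>))) has_vector_derivative (\<i> * complex_of_real (- (\<zeta> $ i)) * cis (- (?l 0 \<bullet> \<zeta>)))) (at 0)"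
        by (rule has_vector_derivative_cis) (auto intro!: derivative_eq_intros simp: inner_add_left inner_axis')
      have d3: "((\<lambda>s. complex_of_real (gs (?l s) ^ j)) has_vector_derivative complex_of_real (- (real j * x $ i) * gs x ^ j)) (at 0)"
        by (rule has_vector_derivative_of_real[OF has_real_derivative_gs_power_line])
      have d4: "((\<lambda>s. complex_of_real (U (T * ?\<psi> (?l s)))) has_vector_derivative complex_of_real (G (T * ?\<psi> x) * (T * (- (real q * x $ i) * ?\<psi> x)))) (at 0)"
      proof (rule has_vector_derivative_of_real)
        have a: "((\<lambda>s. T * ?\<psi> (?l s)) has_real_derivative T * (- (real q * x $ i) * ?\<psi> x)) (at 0 within UNIV)"
          by (rule DERIV_cmult[OF has_real_derivative_gs_power_line])
        have b: "(U has_real_derivative G (T * ?\<psi> x)) (at (T * ?\<psi> (?l 0)) within (\<lambda>s. T * ?\<psi> (?l s)) ` UNIV)"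
        proof (rule DERIV_subset)
          show "(U has_real_derivative G (T * ?\<psi> x)) (at (T * ?\<psi> (?l 0)) within {0..T})" using W[OF psi[of x]] by simp
          show "(\<lambda>s. T * ?\<psi> (?l s)) ` UNIV \<subseteq> {0..T}" using psi by blast
        qed
        show "((\<lambda>s. U (T * ?\<psi> (?l s))) has_real_derivative G (T * ?\<psi> x) * (T * (- (real q * x $ i) * ?\<psi> x))) (at 0)"
          using DERIV_image_chain[OF b a] unfolding o_def .
      qed
      have "((\<lambda>s. complex_of_real (?l s $ i) * (cis (- (?l s \<bullet> \<zeta>)) * complex_of_real (gs (?l s) ^ j)) * complex_of_real (U (T * ?\<psi> (?l s)))) has_vector_derivative
         ((complex_of_real (?l 0 $ i) * (cis (- (?l 0 \<bullet> \<zeta>)) * complex_of_real (gs (?l 0) ^ j))) * complex_of_real (G (T * ?\<psi> x) * (T * (- (real q * x $ i) * ?\<psi> x)))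
          + (complex_of_real (?l 0 $ i) * (cis (- (?l 0 \<bullet> \<zeta>)) * complex_of_real (- (real j * x $ i) * gs x ^ j) + (\<i> * complex_of_real (- (\<zeta> $ i)) * cis (- (?l 0 \<bullet> \<zeta>))) * complex_of_real (gs (?l 0) ^ j))
          + complex_of_real 1 * (cis (- (?l 0 \<bullet> \<zeta>)) * complex_of_real (gs (?l 0) ^ j))) * complex_of_real (U (T * ?\<psi> (?l 0))))) (at 0)"
        by (rule has_vector_derivative_mult[OF has_vector_derivative_mult[OF d1 has_vector_derivative_mult[OF d2 d3]] d4])
      then show "((\<lambda>s. ?F (?l s)) has_vector_derivative ?F' x) (at 0)"
        by (simp add: algebra_simps power2_eq_square power_add)
    qed
    moreover have "(\<integral>x. ?F' x \<partial>lborel) = (\<integral>x. ?R i x \<partial>lborel) - complex_of_real (real q * T) * (\<integral>x. ?M i x \<partial>lborel)"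
      using iR[of i] iM[of i] by simp
    ultimately show ?thesis by simp
  qed
  have bM: "cmod (\<integral>x. ?M i x \<partial>lborel) \<le> (1 + norm \<zeta>) * (\<integral>x. (1 + norm x + real j * (norm x)\<^sup>2) * gs (x::real^'n) \<partial>lborel) / T" for i
  proof -
    have "real q * T * cmod (\<integral>x. ?M i x \<partial>lborel) = cmod (\<integral>x. ?R i x \<partial>lborel)"
      using arg_cong[OF main[of i], of cmod] T by (simp add: norm_mult)
    also have "\<dots> \<le> (\<integral>x. (1 + norm \<zeta>) * ((1 + norm x + real j * (norm x)\<^sup>2) * gs (x::real^'n)) \<partial>lborel)"
      by (rule order_trans[OF integral_norm_bound])
         (intro Bochner_Integration.integral_mono integrable_norm iR Rle integrable_mult_right integrable_osc)
    also have "\<dots> = (1 + norm \<zeta>) * (\<integral>x. (1 + norm x + real j * (norm x)\<^sup>2) * gs (x::real^'n) \<partial>lborel)" by simp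
    finally have "real q * T * cmod (\<integral>x. ?M i x \<partial>lborel) \<le> (1 + norm \<zeta>) * (\<integral>x. (1 + norm x + real j * (norm x)\<^sup>2) * gs (x::real^'n) \<partial>lborel)" .
    moreover have "T * cmod (\<integral>x. ?M i x \<partial>lborel) \<le> real q * T * cmod (\<integral>x. ?M i x \<partial>lborel)"
      using q T by (intro mult_right_mono) auto
    ultimately have "T * cmod (\<integral>x. ?M i x \<partial>lborel) \<le> (1 + norm \<zeta>) * (\<integral>x. (1 + norm x + real j * (norm x)\<^sup>2) * gs (x::real^'n) \<partial>lborel)"
      by linarith
    then show ?thesis using T by (simp add: pos_le_divide_eq mult.commute)
  qed
  have n2: "(norm x)\<^sup>2 = (\<Sum>i\<in>UNIV. (x $ i)\<^sup>2)" for x :: "real^'n"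
    by (simp add: norm_vec_def L2_set_def sum_nonneg)
  have sM: "cis (- (x \<bullet> \<zeta>)) * complex_of_real ((norm x)\<^sup>2 * gs x ^ (q + j) * G (T * gs x ^ q)) = (\<Sum>i\<in>UNIV. ?M i x)" for x
    unfolding n2 by (simp add: sum_distrib_right sum_distrib_left)
  have "cmod (\<integral>x. (\<Sum>i\<in>UNIV. ?M i x) \<partial>lborel) = cmod (\<Sum>i\<in>UNIV. \<integral>x. ?M i x \<partial>lborel)"
    by (subst Bochner_Integration.integral_sum) (use iM in auto)
  also have "\<dots> \<le> (\<Sum>i\<in>(UNIV::'n set). (1 + norm \<zeta>) * (\<integral>x. (1 + norm x + real j * (norm x)\<^sup>2) * gs (x::real^'n) \<partial>lborel) / T)"
    by (rule order_trans[OF norm_sum]) (intro sum_mono bM)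
  also have "\<dots> = osc_const TYPE('n) j * (1 + norm \<zeta>) / T" by (simp add: osc_const_def)
  finally show "cmod (\<integral>x. cis (- (x \<bullet> \<zeta>)) * complex_of_real ((norm x)\<^sup>2 * gs x ^ (q + j) * G (T * gs x ^ q)) \<partial>lborel)
     \<le> osc_const TYPE('n) j * (1 + norm \<zeta>) / T"
    unfolding sM .
  show "integrable lborel (\<lambda>x::real^'n. (norm x)\<^sup>2 * gs x ^ (q + j) * G (T * gs x ^ q))"
  proof (rule Bochner_Integration.integrable_bound[OF integrable_mult_right[OF integrable_power_gs[of 2], of BG]])
    show "AE x::real^'n in lborel. norm ((norm x)\<^sup>2 * gs x ^ (q + j) * G (T * gs x ^ q)) \<le> norm (BG * (norm x ^ 2 * gs x))"
    proof (intro AE_I2)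
      fix x :: "real^'n"
      have "(norm x)\<^sup>2 * gs x ^ (q + j) * \<bar>G (T * gs x ^ q)\<bar> \<le> (norm x)\<^sup>2 * gs x * BG"
        using gs_pos[of x] by (intro mult_mono gj BG) auto
      then show "norm ((norm x)\<^sup>2 * gs x ^ (q + j) * G (T * gs x ^ q)) \<le> norm (BG * (norm x ^ 2 * gs x))"
        using gs_pos[of x] BG0 by (simp add: abs_mult mult_ac)
    qed
  qed measurable
qed

section \<open>Growth of the Sobolev norm\<close>

text \<open>Parseval's formula in bilinear form, with inversion used for the factor from the
  algebra.\<close>

lemma integral_mult_fn:
  fixes f :: "'n::finite walg" and g :: "real^'n \<Rightarrow> real"
  assumes g: "integrable lborel g"
  shows "complex_of_real (\<integral>x. g x * fn f x \<partial>lborel) = complex_of_real (fnorm TYPE('n)) * (\<integral>\<eta>. ft f \<eta> * FT g (- \<eta>) \<partial>lborel)"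
proof -
  have "complex_of_real (\<integral>x. g x * fn f x \<partial>lborel) = (\<integral>x. complex_of_real (g x * fn f x) \<partial>lborel)"
    by (rule integral_complex_of_real[symmetric])
  also have "\<dots> = (\<integral>x. complex_of_real (fnorm TYPE('n)) * (complex_of_real (g x) * (\<integral>\<eta>. cis (x \<bullet> \<eta>) * ft f \<eta> \<partial>lborel)) \<partial>lborel)"
  proof (rule Bochner_Integration.integral_cong[OF refl])
    fix x :: "real^'n"
    show "complex_of_real (g x * fn f x) = complex_of_real (fnorm TYPE('n)) * (complex_of_real (g x) * (\<integral>\<eta>. cis (x \<bullet> \<eta>) * ft f \<eta> \<partial>lborel))"
      using walgD(3)[of f x] unfolding inv_fourier_cis by simp
  qed
  also have "\<dots> = complex_of_real (fnorm TYPE('n)) * (\<integral>x. complex_of_real (g x) * (\<integral>\<eta>. cis (x \<bullet> \<eta>) * ft f \<eta> \<partial>lborel) \<partial>lborel)"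
    by (rule integral_mult_right_zero)
  also have "(\<integral>x. complex_of_real (g x) * (\<integral>\<eta>. cis (x \<bullet> \<eta>) * ft f \<eta> \<partial>lborel) \<partial>lborel)
     = (\<integral>\<eta>. ft f \<eta> * (\<integral>x. cis (x \<bullet> \<eta>) * complex_of_real (g x) \<partial>lborel) \<partial>lborel)"
  proof (rule integral_swap_phase[where C=1])
    show "(\<lambda>(x, y). cis ((x::real^'n) \<bullet> (y::real^'n))) \<in> borel_measurable (borel \<Otimes>\<^sub>M borel)"
      unfolding borel_prod by (intro borel_measurable_continuous_onI) (auto simp: split_beta intro!: continuous_intros)
  qed (use g walgD(4)[of f] in auto)
  also have "\<dots> = (\<integral>\<eta>. ft f \<eta> * FT g (- \<eta>) \<partial>lborel)" unfolding fourier_cis by simp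
  finally show ?thesis .
qed

lemma FT_minus: "integrable lborel g \<Longrightarrow> FT g (- \<eta>) = cnj (FT g \<eta>)"
  using fourier_cnj[of "\<lambda>x. complex_of_real (g x)" "- \<eta>"] by (simp add: integrable_of_real)

lemma plancherel_walg:
  fixes f :: "'n::finite walg"
  shows "(\<integral>x. (fn f x)\<^sup>2 \<partial>lborel) = fnorm TYPE('n) * (\<integral>\<eta>. (cmod (ft f \<eta>))\<^sup>2 \<partial>lborel)"
proof -
  have "complex_of_real (\<integral>x. fn f x * fn f x \<partial>lborel) = complex_of_real (fnorm TYPE('n)) * (\<integral>\<eta>. ft f \<eta> * FT (fn f) (- \<eta>) \<partial>lborel)"
    by (rule integral_mult_fn) (rule walgD)
  also have "(\<integral>\<eta>. ft f \<eta> * FT (fn f) (- \<eta>) \<partial>lborel) = (\<integral>\<eta>. complex_of_real ((cmod (ft f \<eta>))\<^sup>2) \<partial>lborel)"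
    unfolding FT_minus[OF walgD(1)] complex_norm_square of_real_power[symmetric] ..
  also have "\<dots> = complex_of_real (\<integral>\<eta>. (cmod (ft f \<eta>))\<^sup>2 \<partial>lborel)" by (rule integral_complex_of_real)
  finally have "complex_of_real (\<integral>x. fn f x * fn f x \<partial>lborel) = complex_of_real (fnorm TYPE('n) * (\<integral>\<eta>. (cmod (ft f \<eta>))\<^sup>2 \<partial>lborel))"
    by (simp only: of_real_mult)
  then show ?thesis unfolding of_real_eq_iff by (simp only: power2_eq_square)
qed

text \<open>In terms of r = sqrt |\<eta>| the bracket is at most (1 + r)^4, and any power of 1 + r
  is dominated by exp (1 + r).\<close>

lemma powr_le_W:
  fixes s :: real
  assumes s: "s \<ge> 0"
  shows "\<exists>C>0. \<forall>\<eta>::real^'n. (1 + (norm \<eta>)\<^sup>2) powr s \<le> C * W \<eta>"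
proof (intro exI conjI allI)
  let ?k = "nat \<lceil>4 * s\<rceil>"
  show "fact ?k * exp 1 > (0::real)" by simp
  fix \<eta> :: "real^'n"
  let ?r = "sqrt (norm \<eta>)"
  have "1 + (norm \<eta>)\<^sup>2 \<le> (1 + norm \<eta>)\<^sup>2" by (simp add: power2_eq_square algebra_simps)
  also have "\<dots> \<le> ((1 + ?r)\<^sup>2)\<^sup>2"
  proof (rule power_mono)
    have "(1 + ?r)\<^sup>2 = 1 + 2 * ?r + norm \<eta>" by (simp add: power2_eq_square algebra_simps)
    then show "1 + norm \<eta> \<le> (1 + ?r)\<^sup>2" by simp
  qed simp
  also have "\<dots> = (1 + ?r) powr 4"
    by (subst powr_numeral) (auto simp: add_pos_nonneg)
  finally have "(1 + (norm \<eta>)\<^sup>2) powr s \<le> ((1 + ?r) powr 4) powr s"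
    using s by (intro powr_mono2) auto
  also have "\<dots> = (1 + ?r) powr (4 * s)" by (rule powr_powr)
  also have "\<dots> \<le> (1 + ?r) powr (real ?k)" by (intro powr_mono real_nat_ceiling_ge) simp
  also have "\<dots> = (1 + ?r) ^ ?k" by (intro powr_realpow) (simp add: add_pos_nonneg)
  also have "\<dots> \<le> fact ?k * exp (1 + ?r)" by (rule power_le_exp) simp
  also have "\<dots> = fact ?k * exp 1 * W \<eta>" by (simp add: exp_add W_def)
  finally show "(1 + (norm \<eta>)\<^sup>2) powr s \<le> fact ?k * exp 1 * W \<eta>" .
qed

lemma powr_le_bracket: "s \<ge> 0 \<Longrightarrow> norm \<eta> powr (2 * s) \<le> (1 + (norm \<eta>)\<^sup>2) powr s"
proof -
  assume s: "s \<ge> 0"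
  have "norm \<eta> powr (2 * s) = ((norm \<eta>)\<^sup>2) powr s"
    by (cases "norm \<eta> = 0") (auto simp: powr_powr[symmetric] powr_numeral)
  also have "\<dots> \<le> (1 + (norm \<eta>)\<^sup>2) powr s" using s by (intro powr_mono2) auto
  finally show ?thesis .
qed

lemma integrable_weight_mult_ft:
  fixes f g :: "'n::finite walg" and w :: "real^'n \<Rightarrow> real"
  assumes [measurable]: "w \<in> borel_measurable borel" and w: "\<And>\<eta>. \<bar>w \<eta>\<bar> \<le> C * W \<eta>"
  shows "integrable lborel (\<lambda>\<eta>. w \<eta> * (cmod (ft f \<eta>) * cmod (ft g \<eta>)))"
proof (rule Bochner_Integration.integrable_bound[OF integrable_mult_right[OF walgD(2)[of g], of "C * norm f"]])
  note [measurable] = walgD(6)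
  show "(\<lambda>\<eta>. w \<eta> * (cmod (ft f \<eta>) * cmod (ft g \<eta>))) \<in> borel_measurable lborel" by measurable
  show "AE \<eta> in lborel. norm (w \<eta> * (cmod (ft f \<eta>) * cmod (ft g \<eta>))) \<le> norm (C * norm f * (W \<eta> * cmod (ft g \<eta>)))"
  proof (intro AE_I2)
    fix \<eta> :: "real^'n"
    have "norm (w \<eta> * (cmod (ft f \<eta>) * cmod (ft g \<eta>))) = \<bar>w \<eta>\<bar> * (cmod (ft f \<eta>) * cmod (ft g \<eta>))"
      by (simp add: abs_mult)
    also have "\<dots> \<le> (C * W \<eta>) * (norm f * cmod (ft g \<eta>))"
      by (intro mult_mono w cmod_ft_le mult_right_mono order_trans[OF abs_ge_zero w]) auto
    also have "\<dots> \<le> norm (C * norm f * (W \<eta> * cmod (ft g \<eta>)))"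
      unfolding real_norm_def by (rule order_trans[OF _ abs_ge_self]) (simp add: mult_ac)
    finally show "norm (w \<eta> * (cmod (ft f \<eta>) * cmod (ft g \<eta>))) \<le> norm (C * norm f * (W \<eta> * cmod (ft g \<eta>)))" .
  qed
qed

section \<open>The homogeneous Sobolev energy\<close>

definition hom_energy :: "real \<Rightarrow> 'n::finite walg \<Rightarrow> real" where
  "hom_energy s f = (\<integral>\<eta>. norm \<eta> powr (2 * s) * (cmod (ft f \<eta>))\<^sup>2 \<partial>lborel)"

lemma norm_powr_le_W:
  fixes s :: real assumes s: "s > 0"
  obtains C where "C > 0" "\<And>\<eta>::real^'n. \<bar>norm \<eta> powr (2 * s)\<bar> \<le> C * W \<eta>"
proof -
  obtain C where "C > 0" "\<And>\<eta>::real^'n. (1 + (norm \<eta>)\<^sup>2) powr s \<le> C * W \<eta>"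
    using powr_le_W[of s] s by auto
  with that[of C] show ?thesis using order_trans[OF powr_le_bracket] s by (metis abs_of_nonneg less_imp_le powr_ge_zero)
qed

lemma integrable_hom_energy:
  fixes f :: "'n::finite walg"
  assumes s: "s > 0"
  shows "integrable lborel (\<lambda>\<eta>. norm \<eta> powr (2 * s) * (cmod (ft f \<eta>))\<^sup>2)"
proof -
  obtain C where "C > 0" and C: "\<And>\<eta>::real^'n. \<bar>norm \<eta> powr (2 * s)\<bar> \<le> C * W \<eta>" using norm_powr_le_W[OF s] by blast
  show ?thesis unfolding power2_eq_square
    by (rule integrable_weight_mult_ft[OF _ C]) measurable
qed

text \<open>In the difference of squares, the sum of the two transforms is bounded by the norms, and
  their difference is integrated against the weight. Hence growth of the energy for the pointwise
  solution survives a perturbation that is small in the algebra.\<close>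

lemma hom_energy_diff_le:
  fixes s :: real
  assumes s: "s > 0"
  shows "\<exists>C>0. \<forall>f g :: 'n::finite walg. \<bar>hom_energy s f - hom_energy s g\<bar> \<le> C * (norm (f - g) * (norm f + norm g))"
proof -
  obtain C where C0: "C > 0" and C: "\<And>\<eta>::real^'n. \<bar>norm \<eta> powr (2 * s)\<bar> \<le> C * W \<eta>" using norm_powr_le_W[OF s] by blast
  define K where "K = C / fnorm TYPE('n)"
  have f0: "fnorm TYPE('n) > 0" by (rule fnorm_pos)
  have "\<bar>hom_energy s f - hom_energy s g\<bar> \<le> K * (norm (f - g) * (norm f + norm g))" for f g :: "'n walg"
  proof -
    have "hom_energy s f - hom_energy s g = (\<integral>\<eta>. norm \<eta> powr (2 * s) * (cmod (ft f \<eta>))\<^sup>2 - norm \<eta> powr (2 * s) * (cmod (ft g \<eta>))\<^sup>2 \<partial>lborel)"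
      unfolding hom_energy_def by (rule Bochner_Integration.integral_diff[symmetric]) (intro integrable_hom_energy s)+
    also have "\<bar>\<dots>\<bar> \<le> (\<integral>\<eta>. C * (norm f + norm g) * (W \<eta> * cmod (ft (f - g) \<eta>)) \<partial>lborel)"
    proof (rule order_trans[OF integral_abs_bound], rule Bochner_Integration.integral_mono)
      show "integrable lborel (\<lambda>\<eta>. \<bar>norm \<eta> powr (2 * s) * (cmod (ft f \<eta>))\<^sup>2 - norm \<eta> powr (2 * s) * (cmod (ft g \<eta>))\<^sup>2\<bar>)"
        by (intro integrable_abs Bochner_Integration.integrable_diff integrable_hom_energy s)
      show "integrable lborel (\<lambda>\<eta>. C * (norm f + norm g) * (W \<eta> * cmod (ft (f - g) \<eta>)))"
        by (intro integrable_mult_right walgD)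
      fix \<eta> :: "real^'n"
      have "norm \<eta> powr (2 * s) * (cmod (ft f \<eta>))\<^sup>2 - norm \<eta> powr (2 * s) * (cmod (ft g \<eta>))\<^sup>2
          = norm \<eta> powr (2 * s) * ((cmod (ft f \<eta>) + cmod (ft g \<eta>)) * (cmod (ft f \<eta>) - cmod (ft g \<eta>)))"
        by (simp add: algebra_simps power2_eq_square)
      also have "\<bar>\<dots>\<bar> = \<bar>norm \<eta> powr (2 * s)\<bar> * ((cmod (ft f \<eta>) + cmod (ft g \<eta>)) * \<bar>cmod (ft f \<eta>) - cmod (ft g \<eta>)\<bar>)"
        by (simp add: abs_mult)
      also have "\<dots> \<le> (C * W \<eta>) * ((norm f + norm g) * cmod (ft (f - g) \<eta>))"
      proof (intro mult_mono C cmod_ft_le add_mono)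
        show "\<bar>cmod (ft f \<eta>) - cmod (ft g \<eta>)\<bar> \<le> cmod (ft (f - g) \<eta>)"
          unfolding ft_diff by (rule norm_triangle_ineq3)
      qed (use C0 in auto)
      finally show "\<bar>norm \<eta> powr (2 * s) * (cmod (ft f \<eta>))\<^sup>2 - norm \<eta> powr (2 * s) * (cmod (ft g \<eta>))\<^sup>2\<bar>
         \<le> C * (norm f + norm g) * (W \<eta> * cmod (ft (f - g) \<eta>))" by (simp add: mult_ac)
    qed
    also have "\<dots> = C * (norm f + norm g) * (\<integral>\<eta>. W \<eta> * cmod (ft (f - g) \<eta>) \<partial>lborel)" by simp
    also have "\<dots> = K * (norm f + norm g) * wnorm (fn (f - g))"
      using f0 by (simp add: K_def wnorm_def)
    also have "\<dots> \<le> K * (norm f + norm g) * norm (f - g)"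
      using C0 f0 by (intro mult_left_mono wnorm_le_norm) (auto simp: K_def)
    finally show ?thesis by (simp add: mult_ac)
  qed
  moreover have "K > 0" using C0 f0 by (simp add: K_def)
  ultimately show ?thesis by blast
qed

lemma osc_const_nonneg: "osc_const TYPE('n::finite) j \<ge> 0"
  unfolding osc_const_def
  by (intro mult_nonneg_nonneg Bochner_Integration.integral_nonneg add_nonneg_nonneg less_imp_le[OF gs_pos]
      of_nat_0_le_iff norm_ge_zero zero_le_power zero_le_one)

lemma integrable_moment_gs_power:
  assumes j: "j \<ge> 1"
  shows "integrable lborel (\<lambda>x::real^'n. norm x ^ k * gs x ^ j)"
proof (rule Bochner_Integration.integrable_bound[OF integrable_power_gs[of k]])
  show "AE x::real^'n in lborel. norm (norm x ^ k * gs x ^ j) \<le> norm (norm x ^ k * gs x)"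
  proof (intro AE_I2)
    fix x :: "real^'n"
    have "norm x ^ k * gs x ^ j \<le> norm x ^ k * gs x" by (intro mult_left_mono gs_power_le[OF j]) simp
    then show "norm (norm x ^ k * gs x ^ j) \<le> norm (norm x ^ k * gs x)"
      by (simp add: abs_mult power_abs abs_of_pos[OF gs_pos])
  qed
qed measurable

lemma second_moment_pos: "(\<integral>x. (norm x)\<^sup>2 * gs (x::real^'n) ^ j \<partial>lborel) > 0" if j: "j \<ge> 1"
proof -
  have i: "integrable lborel (\<lambda>x::real^'n. (norm x)\<^sup>2 * gs x ^ j)"
    by (rule integrable_moment_gs_power[OF j])
  have nn: "(norm x)\<^sup>2 * gs (x::real^'n) ^ j \<ge> 0" for x using gs_pos[of x] by simp
  have "(\<integral>x. (norm x)\<^sup>2 * gs (x::real^'n) ^ j \<partial>lborel) \<noteq> 0"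
  proof
    assume "(\<integral>x. (norm x)\<^sup>2 * gs (x::real^'n) ^ j \<partial>lborel) = 0"
    then have "AE x::real^'n in lborel. (norm x)\<^sup>2 * gs x ^ j = 0"
      using integral_nonneg_eq_0_iff_AE[OF i] nn by auto
    moreover have "AE x::real^'n in lborel. x \<noteq> 0" by (rule AE_lborel_singleton)
    ultimately have "AE x::real^'n in lborel. False"
    proof eventually_elim
      case (elim x)
      then show ?case using gs_pos[of x] by simp
    qed
    then have "emeasure lborel (UNIV :: (real^'n) set) = 0"
      unfolding eventually_False ae_filter_eq_bot_iff by simp
    then show False by simp
  qed
  then show ?thesis using Bochner_Integration.integral_nonneg[of lborel "\<lambda>x::real^'n. (norm x)\<^sup>2 * gs x ^ j"] nn by fastforce
qed

text \<open>The weight |x|^2 gs, required by the oscillation estimate, as an element of the algebra;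
  it is recovered from the Laplacian of the Gaussian.\<close>

definition kap :: "'n::finite walg" where "kap = lphi + real CARD('n) *\<^sub>R phi"

lemma fn_kap: "fn kap x = (norm x)\<^sup>2 * gs x"
  by (simp add: kap_def fn_lphi fn_phi lg_def algebra_simps)

text \<open>Let V be the scalar solution with V(0) = 1 and put t = T gs(x)^q. By scaling, g is |x|^2
  gs^(2 q + 2) V(t)^(2 q + 1), where V^(2 q + 1) = - V'' is the derivative of a bounded function; so
  oscillation makes the transform of g of order 1 / T. In contrast, g v contains V^(2 q + 2), whose
  mean is positive: conservation of energy and (V V')' = V'^2 - V^(2 q + 2) give V^(2 q + 2) = 2 /
  (c + 2) - (c / (c + 2)) (V V')' with c = 2 q + 2, and the last term oscillates away.\<close>

lemma ode_sol_duality: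
  fixes v z :: "real \<Rightarrow> 'n::finite walg"
  assumes q: "q \<ge> 1" and T: "T > 0" and sol: "ode_sol (2 * q) T v z"
  defines "g \<equiv> kap * pw (v T) (2 * q)"
  shows "cmod (ft g \<zeta>) \<le> osc_const TYPE('n) (q + 2) * (1 + norm \<zeta>) / T"
    and "(\<integral>x. fn g x * fn (v T) x \<partial>lborel) \<ge> 2 / (2 * real q + 4) * (\<integral>x. (norm x)\<^sup>2 * gs (x::real^'n) ^ (2 * q + 3) \<partial>lborel) - osc_const TYPE('n) (q + 3) / T"
proof -
  let ?m = "2 * q"
  let ?V = "\<lambda>t. fn (v t) 0" and ?Z = "\<lambda>t. fn (z t) 0"
  have dV: "(?V has_real_derivative ?Z t) (at t within {0..T})"
    and dZ: "(?Z has_real_derivative - (?V t ^ Suc ?m)) (at t within {0..T})" if "t \<in> {0..T}" for t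
    using ode_sol_fn[OF sol that] by auto
  have cV: "continuous_on {0..T} ?V" and cZ: "continuous_on {0..T} ?Z"
    using dV dZ by (meson DERIV_continuous continuous_on_eq_continuous_within)+
  have V1: "\<bar>?V t\<bar> \<le> 1" and Z1: "\<bar>?Z t\<bar> \<le> 1" if "t \<in> {0..T}" for t
    using ode_sol_bounds[OF sol _ that, of 0] by (auto simp: gs_0)
  have en: "(?Z t)\<^sup>2 = 2 / (real ?m + 2) - 2 / (real ?m + 2) * ?V t ^ (?m + 2)" if "t \<in> {0..T}" for t
  proof -
    have "(?Z t)\<^sup>2 = 2 * (1 / (real ?m + 2)) - 2 * (?V t ^ (?m + 2) / (real ?m + 2))"
      using ode_sol_energy[OF sol that, of 0, unfolded gs_0 power_one] by linarith
    then show ?thesis by (simp only: times_divide_eq_right times_divide_eq_left mult_1_right)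
  qed
  have T0: "T \<in> {0..T}" using T by simp
  have psi: "T * gs x ^ q \<in> {0..T}" for x :: "real^'n"
    using T gs_pos[of x] gs_le_1[of x] by (auto simp: mult_left_le power_le_one)
  have fv: "fn (v T) x = gs x * ?V (T * gs x ^ q)" for x by (rule ode_sol_scaling[OF sol T0])
  have fg: "fn g x = (norm x)\<^sup>2 * gs x ^ (q + (q + 2)) * ?V (T * gs x ^ q) ^ Suc ?m" for x
    unfolding g_def fn_mult fn_kap fn_pw fv power_mult_distrib
    by (simp add: power_add power_mult power2_eq_square mult_ac power_mult_distrib)
  have "cmod (ft g \<zeta>) = cmod (\<integral>x. cis (- (x \<bullet> \<zeta>)) * complex_of_real ((norm x)\<^sup>2 * gs x ^ (q + (q + 2)) * ?V (T * gs x ^ q) ^ Suc ?m) \<partial>lborel)"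
    unfolding fourier_cis fg ..
  also have "\<dots> \<le> osc_const TYPE('n) (q + 2) * (1 + norm \<zeta>) / T"
  proof (rule oscillation(1)[where U="\<lambda>t. - ?Z t"])
    show "((\<lambda>t. - ?Z t) has_real_derivative ?V t ^ Suc ?m) (at t within {0..T})" if "t \<in> {0..T}" for t
      using DERIV_minus[OF dZ[OF that]] by simp
    show "continuous_on {0..T} (\<lambda>t. ?V t ^ Suc ?m)" by (intro continuous_intros cV)
  qed (use T q Z1 in auto)
  finally show "cmod (ft g \<zeta>) \<le> osc_const TYPE('n) (q + 2) * (1 + norm \<zeta>) / T" .
  let ?G = "\<lambda>t. ?Z t * ?Z t - ?V t * ?V t ^ Suc ?m"
  let ?c = "real ?m + 2"
  have osc: "\<bar>\<integral>x. (norm x)\<^sup>2 * gs (x::real^'n) ^ (q + (q + 3)) * ?G (T * gs x ^ q) \<partial>lborel\<bar> \<le> osc_const TYPE('n) (q + 3) / T"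
    and iG: "integrable lborel (\<lambda>x::real^'n. (norm x)\<^sup>2 * gs x ^ (q + (q + 3)) * ?G (T * gs x ^ q))"
  proof -
    have d: "((\<lambda>t. ?V t * ?Z t) has_real_derivative ?G t) (at t within {0..T})" if "t \<in> {0..T}" for t
      using DERIV_mult[OF dV[OF that] dZ[OF that]] by (simp add: algebra_simps)
    have c: "continuous_on {0..T} ?G" by (intro continuous_intros cV cZ)
    have b: "\<bar>?V t * ?Z t\<bar> \<le> 1" if "t \<in> {0..T}" for t
      using V1[OF that] Z1[OF that] by (simp add: abs_mult mult_le_one)
    have "q + 3 \<ge> 1" by simp
    note o = oscillation[OF T q this d c b]
    show "integrable lborel (\<lambda>x::real^'n. (norm x)\<^sup>2 * gs x ^ (q + (q + 3)) * ?G (T * gs x ^ q))" by (rule o(2))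
    have "cmod (\<integral>x. cis (- (x \<bullet> 0)) * complex_of_real ((norm x)\<^sup>2 * gs (x::real^'n) ^ (q + (q + 3)) * ?G (T * gs x ^ q)) \<partial>lborel)
       \<le> osc_const TYPE('n) (q + 3) * (1 + norm (0::real^'n)) / T" by (rule o(1))
    then show "\<bar>\<integral>x. (norm x)\<^sup>2 * gs (x::real^'n) ^ (q + (q + 3)) * ?G (T * gs x ^ q) \<partial>lborel\<bar> \<le> osc_const TYPE('n) (q + 3) / T"
      by (simp only: inner_zero_right minus_zero cis_zero mult_1 integral_complex_of_real norm_of_real norm_zero add_0_right mult_1_right)
  qed
  let ?w = "\<lambda>x::real^'n. (norm x)\<^sup>2 * gs x ^ (2 * q + 3)"
  have iw: "integrable lborel ?w"
    by (rule integrable_moment_gs_power) simp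
  have pt: "fn g x * fn (v T) x = 2 / (?c + 2) * ?w x - ?c / (?c + 2) * ((norm x)\<^sup>2 * gs x ^ (q + (q + 3)) * ?G (T * gs x ^ q))" for x :: "real^'n"
  proof -
    let ?y = "?V (T * gs x ^ q) ^ (?m + 2)"
    have a: "fn g x * fn (v T) x = ?w x * ?y"
      unfolding fg fv by (simp add: power_add power_mult power2_eq_square power3_eq_cube mult_ac power_mult_distrib)
    have b: "?G (T * gs x ^ q) = 2 / ?c - (?c + 2) / ?c * ?y"
    proof -
      have "?G (T * gs x ^ q) = (?Z (T * gs x ^ q))\<^sup>2 - ?y" by (simp add: power2_eq_square)
      moreover have "2 / d - 2 / d * y - y = 2 / d - (d + 2) / d * y" if "d \<noteq> 0" for d y :: real
        using that by (simp add: field_simps)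
      ultimately show ?thesis unfolding en[OF psi] by simp
    qed
    have e: "q + (q + 3) = 2 * q + 3" by simp
    have "?w x * ?y = 2 / (?c + 2) * ?w x - ?c / (?c + 2) * (?w x * (2 / ?c - (?c + 2) / ?c * ?y))"
    proof -
      have eq: "w * y = 2 / (d + 2) * w - d / (d + 2) * (w * (2 / d - (d + 2) / d * y))" if "d > 0" for d w y :: real
      proof -
        have "d / (d + 2) * (w * (2 / d - (d + 2) / d * y)) = 2 / (d + 2) * w - w * y"
          using that by (simp add: right_diff_distrib)
        then show ?thesis by simp
      qed
      show ?thesis by (rule eq) simp
    qed
    then show ?thesis unfolding a b e .
  qed
  define w where "w x = ?w x" for x
  define h where "h x = (norm x)\<^sup>2 * gs x ^ (q + (q + 3)) * ?G (T * gs x ^ q)" for x :: "real^'n"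
  have "(\<lambda>x. fn g x * fn (v T) x) = (\<lambda>x. 2 / (?c + 2) * w x - ?c / (?c + 2) * h x)"
    by (rule ext) (unfold w_def h_def, rule pt)
  then have "(\<integral>x. fn g x * fn (v T) x \<partial>lborel) = (\<integral>x. 2 / (?c + 2) * w x - ?c / (?c + 2) * h x \<partial>lborel)"
    by (rule arg_cong[where f="integral\<^sup>L lborel"])
  also have "\<dots> = (\<integral>x. 2 / (?c + 2) * w x \<partial>lborel) - (\<integral>x. ?c / (?c + 2) * h x \<partial>lborel)"
    by (intro Bochner_Integration.integral_diff integrable_mult_right; unfold w_def h_def; intro iw iG)
  also have "\<dots> = 2 / (?c + 2) * (\<integral>x. w x \<partial>lborel) - ?c / (?c + 2) * (\<integral>x. h x \<partial>lborel)"
    unfolding integral_mult_right_zero ..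
  also have "\<dots> \<ge> 2 / (?c + 2) * (\<integral>x. w x \<partial>lborel) - osc_const TYPE('n) (q + 3) / T"
  proof -
    let ?I = "\<integral>x. h x \<partial>lborel"
    have "?c / (?c + 2) * ?I \<le> ?c / (?c + 2) * \<bar>?I\<bar>" by (intro mult_left_mono) auto
    also have "\<dots> \<le> 1 * \<bar>?I\<bar>" by (intro mult_right_mono) auto
    also have "\<dots> \<le> osc_const TYPE('n) (q + 3) / T" using osc unfolding h_def by simp
    finally show ?thesis by simp
  qed
  finally show "(\<integral>x. fn g x * fn (v T) x \<partial>lborel) \<ge> 2 / (2 * real q + 4) * (\<integral>x. (norm x)\<^sup>2 * gs (x::real^'n) ^ (2 * q + 3) \<partial>lborel) - osc_const TYPE('n) (q + 3) / T"
    by (simp add: add.commute w_def)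
qed

text \<open>The pairing with g stays bounded below while \<open>ft g\<close> tends to 0 on bounded sets,
  so the spectrum of the solution must move to infinity.\<close>

theorem hom_energy_unbounded:
  fixes B s :: real
  assumes q: "q \<ge> 1" and s: "s > 0"
  shows "\<exists>T>0. \<exists>v z :: real \<Rightarrow> 'n::finite walg. ode_sol (2 * q) T v z \<and> hom_energy s (v T) > B"
proof (rule ccontr)
  assume neg: "\<not> ?thesis"
  define c where "c = 2 / (2 * real q + 4) * (\<integral>x. (norm x)\<^sup>2 * gs (x::real^'n) ^ (2 * q + 3) \<partial>lborel)"
  define M where "M = (\<integral>x. norm x ^ 4 * gs (x::real^'n) \<partial>lborel)"
  define F where "F = fnorm TYPE('n)"
  \<comment> \<open>The weight in the inequality |f| |g| \<le> (\<theta> / 2) |g|^2 + |f|^2 / (2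
    \<theta>) at high frequencies: by Plancherel's theorem the first term contributes at most c /
    4.\<close>
  define \<theta> where "\<theta> = c / (2 * (M + 1))"
  define B' where "B' = \<bar>B\<bar> + 1"
  \<comment> \<open>Beyond the radius R one has |\<eta>|^(2 s) \<ge> X, and there the bound B' on
    the energy makes the second term at most c / 4.\<close>
  define X where "X = 4 * F * B' / (2 * \<theta> * c) + 1"
  define R where "R = X powr (1 / (2 * s))"
  define vol where "vol = measure lborel (cball (0::real^'n) R)"
  define L where "L = lnorm (gs :: real^'n \<Rightarrow> real)"
  define o2 where "o2 = osc_const TYPE('n) (q + 2)"
  define o3 where "o3 = osc_const TYPE('n) (q + 3)"
  define K where "K = o3 + F * (L * (o2 * (1 + R)) * vol)"
  \<comment> \<open>K gathers what decays like 1 / T, namely the oscillating part of the pairing and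
    the frequencies below R. As R is fixed before T, this can be made at most c / 8, and the
    contradiction is c \<le> c / 8 + c / 4 + c / 4.\<close>
  define T where "T = 1 + 8 * K / c"
  have c: "c > 0" unfolding c_def by (intro mult_pos_pos second_moment_pos) auto
  have M: "M \<ge> 0" unfolding M_def by (intro Bochner_Integration.integral_nonneg mult_nonneg_nonneg zero_le_power norm_ge_zero less_imp_le[OF gs_pos])
  have F: "F > 0" by (simp add: F_def fnorm_pos)
  have \<theta>: "\<theta> > 0" using c M by (simp add: \<theta>_def)
  have B': "B' > 0" by (simp add: B'_def)
  have X: "X > 1" using F B' \<theta> c by (simp add: X_def)
  have R: "R > 0" "R powr (2 * s) = X" using X s by (simp_all add: R_def powr_powr)
  have L: "L \<ge> 0" unfolding L_def by (rule lnorm_nonneg)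
  have o: "o2 \<ge> 0" "o3 \<ge> 0" by (simp_all add: o2_def o3_def osc_const_nonneg)
  have K: "K \<ge> 0" unfolding K_def using o F L R by (intro add_nonneg_nonneg mult_nonneg_nonneg) (auto simp: vol_def)
  have T: "T \<ge> 1" using K c by (simp add: T_def)
  have KT: "K / T \<le> c / 8"
  proof -
    have "K \<le> c / 8 * T" using c K by (simp add: T_def field_simps)
    then show ?thesis using T by (simp add: pos_divide_le_eq)
  qed
  have "T > 0" using T by simp
  obtain v z where sol: "ode_sol (2 * q) T (v :: real \<Rightarrow> 'n walg) z"
    using ode_sol_exists[of "2 * q" T] \<open>T > 0\<close> by auto
  have Q: "hom_energy s (v T) \<le> B'"
    using neg sol \<open>T > 0\<close> by (force simp: B'_def not_less)
  define f where "f = v T"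
  define g where "g = kap * pw (v T) (2 * q)"
  have dual: "cmod (ft g \<zeta>) \<le> o2 * (1 + norm \<zeta>) / T" "(\<integral>x. fn g x * fn f x \<partial>lborel) \<ge> c - o3 / T" for \<zeta>
    using ode_sol_duality[OF q \<open>T > 0\<close> sol] by (simp_all add: o2_def o3_def c_def g_def f_def)
  have T0: "T \<in> {0..T}" using T by simp
  have fle: "\<bar>fn f x\<bar> \<le> gs x" for x unfolding f_def by (rule ode_sol_bounds[OF sol _ T0]) simp
  have ftf: "cmod (ft f \<eta>) \<le> L" for \<eta>
  proof -
    have "lnorm (fn f) \<le> lnorm (gs :: real^'n \<Rightarrow> real)"
      unfolding lnorm_def using fle gs_pos[where 'a='n]
      by (intro Bochner_Integration.integral_mono integrable_abs integrable_gs walgD) (auto simp: less_imp_le)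
    then show ?thesis unfolding L_def using FT_le_lnorm[of "fn f" \<eta>] by linarith
  qed
  have gle: "\<bar>fn g x\<bar> \<le> (norm x)\<^sup>2 * gs x" for x
  proof -
    have "\<bar>fn f x\<bar> ^ Suc (2 * q) \<le> 1" using fle[of x] gs_le_1[of x] by (intro power_le_one) auto
    then show ?thesis unfolding g_def f_def[symmetric] fn_mult fn_kap fn_pw abs_mult power_abs[symmetric]
      using gs_pos[of x] by (simp del: power_Suc add: abs_mult mult_left_le)
  qed
  have iM: "integrable lborel (\<lambda>x::real^'n. norm x ^ 4 * gs x)" by (rule integrable_power_gs)
  have g2: "(\<integral>\<eta>. (cmod (ft g \<eta>))\<^sup>2 \<partial>lborel) \<le> M / F"
  proof -
    have le: "(fn g x)\<^sup>2 \<le> norm x ^ 4 * gs x" for x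
    proof -
      have "(fn g x)\<^sup>2 \<le> ((norm x)\<^sup>2 * gs x)\<^sup>2" using gle[of x] by (metis abs_ge_zero power2_abs power_mono)
      also have "\<dots> = norm x ^ 4 * gs x ^ 2" by (simp add: power_mult_distrib power_mult[symmetric])
      also have "\<dots> \<le> norm x ^ 4 * gs x" by (intro mult_left_mono gs_power_le) auto
      finally show ?thesis .
    qed
    have "(\<integral>x. (fn g x)\<^sup>2 \<partial>lborel) \<le> M"
      unfolding M_def
      by (rule integral_mono_AE'[OF iM]; intro AE_I2 le mult_nonneg_nonneg zero_le_power norm_ge_zero less_imp_le[OF gs_pos])
    then show ?thesis unfolding plancherel_walg F_def using F by (simp add: F_def pos_le_divide_eq mult.commute)
  qed
  have ig: "integrable lborel (\<lambda>\<eta>. (cmod (ft g \<eta>))\<^sup>2)"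
    using integrable_weight_mult_ft[of "\<lambda>_. 1" 1 g g] by (simp add: power2_eq_square)
  have iQ: "integrable lborel (\<lambda>\<eta>. norm \<eta> powr (2 * s) * (cmod (ft f \<eta>))\<^sup>2)" by (rule integrable_hom_energy[OF s])
  have ib: "integrable lborel (indicator (cball (0::real^'n) R) :: _ \<Rightarrow> real)"
    by (rule integrable_real_indicator) (simp_all add: emeasure_lborel_cball_finite[unfolded infinity_ennreal_def])
  let ?b = "\<lambda>\<eta>::real^'n. (L * (o2 * (1 + R) / T)) * indicator (cball 0 R) \<eta> + (\<theta> / 2 * (cmod (ft g \<eta>))\<^sup>2 + 1 / (2 * \<theta> * X) * (norm \<eta> powr (2 * s) * (cmod (ft f \<eta>))\<^sup>2))"
  have pt: "cmod (ft f \<eta> * FT (fn g) (- \<eta>)) \<le> ?b \<eta>" for \<eta>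
  proof -
    have e: "cmod (ft f \<eta> * FT (fn g) (- \<eta>)) = cmod (ft f \<eta>) * cmod (ft g \<eta>)"
      by (simp add: FT_minus[OF walgD(1)] norm_mult)
    show ?thesis
    proof (cases "norm \<eta> \<le> R")
      case True
      have "cmod (ft f \<eta>) * cmod (ft g \<eta>) \<le> L * (o2 * (1 + R) / T)"
      proof (intro mult_mono ftf L)
        have "o2 * (1 + norm \<eta>) / T \<le> o2 * (1 + R) / T" using True o T by (intro divide_right_mono mult_left_mono) auto
        then show "cmod (ft g \<eta>) \<le> o2 * (1 + R) / T" using dual(1)[of \<eta>] by linarith
      qed auto
      moreover have "0 \<le> \<theta> / 2 * (cmod (ft g \<eta>))\<^sup>2 + 1 / (2 * \<theta> * X) * (norm \<eta> powr (2 * s) * (cmod (ft f \<eta>))\<^sup>2)"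
        using \<theta> X by (intro add_nonneg_nonneg mult_nonneg_nonneg) auto
      ultimately show ?thesis unfolding e using True by simp
    next
      case False
      let ?a = "cmod (ft f \<eta>)" and ?c = "cmod (ft g \<eta>)"
      have "?a * ?c \<le> \<theta> / 2 * ?c\<^sup>2 + 1 / (2 * \<theta>) * ?a\<^sup>2"
      proof -
        have "0 \<le> (\<theta> * ?c - ?a)\<^sup>2" by simp
        then show ?thesis using \<theta> by (simp add: field_simps power2_eq_square)
      qed
      also have "1 / (2 * \<theta>) * ?a\<^sup>2 \<le> 1 / (2 * \<theta> * X) * (norm \<eta> powr (2 * s) * ?a\<^sup>2)"
      proof -
        have "X \<le> norm \<eta> powr (2 * s)" unfolding R(2)[symmetric] using False R s by (intro powr_mono2) auto
        then have "X * ?a\<^sup>2 \<le> norm \<eta> powr (2 * s) * ?a\<^sup>2" by (intro mult_right_mono) auto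
        then have "1 / (2 * \<theta> * X) * (X * ?a\<^sup>2) \<le> 1 / (2 * \<theta> * X) * (norm \<eta> powr (2 * s) * ?a\<^sup>2)"
          using \<theta> X by (intro mult_left_mono) auto
        moreover have "1 / (2 * \<theta> * X) * (X * ?a\<^sup>2) = 1 / (2 * \<theta>) * ?a\<^sup>2" using X by simp
        ultimately show ?thesis by linarith
      qed
      finally show ?thesis unfolding e using False by simp
    qed
  qed
  have ib': "integrable lborel ?b"
    by (intro Bochner_Integration.integrable_add integrable_mult_right ib ig iQ)
  have "(\<integral>x. fn g x * fn f x \<partial>lborel) = cmod (complex_of_real (\<integral>x. fn g x * fn f x \<partial>lborel))"
    if "(\<integral>x. fn g x * fn f x \<partial>lborel) \<ge> 0" using that by simp
  then have "(\<integral>x. fn g x * fn f x \<partial>lborel) \<le> cmod (complex_of_real (\<integral>x. fn g x * fn f x \<partial>lborel))" by simp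
  also have "\<dots> = F * cmod (\<integral>\<eta>. ft f \<eta> * FT (fn g) (- \<eta>) \<partial>lborel)"
    unfolding integral_mult_fn[OF walgD(1)] norm_mult F_def using F by (simp add: F_def)
  also have "\<dots> \<le> F * (\<integral>\<eta>. ?b \<eta> \<partial>lborel)"
  proof (intro mult_left_mono order_trans[OF integral_norm_bound])
    show "(\<integral>\<eta>. cmod (ft f \<eta> * FT (fn g) (- \<eta>)) \<partial>lborel) \<le> (\<integral>\<eta>. ?b \<eta> \<partial>lborel)"
    proof (rule integral_mono_AE'[OF ib'])
      show "AE \<eta> in lborel. cmod (ft f \<eta> * FT (fn g) (- \<eta>)) \<le> ?b \<eta>" by (intro AE_I2 pt)
      show "AE \<eta> in lborel. 0 \<le> ?b \<eta>" by (intro AE_I2 order_trans[OF norm_ge_zero pt])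
    qed
  qed (use F in simp)
  also have "(\<integral>\<eta>. ?b \<eta> \<partial>lborel) = (L * (o2 * (1 + R) / T)) * vol + (\<theta> / 2 * (\<integral>\<eta>. (cmod (ft g \<eta>))\<^sup>2 \<partial>lborel) + 1 / (2 * \<theta> * X) * hom_energy s f)"
    unfolding hom_energy_def vol_def
    by (simp only: Bochner_Integration.integral_add[OF integrable_mult_right[OF ib] Bochner_Integration.integrable_add[OF integrable_mult_right[OF ig] integrable_mult_right[OF iQ]]]
        Bochner_Integration.integral_add[OF integrable_mult_right[OF ig] integrable_mult_right[OF iQ]] integral_mult_right_zero) simp
  also have "F * \<dots> = F * (L * (o2 * (1 + R)) * vol) / T + F * (\<theta> / 2 * (\<integral>\<eta>. (cmod (ft g \<eta>))\<^sup>2 \<partial>lborel)) + F * (1 / (2 * \<theta> * X) * hom_energy s f)"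
    by (simp add: algebra_simps)
  finally have main: "c - o3 / T \<le> F * (L * (o2 * (1 + R)) * vol) / T + F * (\<theta> / 2 * (\<integral>\<eta>. (cmod (ft g \<eta>))\<^sup>2 \<partial>lborel)) + F * (1 / (2 * \<theta> * X) * hom_energy s f)"
    using dual(2) by linarith
  have t1: "F * (\<theta> / 2 * (\<integral>\<eta>. (cmod (ft g \<eta>))\<^sup>2 \<partial>lborel)) \<le> c / 4"
  proof -
    have "F * (\<theta> / 2 * (\<integral>\<eta>. (cmod (ft g \<eta>))\<^sup>2 \<partial>lborel)) \<le> F * (\<theta> / 2 * (M / F))"
      using F \<theta> by (intro mult_left_mono g2) auto
    also have "\<dots> = \<theta> / 2 * M" using F by simp
    also have "\<dots> \<le> \<theta> / 2 * (M + 1)" using \<theta> by (intro mult_left_mono) auto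
    also have "\<dots> = c / 4"
    proof -
      have e: "c / (2 * N) / 2 * N = c / 4" if "N \<noteq> 0" for N :: real using that by (simp add: field_simps)
      show ?thesis unfolding \<theta>_def by (rule e) (use M in linarith)
    qed
    finally show ?thesis .
  qed
  have t2: "F * (1 / (2 * \<theta> * X) * hom_energy s f) \<le> c / 4"
  proof -
    have "F * (1 / (2 * \<theta> * X) * hom_energy s f) \<le> F * (1 / (2 * \<theta> * X) * B')"
      using F \<theta> X Q by (intro mult_left_mono) (auto simp: f_def)
    also have "\<dots> \<le> c / 4"
    proof -
      have "4 * F * B' / (2 * \<theta> * c) \<le> X" by (simp add: X_def)
      then show ?thesis using F \<theta> X c B' by (simp add: field_simps)
    qed
    finally show ?thesis .
  qed
  have "o3 / T + F * (L * (o2 * (1 + R)) * vol) / T = K / T" by (simp add: K_def add_divide_distrib)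
  then have "c \<le> K / T + c / 4 + c / 4" using main t1 t2 by linarith
  then show False using KT c by linarith
qed

section \<open>Fourier multipliers\<close>

text \<open>Lipschitz dependence on the first argument, uniform in the second, upgrades separate
  continuity to joint continuity.\<close>

lemma continuous_on_joint:
  fixes F :: "'a::real_normed_vector \<Rightarrow> 'b::real_normed_vector \<Rightarrow> 'c::real_normed_vector"
  assumes c: "\<And>f. continuous_on UNIV (F f)" and l: "\<And>f g x. norm (F f x - F g x) \<le> C * norm (f - g)"
    and v: "continuous_on S v" and X: "continuous_on S X"
  shows "continuous_on S (\<lambda>p. F (v p) (X p))"
proof -
  have "continuous_on UNIV (\<lambda>p. F (fst p) (snd p))"
    unfolding continuous_on_eq_continuous_at[OF open_UNIV] isCont_def
  proof
    fix p :: "'a \<times> 'b"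
    obtain f x where p: "p = (f, x)" by (cases p)
    have f1: "(fst \<longlongrightarrow> f) (at p)" and x1: "(snd \<longlongrightarrow> x) (at p)"
      using tendsto_fst[OF tendsto_ident_at[of p UNIV]] tendsto_snd[OF tendsto_ident_at[of p UNIV]] by (simp_all add: p)
    have cx: "isCont (F f) x" using c[of f] by (simp add: continuous_on_eq_continuous_at)
    have "((\<lambda>p. C * norm (fst p - f) + norm (F f (snd p) - F f x)) \<longlongrightarrow> C * norm (f - f) + norm (F f x - F f x)) (at p)"
      by (intro tendsto_intros f1 isCont_tendsto_compose[OF cx] x1)
    then have lim: "((\<lambda>p. C * norm (fst p - f) + norm (F f (snd p) - F f x)) \<longlongrightarrow> 0) (at p)" by simp
    have "((\<lambda>p. F (fst p) (snd p) - F f x) \<longlongrightarrow> 0) (at p)"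
    proof (rule Lim_null_comparison[OF always_eventually lim], intro allI)
      fix r :: "'a \<times> 'b"
      have "norm (F (fst r) (snd r) - F f x) \<le> norm (F (fst r) (snd r) - F f (snd r)) + norm (F f (snd r) - F f x)"
        using norm_triangle_ineq[of "F (fst r) (snd r) - F f (snd r)" "F f (snd r) - F f x"] by simp
      then show "norm (F (fst r) (snd r) - F f x) \<le> C * norm (fst r - f) + norm (F f (snd r) - F f x)"
        using l[of "fst r" "snd r" f] by linarith
    qed
    then show "((\<lambda>p. F (fst p) (snd p)) \<longlongrightarrow> F (fst p) (snd p)) (at p)" by (simp add: p LIM_zero_iff)
  qed
  from continuous_on_compose2[OF this continuous_on_Pair[OF v X]] show ?thesis by simp
qed

lemma continuous_on_ft:
  fixes v :: "'a::topological_space \<Rightarrow> 'n::finite walg"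
  assumes "continuous_on S v" "continuous_on S X"
  shows "continuous_on S (\<lambda>p. ft (v p) (X p))"
proof (rule continuous_on_joint[where F=ft and C=1, OF _ _ assms])
  show "continuous_on UNIV (ft f)" for f :: "'n walg"
    by (intro continuous_fourier integrable_of_real walgD)
  show "cmod (ft f x - ft g x) \<le> 1 * norm (f - g)" for f g :: "'n walg" and x
    using cmod_ft_le[of "f - g" x] unfolding ft_diff by simp
qed

text \<open>Quadratic growth covers |D| and all derivatives up to second order and is still
  dominated by \<open>W\<close>, so these symbols act on the whole algebra.\<close>

definition symb :: "(real^'n \<Rightarrow> complex) \<Rightarrow> bool" where
  "symb \<sigma> \<longleftrightarrow> continuous_on UNIV \<sigma> \<and> (\<forall>\<xi>. cmod (\<sigma> \<xi>) \<le> 1 + (norm \<xi>)\<^sup>2)"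

text \<open>A function and not an element of the algebra: after multiplication by \<sigma> the
  transform is integrable, but not necessarily against \<open>W\<close>.\<close>

definition fmul :: "(real^'n \<Rightarrow> complex) \<Rightarrow> 'n::finite walg \<Rightarrow> real^'n \<Rightarrow> real" where
  "fmul \<sigma> f x = Re (inv_fourier (\<lambda>\<xi>. \<sigma> \<xi> * ft f \<xi>) x)"

lemma symb_measurable: "symb \<sigma> \<Longrightarrow> \<sigma> \<in> borel_measurable borel"
  unfolding symb_def by (intro borel_measurable_continuous_onI) auto

lemma ex_symb_le_W: "\<exists>C>0. \<forall>\<xi>::real^'n. 1 + (norm \<xi>)\<^sup>2 \<le> C * W \<xi>"
  using powr_le_W[of 1, where 'n='n] by (simp add: add_nonneg_pos powr_one)

lemma integrable_symb:
  fixes f :: "'n::finite walg"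
  assumes s: "symb \<sigma>"
  shows "integrable lborel (\<lambda>\<xi>. \<sigma> \<xi> * ft f \<xi>)"
proof -
  obtain C where C: "C > 0" "\<And>\<xi>::real^'n. 1 + (norm \<xi>)\<^sup>2 \<le> C * W \<xi>" using ex_symb_le_W by blast
  note [measurable] = symb_measurable[OF s] walgD(6)[of f]
  have le: "cmod (\<sigma> \<xi> * ft f \<xi>) \<le> C * (W \<xi> * cmod (ft f \<xi>))" for \<xi>
  proof -
    have "cmod (\<sigma> \<xi>) \<le> C * W \<xi>" using s C(2)[of \<xi>] unfolding symb_def by (meson order_trans)
    then show ?thesis unfolding norm_mult mult.assoc[symmetric] by (intro mult_right_mono) auto
  qed
  show ?thesis
    by (rule Bochner_Integration.integrable_bound[OF integrable_mult_right[OF walgD(2)[of f], of C]])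
       (measurable, intro AE_I2, rule order_trans[OF le], rule order_trans[OF abs_ge_self], simp only: real_norm_def)
qed

lemma ex_symb_bound:
  "\<exists>C>0. \<forall>\<sigma> (f :: 'n::finite walg). symb \<sigma> \<longrightarrow> (\<integral>\<xi>. cmod (\<sigma> \<xi> * ft f \<xi>) \<partial>lborel) \<le> C * norm f"
proof -
  obtain C where C: "C > 0" "\<And>\<xi>::real^'n. 1 + (norm \<xi>)\<^sup>2 \<le> C * W \<xi>" using ex_symb_le_W by blast
  have F: "fnorm TYPE('n) > 0" by (rule fnorm_pos)
  have "(\<integral>\<xi>. cmod (\<sigma> \<xi> * ft f \<xi>) \<partial>lborel) \<le> (C / fnorm TYPE('n)) * norm f" if s: "symb \<sigma>" for \<sigma> and f :: "'n walg"
  proof -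
    have "(\<integral>\<xi>. cmod (\<sigma> \<xi> * ft f \<xi>) \<partial>lborel) \<le> (\<integral>\<xi>. C * (W \<xi> * cmod (ft f \<xi>)) \<partial>lborel)"
    proof (rule Bochner_Integration.integral_mono)
      show "integrable lborel (\<lambda>\<xi>. cmod (\<sigma> \<xi> * ft f \<xi>))" by (intro integrable_norm integrable_symb s)
      show "integrable lborel (\<lambda>\<xi>. C * (W \<xi> * cmod (ft f \<xi>)))" by (intro integrable_mult_right walgD)
      fix \<xi> :: "real^'n"
      have "cmod (\<sigma> \<xi>) \<le> C * W \<xi>" using s C(2)[of \<xi>] unfolding symb_def by (meson order_trans)
      then show "cmod (\<sigma> \<xi> * ft f \<xi>) \<le> C * (W \<xi> * cmod (ft f \<xi>))"
        unfolding norm_mult mult.assoc[symmetric] by (intro mult_right_mono) auto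
    qed
    also have "\<dots> = C / fnorm TYPE('n) * wnorm (fn f)" using F by (simp add: wnorm_def)
    also have "\<dots> \<le> C / fnorm TYPE('n) * norm f" using C F by (intro mult_left_mono wnorm_le_norm) auto
    finally show ?thesis .
  qed
  moreover have "C / fnorm TYPE('n) > 0" using C F by simp
  ultimately show ?thesis by blast
qed

lemma continuous_on_inv_fourier: "integrable lborel g \<Longrightarrow> continuous_on UNIV (inv_fourier g)"
proof -
  assume "integrable lborel g"
  then have "continuous_on UNIV (\<lambda>x. complex_of_real (fnorm TYPE('a)) * fourier g (- x))"
    by (intro continuous_intros continuous_on_compose2[OF continuous_fourier]) auto
  then show ?thesis unfolding inv_fourier_conv_fourier[abs_def] .
qed

lemma cmod_inv_fourier_le_integral: "cmod (inv_fourier g (x::real^'n)) \<le> fnorm TYPE('n) * (\<integral>\<xi>. cmod (g \<xi>) \<partial>lborel)"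
  unfolding inv_fourier_conv_fourier norm_mult
  using fnorm_pos[where 'n='n] by (auto intro!: mult_left_mono cmod_fourier_le)

lemma continuous_on_inv_fourier_ft:
  fixes v :: "'a::topological_space \<Rightarrow> 'n::finite walg"
  assumes s: "symb \<sigma>" and "continuous_on S v" "continuous_on S X"
  shows "continuous_on S (\<lambda>p. inv_fourier (\<lambda>\<xi>. \<sigma> \<xi> * ft (v p) \<xi>) (X p))"
proof -
  obtain C where C: "C > 0" "\<And>\<sigma> (f :: 'n walg). symb \<sigma> \<Longrightarrow> (\<integral>\<xi>. cmod (\<sigma> \<xi> * ft f \<xi>) \<partial>lborel) \<le> C * norm f"
    using ex_symb_bound by blast
  let ?F = "\<lambda>f. inv_fourier (\<lambda>\<xi>. \<sigma> \<xi> * ft f \<xi>)"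
  show ?thesis
  proof (rule continuous_on_joint[where F="?F" and C="fnorm TYPE('n) * C", OF _ _ assms(2,3)])
    show "continuous_on UNIV (?F f)" for f :: "'n walg"
      by (intro continuous_on_inv_fourier integrable_symb s)
    show "norm (?F f x - ?F g x) \<le> fnorm TYPE('n) * C * norm (f - g)" for f g :: "'n walg" and x
    proof -
      have e: "(\<lambda>\<xi>. \<sigma> \<xi> * ft f \<xi>) = (\<lambda>\<xi>. \<sigma> \<xi> * ft (f - g) \<xi> + \<sigma> \<xi> * ft g \<xi>)"
        by (rule ext) (simp only: ft_diff ring_distribs diff_add_cancel)
      have "?F f x - ?F g x = ?F (f - g) x"
        unfolding e inv_fourier_add[OF integrable_symb[OF s] integrable_symb[OF s]] by simp
      then have "norm (?F f x - ?F g x) = cmod (?F (f - g) x)" by (rule arg_cong)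
      also have "\<dots> \<le> fnorm TYPE('n) * (\<integral>\<xi>. cmod (\<sigma> \<xi> * ft (f - g) \<xi>) \<partial>lborel)"
        by (rule cmod_inv_fourier_le_integral)
      also have "\<dots> \<le> fnorm TYPE('n) * (C * norm (f - g))"
        using fnorm_pos[where 'n='n] by (intro mult_left_mono C s) auto
      finally show ?thesis by (simp add: mult.assoc)
    qed
  qed
qed

lemma continuous_on_fmul:
  "symb \<sigma> \<Longrightarrow> continuous_on S v \<Longrightarrow> continuous_on S X \<Longrightarrow> continuous_on S (\<lambda>p. fmul \<sigma> (v p) (X p))"
  unfolding fmul_def by (intro continuous_on_Re continuous_on_inv_fourier_ft)

lemma norm_le_bracket: "norm \<xi> \<le> 1 + (norm \<xi>)\<^sup>2" "1 \<le> 1 + (norm \<xi>)\<^sup>2"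
proof -
  have "0 \<le> (norm \<xi> - 1/2)\<^sup>2" by simp
  then show "norm \<xi> \<le> 1 + (norm \<xi>)\<^sup>2" by (simp add: power2_eq_square algebra_simps)
qed simp

lemma symb_intros:
  "symb (\<lambda>_. 1)" "symb (\<lambda>\<xi>. complex_of_real (norm \<xi>))" "symb (\<lambda>\<xi>. - complex_of_real ((norm \<xi>)\<^sup>2))"
  "symb (\<lambda>\<xi>. \<i> * complex_of_real (\<xi> $ i))" "symb (\<lambda>\<xi>. \<i> * complex_of_real (\<xi> $ i) * (\<i> * complex_of_real (\<xi> $ i)))"
proof -
  have 1: "\<bar>\<xi> $ i\<bar> \<le> norm \<xi>" for \<xi> by (rule component_le_norm_cart)
  then have 2: "\<bar>\<xi> $ i\<bar> * \<bar>\<xi> $ i\<bar> \<le> (norm \<xi>)\<^sup>2" for \<xi> unfolding power2_eq_square by (intro mult_mono) auto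
  show "symb (\<lambda>_. 1)" "symb (\<lambda>\<xi>. complex_of_real (norm \<xi>))" "symb (\<lambda>\<xi>. - complex_of_real ((norm \<xi>)\<^sup>2))"
    by (auto simp: symb_def norm_le_bracket norm_power intro!: continuous_intros)
  show "symb (\<lambda>\<xi>. \<i> * complex_of_real (\<xi> $ i))"
    using order_trans[OF 1 norm_le_bracket(1)] by (auto simp: symb_def norm_mult intro!: continuous_intros)
  have "\<bar>\<xi> $ i\<bar> * \<bar>\<xi> $ i\<bar> \<le> 1 + (norm \<xi>)\<^sup>2" for \<xi> using 2[of \<xi>] by linarith
  then show "symb (\<lambda>\<xi>. \<i> * complex_of_real (\<xi> $ i) * (\<i> * complex_of_real (\<xi> $ i)))"
    by (auto simp: symb_def norm_mult intro!: continuous_intros)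
qed

lemma fmul_1: "fmul (\<lambda>_. 1) f x = fn f x"
  unfolding fmul_def by (simp add: walgD(3))

lemma has_vector_derivative_inv_fourier:
  fixes a :: "real^'n \<Rightarrow> complex"
  assumes a: "integrable lborel a" and a': "integrable lborel (\<lambda>\<xi>. \<i> * complex_of_real (\<xi> $ i) * a \<xi>)"
  shows "((\<lambda>h. inv_fourier a (x + h *\<^sub>R axis i 1)) has_vector_derivative inv_fourier (\<lambda>\<xi>. \<i> * complex_of_real (\<xi> $ i) * a \<xi>) x) (at 0)"
proof -
  have "((\<lambda>h. \<integral>\<xi>. cis ((x + h *\<^sub>R axis i 1) \<bullet> \<xi>) * a \<xi> \<partial>lborel) has_vector_derivative
      (\<integral>\<xi>. cis ((x + 0 *\<^sub>R axis i 1) \<bullet> \<xi>) * (\<i> * complex_of_real (\<xi> $ i) * a \<xi>) \<partial>lborel)) (at 0)"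
  proof (rule has_vector_derivative_integral_dominated[where g="\<lambda>\<xi>. cmod (\<i> * complex_of_real (\<xi> $ i) * a \<xi>)"
        and f'="\<lambda>h \<xi>. cis ((x + h *\<^sub>R axis i 1) \<bullet> \<xi>) * (\<i> * complex_of_real (\<xi> $ i) * a \<xi>)"])
    have cm: "(\<lambda>\<xi>. cis ((x + h *\<^sub>R axis i 1) \<bullet> \<xi>)) \<in> borel_measurable borel" for h
      by (intro borel_measurable_continuous_onI continuous_intros)
    show "integrable lborel (\<lambda>\<xi>. cis ((x + h *\<^sub>R axis i 1) \<bullet> \<xi>) * a \<xi>)" for h
      by (rule integrable_phase[where C=1, OF a cm]) simp
    show "(\<lambda>\<xi>. cis ((x + h *\<^sub>R axis i 1) \<bullet> \<xi>) * (\<i> * complex_of_real (\<xi> $ i) * a \<xi>)) \<in> borel_measurable lborel" for h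
      using integrable_phase[where C=1, OF a' cm] by (intro borel_measurable_integrable) simp
    show "((\<lambda>h. cis ((x + h *\<^sub>R axis i 1) \<bullet> \<xi>) * a \<xi>) has_vector_derivative cis ((x + h *\<^sub>R axis i 1) \<bullet> \<xi>) * (\<i> * complex_of_real (\<xi> $ i) * a \<xi>)) (at h)" for h \<xi>
    proof -
      have "((\<lambda>h. (x + h *\<^sub>R axis i 1) \<bullet> \<xi>) has_real_derivative \<xi> $ i) (at h)"
        by (auto intro!: derivative_eq_intros simp: inner_add_left inner_axis')
      from has_vector_derivative_mult_left[OF has_vector_derivative_cis[OF this], of "a \<xi>"]
      show ?thesis by (simp add: mult_ac)
    qed
    show "cmod (cis ((x + h *\<^sub>R axis i 1) \<bullet> \<xi>) * (\<i> * complex_of_real (\<xi> $ i) * a \<xi>)) \<le> cmod (\<i> * complex_of_real (\<xi> $ i) * a \<xi>)" for h \<xi>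
      by (simp add: norm_mult)
    show "integrable lborel (\<lambda>\<xi>. cmod (\<i> * complex_of_real (\<xi> $ i) * a \<xi>))" by (rule integrable_norm[OF a'])
  qed
  from has_vector_derivative_mult_right[OF this, of "complex_of_real (fnorm TYPE('n))"]
  show ?thesis unfolding inv_fourier_cis scaleR_zero_left add_0_right .
qed

lemma has_real_derivative_fmul_line:
  assumes s: "symb \<sigma>" and s': "symb (\<lambda>\<xi>. \<i> * complex_of_real (\<xi> $ i) * \<sigma> \<xi>)"
  shows "((\<lambda>h. fmul \<sigma> f (x + h *\<^sub>R axis i 1)) has_real_derivative fmul (\<lambda>\<xi>. \<i> * complex_of_real (\<xi> $ i) * \<sigma> \<xi>) f x) (at 0)"
proof -
  have "((\<lambda>h. inv_fourier (\<lambda>\<xi>. \<sigma> \<xi> * ft f \<xi>) (x + h *\<^sub>R axis i 1)) has_vector_derivative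
      inv_fourier (\<lambda>\<xi>. \<i> * complex_of_real (\<xi> $ i) * (\<sigma> \<xi> * ft f \<xi>)) x) (at 0)"
    using integrable_symb[OF s', of f] by (intro has_vector_derivative_inv_fourier integrable_symb s) (simp add: mult.assoc)
  from bounded_linear.has_vector_derivative[OF bounded_linear_Re this]
  show ?thesis unfolding fmul_def has_real_derivative_iff_has_vector_derivative by (simp add: mult.assoc)
qed

lemma has_real_derivative_fn_line:
  fixes f :: "'n::finite walg"
  shows "((\<lambda>h. fn f (x + h *\<^sub>R axis i 1)) has_real_derivative fmul (\<lambda>\<xi>. \<i> * complex_of_real (\<xi> $ i)) f x) (at 0)"
proof -
  have "symb (\<lambda>\<xi>::real^'n. \<i> * complex_of_real (\<xi> $ i) * 1)" using symb_intros(4)[of i] by simp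
  from has_real_derivative_fmul_line[OF symb_intros(1) this, of f x] show ?thesis by (simp add: fmul_1)
qed

lemma has_real_derivative_fn_line2:
  "((\<lambda>h. fmul (\<lambda>\<xi>. \<i> * complex_of_real (\<xi> $ i)) f (x + h *\<^sub>R axis i 1)) has_real_derivative
     fmul (\<lambda>\<xi>. \<i> * complex_of_real (\<xi> $ i) * (\<i> * complex_of_real (\<xi> $ i))) f x) (at 0)"
  by (rule has_real_derivative_fmul_line) (rule symb_intros)+

lemma sum_fmul_second:
  "(\<Sum>i\<in>UNIV. fmul (\<lambda>\<xi>. \<i> * complex_of_real (\<xi> $ i) * (\<i> * complex_of_real (\<xi> $ i))) f x)
     = fmul (\<lambda>\<xi>. - complex_of_real ((norm \<xi>)\<^sup>2)) f (x :: real^'n::finite)"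
proof -
  let ?a = "\<lambda>i \<xi>. \<i> * complex_of_real (\<xi> $ i) * (\<i> * complex_of_real (\<xi> $ i)) * ft f \<xi>"
  have n2: "(norm \<xi>)\<^sup>2 = (\<Sum>i\<in>UNIV. (\<xi> $ i)\<^sup>2)" for \<xi> :: "real^'n"
    by (simp add: norm_vec_def L2_set_def sum_nonneg)
  have i: "integrable lborel (\<lambda>\<xi>. cis (x \<bullet> \<xi>) * ?a i \<xi>)" for i
    by (rule integrable_phase[where C=1, OF integrable_symb[OF symb_intros(5)]])
       (auto intro!: borel_measurable_continuous_onI continuous_intros)
  have e: "cis (x \<bullet> \<xi>) * (- complex_of_real ((norm \<xi>)\<^sup>2) * ft f \<xi>) = (\<Sum>i\<in>UNIV. cis (x \<bullet> \<xi>) * ?a i \<xi>)" for \<xi>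
    unfolding n2 by (simp add: sum_distrib_left sum_distrib_right power2_eq_square sum_negf[symmetric] mult_ac)
  have "inv_fourier (\<lambda>\<xi>. - complex_of_real ((norm \<xi>)\<^sup>2) * ft f \<xi>) x = (\<Sum>i\<in>UNIV. inv_fourier (?a i) x)"
    unfolding inv_fourier_cis e by (subst Bochner_Integration.integral_sum) (use i in \<open>auto simp: sum_distrib_left\<close>)
  then show ?thesis unfolding fmul_def by simp
qed

section \<open>The viscous wave equation in Duhamel form\<close>

text \<open>One frequency at a time, with \<eta> in the role of \<delta> |\<xi>|: differentiating
  the Duhamel integral yields the damped oscillator for the displacement \<open>vh t - vh 0\<close>.
  The argument never divides by \<eta>, so frequency 0 is included.\<close>

lemma wave_ode:
  fixes N zh vh :: "real \<Rightarrow> complex"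
  assumes N: "continuous_on {0..T} N"
    and z: "\<And>t. t \<in> {0..T} \<Longrightarrow> zh t = - integral {0..t} (\<lambda>s. gsym (\<eta> * (t - s)) * N s)"
    and v: "\<And>t. t \<in> {0..T} \<Longrightarrow> (vh has_vector_derivative zh t) (at t within {0..T})"
    and t: "t \<in> {0..T}"
  shows "(zh has_vector_derivative (- N t - of_real \<eta> * zh t - of_real (\<eta>\<^sup>2) * (vh t - vh 0))) (at t within {0..T})"
proof -
  \<comment> \<open>The two modes of the oscillator, indexed by the root o'; each solves a
    first-order equation with forcing N.\<close>
  define P where "P o' t = exp (- o' * of_real (\<eta> * t)) * integral {0..t} (\<lambda>s. exp (o' * of_real (\<eta> * s)) * N s)" for o' t
  have cont: "continuous_on {0..T} (\<lambda>s. exp (o' * of_real (\<eta> * s)) * N s)" for o'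
    by (intro continuous_intros N)
  have dP: "(P o' has_vector_derivative (N t - o' * of_real \<eta> * P o' t)) (at t within {0..T})" if t: "t \<in> {0..T}" for o' t
  proof -
    have d1: "((\<lambda>t. exp (- o' * of_real (\<eta> * t))) has_vector_derivative ((- o' * of_real \<eta>) * exp (- o' * of_real (\<eta> * t)))) (at t within {0..T})"
    proof (rule has_vector_derivative_exp_comp)
      have "((\<lambda>t. of_real (\<eta> * t) :: complex) has_vector_derivative of_real \<eta>) (at t within {0..T})"
        by (rule has_vector_derivative_of_real) (auto intro!: derivative_eq_intros)
      then show "((\<lambda>t. - o' * of_real (\<eta> * t)) has_vector_derivative - o' * of_real \<eta>) (at t within {0..T})"
        by (rule has_vector_derivative_mult_right)
    qed
    have "(P o' has_vector_derivative (exp (- o' * of_real (\<eta> * t)) * (exp (o' * of_real (\<eta> * t)) * N t)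
        + (- o' * of_real \<eta>) * exp (- o' * of_real (\<eta> * t)) * integral {0..t} (\<lambda>s. exp (o' * of_real (\<eta> * s)) * N s))) (at t within {0..T})"
      unfolding P_def by (rule has_vector_derivative_mult[OF d1 integral_has_vector_derivative[OF cont t]])
    moreover have e: "exp (- o' * of_real (\<eta> * t)) * (exp (o' * of_real (\<eta> * t)) * N t) = N t"
      by (simp add: mult.assoc[symmetric] exp_minus_inverse exp_add[symmetric])
    have "exp (- o' * of_real (\<eta> * t)) * (exp (o' * of_real (\<eta> * t)) * N t)
        + (- o' * of_real \<eta>) * exp (- o' * of_real (\<eta> * t)) * integral {0..t} (\<lambda>s. exp (o' * of_real (\<eta> * s)) * N s)
        = N t - o' * of_real \<eta> * P o' t"
      unfolding e P_def by (simp only: mult.assoc mult_minus_left add_uminus_conv_diff)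
    ultimately show ?thesis by (simp only:)
  qed
  have zP: "zh t = - (gam * P om t + cnj gam * P (cnj om) t)" if t: "t \<in> {0..T}" for t
  proof -
    have e: "gsym (\<eta> * (t - s)) * N s = (gam * exp (- om * of_real (\<eta> * t))) * (exp (om * of_real (\<eta> * s)) * N s)
        + (cnj gam * exp (- cnj om * of_real (\<eta> * t))) * (exp (cnj om * of_real (\<eta> * s)) * N s)" for s
    proof -
      have x: "exp (- o' * of_real (\<eta> * (t - s))) = exp (- o' * of_real (\<eta> * t)) * exp (o' * of_real (\<eta> * s))" for o' :: complex
        unfolding exp_add[symmetric] by (simp add: algebra_simps)
      show ?thesis unfolding gsym_def x by (simp only: ring_distribs mult.assoc)
    qed
    have i: "(\<lambda>s. exp (o' * of_real (\<eta> * s)) * N s) integrable_on {0..t}" for o'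
      by (rule integrable_continuous_real[OF continuous_on_subset[OF cont]]) (use t in auto)
    have "integral {0..t} (\<lambda>s. gsym (\<eta> * (t - s)) * N s) = gam * P om t + cnj gam * P (cnj om) t"
      unfolding e P_def
      by (subst Henstock_Kurzweil_Integration.integral_add[OF integrable_on_mult_right[OF i] integrable_on_mult_right[OF i]])
         (simp only: Henstock_Kurzweil_Integration.integral_mult_right mult.assoc)
    then show ?thesis using z[OF t] by simp
  qed
  have dz: "(zh has_vector_derivative - (gam * (N t - om * of_real \<eta> * P om t) + cnj gam * (N t - cnj om * of_real \<eta> * P (cnj om) t))) (at t within {0..T})"
    if t: "t \<in> {0..T}" for t
  proof (rule has_vector_derivative_transform[OF t])
    show "((\<lambda>t. - (gam * P om t + cnj gam * P (cnj om) t)) has_vector_derivative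
        - (gam * (N t - om * of_real \<eta> * P om t) + cnj gam * (N t - cnj om * of_real \<eta> * P (cnj om) t))) (at t within {0..T})"
      by (intro has_vector_derivative_minus has_vector_derivative_add has_vector_derivative_mult_right dP t)
  qed (rule zP)
  \<comment> \<open>A conserved quantity that recovers the displacement: the modes with weights
    \<open>gam * cnj om\<close> and its conjugate have a sum with derivative \<eta> zh, since the
    forcing cancels by \<open>gam_om\<close>.\<close>
  define Y where "Y t = gam * cnj om * P om t + cnj gam * om * P (cnj om) t - of_real \<eta> * vh t" for t
  have dY: "(Y has_vector_derivative 0) (at t within {0..T})" if t: "t \<in> {0..T}" for t
  proof -
    have "(Y has_vector_derivative (gam * cnj om * (N t - om * of_real \<eta> * P om t) + cnj gam * om * (N t - cnj om * of_real \<eta> * P (cnj om) t) - of_real \<eta> * zh t)) (at t within {0..T})"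
      unfolding Y_def
      by (intro has_vector_derivative_diff has_vector_derivative_add has_vector_derivative_mult_right dP t v)
    moreover have "gam * cnj om * (N t - om * of_real \<eta> * P om t) + cnj gam * om * (N t - cnj om * of_real \<eta> * P (cnj om) t) - of_real \<eta> * zh t
       = (gam * cnj om + cnj gam * om) * N t - (om * cnj om) * of_real \<eta> * (gam * P om t + cnj gam * P (cnj om) t) - of_real \<eta> * zh t"
      by (simp add: algebra_simps)
    moreover have "\<dots> = 0" unfolding gam_om om_mult_cnj zP[OF t] by (simp add: algebra_simps)
    ultimately show ?thesis by simp
  qed
  obtain c where c: "\<And>t. t \<in> {0..T} \<Longrightarrow> Y t = c"
    using has_vector_derivative_zero_constant[of "{0..T}" Y] dY by auto
  have "0 \<in> {0..T}" using t by auto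
  then have "Y t = Y 0" using c t by simp
  also have "Y 0 = - of_real \<eta> * vh 0" by (simp add: Y_def P_def)
  finally have Y: "gam * cnj om * P om t + cnj gam * om * P (cnj om) t = of_real \<eta> * (vh t - vh 0)"
    by (simp add: Y_def algebra_simps)
  \<comment> \<open>As om + cnj om = 1, the combination needed for the second derivative is the
    difference of two that are known: the velocity, up to sign, and \<eta> times the
    displacement.\<close>
  have o1: "om = 1 - cnj om" "cnj om = 1 - om" using om_plus_cnj by (simp_all add: eq_diff_eq add.commute)
  have "gam * om * P om t + cnj gam * cnj om * P (cnj om) t = (gam * P om t + cnj gam * P (cnj om) t) - (gam * cnj om * P om t + cnj gam * om * P (cnj om) t)"
  proof -
    have "gam * om * P om t = gam * (1 - cnj om) * P om t" using o1(1) by (rule arg_cong)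
    moreover have "cnj gam * cnj om * P (cnj om) t = cnj gam * (1 - om) * P (cnj om) t" using o1(2) by (rule arg_cong)
    ultimately show ?thesis by (simp only: ring_distribs left_diff_distrib right_diff_distrib mult_1_right) (simp add: algebra_simps)
  qed
  then have a: "gam * om * P om t + cnj gam * cnj om * P (cnj om) t = - zh t - of_real \<eta> * (vh t - vh 0)"
    unfolding Y using zP[OF t] by simp
  have "- (gam * (N t - om * of_real \<eta> * P om t) + cnj gam * (N t - cnj om * of_real \<eta> * P (cnj om) t))
      = - ((gam + cnj gam) * N t) + of_real \<eta> * (gam * om * P om t + cnj gam * cnj om * P (cnj om) t)"
    by (simp add: algebra_simps)
  also have "\<dots> = - N t - of_real \<eta> * zh t - of_real (\<eta>\<^sup>2) * (vh t - vh 0)"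
    unfolding gam_plus_cnj a by (simp add: algebra_simps power2_eq_square)
  finally show ?thesis using dz[OF t] by (simp only:)
qed

text \<open>Time integrals are Henstock-Kurzweil integrals and frequency integrals are Lebesgue
  integrals. For continuous integrands on a compact interval the former are Lebesgue integrals as
  well, and then Fubini's theorem applies.\<close>

lemma fubini_time:
  fixes b :: "real \<Rightarrow> real^'n \<Rightarrow> complex"
  assumes b: "continuous_on ({0..t} \<times> UNIV) (\<lambda>p. b (fst p) (snd p))"
    and int: "\<And>s. s \<in> {0..t} \<Longrightarrow> integrable lborel (b s)"
    and le: "\<And>s. s \<in> {0..t} \<Longrightarrow> (\<integral>\<xi>. cmod (b s \<xi>) \<partial>lborel) \<le> C"
    and y: "\<And>\<xi>. ((\<lambda>s. b s \<xi>) has_integral y \<xi>) {0..t}"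
    and q: "continuous_on UNIV q" "\<And>\<xi>. cmod (q \<xi>) \<le> 1"
    and c: "continuous_on {0..t} (\<lambda>s. \<integral>\<xi>. q \<xi> * b s \<xi> \<partial>lborel)"
  shows "(\<integral>\<xi>. q \<xi> * y \<xi> \<partial>lborel) = integral {0..t} (\<lambda>s. \<integral>\<xi>. q \<xi> * b s \<xi> \<partial>lborel)"
proof -
  let ?I = "indicator {0..t} :: real \<Rightarrow> real"
  let ?f = "\<lambda>s \<xi>. ?I s *\<^sub>R (q \<xi> * b s \<xi>)"
  have swap: "(\<integral>s. (\<integral>\<xi>. ?f s \<xi> \<partial>lborel) \<partial>lborel) = (\<integral>\<xi>. (\<integral>s. ?f s \<xi> \<partial>lborel) \<partial>lborel)"
  proof (rule integral_swap(1)[where b="\<lambda>s \<xi>. ?I s * cmod (b s \<xi>)" and B="\<lambda>s. ?I s * C"])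
    have "(\<lambda>p. indicator ({0..t} \<times> UNIV) p *\<^sub>R (q (snd p) * b (fst p) (snd p))) \<in> borel_measurable borel"
      by (intro borel_measurable_continuous_on_indicator continuous_intros b continuous_on_compose2[OF q(1)]
          borel_closed closed_Times) auto
    moreover have "(\<lambda>p. indicator ({0..t} \<times> UNIV) p *\<^sub>R (q (snd p) * b (fst p) (snd p))) = (\<lambda>(s, \<xi>). ?f s \<xi>)"
      by (auto simp: fun_eq_iff indicator_def)
    ultimately show "(\<lambda>(s, \<xi>). ?f s \<xi>) \<in> borel_measurable (borel \<Otimes>\<^sub>M borel)" unfolding borel_prod by simp
    show "integrable lborel (\<lambda>\<xi>. ?I s * cmod (b s \<xi>))" for s
      using int[of s] by (cases "s \<in> {0..t}") auto
    show "norm (?f s \<xi>) \<le> ?I s * cmod (b s \<xi>)" for s \<xi>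
      using q(2)[of \<xi>] by (auto simp: indicator_def norm_mult mult_left_le_one_le)
    show "integrable lborel (\<lambda>s. ?I s * C)"
      by (intro integrable_mult_left integrable_real_indicator) (auto simp: emeasure_lborel_Icc_eq)
    show "(\<integral>\<xi>. ?I s * cmod (b s \<xi>) \<partial>lborel) \<le> ?I s * C" for s
      using le[of s] by (cases "s \<in> {0..t}") auto
  qed
  have L: "(\<integral>s. ?I s *\<^sub>R f s \<partial>lborel) = integral {0..t} f" if "continuous_on {0..t} f" for f :: "real \<Rightarrow> complex"
    using set_borel_integral_eq_integral(2)[of "{0..t}" f] borel_integrable_compact[OF compact_Icc that]
    by (simp add: set_integrable_def set_lebesgue_integral_def)
  have "(\<integral>s. ?f s \<xi> \<partial>lborel) = q \<xi> * y \<xi>" for \<xi>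
  proof -
    have cb: "continuous_on {0..t} (\<lambda>s. b s \<xi>)"
    proof -
      have "continuous_on {0..t} (\<lambda>s. (s, \<xi>))" "(\<lambda>s. (s, \<xi>)) ` {0..t} \<subseteq> {0..t} \<times> UNIV"
        by (auto intro!: continuous_intros)
      from continuous_on_compose2[OF b this] show ?thesis by simp
    qed
    have "(\<integral>s. ?f s \<xi> \<partial>lborel) = integral {0..t} (\<lambda>s. q \<xi> * b s \<xi>)"
      by (rule L) (intro continuous_intros cb)
    also have "\<dots> = q \<xi> * y \<xi>" using integral_unique[OF has_integral_mult_right[OF y]] .
    finally show ?thesis .
  qed
  moreover have "(\<integral>s. (\<integral>\<xi>. ?f s \<xi> \<partial>lborel) \<partial>lborel) = integral {0..t} (\<lambda>s. \<integral>\<xi>. q \<xi> * b s \<xi> \<partial>lborel)"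
    using L[OF c] by simp
  ultimately show ?thesis using swap by simp
qed

text \<open>The velocity z is continuous in the algebra but need not be differentiable there,
  because the Laplacian of v may leave the algebra. The second derivative is therefore computed for
  each Fourier coefficient, integrated in time, and carried back to each point x by inversion and
  Fubini's theorem; the resulting integral is then differentiated at that point.\<close>

lemma viscous_solution:
  fixes v :: "real \<Rightarrow> 'n::finite walg"
  assumes k: "integrable lborel k" "\<And>\<xi>::real^'n. FT k \<xi> = gsym (norm \<xi>)"
    and d: "\<delta> > 0" "\<delta> \<le> 1" and v: "continuous_on {0..T} v"
    and eq: "\<And>t. t \<in> {0..T} \<Longrightarrow> v t = phi - duhamel.D2 (\<lambda>\<tau>. kop k (\<delta> * \<tau>)) (\<lambda>s. pw (v s) m - \<delta>\<^sup>2 *\<^sub>R lphi) t"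
  shows "\<exists>z. continuous_on {0..T} z \<and> z 0 = 0 \<and> (\<forall>t\<in>{0..T}. \<forall>x.
     ((\<lambda>t. fn (v t) x) has_real_derivative fn (z t) x) (at t within {0..T}) \<and>
     ((\<lambda>t. fn (z t) x) has_real_derivative
        (\<delta>\<^sup>2 * fmul (\<lambda>\<xi>. - complex_of_real ((norm \<xi>)\<^sup>2)) (v t) x - \<delta> * fmul (\<lambda>\<xi>. complex_of_real (norm \<xi>)) (z t) x
          - fn (v t) x ^ Suc m)) (at t within {0..T}))"
proof -
  let ?H = "\<lambda>\<tau>. kop k (\<delta> * \<tau>) :: 'n walg \<Rightarrow> 'n walg"
  interpret H: duhamel ?H "lnorm k"
    by (intro duhamel.intro bounded_linear_kop norm_kop_le lnorm_nonneg continuous_on_kop k continuous_intros)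
  \<comment> \<open>\<open>D2\<close> starts from 0 and so describes v - phi. The Laplacian of the
    datum becomes a source, which at each frequency cancels the initial value in the restoring term
    of \<open>wave_ode\<close>.\<close>
  define N where "N s = pw (v s) m - \<delta>\<^sup>2 *\<^sub>R lphi" for s
  have cN: "continuous_on {0..T} N" unfolding N_def by (intro continuous_intros continuous_on_pw v)
  define z where "z t = - H.D1 N t" for t
  have eqN: "v t = phi - H.D2 N t" if "t \<in> {0..T}" for t using eq[OF that] unfolding N_def .
  have cD: "continuous_on {0..T} (H.D1 N)" by (rule H.continuous_on_D1[OF cN])
  have cz: "continuous_on {0..T} z" unfolding z_def by (intro continuous_intros cD)
  have z0: "z 0 = 0" by (simp add: z_def H.D1_def)
  have dv: "(v has_vector_derivative z t) (at t within {0..T})" if t: "t \<in> {0..T}" for t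
  proof (rule has_vector_derivative_transform[OF t eqN])
    have "((\<lambda>t. phi - H.D2 N t) has_vector_derivative 0 - H.D1 N t) (at t within {0..T})"
      unfolding H.D2_def by (intro has_vector_derivative_diff has_vector_derivative_const integral_has_vector_derivative cD t)
    then show "((\<lambda>t. phi - H.D2 N t) has_vector_derivative z t) (at t within {0..T})" by (simp add: z_def)
  qed
  have v0: "v 0 = phi" if "0 \<in> {0..T}" using eqN[OF that] by (simp add: H.D2_def)
  let ?b = "\<lambda>s \<xi>. - ft (pw (v s) m) \<xi> - of_real (\<delta> * norm \<xi>) * ft (z s) \<xi> - of_real ((\<delta> * norm \<xi>)\<^sup>2) * ft (v s) \<xi>"
  have dz: "((\<lambda>t. ft (z t) \<xi>) has_vector_derivative ?b t \<xi>) (at t within {0..T})" if t: "t \<in> {0..T}" for t \<xi>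
  proof -
    let ?\<eta> = "\<delta> * norm \<xi>"
    have "((\<lambda>t. ft (z t) \<xi>) has_vector_derivative (- ft (N t) \<xi> - of_real ?\<eta> * ft (z t) \<xi> - of_real (?\<eta>\<^sup>2) * (ft (v t) \<xi> - ft (v 0) \<xi>))) (at t within {0..T})"
    proof (rule wave_ode[OF _ _ _ t])
      show "continuous_on {0..T} (\<lambda>s. ft (N s) \<xi>)" by (intro continuous_on_ft cN continuous_intros)
      show "((\<lambda>t. ft (v t) \<xi>) has_vector_derivative ft (z t) \<xi>) (at t within {0..T})" if "t \<in> {0..T}" for t
        by (rule bounded_linear.has_vector_derivative[OF bounded_linear_ft dv[OF that]])
      show "ft (z t) \<xi> = - integral {0..t} (\<lambda>s. gsym (?\<eta> * (t - s)) * ft (N s) \<xi>)" if t: "t \<in> {0..T}" for t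
      proof -
        have "(\<lambda>s. ?H (t - s) (N s)) integrable_on {0..t}"
          by (rule integrable_continuous_real[OF H.cont_integrand[OF cN]]) (use t in simp)
        from integral_linear[OF this bounded_linear_ft[of \<xi>]]
        have "ft (H.D1 N t) \<xi> = integral {0..t} (\<lambda>s. ft (?H (t - s) (N s)) \<xi>)"
          unfolding H.D1_def o_def by (rule sym)
        also have "\<dots> = integral {0..t} (\<lambda>s. gsym (?\<eta> * (t - s)) * ft (N s) \<xi>)"
        proof (rule Henstock_Kurzweil_Integration.integral_cong)
          fix s assume "s \<in> {0..t}"
          then have "norm ((\<delta> * (t - s)) *\<^sub>R \<xi>) = ?\<eta> * (t - s)" using d by (simp add: abs_mult)
          then show "ft (?H (t - s) (N s)) \<xi> = gsym (?\<eta> * (t - s)) * ft (N s) \<xi>"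
            unfolding ft_kop[OF k(1)] k(2) by (simp only:)
        qed
        moreover have "ft (z t) \<xi> = - ft (H.D1 N t) \<xi>"
          unfolding z_def using ft_scaleR[of "-1" "H.D1 N t" \<xi>] by simp
        ultimately show ?thesis by simp
      qed
    qed
    moreover have "- ft (N t) \<xi> - of_real ?\<eta> * ft (z t) \<xi> - of_real (?\<eta>\<^sup>2) * (ft (v t) \<xi> - ft (v 0) \<xi>) = ?b t \<xi>"
    proof -
      have "0 \<in> {0..T}" using t by auto
      then have "ft (v 0) \<xi> = ft phi \<xi>" using v0 by simp
      moreover have "ft (N t) \<xi> = ft (pw (v t) m) \<xi> + of_real (?\<eta>\<^sup>2) * ft phi \<xi>"
        unfolding N_def ft_diff ft_scaleR ft_lphi by (simp add: power_mult_distrib)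
      moreover have "- (a + e * p) - y - e * (w - p) = - a - y - e * w" for a e p y w :: complex
        by (simp add: algebra_simps)
      ultimately show ?thesis by (simp only:)
    qed
    ultimately show ?thesis by (simp only:)
  qed
  define A where "A x s = \<delta>\<^sup>2 * fmul (\<lambda>\<xi>. - complex_of_real ((norm \<xi>)\<^sup>2)) (v s) x - \<delta> * fmul (\<lambda>\<xi>. complex_of_real (norm \<xi>)) (z s) x - fn (v s) x ^ Suc m" for x s
  have symb2: "symb (\<lambda>\<xi>::real^'n. of_real (\<delta> * norm \<xi>))" "symb (\<lambda>\<xi>::real^'n. of_real ((\<delta> * norm \<xi>)\<^sup>2))"
  proof -
    have "\<delta> * norm \<xi> \<le> norm \<xi>" for \<xi> :: "real^'n" using d by (simp add: mult_left_le_one_le)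
    moreover have "\<delta>\<^sup>2 * (norm \<xi>)\<^sup>2 \<le> (norm \<xi>)\<^sup>2" for \<xi> :: "real^'n" using d by (simp add: mult_left_le_one_le power_le_one)
    ultimately have "\<delta> * norm \<xi> \<le> 1 + (norm \<xi>)\<^sup>2" "\<delta>\<^sup>2 * (norm \<xi>)\<^sup>2 \<le> 1 + (norm \<xi>)\<^sup>2" for \<xi> :: "real^'n"
      using order_trans[OF _ norm_le_bracket(1)] by (auto intro: add_increasing)
    then show "symb (\<lambda>\<xi>::real^'n. of_real (\<delta> * norm \<xi>))" "symb (\<lambda>\<xi>::real^'n. of_real ((\<delta> * norm \<xi>)\<^sup>2))"
      unfolding symb_def using d
      by (auto simp: norm_mult norm_power power_mult_distrib intro!: continuous_intros)
  qed
  have ib1: "integrable lborel (ft (pw (v s) m))" for s by (rule walgD)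
  have ib2: "integrable lborel (\<lambda>\<xi>. of_real (\<delta> * norm \<xi>) * ft (z s) \<xi>)" "integrable lborel (\<lambda>\<xi>. of_real ((\<delta> * norm \<xi>)\<^sup>2) * ft (v s) \<xi>)" for s
    by (intro integrable_symb symb2)+
  have ib: "integrable lborel (?b s)" for s
    by (intro Bochner_Integration.integrable_diff Bochner_Integration.integrable_minus ib1 ib2)
  have invb: "inv_fourier (?b s) x = - complex_of_real (fn (pw (v s) m) x) - of_real \<delta> * inv_fourier (\<lambda>\<xi>. complex_of_real (norm \<xi>) * ft (z s) \<xi>) x
      + of_real (\<delta>\<^sup>2) * inv_fourier (\<lambda>\<xi>. - complex_of_real ((norm \<xi>)\<^sup>2) * ft (v s) \<xi>) x" for s x
  proof -
    have "?b s = (\<lambda>\<xi>. ((-1) * ft (pw (v s) m) \<xi> + (- of_real \<delta>) * (complex_of_real (norm \<xi>) * ft (z s) \<xi>)) + of_real (\<delta>\<^sup>2) * (- complex_of_real ((norm \<xi>)\<^sup>2) * ft (v s) \<xi>))"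
      by (simp add: fun_eq_iff power_mult_distrib)
    then have "inv_fourier (?b s) x = ((-1) * inv_fourier (ft (pw (v s) m)) x + (- of_real \<delta>) * inv_fourier (\<lambda>\<xi>. complex_of_real (norm \<xi>) * ft (z s) \<xi>) x)
       + of_real (\<delta>\<^sup>2) * inv_fourier (\<lambda>\<xi>. - complex_of_real ((norm \<xi>)\<^sup>2) * ft (v s) \<xi>) x"
      by (simp only: inv_fourier_cmult[symmetric])
         (intro trans[OF inv_fourier_add] arg_cong2[of _ _ _ _ "(+)"] inv_fourier_add refl
           Bochner_Integration.integrable_add integrable_mult_right ib1 integrable_symb symb_intros)
    then show ?thesis unfolding walgD(3) by simp
  qed
  have Ab: "A x s = Re (inv_fourier (?b s) x)" for x s
    unfolding invb A_def fmul_def by (simp add: fn_pw)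
  have cA: "continuous_on {0..T} (A x)" for x
    unfolding A_def by (intro continuous_intros continuous_on_fmul symb_intros v cz bounded_linear.continuous_on[OF bounded_linear_fn])
  have cB: "continuous_on {0..T} (\<lambda>s. inv_fourier (?b s) x)" for x
    unfolding invb by (intro continuous_intros continuous_on_inv_fourier_ft symb_intros v cz continuous_on_pw
      bounded_linear.continuous_on[OF bounded_linear_fn])
  have zint: "fn (z t) x = integral {0..t} (A x)" if t: "t \<in> {0..T}" for t x
  proof -
    have sub: "{0..t} \<subseteq> {0..T}" using t by auto
    obtain C where C: "C > 0" "\<And>\<sigma> (f :: 'n walg). symb \<sigma> \<Longrightarrow> (\<integral>\<xi>. cmod (\<sigma> \<xi> * ft f \<xi>) \<partial>lborel) \<le> C * norm f"
      using ex_symb_bound by blast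
    have cn: "continuous_on {0..T} (\<lambda>s. C * norm (pw (v s) m) + C * norm (z s) + C * norm (v s))"
      by (intro continuous_intros continuous_on_pw v cz)
    obtain M where "\<forall>x\<in>(\<lambda>s. C * norm (pw (v s) m) + C * norm (z s) + C * norm (v s)) ` {0..T}. norm x \<le> M"
      using compact_imp_bounded[OF compact_continuous_image[OF cn compact_Icc]] unfolding bounded_iff by blast
    then have M: "C * norm (pw (v s) m) + C * norm (z s) + C * norm (v s) \<le> M" if "s \<in> {0..T}" for s
      using that by force
    have "(\<integral>\<xi>. cis (x \<bullet> \<xi>) * ft (z t) \<xi> \<partial>lborel) = integral {0..t} (\<lambda>s. \<integral>\<xi>. cis (x \<bullet> \<xi>) * ?b s \<xi> \<partial>lborel)"
    proof (rule fubini_time[where C=M])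
      show "continuous_on ({0..t} \<times> UNIV) (\<lambda>p. ?b (fst p) (snd p))"
        by (intro continuous_intros continuous_on_ft continuous_on_pw
            continuous_on_compose2[OF v] continuous_on_compose2[OF cz]) (use sub in auto)
      show "integrable lborel (?b s)" for s by (rule ib)
      show "(\<integral>\<xi>. cmod (?b s \<xi>) \<partial>lborel) \<le> M" if s: "s \<in> {0..t}" for s
      proof -
        have "(\<integral>\<xi>. cmod (?b s \<xi>) \<partial>lborel) \<le> (\<integral>\<xi>. cmod (1 * ft (pw (v s) m) \<xi>) + cmod (of_real (\<delta> * norm \<xi>) * ft (z s) \<xi>) + cmod (of_real ((\<delta> * norm \<xi>)\<^sup>2) * ft (v s) \<xi>) \<partial>lborel)"
        proof (rule Bochner_Integration.integral_mono)
          show "cmod (?b s \<xi>) \<le> cmod (1 * ft (pw (v s) m) \<xi>) + cmod (of_real (\<delta> * norm \<xi>) * ft (z s) \<xi>) + cmod (of_real ((\<delta> * norm \<xi>)\<^sup>2) * ft (v s) \<xi>)" for \<xi>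
            unfolding mult_1_left
            by (rule order_trans[OF norm_triangle_ineq4], rule add_right_mono, rule order_trans[OF norm_triangle_ineq4]) simp
          have "integrable lborel (\<lambda>\<xi>. 1 * ft (pw (v s) m) \<xi>)" unfolding mult_1_left by (rule ib1)
          then show "integrable lborel (\<lambda>\<xi>. cmod (1 * ft (pw (v s) m) \<xi>) + cmod (of_real (\<delta> * norm \<xi>) * ft (z s) \<xi>) + cmod (of_real ((\<delta> * norm \<xi>)\<^sup>2) * ft (v s) \<xi>))"
            by (intro Bochner_Integration.integrable_add integrable_norm ib2)
        qed (rule integrable_norm[OF ib])
        also have "\<dots> = (\<integral>\<xi>. cmod (1 * ft (pw (v s) m) \<xi>) \<partial>lborel) + (\<integral>\<xi>. cmod (of_real (\<delta> * norm \<xi>) * ft (z s) \<xi>) \<partial>lborel) + (\<integral>\<xi>. cmod (of_real ((\<delta> * norm \<xi>)\<^sup>2) * ft (v s) \<xi>) \<partial>lborel)"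
        proof -
          note i1 = integrable_norm[OF integrable_symb[OF symb_intros(1), of "pw (v s) m"]]
            and i2 = integrable_norm[OF ib2(1)[of s]] and i3 = integrable_norm[OF ib2(2)[of s]]
          show ?thesis
            by (simp only: Bochner_Integration.integral_add[OF Bochner_Integration.integrable_add[OF i1 i2] i3] Bochner_Integration.integral_add[OF i1 i2])
        qed
        also have "\<dots> \<le> C * norm (pw (v s) m) + C * norm (z s) + C * norm (v s)"
          by (rule add_mono[OF add_mono[OF C(2)[OF symb_intros(1)] C(2)[OF symb2(1)]] C(2)[OF symb2(2)]])
        also have "\<dots> \<le> M" using s sub by (intro M) auto
        finally show ?thesis .
      qed
      show "((\<lambda>s. ?b s \<xi>) has_integral ft (z t) \<xi>) {0..t}" for \<xi>
      proof -
        have "((\<lambda>s. ?b s \<xi>) has_integral (ft (z t) \<xi> - ft (z 0) \<xi>)) {0..t}"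
        proof (rule fundamental_theorem_of_calculus)
          show "((\<lambda>a. ft (z a) \<xi>) has_vector_derivative ?b s \<xi>) (at s within {0..t})" if "s \<in> {0..t}" for s
            by (rule has_vector_derivative_within_subset[OF dz sub]) (use that sub in blast)
        qed (use t in simp)
        moreover have "ft (z 0) \<xi> = 0" unfolding z0 by (simp add: fourier_def)
        ultimately show ?thesis by simp
      qed
      show "continuous_on UNIV (\<lambda>\<xi>. cis (x \<bullet> \<xi>))" by (intro continuous_intros)
      have "continuous_on {0..t} (\<lambda>s. inv_fourier (?b s) x / of_real (fnorm TYPE('n)))"
        using fnorm_pos[where 'n='n] by (intro continuous_on_divide continuous_on_const continuous_on_subset[OF cB sub]) simp
      moreover have "inv_fourier (?b s) x / of_real (fnorm TYPE('n)) = (\<integral>\<xi>. cis (x \<bullet> \<xi>) * ?b s \<xi> \<partial>lborel)" for s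
        unfolding inv_fourier_cis using fnorm_pos[where 'n='n] by (intro nonzero_mult_div_cancel_left) simp
      ultimately show "continuous_on {0..t} (\<lambda>s. \<integral>\<xi>. cis (x \<bullet> \<xi>) * ?b s \<xi> \<partial>lborel)" by (simp only:)
    qed simp
    then have "complex_of_real (fn (z t) x) = complex_of_real (fnorm TYPE('n)) * integral {0..t} (\<lambda>s. \<integral>\<xi>. cis (x \<bullet> \<xi>) * ?b s \<xi> \<partial>lborel)"
      using walgD(3)[of "z t" x] unfolding inv_fourier_cis by simp
    also have "\<dots> = integral {0..t} (\<lambda>s. inv_fourier (?b s) x)"
      unfolding inv_fourier_cis by (rule Henstock_Kurzweil_Integration.integral_mult_right[symmetric])
    finally have "fn (z t) x = Re (integral {0..t} (\<lambda>s. inv_fourier (?b s) x))" by (metis Re_complex_of_real)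
    also have "\<dots> = integral {0..t} (Re \<circ> (\<lambda>s. inv_fourier (?b s) x))"
      by (rule integral_linear[symmetric]) (intro integrable_continuous_real continuous_on_subset[OF cB sub] bounded_linear_Re)+
    also have "Re \<circ> (\<lambda>s. inv_fourier (?b s) x) = A x" using Ab by (simp add: fun_eq_iff)
    finally show ?thesis .
  qed
  have "((\<lambda>t. fn (z t) x) has_real_derivative A x t) (at t within {0..T})" if t: "t \<in> {0..T}" for t x
    unfolding has_real_derivative_iff_has_vector_derivative
    by (rule has_vector_derivative_transform[OF t zint integral_has_vector_derivative[OF cA t]])
  moreover have "((\<lambda>t. fn (v t) x) has_real_derivative fn (z t) x) (at t within {0..T})" if t: "t \<in> {0..T}" for t x
    unfolding has_real_derivative_iff_has_vector_derivative
    by (rule bounded_linear.has_vector_derivative[OF bounded_linear_fn dv[OF t]])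
  ultimately show ?thesis using cz z0 unfolding A_def by blast
qed

section \<open>Rescaled solutions\<close>

lemma has_real_derivative_scaled_line:
  fixes F :: "real^'n \<Rightarrow> real"
  assumes "((\<lambda>h. F (\<mu> *\<^sub>R x + h *\<^sub>R axis i 1)) has_real_derivative D) (at 0)"
  shows "((\<lambda>h. \<kappa> * F (\<mu> *\<^sub>R (x + h *\<^sub>R axis i 1))) has_real_derivative \<kappa> * (D * \<mu>)) (at 0)"
proof -
  have "((\<lambda>h. \<mu> * h) has_real_derivative \<mu>) (at 0)"
    using DERIV_cmult_Id[of \<mu> 0 UNIV] by simp
  from DERIV_chain2[of "\<lambda>h. F (\<mu> *\<^sub>R x + h *\<^sub>R axis i 1)" D "\<lambda>h. \<mu> * h" 0 \<mu> UNIV, OF _ this] assms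
  have "((\<lambda>h. F (\<mu> *\<^sub>R x + (\<mu> * h) *\<^sub>R axis i 1)) has_real_derivative D * \<mu>) (at 0)" by simp
  from DERIV_cmult[OF this, of \<kappa>] show ?thesis by (simp add: scaleR_add_right)
qed

lemma partial_scaled:
  fixes f :: "'n::finite walg"
  shows "has_partial_at i (\<lambda>x. \<kappa> * fn f (\<mu> *\<^sub>R x)) x"
    and "partial i (\<lambda>x. \<kappa> * fn f (\<mu> *\<^sub>R x)) = (\<lambda>x. (\<kappa> * \<mu>) * fmul (\<lambda>\<xi>. \<i> * complex_of_real (\<xi> $ i)) f (\<mu> *\<^sub>R x))"
    and "has_partial_at i (partial i (\<lambda>x. \<kappa> * fn f (\<mu> *\<^sub>R x))) x"
    and "partial i (partial i (\<lambda>x. \<kappa> * fn f (\<mu> *\<^sub>R x))) x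
       = \<kappa> * \<mu>\<^sup>2 * fmul (\<lambda>\<xi>. \<i> * complex_of_real (\<xi> $ i) * (\<i> * complex_of_real (\<xi> $ i))) f (\<mu> *\<^sub>R x)"
proof -
  have d1: "((\<lambda>h. \<kappa> * fn f (\<mu> *\<^sub>R (x + h *\<^sub>R axis i 1))) has_real_derivative
      \<kappa> * (fmul (\<lambda>\<xi>. \<i> * complex_of_real (\<xi> $ i)) f (\<mu> *\<^sub>R x) * \<mu>)) (at 0)" for x
    by (rule has_real_derivative_scaled_line, rule has_real_derivative_fn_line)
  show "has_partial_at i (\<lambda>x. \<kappa> * fn f (\<mu> *\<^sub>R x)) x"
    unfolding has_partial_at_def real_differentiable_def using d1 by blast
  show p: "partial i (\<lambda>x. \<kappa> * fn f (\<mu> *\<^sub>R x)) = (\<lambda>x. (\<kappa> * \<mu>) * fmul (\<lambda>\<xi>. \<i> * complex_of_real (\<xi> $ i)) f (\<mu> *\<^sub>R x))"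
    by (rule ext) (simp only: partial_def DERIV_imp_deriv[OF d1] mult_ac)
  have d2: "((\<lambda>h. (\<kappa> * \<mu>) * fmul (\<lambda>\<xi>. \<i> * complex_of_real (\<xi> $ i)) f (\<mu> *\<^sub>R (x + h *\<^sub>R axis i 1))) has_real_derivative
      (\<kappa> * \<mu>) * (fmul (\<lambda>\<xi>. \<i> * complex_of_real (\<xi> $ i) * (\<i> * complex_of_real (\<xi> $ i))) f (\<mu> *\<^sub>R x) * \<mu>)) (at 0)" for x
    by (rule has_real_derivative_scaled_line, rule has_real_derivative_fn_line2)
  show "has_partial_at i (partial i (\<lambda>x. \<kappa> * fn f (\<mu> *\<^sub>R x))) x"
    unfolding p has_partial_at_def real_differentiable_def using d2 by blast
  show "partial i (partial i (\<lambda>x. \<kappa> * fn f (\<mu> *\<^sub>R x))) x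
       = \<kappa> * \<mu>\<^sup>2 * fmul (\<lambda>\<xi>. \<i> * complex_of_real (\<xi> $ i) * (\<i> * complex_of_real (\<xi> $ i))) f (\<mu> *\<^sub>R x)"
    unfolding p unfolding partial_def DERIV_imp_deriv[OF d2] by (simp only: power2_eq_square mult_ac)
qed

lemma laplacian_scaled:
  fixes f :: "'n::finite walg"
  shows "laplacian (\<lambda>x. \<kappa> * fn f (\<mu> *\<^sub>R x)) x = \<kappa> * \<mu>\<^sup>2 * fmul (\<lambda>\<xi>. - complex_of_real ((norm \<xi>)\<^sup>2)) f (\<mu> *\<^sub>R x)"
  unfolding laplacian_def partial_scaled(4) sum_distrib_left[symmetric] sum_fmul_second ..

lemma FT_scaled:
  fixes f :: "'n::finite walg"
  assumes "\<mu> > 0"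
  shows "FT (\<lambda>x. \<kappa> * fn f (\<mu> *\<^sub>R x)) \<xi> = complex_of_real (\<kappa> * \<mu> powr (- real CARD('n))) * ft f (\<xi> /\<^sub>R \<mu>)"
proof -
  have "(\<lambda>x. complex_of_real (fn f x)) \<in> borel_measurable borel" using walgD(5)[of f] by measurable
  from fourier_scaleR_arg[OF this assms, of \<xi>]
  show ?thesis by (simp only: of_real_mult fourier_cmult mult.assoc)
qed

lemma powr_minus_card: "\<mu> > 0 \<Longrightarrow> \<bar>\<mu>\<bar> ^ DIM(real^'n) * \<mu> powr (- real CARD('n)) = 1"
  by (simp add: powr_minus powr_realpow)

lemma sqrt_neg_lap_scaled:
  fixes f :: "'n::finite walg"
  assumes mu: "\<mu> > 0"
  shows "sqrt_neg_lap (\<lambda>x. \<kappa> * fn f (\<mu> *\<^sub>R x)) x = \<kappa> * \<mu> * fmul (\<lambda>\<xi>. complex_of_real (norm \<xi>)) f (\<mu> *\<^sub>R x)"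
proof -
  let ?c = "\<kappa> * \<mu> powr (- real CARD('n))"
  let ?g = "\<lambda>\<xi>. cis (x \<bullet> \<xi>) * (complex_of_real (norm \<xi>) * (complex_of_real ?c * ft f (\<xi> /\<^sub>R \<mu>)))"
  have cont: "continuous_on UNIV ?g"
    by (intro continuous_intros continuous_on_ft)
  have g: "?g (0 + \<mu> *\<^sub>R \<eta>) = complex_of_real (\<mu> * ?c) * (cis ((\<mu> *\<^sub>R x) \<bullet> \<eta>) * (complex_of_real (norm \<eta>) * ft f \<eta>))" for \<eta>
    using mu by simp
  have "(\<integral>\<xi>. ?g \<xi> \<partial>lborel) = \<bar>\<mu>\<bar> ^ DIM(real^'n) *\<^sub>R (\<integral>\<eta>. ?g (0 + \<mu> *\<^sub>R \<eta>) \<partial>lborel)"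
    by (rule integral_affine) (use mu cont in \<open>auto intro: borel_measurable_continuous_onI\<close>)
  also have "\<dots> = complex_of_real (\<bar>\<mu>\<bar> ^ DIM(real^'n) * (\<mu> * ?c)) * (\<integral>\<eta>. cis ((\<mu> *\<^sub>R x) \<bullet> \<eta>) * (complex_of_real (norm \<eta>) * ft f \<eta>) \<partial>lborel)"
    unfolding g integral_mult_right_zero by (simp only: scaleR_conv_of_real of_real_mult mult.assoc)
  also have "\<bar>\<mu>\<bar> ^ DIM(real^'n) * (\<mu> * ?c) = \<kappa> * \<mu> * (\<bar>\<mu>\<bar> ^ DIM(real^'n) * \<mu> powr (- real CARD('n)))"
    by (simp only: mult_ac)
  also have "\<dots> = \<kappa> * \<mu>" unfolding powr_minus_card[OF mu] by simp
  finally have "(\<integral>\<xi>. ?g \<xi> \<partial>lborel) = complex_of_real (\<kappa> * \<mu>) * (\<integral>\<eta>. cis ((\<mu> *\<^sub>R x) \<bullet> \<eta>) * (complex_of_real (norm \<eta>) * ft f \<eta>) \<partial>lborel)" .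
  then have "inv_fourier (\<lambda>\<xi>. complex_of_real (norm \<xi>) * FT (\<lambda>x. \<kappa> * fn f (\<mu> *\<^sub>R x)) \<xi>) x
     = complex_of_real (\<kappa> * \<mu>) * inv_fourier (\<lambda>\<xi>. complex_of_real (norm \<xi>) * ft f \<xi>) (\<mu> *\<^sub>R x)"
    unfolding FT_scaled[OF mu] inv_fourier_cis by (simp only: mult.left_commute)
  then show ?thesis unfolding sqrt_neg_lap_def fmul_def
    by (simp only: times_complex.sel Re_complex_of_real Im_complex_of_real mult_zero_left diff_zero)
qed

lemma integrable_scaled:
  fixes f :: "'n::finite walg"
  assumes mu: "\<mu> > 0"
  shows "integrable lborel (\<lambda>x. \<kappa> * fn f (\<mu> *\<^sub>R x))"
    and "integrable lborel (\<lambda>\<xi>. norm \<xi> * cmod (FT (\<lambda>x. \<kappa> * fn f (\<mu> *\<^sub>R x)) \<xi>))"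
proof -
  show "integrable lborel (\<lambda>x. \<kappa> * fn f (\<mu> *\<^sub>R x))"
    using integrable_affine_iff[of "fn f" \<mu> 0] walgD(1,5)[of f] mu by (intro integrable_mult_right) auto
  let ?h = "\<lambda>\<eta>. cmod (complex_of_real (norm \<eta>) * ft f \<eta>)"
  have i: "integrable lborel ?h" by (intro integrable_norm integrable_symb symb_intros)
  then have "integrable lborel (\<lambda>\<xi>. ?h (0 + inverse \<mu> *\<^sub>R \<xi>))"
    by (subst integrable_affine_iff) (use mu in auto)
  then have "integrable lborel (\<lambda>\<xi>. (\<mu> * \<bar>\<kappa> * \<mu> powr (- real CARD('n))\<bar>) * ?h (0 + inverse \<mu> *\<^sub>R \<xi>))"
    by (rule integrable_mult_right)
  moreover have "(\<mu> * \<bar>\<kappa> * \<mu> powr (- real CARD('n))\<bar>) * ?h (0 + inverse \<mu> *\<^sub>R \<xi>)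
      = norm \<xi> * cmod (FT (\<lambda>x. \<kappa> * fn f (\<mu> *\<^sub>R x)) \<xi>)" for \<xi>
  proof -
    have "norm (inverse \<mu> *\<^sub>R \<xi>) = norm \<xi> / \<mu>" using mu by (simp add: divide_inverse mult.commute)
    then show ?thesis unfolding FT_scaled[OF mu] add_0_left norm_mult norm_of_real using mu by simp
  qed
  ultimately show "integrable lborel (\<lambda>\<xi>. norm \<xi> * cmod (FT (\<lambda>x. \<kappa> * fn f (\<mu> *\<^sub>R x)) \<xi>))" by (simp only:)
qed

lemma sobolev_norm_scaled:
  fixes f :: "'n::finite walg"
  assumes mu: "\<mu> > 0"
  shows "sobolev_norm s (\<lambda>x. \<kappa> * fn f (\<mu> *\<^sub>R x)) = sqrt (fnorm TYPE('n) *
      (\<kappa>\<^sup>2 * \<mu> powr (- real CARD('n)) * (\<integral>\<eta>. (1 + \<mu>\<^sup>2 * (norm \<eta>)\<^sup>2) powr s * (cmod (ft f \<eta>))\<^sup>2 \<partial>lborel)))"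
proof -
  let ?c = "\<kappa> * \<mu> powr (- real CARD('n))"
  let ?g = "\<lambda>\<xi>. (1 + (norm \<xi>)\<^sup>2) powr s * (cmod (complex_of_real ?c * ft f (\<xi> /\<^sub>R \<mu>)))\<^sup>2"
  have cont: "continuous_on UNIV ?g"
    by (intro continuous_intros continuous_on_ft) (auto simp: add_nonneg_eq_0_iff)
  have g: "?g (0 + \<mu> *\<^sub>R \<eta>) = ?c\<^sup>2 * ((1 + \<mu>\<^sup>2 * (norm \<eta>)\<^sup>2) powr s * (cmod (ft f \<eta>))\<^sup>2)" for \<eta>
    using mu by (simp add: norm_mult power_mult_distrib)
  have "(\<integral>\<xi>. ?g \<xi> \<partial>lborel) = \<bar>\<mu>\<bar> ^ DIM(real^'n) *\<^sub>R (\<integral>\<eta>. ?g (0 + \<mu> *\<^sub>R \<eta>) \<partial>lborel)"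
    by (rule integral_affine) (use mu cont in \<open>auto intro: borel_measurable_continuous_onI\<close>)
  also have "\<dots> = (\<bar>\<mu>\<bar> ^ DIM(real^'n) * ?c\<^sup>2) * (\<integral>\<eta>. (1 + \<mu>\<^sup>2 * (norm \<eta>)\<^sup>2) powr s * (cmod (ft f \<eta>))\<^sup>2 \<partial>lborel)"
    unfolding g integral_mult_right_zero by (simp only: real_scaleR_def mult.assoc)
  also have "\<bar>\<mu>\<bar> ^ DIM(real^'n) * ?c\<^sup>2 = \<kappa>\<^sup>2 * \<mu> powr (- real CARD('n)) * (\<bar>\<mu>\<bar> ^ DIM(real^'n) * \<mu> powr (- real CARD('n)))"
    by (simp only: power2_eq_square mult_ac)
  also have "\<dots> = \<kappa>\<^sup>2 * \<mu> powr (- real CARD('n))" unfolding powr_minus_card[OF mu] by simp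
  finally show ?thesis unfolding sobolev_norm_def FT_scaled[OF mu] fnorm_def by (simp only:)
qed

lemma continuous_on_fn_joint:
  fixes v :: "'a::topological_space \<Rightarrow> 'n::finite walg"
  assumes "continuous_on S v" "continuous_on S X"
  shows "continuous_on S (\<lambda>p. fn (v p) (X p))"
  unfolding fmul_1[symmetric] by (intro continuous_on_fmul symb_intros assms)

lemma has_real_derivative_time_scaled:
  fixes g :: "real \<Rightarrow> real"
  assumes l: "\<rho> > 0" and t: "t \<in> {0..\<rho> * T}"
    and g: "(g has_real_derivative D) (at (t / \<rho>) within {0..T})"
  shows "((\<lambda>\<tau>. \<kappa> * g (\<tau> / \<rho>)) has_real_derivative \<kappa> / \<rho> * D) (at t within {0..\<rho> * T})"
proof -
  have "(g has_real_derivative D) (at (t / \<rho>) within (\<lambda>\<tau>. \<tau> / \<rho>) ` {0..\<rho> * T})"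
    by (rule DERIV_subset[OF g]) (use l in \<open>auto simp: field_simps\<close>)
  moreover have "((\<lambda>\<tau>. \<tau> / \<rho>) has_real_derivative 1 / \<rho>) (at t within {0..\<rho> * T})"
    by (rule DERIV_cdivide[OF DERIV_ident])
  ultimately have "((g \<circ> (\<lambda>\<tau>. \<tau> / \<rho>)) has_real_derivative D * (1 / \<rho>)) (at t within {0..\<rho> * T})"
    by (rule DERIV_image_chain)
  from DERIV_cmult[OF this, of \<kappa>] show ?thesis by (simp add: o_def)
qed

lemma dt_eqI:
  assumes "T > 0" "t \<in> {0..T}" "((\<lambda>\<tau>. u \<tau> x) has_real_derivative D) (at t within {0..T})"
  shows "dt T u t x = D"
  unfolding dt_def using assms
  by (intro vector_derivative_within_closed_interval) (auto simp: has_real_derivative_iff_has_vector_derivative)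

text \<open>The condition on \<kappa> makes the second time derivative and the power carry the same
  factor \<kappa> / \<rho>^2. With spatial scale \<mu> = \<delta> / \<rho>, the Laplacian and the
  damping carry it too, with the coefficients \<delta>^2 and \<delta> of the rescaled
  equation.\<close>

lemma solves_vnlw_scaled:
  fixes v z :: "real \<Rightarrow> 'n::finite walg"
  assumes T: "T > 0" and l: "\<rho> > 0" and d: "\<delta> > 0" and k: "\<kappa> ^ m * \<rho>\<^sup>2 = 1"
    and v: "continuous_on {0..T} v" and z: "continuous_on {0..T} z" and z0: "z 0 = 0"
    and dv: "\<And>t x. t \<in> {0..T} \<Longrightarrow> ((\<lambda>t. fn (v t) x) has_real_derivative fn (z t) x) (at t within {0..T})"
    and dz: "\<And>t x. t \<in> {0..T} \<Longrightarrow> ((\<lambda>t. fn (z t) x) has_real_derivative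
        (\<delta>\<^sup>2 * fmul (\<lambda>\<xi>. - complex_of_real ((norm \<xi>)\<^sup>2)) (v t) x - \<delta> * fmul (\<lambda>\<xi>. complex_of_real (norm \<xi>)) (z t) x
          - fn (v t) x ^ Suc m)) (at t within {0..T})"
  defines "u \<equiv> \<lambda>t x. \<kappa> * fn (v (t / \<rho>)) ((\<delta> / \<rho>) *\<^sub>R x)"
  shows "solves_vnlw (Suc m) (\<rho> * T) u" and "dt (\<rho> * T) u 0 x = 0"
proof -
  define \<mu> where "\<mu> = \<delta> / \<rho>"
  have mu: "\<mu> > 0" using d l by (simp add: \<mu>_def)
  have u: "u = (\<lambda>t x. \<kappa> * fn (v (t / \<rho>)) (\<mu> *\<^sub>R x))" by (simp add: u_def \<mu>_def)
  let ?T = "\<rho> * T"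
  have T': "?T > 0" using T l by simp
  have in_T: "t / \<rho> \<in> {0..T}" if "t \<in> {0..?T}" for t using that l by (auto simp: field_simps)
  define a where "a t x = \<delta>\<^sup>2 * fmul (\<lambda>\<xi>. - complex_of_real ((norm \<xi>)\<^sup>2)) (v t) x - \<delta> * fmul (\<lambda>\<xi>. complex_of_real (norm \<xi>)) (z t) x
          - fn (v t) x ^ Suc m" for t and x :: "real^'n"
  have d1: "((\<lambda>\<tau>. u \<tau> x) has_real_derivative \<kappa> / \<rho> * fn (z (t / \<rho>)) (\<mu> *\<^sub>R x)) (at t within {0..?T})" if t: "t \<in> {0..?T}" for t x
    unfolding u by (rule has_real_derivative_time_scaled[OF l t dv[OF in_T[OF t]]])
  have dt1: "dt ?T u t x = \<kappa> / \<rho> * fn (z (t / \<rho>)) (\<mu> *\<^sub>R x)" if t: "t \<in> {0..?T}" for t x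
    by (rule dt_eqI[OF T' t d1[OF t]])
  have d2: "((\<lambda>\<tau>. dt ?T u \<tau> x) has_real_derivative \<kappa> / \<rho> / \<rho> * a (t / \<rho>) (\<mu> *\<^sub>R x)) (at t within {0..?T})" if t: "t \<in> {0..?T}" for t x
  proof -
    have "((\<lambda>\<tau>. \<kappa> / \<rho> * fn (z (\<tau> / \<rho>)) (\<mu> *\<^sub>R x)) has_real_derivative \<kappa> / \<rho> / \<rho> * a (t / \<rho>) (\<mu> *\<^sub>R x)) (at t within {0..?T})"
      unfolding a_def by (rule has_real_derivative_time_scaled[OF l t dz[OF in_T[OF t]]])
    then show ?thesis unfolding has_real_derivative_iff_has_vector_derivative
      by (rule has_vector_derivative_transform[OF t dt1, rotated])
  qed
  have dt2: "dt ?T (dt ?T u) t x = \<kappa> / \<rho> / \<rho> * a (t / \<rho>) (\<mu> *\<^sub>R x)" if t: "t \<in> {0..?T}" for t x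
    by (rule dt_eqI[OF T' t d2[OF t]])
  have dt1': "dt ?T u t = (\<lambda>x. \<kappa> / \<rho> * fn (z (t / \<rho>)) (\<mu> *\<^sub>R x))" if "t \<in> {0..?T}" for t
    using dt1[OF that] by (rule ext)
  let ?S = "{0..?T} \<times> (UNIV :: (real^'n) set)"
  have cf: "continuous_on ?S (\<lambda>p. fst p / \<rho>)" "(\<lambda>p. fst p / \<rho>) ` ?S \<subseteq> {0..T}"
    using l in_T by (auto intro!: continuous_intros)
  have cvs: "continuous_on ?S (\<lambda>p. v (fst p / \<rho>))" "continuous_on ?S (\<lambda>p. z (fst p / \<rho>))" "continuous_on ?S (\<lambda>p. \<mu> *\<^sub>R snd p)"
    by (intro continuous_on_compose2[OF v cf] continuous_on_compose2[OF z cf] continuous_intros)+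
  have c1: "continuous_on ?S (\<lambda>(t, x). u t x)"
    unfolding u case_prod_unfold by (intro continuous_intros continuous_on_fn_joint cvs)
  have c2: "continuous_on ?S (\<lambda>(t, x). dt ?T u t x)"
  proof -
    have "continuous_on ?S (\<lambda>p. \<kappa> / \<rho> * fn (z (fst p / \<rho>)) (\<mu> *\<^sub>R snd p))"
      by (intro continuous_on_mult continuous_on_const continuous_on_fn_joint cvs)
    then show ?thesis by (rule continuous_on_eq) (auto simp: dt1)
  qed
  have c3: "continuous_on ?S (\<lambda>(t, x). dt ?T (dt ?T u) t x)"
  proof -
    have "continuous_on ?S (\<lambda>p. \<kappa> / \<rho> / \<rho> * a (fst p / \<rho>) (\<mu> *\<^sub>R snd p))"
      unfolding a_def
      by (intro continuous_on_mult continuous_on_diff continuous_on_power continuous_on_const continuous_on_fn_joint continuous_on_fmul symb_intros cvs)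
    then show ?thesis by (rule continuous_on_eq) (auto simp: dt2)
  qed
  have pde: "dt ?T (dt ?T u) t x - laplacian (u t) x + sqrt_neg_lap (dt ?T u t) x + u t x ^ Suc m = 0" if t: "t \<in> {0..?T}" for t x
  proof -
    let ?L = "fmul (\<lambda>\<xi>. - complex_of_real ((norm \<xi>)\<^sup>2)) (v (t / \<rho>)) (\<mu> *\<^sub>R x)"
    let ?D = "fmul (\<lambda>\<xi>. complex_of_real (norm \<xi>)) (z (t / \<rho>)) (\<mu> *\<^sub>R x)"
    let ?V = "fn (v (t / \<rho>)) (\<mu> *\<^sub>R x)"
    have "laplacian (u t) x = \<kappa> * \<mu>\<^sup>2 * ?L" unfolding u by (rule laplacian_scaled)
    moreover have "sqrt_neg_lap (dt ?T u t) x = \<kappa> / \<rho> * \<mu> * ?D" unfolding dt1'[OF t] by (rule sqrt_neg_lap_scaled[OF mu])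
    moreover have "u t x ^ Suc m = \<kappa> / \<rho>\<^sup>2 * ?V ^ Suc m"
    proof -
      have "\<kappa> ^ m = 1 / \<rho>\<^sup>2" using k l by (simp add: field_simps)
      then have "\<kappa> ^ Suc m = \<kappa> / \<rho>\<^sup>2" by simp
      then show ?thesis unfolding u power_mult_distrib by (simp only:)
    qed
    moreover have "\<kappa> / \<rho> / \<rho> * (\<delta>\<^sup>2 * L - \<delta> * D - y) - \<kappa> * \<mu>\<^sup>2 * L + \<kappa> / \<rho> * \<mu> * D + \<kappa> / \<rho>\<^sup>2 * y = 0" for L D y :: real
      using l by (simp add: \<mu>_def field_simps power2_eq_square)
    ultimately show ?thesis unfolding dt2[OF t] a_def by (simp only:)
  qed
  show "solves_vnlw (Suc m) ?T u"
    unfolding solves_vnlw_def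
  proof (intro conjI ballI allI)
    fix t x assume t: "t \<in> {0..?T}"
    show "(\<lambda>\<tau>. u \<tau> x) differentiable (at t within {0..?T})" "(\<lambda>\<tau>. dt ?T u \<tau> x) differentiable (at t within {0..?T})"
      unfolding real_differentiable_def using d1[OF t] d2[OF t] by blast+
    show "has_partial_at i (u t) x" "has_partial_at i (partial i (u t)) x" for i
      unfolding u by (rule partial_scaled)+
    show "dt ?T (dt ?T u) t x - laplacian (u t) x + sqrt_neg_lap (dt ?T u t) x + u t x ^ Suc m = 0" by (rule pde[OF t])
  next
    fix t assume t: "t \<in> {0..?T}"
    show "integrable lborel (u t)" unfolding u by (rule integrable_scaled[OF mu])
    show "integrable lborel (dt ?T u t)" "integrable lborel (\<lambda>\<xi>. norm \<xi> * cmod (FT (dt ?T u t) \<xi>))"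
      unfolding dt1'[OF t] by (rule integrable_scaled[OF mu])+
  qed (use T' c1 c2 c3 in simp_all)
  show "dt ?T u 0 x = 0" using dt1[of 0 x] T' z0 by simp
qed

section \<open>Gaussians are Schwartz functions\<close>

text \<open>Polynomials times a dilated Gaussian, generated inductively: closure under partial
  derivatives then follows by induction, without explicit Hermite polynomials.\<close>

inductive pgauss :: "real \<Rightarrow> (real^'n \<Rightarrow> real) \<Rightarrow> bool" for \<mu> where
  base: "pgauss \<mu> (\<lambda>x. c * gs (\<mu> *\<^sub>R x))"
| coord: "pgauss \<mu> f \<Longrightarrow> pgauss \<mu> (\<lambda>x. x $ i * f x)"
| add: "pgauss \<mu> f \<Longrightarrow> pgauss \<mu> g \<Longrightarrow> pgauss \<mu> (\<lambda>x. f x + g x)"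

lemma pgauss_cmult: "pgauss \<mu> f \<Longrightarrow> pgauss \<mu> (\<lambda>x. c * f x)"
proof (induction rule: pgauss.induct)
  case (base c')
  have "(\<lambda>x::real^'a. c * (c' * gs (\<mu> *\<^sub>R x))) = (\<lambda>x. (c * c') * gs (\<mu> *\<^sub>R x))" by (simp add: mult.assoc)
  then show ?case by (simp only: pgauss.base)
next
  case (coord f i)
  have "(\<lambda>x. c * (x $ i * f x)) = (\<lambda>x. x $ i * (c * f x))" by (simp add: mult.left_commute)
  then show ?case using pgauss.coord[OF coord.IH, of i] by (simp only:)
next
  case (add f g)
  then show ?case using pgauss.add[OF add.IH] by (simp add: ring_distribs)
qed

lemma pgauss_continuous: "pgauss \<mu> f \<Longrightarrow> continuous_on UNIV f"
  by (induction rule: pgauss.induct) (auto intro!: continuous_intros continuous_on_compose2[OF continuous_on_gs])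

lemma pgauss_derivative:
  fixes f :: "real^'n \<Rightarrow> real"
  shows "pgauss \<mu> f \<Longrightarrow> \<exists>f'. pgauss \<mu> f' \<and> (\<forall>x. ((\<lambda>h. f (x + h *\<^sub>R axis i 1)) has_real_derivative f' x) (at 0))"
proof (induction rule: pgauss.induct)
  case (base c)
  have "((\<lambda>h. c * gs (\<mu> *\<^sub>R (x + h *\<^sub>R axis i 1))) has_real_derivative x $ i * ((- (c * \<mu>\<^sup>2)) * gs (\<mu> *\<^sub>R x))) (at 0)" for x :: "real^'n"
    using has_real_derivative_scaled_line[OF has_real_derivative_gs_line[of "\<mu> *\<^sub>R x" i], of c] by (simp add: power2_eq_square mult_ac)
  then show ?case using pgauss.coord[OF pgauss.base[where c="- (c * \<mu>\<^sup>2)" and \<mu>=\<mu>], of i] by blast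
next
  case (coord f j)
  then obtain f' where f': "pgauss \<mu> f'" "\<And>x. ((\<lambda>h. f (x + h *\<^sub>R axis i 1)) has_real_derivative f' x) (at 0)" by blast
  let ?e = "if j = i then 1 else 0 :: real"
  have "((\<lambda>h. (x + h *\<^sub>R axis i 1) $ j * f (x + h *\<^sub>R axis i 1)) has_real_derivative ?e * f x + x $ j * f' x) (at 0)" for x
  proof -
    have "((\<lambda>h. (x + h *\<^sub>R axis i 1) $ j) has_real_derivative ?e) (at 0)"
      by (auto intro!: derivative_eq_intros simp: axis_def)
    from DERIV_mult[OF this f'(2)[of x]] show ?thesis by (simp add: mult_ac add_ac)
  qed
  moreover have "pgauss \<mu> (\<lambda>x. ?e * f x + x $ j * f' x)"
    by (intro pgauss.add pgauss_cmult pgauss.coord coord f')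
  ultimately show ?case by blast
next
  case (add f g)
  then obtain f' g' where "pgauss \<mu> f'" "\<And>x. ((\<lambda>h. f (x + h *\<^sub>R axis i 1)) has_real_derivative f' x) (at 0)"
    "pgauss \<mu> g'" "\<And>x. ((\<lambda>h. g (x + h *\<^sub>R axis i 1)) has_real_derivative g' x) (at 0)" by blast
  then show ?case by (intro exI[of _ "\<lambda>x. f' x + g' x"]) (auto intro!: pgauss.add DERIV_add)
qed

text \<open>The exponent k varies in the induction because a coordinate factor consumes one power of
  1 + |x|.\<close>

lemma pgauss_decay:
  fixes f :: "real^'n \<Rightarrow> real"
  assumes mu: "\<mu> > 0"
  shows "pgauss \<mu> f \<Longrightarrow> \<exists>C. \<forall>x. (1 + norm x) ^ k * \<bar>f x\<bar> \<le> C"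
proof (induction arbitrary: k rule: pgauss.induct)
  case (base c)
  let ?C = "fact k * exp (1 + 1 / (2 * \<mu>\<^sup>2)) * \<bar>c\<bar>"
  have "(1 + norm x) ^ k * \<bar>c * gs (\<mu> *\<^sub>R x)\<bar> \<le> ?C" for x :: "real^'n"
  proof -
    have "(1 + norm x) ^ k * gs (\<mu> *\<^sub>R x) \<le> (fact k * exp (1 + norm x)) * gs (\<mu> *\<^sub>R x)"
      by (intro mult_right_mono power_le_exp less_imp_le[OF gs_pos]) simp
    also have "\<dots> = fact k * exp (1 + norm x - (\<mu> * norm x)\<^sup>2 / 2)"
      using mu by (simp add: gs_def exp_add[symmetric] power_mult_distrib)
    also have "\<dots> \<le> fact k * exp (1 + 1 / (2 * \<mu>\<^sup>2))"
    proof -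
      have "0 \<le> (\<mu> * norm x - 1 / \<mu>)\<^sup>2" by simp
      also have "\<dots> = (\<mu> * norm x)\<^sup>2 - 2 * norm x + 1 / \<mu>\<^sup>2"
        using mu by (simp add: power2_diff power_divide)
      finally have "1 + norm x - (\<mu> * norm x)\<^sup>2 / 2 \<le> 1 + 1 / (2 * \<mu>\<^sup>2)" by simp
      then show ?thesis by simp
    qed
    finally have "((1 + norm x) ^ k * gs (\<mu> *\<^sub>R x)) * \<bar>c\<bar> \<le> ?C" by (rule mult_right_mono) simp
    then show ?thesis by (simp add: abs_mult abs_of_pos[OF gs_pos] mult_ac)
  qed
  then show ?case by blast
next
  case (coord f i)
  obtain C where C: "\<And>x. (1 + norm x) ^ Suc k * \<bar>f x\<bar> \<le> C" using coord.IH[of "Suc k"] by blast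
  have "(1 + norm x) ^ k * \<bar>x $ i * f x\<bar> \<le> C" for x
  proof -
    have "\<bar>x $ i\<bar> \<le> 1 + norm x" using component_le_norm_cart[of x i] by linarith
    then have "(1 + norm x) ^ k * (\<bar>x $ i\<bar> * \<bar>f x\<bar>) \<le> (1 + norm x) ^ k * ((1 + norm x) * \<bar>f x\<bar>)"
      by (intro mult_left_mono mult_right_mono) auto
    also have "\<dots> = (1 + norm x) ^ Suc k * \<bar>f x\<bar>" by (simp only: power_Suc mult_ac)
    also have "\<dots> \<le> C" by (rule C)
    finally show ?thesis by (simp only: abs_mult)
  qed
  then show ?case by blast
next
  case (add f g)
  obtain C D where C: "\<And>x. (1 + norm x) ^ k * \<bar>f x\<bar> \<le> C" and D: "\<And>x. (1 + norm x) ^ k * \<bar>g x\<bar> \<le> D"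
    using add.IH by blast
  have "(1 + norm x) ^ k * \<bar>f x + g x\<bar> \<le> C + D" for x
  proof -
    have "(1 + norm x) ^ k * \<bar>f x + g x\<bar> \<le> (1 + norm x) ^ k * (\<bar>f x\<bar> + \<bar>g x\<bar>)"
      by (intro mult_left_mono) auto
    then show ?thesis using C[of x] D[of x] by (simp only: ring_distribs)
  qed
  then show ?case by blast
qed

lemma schwartz_pgauss:
  fixes f :: "real^'n \<Rightarrow> real"
  assumes mu: "\<mu> > 0" and f: "pgauss \<mu> f"
  shows "schwartz f"
proof -
  have P: "pgauss \<mu> (partials ds f)" for ds
  proof (induction ds)
    case (Cons i ds)
    obtain f' where f': "pgauss \<mu> f'" "\<And>x. ((\<lambda>h. partials ds f (x + h *\<^sub>R axis i 1)) has_real_derivative f' x) (at 0)"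
      using pgauss_derivative[OF Cons.IH] by blast
    have "partials (i # ds) f = f'"
      by (rule ext) (simp only: partials.simps partial_def DERIV_imp_deriv[OF f'(2)])
    then show ?case using f'(1) by (simp only:)
  qed (simp add: f)
  have "has_partial_at i (partials ds f) x" for i ds x
    using pgauss_derivative[OF P[of ds]] unfolding has_partial_at_def real_differentiable_def by blast
  then show ?thesis unfolding schwartz_def using pgauss_continuous[OF P] pgauss_decay[OF mu P] by blast
qed

section \<open>Norm inflation\<close>

text \<open>For \<mu> \<ge> 1 the rescaled bracket lies between the homogeneous and the
  inhomogeneous symbol, both multiplied by \<mu>^(2 s). The lower bound serves the final time and
  the upper bound the datum.\<close>

lemma scaled_energy_bounds:
  fixes f :: "'n::finite walg"
  assumes mu: "\<mu> \<ge> 1" and s: "s > 0"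
  shows "\<mu> powr (2 * s) * hom_energy s f \<le> (\<integral>\<eta>. (1 + \<mu>\<^sup>2 * (norm \<eta>)\<^sup>2) powr s * (cmod (ft f \<eta>))\<^sup>2 \<partial>lborel)"
    and "(\<integral>\<eta>. (1 + \<mu>\<^sup>2 * (norm \<eta>)\<^sup>2) powr s * (cmod (ft f \<eta>))\<^sup>2 \<partial>lborel)
      \<le> \<mu> powr (2 * s) * (\<integral>\<eta>. (1 + (norm \<eta>)\<^sup>2) powr s * (cmod (ft f \<eta>))\<^sup>2 \<partial>lborel)"
proof -
  obtain C where C: "C > 0" "\<And>\<eta>::real^'n. (1 + (norm \<eta>)\<^sup>2) powr s \<le> C * W \<eta>" using powr_le_W[of s] s by auto
  have up: "(1 + \<mu>\<^sup>2 * (norm \<eta>)\<^sup>2) powr s \<le> \<mu> powr (2 * s) * (1 + (norm \<eta>)\<^sup>2) powr s" for \<eta> :: "real^'n"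
  proof -
    have "1 \<le> \<mu>\<^sup>2" using mu by simp
    then have "(1 + \<mu>\<^sup>2 * (norm \<eta>)\<^sup>2) powr s \<le> (\<mu>\<^sup>2 * (1 + (norm \<eta>)\<^sup>2)) powr s"
      using s by (intro powr_mono2) (auto simp: ring_distribs)
    also have "\<dots> = (\<mu>\<^sup>2) powr s * (1 + (norm \<eta>)\<^sup>2) powr s" by (rule powr_mult)
    also have "(\<mu>\<^sup>2) powr s = \<mu> powr (2 * s)" using mu by (simp add: powr_powr[symmetric] powr_numeral)
    finally show ?thesis .
  qed
  have lo: "\<mu> powr (2 * s) * norm \<eta> powr (2 * s) \<le> (1 + \<mu>\<^sup>2 * (norm \<eta>)\<^sup>2) powr s" for \<eta> :: "real^'n"
    using powr_le_bracket[of s "\<mu> *\<^sub>R \<eta>"] mu s by (simp add: powr_mult power_mult_distrib)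
  have i1: "integrable lborel (\<lambda>\<eta>. (1 + \<mu>\<^sup>2 * (norm \<eta>)\<^sup>2) powr s * (cmod (ft f \<eta>))\<^sup>2)"
    unfolding power2_eq_square[of "cmod _"]
  proof (rule integrable_weight_mult_ft)
    show "\<bar>(1 + \<mu>\<^sup>2 * (norm \<eta>)\<^sup>2) powr s\<bar> \<le> (\<mu> powr (2 * s) * C) * W \<eta>" for \<eta> :: "real^'n"
      using order_trans[OF up mult_left_mono[OF C(2)[of \<eta>], of "\<mu> powr (2 * s)"]] by (simp add: mult.assoc)
  qed measurable
  have i2: "integrable lborel (\<lambda>\<eta>. (1 + (norm \<eta>)\<^sup>2) powr s * (cmod (ft f \<eta>))\<^sup>2)"
    unfolding power2_eq_square[of "cmod _"]
    by (rule integrable_weight_mult_ft[where C=C]) (use C in auto)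
  show "\<mu> powr (2 * s) * hom_energy s f \<le> (\<integral>\<eta>. (1 + \<mu>\<^sup>2 * (norm \<eta>)\<^sup>2) powr s * (cmod (ft f \<eta>))\<^sup>2 \<partial>lborel)"
    unfolding hom_energy_def integral_mult_right_zero[symmetric]
    by (intro Bochner_Integration.integral_mono integrable_mult_right integrable_hom_energy s i1)
       (simp add: mult.assoc[symmetric] mult_right_mono lo)
  show "(\<integral>\<eta>. (1 + \<mu>\<^sup>2 * (norm \<eta>)\<^sup>2) powr s * (cmod (ft f \<eta>))\<^sup>2 \<partial>lborel)
      \<le> \<mu> powr (2 * s) * (\<integral>\<eta>. (1 + (norm \<eta>)\<^sup>2) powr s * (cmod (ft f \<eta>))\<^sup>2 \<partial>lborel)"
    unfolding integral_mult_right_zero[symmetric]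
    by (intro Bochner_Integration.integral_mono integrable_mult_right i1 i2)
       (simp add: mult.assoc[symmetric] mult_right_mono up)
qed

text \<open>Integrating twice puts the pointwise solution into the form required by
  \<open>perturbed_solution\<close>; with the identity as propagator, \<open>D1\<close> is minus the
  velocity.\<close>

lemma ode_sol_duhamel:
  fixes v z :: "real \<Rightarrow> 'n::finite walg"
  assumes sol: "ode_sol m T v z"
  shows "continuous_on {0..T} v"
    and "t \<in> {0..T} \<Longrightarrow> v t = phi - duhamel.D2 (\<lambda>\<tau> x. x) (\<lambda>s. pw (v s) m) t"
proof -
  interpret I: duhamel "\<lambda>\<tau> x. x :: 'n walg" 1 by (rule duhamel_id)
  have dv: "(v has_vector_derivative z t) (at t within {0..T})" and dz: "(z has_vector_derivative - pw (v t) m) (at t within {0..T})"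
    if "t \<in> {0..T}" for t using sol that by (auto simp: ode_sol_def)
  show "continuous_on {0..T} v"
    using dv by (rule continuous_on_vector_derivative)
  have D1: "I.D1 (\<lambda>s. pw (v s) m) r = - z r" if r: "r \<in> {0..T}" for r
  proof -
    have "((\<lambda>s. - pw (v s) m) has_integral (z r - z 0)) {0..r}"
    proof (rule fundamental_theorem_of_calculus)
      show "(z has_vector_derivative - pw (v s) m) (at s within {0..r})" if "s \<in> {0..r}" for s
        by (rule has_vector_derivative_within_subset[OF dz]) (use that r in auto)
    qed (use r in simp)
    from integral_unique[OF has_integral_neg[OF this]] show ?thesis
      using sol by (simp add: I.D1_def ode_sol_def)
  qed
  show "v t = phi - I.D2 (\<lambda>s. pw (v s) m) t" if t: "t \<in> {0..T}"
  proof -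
    have "(z has_integral (v t - v 0)) {0..t}"
    proof (rule fundamental_theorem_of_calculus)
      show "(v has_vector_derivative z s) (at s within {0..t})" if "s \<in> {0..t}" for s
        by (rule has_vector_derivative_within_subset[OF dv]) (use that t in auto)
    qed (use t in simp)
    from integral_unique[OF has_integral_neg[OF this]]
    have "integral {0..t} (\<lambda>s. - z s) = - (v t - v 0)" .
    moreover have "I.D2 (\<lambda>s. pw (v s) m) t = integral {0..t} (\<lambda>s. - z s)"
      unfolding I.D2_def by (rule Henstock_Kurzweil_Integration.integral_cong) (use D1 t in auto)
    ultimately show ?thesis using sol by (simp add: ode_sol_def)
  qed
qed

lemma ex_small_powr:
  fixes a b c X Y :: real
  assumes "a > 0" "b > 0" "c > 0" "X > 0" "Y > 0"
  shows "\<exists>\<delta>>0. \<delta> \<le> a \<and> \<delta> powr b \<le> X \<and> \<delta> powr c \<le> Y"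
proof (intro exI conjI)
  let ?d = "min a (min (X powr (1 / b)) (Y powr (1 / c)))"
  show d: "?d > 0" "?d \<le> a" using assms by auto
  have "?d powr b \<le> (X powr (1 / b)) powr b" using d assms by (intro powr_mono2) auto
  then show "?d powr b \<le> X" using assms by (simp add: powr_powr)
  have "?d powr c \<le> (Y powr (1 / c)) powr c" using d assms by (intro powr_mono2) auto
  then show "?d powr c \<le> Y" using assms by (simp add: powr_powr)
qed

text \<open>The kernel has total integral \<open>gsym 0 = 1\<close>, so the propagator starts from
  the identity; this is what makes small dispersion a perturbation of the pointwise
  equation.\<close>

lemma viscous_approximation:
  fixes v0 z0 :: "real \<Rightarrow> 'n::finite walg"
  assumes sol: "ode_sol m T v0 z0" and T: "T > 0" and \<eta>: "\<eta> > 0"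
  shows "\<exists>\<delta>0>0. \<forall>\<delta>. 0 < \<delta> \<and> \<delta> \<le> \<delta>0 \<longrightarrow> (\<exists>v z. continuous_on {0..T} v \<and> continuous_on {0..T} z \<and> v 0 = phi \<and> z 0 = 0 \<and>
     norm (v T - v0 T) \<le> \<eta> \<and> (\<forall>t\<in>{0..T}. \<forall>x.
     ((\<lambda>t. fn (v t) x) has_real_derivative fn (z t) x) (at t within {0..T}) \<and>
     ((\<lambda>t. fn (z t) x) has_real_derivative
        (\<delta>\<^sup>2 * fmul (\<lambda>\<xi>. - complex_of_real ((norm \<xi>)\<^sup>2)) (v t) x - \<delta> * fmul (\<lambda>\<xi>. complex_of_real (norm \<xi>)) (z t) x
          - fn (v t) x ^ Suc m)) (at t within {0..T})))"
proof -
  obtain k where k: "integrable lborel k" "\<And>\<xi>::real^'n. FT k \<xi> = gsym (norm \<xi>)" using ex_wave_kernel by blast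
  have "complex_of_real (\<integral>x. k x \<partial>lborel) = FT k 0" by (simp add: fourier_def)
  then have "(\<integral>x. k x \<partial>lborel) = 1" unfolding k(2) by simp
  then have H0: "kop k 0 x = x" for x using kop_0_left[OF k(1)] by simp
  have duh: "duhamel (kop k) (lnorm k)"
    by (intro duhamel.intro bounded_linear_kop norm_kop_le lnorm_nonneg continuous_on_kop k continuous_intros)
  obtain \<delta>0 where \<delta>0: "\<delta>0 > 0" "\<And>\<delta>. 0 < \<delta> \<Longrightarrow> \<delta> \<le> \<delta>0 \<Longrightarrow> \<exists>v. continuous_on {0..T} v \<and> (\<forall>t\<in>{0..T}. norm (v t - v0 t) \<le> \<eta>) \<and>
     (\<forall>t\<in>{0..T}. v t = phi - duhamel.D2 (\<lambda>\<tau>. kop k (\<delta> * \<tau>)) (\<lambda>s. pw (v s) m - \<delta>\<^sup>2 *\<^sub>R lphi) t)"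
    using perturbed_solution[OF duh H0 T ode_sol_duhamel[OF sol] \<eta>, of lphi] by blast
  show ?thesis
  proof (intro exI[of _ "min \<delta>0 1"] conjI allI impI)
    show "min \<delta>0 1 > 0" using \<delta>0 by simp
    fix \<delta> assume d: "0 < \<delta> \<and> \<delta> \<le> min \<delta>0 1"
    then obtain v where v: "continuous_on {0..T} v" "\<And>t. t \<in> {0..T} \<Longrightarrow> norm (v t - v0 t) \<le> \<eta>"
      "\<And>t. t \<in> {0..T} \<Longrightarrow> v t = phi - duhamel.D2 (\<lambda>\<tau>. kop k (\<delta> * \<tau>)) (\<lambda>s. pw (v s) m - \<delta>\<^sup>2 *\<^sub>R lphi) t"
      using \<delta>0(2)[of \<delta>] by auto
    have d1: "0 < \<delta>" "\<delta> \<le> 1" using d by auto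
    have "duhamel (\<lambda>\<tau>. kop k (\<delta> * \<tau>) :: 'n walg \<Rightarrow> 'n walg) (lnorm k)"
      by (intro duhamel.intro bounded_linear_kop norm_kop_le lnorm_nonneg continuous_on_kop k continuous_intros)
    then have "v 0 = phi" using v(3)[of 0] T by (simp add: duhamel.D2_def)
    moreover have "norm (v T - v0 T) \<le> \<eta>" using v(2)[of T] T by simp
    moreover obtain z where "continuous_on {0..T} z" "z 0 = 0" "\<forall>t\<in>{0..T}. \<forall>x.
     ((\<lambda>t. fn (v t) x) has_real_derivative fn (z t) x) (at t within {0..T}) \<and>
     ((\<lambda>t. fn (z t) x) has_real_derivative
        (\<delta>\<^sup>2 * fmul (\<lambda>\<xi>. - complex_of_real ((norm \<xi>)\<^sup>2)) (v t) x - \<delta> * fmul (\<lambda>\<xi>. complex_of_real (norm \<xi>)) (z t) x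
          - fn (v t) x ^ Suc m)) (at t within {0..T})"
      using viscous_solution[OF k d1 v(1) v(3)] by auto
    ultimately show "\<exists>v z. continuous_on {0..T} v \<and> continuous_on {0..T} z \<and> v 0 = phi \<and> z 0 = 0 \<and>
     norm (v T - v0 T) \<le> \<eta> \<and> (\<forall>t\<in>{0..T}. \<forall>x.
     ((\<lambda>t. fn (v t) x) has_real_derivative fn (z t) x) (at t within {0..T}) \<and>
     ((\<lambda>t. fn (z t) x) has_real_derivative
        (\<delta>\<^sup>2 * fmul (\<lambda>\<xi>. - complex_of_real ((norm \<xi>)\<^sup>2)) (v t) x - \<delta> * fmul (\<lambda>\<xi>. complex_of_real (norm \<xi>)) (z t) x
          - fn (v t) x ^ Suc m)) (at t within {0..T}))"
      using v(1) by blast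
  qed
qed

text \<open>The parameters are fixed in the order \<kappa>0, T, \<eta>, \<delta>. The amplitude
  \<kappa>0 decides the size of the datum and the energy that must be reached, T is a time at which
  the pointwise solution reaches it, and \<eta> is the tolerance for the viscous solution. All of
  these are independent of \<delta>, so a small \<delta> can shrink the lifespan
  \<open>\<rho> * T\<close> afterwards.\<close>

theorem theorem1:
  fixes p :: nat and s :: real and \<epsilon> :: real
  assumes "odd p" and "p > 1"
    and "0 < s" and "s < real CARD('n) / 2 - 2 / (real p - 1)"
    and "\<epsilon> > 0"
  shows "\<exists>(u :: real \<Rightarrow> real^'n \<Rightarrow> real) T t.
           solves_vnlw p T u \<and> schwartz (u 0) \<and>
           sobolev_norm s (u 0) < \<epsilon> \<and>
           (\<forall>x. dt T u 0 x = 0) \<and>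
           0 < t \<and> t < \<epsilon> \<and> t \<le> T \<and>
           sobolev_norm s (u t) > 1 / \<epsilon>"
proof -
  obtain q where p: "p = Suc (2 * q)" using assms(1) by (auto elim: oddE)
  have q: "q \<ge> 1" using assms(2) p by simp
  define n where "n = real CARD('n)"
  \<comment> \<open>The distance s_cr - s to the critical exponent, because 2 / (p - 1) = 1 /
    q.\<close>
  define \<sigma> where "\<sigma> = n / 2 - 1 / real q - s"
  have \<sigma>: "\<sigma> > 0" using assms(4) q by (simp add: \<sigma>_def n_def p)
  have s: "s > 0" by (rule assms(3))
  \<comment> \<open>Both norms carry the factor \<kappa>^2 \<mu>^(2 s - n) = \<delta>^(2 s - n)
    \<rho>^(2 \<sigma>); keeping it equal to \<kappa>0^2 forces \<rho> = \<kappa>0^(1 / \<sigma>)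
    \<delta>^\<beta>. Since \<sigma> > 0, \<rho> tends to 0 with \<delta>, and \<beta> > 1 makes
    \<mu> = \<delta> / \<rho> tend to infinity.\<close>
  define \<beta> where "\<beta> = (n / 2 - s) / \<sigma>"
  have \<beta>: "\<beta> > 1" using \<sigma> q unfolding \<beta>_def by (simp add: pos_less_divide_eq) (simp add: \<sigma>_def)
  have \<beta>\<sigma>: "\<beta> * \<sigma> = n / 2 - s" using \<sigma> by (simp add: \<beta>_def)
  define F where "F = fnorm TYPE('n)"
  have F: "F > 0" by (simp add: F_def fnorm_pos)
  define S0 where "S0 = (\<integral>\<eta>. (1 + (norm \<eta>)\<^sup>2) powr s * (cmod (ft (phi :: 'n walg) \<eta>))\<^sup>2 \<partial>lborel)"
  have S0: "S0 \<ge> 0" unfolding S0_def by (intro Bochner_Integration.integral_nonneg) simp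
  \<comment> \<open>The initial norm will be at most \<open>\<kappa>0 * sqrt (F * S0)\<close>; the 1
    in the denominator makes this strictly smaller than \<epsilon>.\<close>
  define \<kappa>0 where "\<kappa>0 = \<epsilon> / (sqrt (F * S0) + 1)"
  have r0: "sqrt (F * S0) \<ge> 0" using F S0 by simp
  have \<kappa>0: "\<kappa>0 > 0" using assms(5) r0 by (simp add: \<kappa>0_def add_nonneg_pos)
  have \<kappa>0S: "\<kappa>0 * sqrt (F * S0) < \<epsilon>" 
  proof -
    have e: "\<epsilon> / (r + 1) * r < \<epsilon>" if "r \<ge> 0" for r :: real
      using that assms(5) by (simp add: pos_divide_less_eq)
    show ?thesis unfolding \<kappa>0_def by (rule e[OF r0])
  qed
  \<comment> \<open>An energy above B - 1, multiplied by F \<kappa>0^2, exceeds 1 / \<epsilon>^2.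
    The extra 1 is spent on passing from the pointwise to the viscous solution.\<close>
  define B where "B = 1 / (\<epsilon>\<^sup>2 * (F * \<kappa>0\<^sup>2)) + 1"
  obtain T v0 z0 where T: "T > 0" and sol: "ode_sol (2 * q) T (v0 :: real \<Rightarrow> 'n walg) z0" and B: "hom_energy s (v0 T) > B"
    using hom_energy_unbounded[OF q s, of B] by blast
  obtain C where C: "C > 0" "\<And>f g :: 'n walg. \<bar>hom_energy s f - hom_energy s g\<bar> \<le> C * (norm (f - g) * (norm f + norm g))"
    using hom_energy_diff_le[OF s] by blast
  \<comment> \<open>Chosen so that the Lipschitz estimate near \<open>v0 T\<close> changes the
    energy by at most 1.\<close>
  define \<eta> where "\<eta> = 1 / (C * (2 * norm (v0 T) + 1) + 1)"
  have Cp: "C * (2 * norm (v0 T) + 1) > 0" using C(1) by (intro mult_pos_pos) (auto intro: add_nonneg_pos)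
  have \<eta>: "\<eta> > 0" "\<eta> \<le> 1" "C * (\<eta> * (2 * norm (v0 T) + 1)) \<le> 1"
    using Cp unfolding \<eta>_def by (auto simp: field_simps)
  obtain \<delta>0 where \<delta>0: "\<delta>0 > 0" and approx: "\<And>\<delta>. 0 < \<delta> \<Longrightarrow> \<delta> \<le> \<delta>0 \<Longrightarrow> \<exists>v z. continuous_on {0..T} v \<and> continuous_on {0..T} z \<and> v 0 = phi \<and> z 0 = 0 \<and>
     norm (v T - v0 T) \<le> \<eta> \<and> (\<forall>t\<in>{0..T}. \<forall>x.
     ((\<lambda>t. fn (v t) x) has_real_derivative fn (z t) x) (at t within {0..T}) \<and>
     ((\<lambda>t. fn (z t) x) has_real_derivative
        (\<delta>\<^sup>2 * fmul (\<lambda>\<xi>. - complex_of_real ((norm \<xi>)\<^sup>2)) (v t) x - \<delta> * fmul (\<lambda>\<xi>. complex_of_real (norm \<xi>)) (z t) x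
          - fn (v t) x ^ Suc (2 * q))) (at t within {0..T}))"
    using viscous_approximation[OF sol T \<eta>(1)] by blast
  define K where "K = \<kappa>0 powr (1 / \<sigma>)"
  have K: "K > 0" using \<kappa>0 by (simp add: K_def)
  \<comment> \<open>The first power makes the lifespan smaller than \<epsilon>. The second gives
    \<mu> \<ge> 1, on which the comparison of the rescaled norms with the two energies
    rests.\<close>
  obtain \<delta> where \<delta>: "\<delta> > 0" "\<delta> \<le> \<delta>0" "\<delta> powr \<beta> \<le> \<epsilon> / (2 * K * T)" "\<delta> powr (\<beta> - 1) \<le> 1 / K"
    using ex_small_powr[of \<delta>0 \<beta> "\<beta> - 1" "\<epsilon> / (2 * K * T)" "1 / K"] \<delta>0 \<beta> K T assms(5) by auto
  define \<rho> where "\<rho> = K * \<delta> powr \<beta>"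
  have \<rho>: "\<rho> > 0" using K \<delta>(1) by (simp add: \<rho>_def)
  have \<rho>T: "\<rho> * T < \<epsilon>"
  proof -
    have "\<rho> * T \<le> K * (\<epsilon> / (2 * K * T)) * T"
      unfolding \<rho>_def using K T \<delta>(3) by (intro mult_right_mono mult_left_mono) auto
    also have "\<dots> = \<epsilon> / 2" using K T by simp
    finally show ?thesis using assms(5) by linarith
  qed
  define \<mu> where "\<mu> = \<delta> / \<rho>"
  have \<mu>1: "\<mu> \<ge> 1"
  proof -
    have "\<rho> = K * (\<delta> * \<delta> powr (\<beta> - 1))" using \<delta>(1) by (simp add: \<rho>_def powr_diff)
    also have "\<dots> \<le> K * (\<delta> * (1 / K))" using K \<delta> by (intro mult_left_mono) auto
    also have "\<dots> = \<delta>" using K by simp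
    finally show ?thesis using \<rho> by (simp add: \<mu>_def)
  qed
  then have \<mu>: "\<mu> > 0" by simp
  define \<kappa> where "\<kappa> = \<rho> powr (- (1 / real q))"
  have \<kappa>\<rho>: "\<kappa> ^ (2 * q) * \<rho>\<^sup>2 = 1"
  proof -
    have "\<kappa> ^ (2 * q) = \<kappa> powr (real (2 * q))" using \<rho> by (intro powr_realpow[symmetric]) (simp add: \<kappa>_def)
    also have "\<dots> = \<rho> powr (- 2)" using q by (simp add: \<kappa>_def powr_powr)
    also have "\<dots> = 1 / \<rho>\<^sup>2" using \<rho> by (simp add: powr_minus powr_numeral divide_inverse)
    finally show ?thesis using \<rho> by simp
  qed
  have scale: "\<kappa>\<^sup>2 * \<mu> powr (- n) * \<mu> powr (2 * s) = \<kappa>0\<^sup>2"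
  proof -
    have "\<kappa>\<^sup>2 * \<mu> powr (- n) * \<mu> powr (2 * s) = \<rho> powr (- (2 / real q)) * (\<delta> powr (2 * s - n) * \<rho> powr (n - 2 * s))"
    proof -
      have "\<kappa>\<^sup>2 = \<rho> powr (- (2 / real q))" using \<rho> by (simp add: \<kappa>_def power2_eq_square powr_add[symmetric])
      moreover have "\<mu> powr (- n) * \<mu> powr (2 * s) = \<mu> powr (2 * s - n)" by (simp add: powr_add[symmetric])
      moreover have "\<mu> powr (2 * s - n) = \<delta> powr (2 * s - n) * \<rho> powr (n - 2 * s)"
      proof -
        have "\<mu> powr (2 * s - n) = \<delta> powr (2 * s - n) / \<rho> powr (2 * s - n)"
          unfolding \<mu>_def by (rule powr_divide)
        also have "\<dots> = \<delta> powr (2 * s - n) * \<rho> powr (- (2 * s - n))" by (simp only: powr_minus divide_inverse)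
        finally show ?thesis by simp
      qed
      ultimately show ?thesis by (simp only: mult.assoc)
    qed
    also have "\<dots> = \<delta> powr (2 * s - n) * \<rho> powr (2 * \<sigma>)"
    proof -
      have "- (2 / real q) + (n - 2 * s) = 2 * \<sigma>" by (simp add: \<sigma>_def algebra_simps)
      then have "\<rho> powr (- (2 / real q)) * \<rho> powr (n - 2 * s) = \<rho> powr (2 * \<sigma>)" by (simp only: powr_add[symmetric])
      then show ?thesis by (simp only: mult.left_commute)
    qed
    also have "\<rho> powr (2 * \<sigma>) = \<kappa>0\<^sup>2 * \<delta> powr (n - 2 * s)"
    proof -
      have "\<rho> powr (2 * \<sigma>) = K powr (2 * \<sigma>) * \<delta> powr (\<beta> * (2 * \<sigma>))"
        unfolding \<rho>_def using K \<delta>(1) by (simp add: powr_mult powr_powr)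
      moreover have "K powr (2 * \<sigma>) = \<kappa>0\<^sup>2" unfolding K_def powr_powr using \<sigma> \<kappa>0 by (simp add: powr_numeral)
      moreover have "\<beta> * (2 * \<sigma>) = n - 2 * s" using \<beta>\<sigma> by (simp add: mult.left_commute)
      ultimately show ?thesis by (simp only:)
    qed
    also have "\<delta> powr (2 * s - n) * (\<kappa>0\<^sup>2 * \<delta> powr (n - 2 * s)) = \<kappa>0\<^sup>2 * (\<delta> powr (2 * s - n) * \<delta> powr (n - 2 * s))"
      by (simp only: mult_ac)
    also have "\<delta> powr (2 * s - n) * \<delta> powr (n - 2 * s) = 1"
      unfolding powr_add[symmetric] using \<delta>(1) by simp
    finally show ?thesis by simp
  qed
  obtain v z where v: "continuous_on {0..T} v" "continuous_on {0..T} z" "v 0 = phi" "z 0 = 0" "norm (v T - v0 T) \<le> \<eta>"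
    and dv: "\<And>t x. t \<in> {0..T} \<Longrightarrow> ((\<lambda>t. fn (v t) x) has_real_derivative fn (z t) x) (at t within {0..T})"
    and dz: "\<And>t x. t \<in> {0..T} \<Longrightarrow> ((\<lambda>t. fn (z t) x) has_real_derivative
        (\<delta>\<^sup>2 * fmul (\<lambda>\<xi>. - complex_of_real ((norm \<xi>)\<^sup>2)) (v t) x - \<delta> * fmul (\<lambda>\<xi>. complex_of_real (norm \<xi>)) (z t) x
          - fn (v t) x ^ Suc (2 * q))) (at t within {0..T})"
    using approx[OF \<delta>(1,2)] by blast
  define u where "u = (\<lambda>t x. \<kappa> * fn (v (t / \<rho>)) ((\<delta> / \<rho>) *\<^sub>R x))"
  have solves: "solves_vnlw p (\<rho> * T) u"
    unfolding p u_def by (rule solves_vnlw_scaled(1)[OF T \<rho> \<delta>(1) \<kappa>\<rho> v(1,2,4) dv dz])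
  have rest: "dt (\<rho> * T) u 0 x = 0" for x
    unfolding u_def by (rule solves_vnlw_scaled(2)[OF T \<rho> \<delta>(1) \<kappa>\<rho> v(1,2,4) dv dz])
  have u0: "u 0 = (\<lambda>x. \<kappa> * fn phi (\<mu> *\<^sub>R x))" by (simp add: u_def \<mu>_def v)
  have uT: "u (\<rho> * T) = (\<lambda>x. \<kappa> * fn (v T) (\<mu> *\<^sub>R x))" using \<rho> by (simp add: u_def \<mu>_def)
  have "schwartz (u 0)"
    unfolding u0 fn_phi by (rule schwartz_pgauss[OF \<mu> pgauss.base])
  moreover have "sobolev_norm s (u 0) < \<epsilon>"
  proof -
    have "\<kappa>\<^sup>2 * \<mu> powr (- n) * (\<integral>\<eta>. (1 + \<mu>\<^sup>2 * (norm \<eta>)\<^sup>2) powr s * (cmod (ft (phi :: 'n walg) \<eta>))\<^sup>2 \<partial>lborel)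
       \<le> \<kappa>\<^sup>2 * \<mu> powr (- n) * (\<mu> powr (2 * s) * S0)"
      unfolding S0_def by (intro mult_left_mono scaled_energy_bounds \<mu>1 s) auto
    also have "\<dots> = \<kappa>0\<^sup>2 * S0" unfolding mult.assoc[symmetric] scale ..
    finally have "sobolev_norm s (u 0) \<le> sqrt (F * (\<kappa>0\<^sup>2 * S0))"
      unfolding u0 sobolev_norm_scaled[OF \<mu>] F_def[symmetric] n_def[symmetric] using F
      by (intro real_sqrt_le_mono mult_left_mono) auto
    also have "\<dots> = \<kappa>0 * sqrt (F * S0)" using \<kappa>0 by (simp add: real_sqrt_mult)
    finally show ?thesis using \<kappa>0S by linarith
  qed
  moreover have "sobolev_norm s (u (\<rho> * T)) > 1 / \<epsilon>"
  proof -
    have h: "hom_energy s (v T) > B - 1"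
    proof -
      have "norm (v T) \<le> norm (v0 T) + \<eta>" using v(5) norm_triangle_sub[of "v T" "v0 T"] by linarith
      then have "norm (v T) + norm (v0 T) \<le> 2 * norm (v0 T) + 1" using \<eta>(2) by linarith
      then have "C * (norm (v T - v0 T) * (norm (v T) + norm (v0 T))) \<le> C * (\<eta> * (2 * norm (v0 T) + 1))"
        using C(1) v(5) \<eta>(1) by (intro mult_left_mono mult_mono) auto
      then have "\<bar>hom_energy s (v T) - hom_energy s (v0 T)\<bar> \<le> 1" using C(2)[of "v T" "v0 T"] \<eta>(3) by linarith
      then show ?thesis using B by linarith
    qed
    have "1 / \<epsilon>\<^sup>2 = F * (\<kappa>0\<^sup>2 * (B - 1))" using F \<kappa>0 by (simp add: B_def)
    also have "\<dots> < F * (\<kappa>0\<^sup>2 * hom_energy s (v T))" using F \<kappa>0 h by simp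
    also have "\<kappa>0\<^sup>2 * hom_energy s (v T) = \<kappa>\<^sup>2 * \<mu> powr (- n) * (\<mu> powr (2 * s) * hom_energy s (v T))"
      unfolding mult.assoc[symmetric] scale ..
    also have "F * \<dots> \<le> F * (\<kappa>\<^sup>2 * \<mu> powr (- n) * (\<integral>\<eta>. (1 + \<mu>\<^sup>2 * (norm \<eta>)\<^sup>2) powr s * (cmod (ft (v T) \<eta>))\<^sup>2 \<partial>lborel))"
      using F by (intro mult_left_mono scaled_energy_bounds \<mu>1 s) auto
    finally have "sqrt (1 / \<epsilon>\<^sup>2) < sobolev_norm s (u (\<rho> * T))"
      unfolding uT sobolev_norm_scaled[OF \<mu>] F_def[symmetric] n_def[symmetric] by (rule real_sqrt_less_mono)
    then show ?thesis using assms(5) by (simp add: real_sqrt_divide)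
  qed
  moreover have "0 < \<rho> * T" using \<rho> T by simp
  ultimately show ?thesis using solves rest \<rho>T by (intro exI[of _ u] exI[of _ "\<rho> * T"]) auto
qed

end
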